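(* Let $n\in\mathbb{Z}_{>0}$ and let $\{\omega_x\}_{x\in\mathbb{Z}\times\mathbb{Z}_{>0}}$ be i.i.d. exponential random variables with mean $1$, independent of an initial configuration $\eta(0)=(\eta^1(0),\dots,\eta^n(0))\in\mathcal{A}_n$. Choose functions $\{G^i_{(k,0)}\}_{k\in\mathbb{Z}}$ with $\eta^i_k(0)=G^i_{(k,0)}-G^i_{(k-1,0)}$, for $(k,t)\in\mathbb{Z}\times\mathbb{Z}_{>0}$ and $i\in\{1,\dots,n\}$ define $$G^i_{(k,t)}=\sup_{j:\,j\le k}\{G^i_{(j,0)}+G_{(j,1),(k,t)}\},$$ and for $t\in\mathbb{Z}_{>0}$ let $\eta(t)=(\eta^1(t),\dots,\eta^n(t))$ be given by $\eta^i_k(t)=G^i_{(k,t)}-G^i_{(k-1,t)}$. Let $\rho=(\rho_1,\dots,\rho_n)\in(1,\infty)^n$. Then $\mu^\rho$ is an invariant measure of the increment process $\eta(\cdot)$. The measure $\mu^\rho$ is the unique invariant measure for $\eta(\cdot)$ among translation-ergodic probability measures on $\mathcal{A}_n$ with means given by $\rho$ (that is, $\eta^i_k$ has mean $\rho_i$).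
   Context: Last-passage values: for $u\le v$ (coordinatewise) in $\mathbb{Z}\times\mathbb{Z}_{>0}$, $G_{u,v}=\max\sum_i\omega_{x_i}$, the maximum over nearest-neighbor paths from $u$ to $v$ with steps in $\{(1,0),(0,1)\}$ (endpoints included). State space: $\mathcal{A}_n$ is the set of $I=(I^1,\dots,I^n)\in(\mathbb{R}_{\ge0}^{\mathbb{Z}})^n$ such that for each $i\in\{1,\dots,n\}$ the limit $\lim_{m\to-\infty}\frac1{|m|}\sum_{k=m}^0I^i_k$ exists and is $>1$. Translations act by $(\theta_\ell\eta)^i_k=\eta^i_{k+\ell}$; a probability measure is translation-ergodic if it is invariant under all $\theta_\ell$ and gives probability $0$ or $1$ to every Borel set invariant under $\{\theta_\ell\}_{\ell\in\mathbb{Z}}$. A measure $\mu$ is invariant for $\eta(\cdot)$ if $\eta(0)\sim\mu$ implies $\eta(t)\sim\mu$ for all $t$. Queueing map. For $I,w\in\mathbb{R}_{\ge0}^{\mathbb{Z}}$ with $\lim_{m\to-\infty}\sum_{i=m}^0(w_i-I_{i+1})=-\infty$, choose any $F:\mathbb{Z}\to\mathbb{R}$ with $I_k=F_k-F_{k-1}$, put $\widetilde F_\ell=\sup_{k\le\ell}\{F_k+\sum_{i=k}^\ell w_i\}$, and define $D(I,w)=(\widetilde F_\ell-\widetilde F_{\ell-1})_{\ell\in\mathbb{Z}}$ (independent of the choice of $F$). Let $D^{(1)}(\zeta)=\zeta$ and $D^{(m)}(\zeta^1,\dots,\zeta^m)=D\bigl(D^{(m-1)}(\zeta^1,\dots,\zeta^{m-1}),\zeta^m\bigr)$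 for $m\ge2$. For $I=(I^1,\dots,I^m)$ let $\mathcal{D}^{(m)}(I)=(\eta^1,\dots,\eta^m)$ with $\eta^i=D^{(i)}(I^i,I^{i-1},\dots,I^1)$. For $\sigma\in(0,\infty)^m$, $\nu^\sigma$ is the law of $I=(I^1,\dots,I^m)$ with all coordinates $I^i_k$ independent and $I^i_k$ exponential with mean $\sigma_i$. Definition of $\mu^\rho$ for $\rho\in(0,\infty)^n$. (1) If $0<\rho_1<\dots<\rho_n$, $\mu^\rho$ is the law of $\mathcal{D}^{(n)}(I)$ with $I\sim\nu^\rho$. (2) If $0<\rho_1\le\dots\le\rho_n$, there are $m\in\{1,\dots,n\}$, $\sigma=(\sigma_1,\dots,\sigma_m)$ with $0<\sigma_1<\dots<\sigma_m$, and indices $1=i_1<i_2<\dots<i_m<i_{m+1}=n+1$ with $\rho_{i_\ell}=\dots=\rho_{i_{\ell+1}-1}=\sigma_\ell$ for $\ell=1,\dots,m$. Let $I\sim\nu^\sigma$, $\zeta=\mathcal{D}^{(m)}(I)$, and set $\eta^{i_\ell}=\dots=\eta^{i_{\ell+1}-1}=\zeta^\ell$ for $\ell=1,\dots,m$; $\mu^\rho$ is the law of $\eta=(\eta^1,\dots,\eta^n)$. (3) For general $\rho\in(0,\infty)^n$, choose a permutation $\pi$ such that $\pi\rho=(\rho_{\pi(1)},\dots,\rho_{\pi(n)})$ is nondecreasing, and let $\mu^\rho$ be the measure under which $(\eta^{\pi(1)},\dots,\eta^{\pi(n)})$ has law $\mu^{\pi\rho}$ as defined in (2). *)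

theory Defs
  imports "HOL-Probability.Probability" "HOL-Combinatorics.Permutations"
begin

section \<open>Configurations\<close>

text \<open>The \<open>i\<close>-th component of a configuration is \<open>\<eta> i :: int \<Rightarrow> real\<close>, with \<open>i\<close> ranging over
  \<open>{1..n}\<close>; outside this index set configurations are \<open>undefined\<close> (as always for \<open>Pi\<^sub>M\<close>).
  The sigma algebra is the Borel one of \<open>(\<real>\<^sup>\<int>)\<^sup>n\<close>.\<close>

type_synonym config = "nat \<Rightarrow> int \<Rightarrow> real"

definition config_space :: "nat \<Rightarrow> config measure" where
  "config_space n = Pi\<^sub>M {1..n} (\<lambda>_. Pi\<^sub>M (UNIV :: int set) (\<lambda>_. borel))"

definition state_space :: "nat \<Rightarrow> config set" where
  "state_space n = {I \<in> space (config_space n). \<forall>i\<in>{1..n}.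
     (\<forall>k. 0 \<le> I i k) \<and>
     (\<exists>L>1. ((\<lambda>m::int. (\<Sum>k=m..0. I i k) / real_of_int \<bar>m\<bar>) \<longlongrightarrow> L) at_bot)}"

definition prob_measure_on_states :: "nat \<Rightarrow> config measure \<Rightarrow> bool" where
  "prob_measure_on_states n \<mu> \<longleftrightarrow>
     prob_space \<mu> \<and> sets \<mu> = sets (config_space n) \<and> (AE \<eta> in \<mu>. \<eta> \<in> state_space n)"

definition translation :: "nat \<Rightarrow> int \<Rightarrow> config \<Rightarrow> config" where
  "translation n l \<eta> = (\<lambda>i\<in>{1..n}. \<lambda>k. \<eta> i (k + l))"

definition translation_ergodic :: "nat \<Rightarrow> config measure \<Rightarrow> bool" where
  "translation_ergodic n \<mu> \<longleftrightarrow>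
     (\<forall>l. distr \<mu> (config_space n) (translation n l) = \<mu>) \<and>
     (\<forall>A\<in>sets (config_space n).
        (\<forall>l. translation n l -` A \<inter> space (config_space n) = A) \<longrightarrow>
        measure \<mu> A = 0 \<or> measure \<mu> A = 1)"

definition has_means :: "nat \<Rightarrow> (nat \<Rightarrow> real) \<Rightarrow> config measure \<Rightarrow> bool" where
  "has_means n \<rho> \<mu> \<longleftrightarrow> (\<forall>i\<in>{1..n}. \<forall>k.
     integrable \<mu> (\<lambda>\<eta>. \<eta> i k) \<and> (\<integral>\<eta>. \<eta> i k \<partial>\<mu>) = \<rho> i)"

definition is_primitive :: "(int \<Rightarrow> real) \<Rightarrow> (int \<Rightarrow> real) \<Rightarrow> bool" where
  "is_primitive F I \<longleftrightarrow> (\<forall>k. I k = F k - F (k - 1))"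

definition has_law :: "'a measure \<Rightarrow> 'b measure \<Rightarrow> ('a \<Rightarrow> 'b) \<Rightarrow> 'b measure \<Rightarrow> bool" where
  "has_law M N X \<mu> \<longleftrightarrow> X \<in> measurable M N \<and> distr M N X = \<mu>"


section \<open>Last-passage values and the increment process\<close>

definition sites :: "(int \<times> nat) set" where
  "sites = UNIV \<times> {1..}"

definition lattice_step :: "int \<times> nat \<Rightarrow> int \<times> nat \<Rightarrow> bool" where
  "lattice_step x y \<longleftrightarrow> y = (fst x + 1, snd x) \<or> y = (fst x, snd x + 1)"

definition lattice_paths :: "int \<times> nat \<Rightarrow> int \<times> nat \<Rightarrow> (int \<times> nat) list set" where
  "lattice_paths u v =
     {xs. xs \<noteq> [] \<and> hd xs = u \<and> last xs = v \<and> successively lattice_step xs}"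

definition last_passage :: "(int \<times> nat \<Rightarrow> real) \<Rightarrow> int \<times> nat \<Rightarrow> int \<times> nat \<Rightarrow> real" where
  "last_passage \<omega> u v = Max ((\<lambda>xs. \<Sum>x\<leftarrow>xs. \<omega> x) ` lattice_paths u v)"

text \<open>The suprema over \<open>{..k}\<close> below and in \<open>queue_map\<close> are real-valued. They are meaningful where
  the sets are bounded above, which holds almost surely for the measures considered.\<close>

definition boundary_passage ::
  "(int \<times> nat \<Rightarrow> real) \<Rightarrow> (int \<Rightarrow> real) \<Rightarrow> int \<Rightarrow> nat \<Rightarrow> real" where
  "boundary_passage \<omega> G0 k t = (SUP j\<in>{..k}. G0 j + last_passage \<omega> (j, 1) (k, t))"

definition increments ::
  "nat \<Rightarrow> (int \<times> nat \<Rightarrow> real) \<Rightarrow> (nat \<Rightarrow> int \<Rightarrow> real) \<Rightarrow> nat \<Rightarrow> config" where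
  "increments n \<omega> G0 t = (\<lambda>i\<in>{1..n}. \<lambda>k.
     boundary_passage \<omega> (G0 i) k t - boundary_passage \<omega> (G0 i) (k - 1) t)"

text \<open>Independence of \<open>\<omega>\<close> and \<open>\<eta>0\<close> is stated through the generated sigma algebras, since
  \<open>indep_var\<close> needs both random variables to take values in the same type.\<close>

definition process_data ::
  "nat \<Rightarrow> 'a measure \<Rightarrow> (int \<times> nat \<Rightarrow> 'a \<Rightarrow> real) \<Rightarrow> ('a \<Rightarrow> config) \<Rightarrow> bool" where
  "process_data n M \<omega> \<eta>0 \<longleftrightarrow>
     prob_space M \<and>
     prob_space.indep_vars M (\<lambda>_. borel) \<omega> sites \<and>
     (\<forall>x\<in>sites. distributed M lborel (\<omega> x) (exponential_density 1)) \<and>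
     \<eta>0 \<in> measurable M (config_space n) \<and>
     (AE a in M. \<eta>0 a \<in> state_space n) \<and>
     prob_space.indep_set M
       (sets (vimage_algebra (space M) \<eta>0 (config_space n)))
       (sets (vimage_algebra (space M) (\<lambda>a. \<lambda>x\<in>sites. \<omega> x a) (Pi\<^sub>M sites (\<lambda>_. borel))))"

text \<open>HOL cannot quantify over the type of the underlying sample space inside a formula, so this
  type is a parameter. If it is too small there may be no process started from \<open>\<mu>\<close>; the type
  \<open>canonical_sample\<close> always supports one, on the product of \<open>\<mu>\<close> and the law of the weights.\<close>

definition invariant_measure :: "'a itself \<Rightarrow> nat \<Rightarrow> config measure \<Rightarrow> bool" where
  "invariant_measure _ n \<mu> \<longleftrightarrow>
     (\<forall>(M :: 'a measure) \<omega> \<eta>0 G0.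
        process_data n M \<omega> \<eta>0 \<longrightarrow>
        (\<forall>a\<in>space M. \<forall>i\<in>{1..n}. is_primitive (G0 a i) (\<eta>0 a i)) \<longrightarrow>
        has_law M (config_space n) \<eta>0 \<mu> \<longrightarrow>
        (\<forall>t\<ge>1. has_law M (config_space n) (\<lambda>a. increments n (\<lambda>x. \<omega> x a) (G0 a) t) \<mu>))"

type_synonym canonical_sample = "config \<times> (int \<times> nat \<Rightarrow> real)"


section \<open>The queueing map and the measures \<open>\<mu>\<^sup>\<rho>\<close>\<close>

definition departures :: "(int \<Rightarrow> real) \<Rightarrow> (int \<Rightarrow> real) \<Rightarrow> int \<Rightarrow> real" where
  "departures F w l = (SUP k\<in>{..l}. F k + (\<Sum>i=k..l. w i))"

definition queue_map :: "(int \<Rightarrow> real) \<Rightarrow> (int \<Rightarrow> real) \<Rightarrow> int \<Rightarrow> real" where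
  "queue_map I w = (let F = (SOME F. is_primitive F I)
     in (\<lambda>l. departures F w l - departures F w (l - 1)))"

text \<open>\<open>queue_iter m \<zeta>\<close> is the iterated queueing map applied to \<open>(\<zeta> 1, \<dots>, \<zeta> m)\<close>, for \<open>m \<ge> 1\<close>; the equation for \<open>0\<close> is a dummy.\<close>

fun queue_iter :: "nat \<Rightarrow> (nat \<Rightarrow> int \<Rightarrow> real) \<Rightarrow> int \<Rightarrow> real" where
  "queue_iter 0 \<zeta> = (\<lambda>_. 0)"
| "queue_iter (Suc 0) \<zeta> = \<zeta> 1"
| "queue_iter (Suc (Suc m)) \<zeta> = queue_map (queue_iter (Suc m) \<zeta>) (\<zeta> (Suc (Suc m)))"

text \<open>The arguments are passed in reverse order: component \<open>i\<close> is the iterated queueing map applied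
  to \<open>(I i, I (i - 1), \<dots>, I 1)\<close>.\<close>

definition multi_queue :: "nat \<Rightarrow> config \<Rightarrow> config" where
  "multi_queue m I = (\<lambda>i\<in>{1..m}. queue_iter i (\<lambda>j. I (i + 1 - j)))"

definition exp_product :: "nat \<Rightarrow> (nat \<Rightarrow> real) \<Rightarrow> config measure" where
  "exp_product m \<sigma> = Pi\<^sub>M {1..m} (\<lambda>i. Pi\<^sub>M (UNIV :: int set)
     (\<lambda>_. density lborel (\<lambda>x. ennreal (exponential_density (1 / \<sigma> i) x))))"

definition mu_strict :: "nat \<Rightarrow> (nat \<Rightarrow> real) \<Rightarrow> config measure" where
  "mu_strict m \<sigma> = distr (exp_product m \<sigma>) (config_space m) (multi_queue m)"

definition block_decomposition ::
  "nat \<Rightarrow> (nat \<Rightarrow> real) \<Rightarrow> nat \<Rightarrow> (nat \<Rightarrow> real) \<Rightarrow> (nat \<Rightarrow> nat) \<Rightarrow> bool" where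
  "block_decomposition n \<rho> m \<sigma> b \<longleftrightarrow>
     m \<in> {1..n} \<and> (\<forall>l\<in>{1..m}. 0 < \<sigma> l) \<and> strict_mono_on {1..m} \<sigma> \<and>
     b 1 = 1 \<and> b (m + 1) = n + 1 \<and> strict_mono_on {1..m + 1} b \<and>
     (\<forall>l\<in>{1..m}. \<forall>i\<in>{b l..<b (l + 1)}. \<rho> i = \<sigma> l)"

text \<open>For nondecreasing \<open>\<rho>\<close> the decomposition is unique up to irrelevant values of \<open>\<sigma>\<close> and \<open>b\<close>
  outside their index ranges; for strictly increasing \<open>\<rho>\<close> it is \<open>m = n\<close>, \<open>\<sigma> = \<rho>\<close>, and
  \<open>mu_mono n \<rho>\<close> is \<open>mu_strict n \<rho>\<close>.\<close>

definition mu_mono :: "nat \<Rightarrow> (nat \<Rightarrow> real) \<Rightarrow> config measure" where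
  "mu_mono n \<rho> = (let (m, \<sigma>, b) = (SOME (m, \<sigma>, b). block_decomposition n \<rho> m \<sigma> b)
     in distr (mu_strict m \<sigma>) (config_space n)
          (\<lambda>\<zeta>. \<lambda>i\<in>{1..n}. \<zeta> (THE l. l \<in> {1..m} \<and> i \<in> {b l..<b (l + 1)})))"

text \<open>If \<open>\<xi>\<close> has law \<open>mu_mono n (\<rho> \<circ> \<pi>)\<close>, then \<open>\<eta> i = \<xi> (inv \<pi> i)\<close> satisfies
  \<open>(\<eta> (\<pi> 1), \<dots>, \<eta> (\<pi> n)) = \<xi>\<close>.\<close>

definition mu :: "nat \<Rightarrow> (nat \<Rightarrow> real) \<Rightarrow> config measure" where
  "mu n \<rho> = (let \<pi> = (SOME \<pi>. \<pi> permutes {1..n} \<and> mono_on {1..n} (\<rho> \<circ> \<pi>))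
     in distr (mu_mono n (\<rho> \<circ> \<pi>)) (config_space n) (\<lambda>\<xi>. \<lambda>i\<in>{1..n}. \<xi> (inv \<pi> i)))"

end

theory Submission
  imports Defs
begin

text \<open>One time step of the increment process feeds every component through a queue with the same
  fresh exponential services, so both claims reduce to this single queueing step.

  Invariance of \<open>\<mu>\<^sup>\<rho>\<close>: by the interchange identity for two queues in tandem, serving the image of the
  multiline configuration \<open>I\<close> amounts to applying the queueing map to the lines of \<open>I\<close> one after
  the other, where each line is served with the dual services left over by the previous one. By
  Burke's theorem each of these steps replaces the line by an independent copy. Ergodicity holds
  because \<open>\<mu>\<^sup>\<rho>\<close> is a translation-covariant image of independent sequences.

  Uniqueness: couple two ergodic invariant states by using the same services. If \<open>D, J\<close> and \<open>D', J'\<close>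
  are the departures and sojourn times of the two queues with arrivals \<open>I, I'\<close>, then
  \<open>\<bar>D k - D' k\<bar> + \<bar>J k - J' k\<bar> = \<bar>(I k - I' k) - (J (k - 1) - J' (k - 1))\<bar>\<close>, so the mean gap
  \<open>E \<bar>I 0 - I' 0\<bar>\<close> cannot increase, and it loses whatever cancels on the right. A service exceeding
  all arrivals of a window keeps both queues busy, so that all gaps of opposite signs in the window
  cancel. Since both states are ergodic with the same mean, the net gap over a long window is
  negligible compared with its length; hence a fixed proportion of the mean gap is lost in every
  step, up to an arbitrarily small error, and the mean gap tends to \<open>0\<close>.\<close>

section \<open>Sums over integer intervals and primitives\<close>

text \<open>The queue recursion comes out of the infinite past, so every law has to be reached from
  a finite start. For Burke's theorem a queue is started at a remote site with an independent
  exponential workload of rate 1/\<tau> - 1/\<sigma>; for this choice one local step preserves the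
  product law exactly, and stability makes the start forgotten. In the uniqueness part the coupling
  is only kept translation-invariant: a product of ergodic measures need not be ergodic. What
  persists from step to step are the marginals, since both states are invariant. All error terms
  depend on the marginals alone, so one contraction constant serves at every time; this turns a loss
  per step into convergence. No pointwise ergodic theorem is invoked: membership in the state space
  supplies the almost sure averages, and ergodicity only identifies them with the mean. All maps are
  total, with one default value for suprema of unbounded sets. Translation covariance therefore
  holds without exceptional points, and ergodicity, which speaks of strictly invariant sets, passes
  through the queueing maps.\<close>

lemma sum_int_last: "k \<le> l \<Longrightarrow> sum f {k..l} = sum f {k..l - 1} + f l" for k l :: int
proof -
  assume "k \<le> l"
  then have "{k..l} = insert l {k..l - 1}" by auto
  then show ?thesis by (simp add: add.commute)
qed

lemma sum_int_split:
  fixes k l m :: int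
  assumes "k \<le> m + 1" "m \<le> l"
  shows "sum f {k..l} = sum f {k..m} + sum f {m + 1..l}"
proof -
  have "{k..l} = {k..m} \<union> {m + 1..l}" using assms by auto
  then show ?thesis by (simp add: sum.union_disjoint)
qed

lemma sum_primitive:
  assumes "is_primitive F I" "k \<le> l + 1"
  shows "(\<Sum>i=k..l. I i) = F l - F (k - 1)"
proof -
  have "k - 1 \<le> l" using assms(2) by simp
  then show ?thesis
  proof (induction l rule: int_ge_induct)
    case (step i)
    have "(\<Sum>i=k..i + 1. I i) = (\<Sum>i=k..i. I i) + I (i + 1)"
      using sum_int_last[of k "i + 1" I] step by simp
    then show ?case using step assms(1) by (simp add: is_primitive_def)
  qed simp
qed

text \<open>The primitive of \<open>I\<close> that vanishes at 0; on either side of 0 one of the two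
  sums is empty. It is an explicit measurable function of \<open>I\<close>, whereas nothing is known
  about the measurability of the primitive that the choice operator in \<open>queue_map\<close>
  picks.\<close>

definition prim :: "(int \<Rightarrow> real) \<Rightarrow> int \<Rightarrow> real" where
  "prim I k = (\<Sum>i=1..k. I i) - (\<Sum>i=k + 1..0. I i)"

lemma is_primitive_prim: "is_primitive (prim I) I"
proof -
  have "I k = prim I k - prim I (k - 1)" for k
  proof (cases "k \<ge> 1")
    case True
    then show ?thesis using sum_int_last[of 1 k I] by (simp add: prim_def)
  next
    case False
    then have "sum I {k..0} = I k + sum I {k + 1..0}"
      using sum_int_split[of k k 0 I] by simp
    then show ?thesis using False by (simp add: prim_def)
  qed
  then show ?thesis by (simp add: is_primitive_def)
qed

lemma primitive_unique:
  assumes "is_primitive F I" "is_primitive G I"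
  shows "\<exists>c. \<forall>k. F k = G k + c"
proof (intro exI allI)
  fix k :: int
  have F: "F k = F (k - 1) + I k" and G: "G k = G (k - 1) + I k" for k
    using assms[unfolded is_primitive_def, THEN spec, of k] by linarith+
  show "F k = G k + (F 0 - G 0)"
  proof (induction k rule: int_induct[where k = 0])
    case (step1 i)
    then show ?case using F[of "i + 1"] G[of "i + 1"] by simp
  next
    case (step2 i)
    then show ?case using F[of i] G[of i] by simp
  qed simp
qed

lemma is_primitive_shift: "is_primitive F I \<Longrightarrow> is_primitive (\<lambda>k. F (k + l)) (\<lambda>k. I (k + l))"
  by (simp add: is_primitive_def diff_add_eq)


section \<open>Departures\<close>

text \<open>On the reals \<open>Sup\<close> takes the same junk value on all unbounded sets.\<close>

lemma Sup_real_unbounded: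
  fixes S T :: "real set"
  assumes "\<not> bdd_above S" "\<not> bdd_above T"
  shows "Sup S = Sup T"
proof -
  have "(\<lambda>z. \<forall>x\<in>S. x \<le> z) = (\<lambda>z. \<forall>x\<in>T. x \<le> z)"
    using assms by (auto simp: bdd_above_def fun_eq_iff)
  then show ?thesis by (simp add: Sup_real_def)
qed

lemma bdd_above_add_iff:
  fixes f :: "'a \<Rightarrow> real"
  shows "bdd_above ((\<lambda>x. f x + c) ` A) \<longleftrightarrow> bdd_above (f ` A)"
proof
  assume "bdd_above ((\<lambda>x. f x + c) ` A)"
  then obtain b where "\<And>x. x \<in> A \<Longrightarrow> f x + c \<le> b" by (auto simp: bdd_above_def)
  then have "\<And>x. x \<in> A \<Longrightarrow> f x \<le> b - c" by (simp add: le_diff_eq)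
  then show "bdd_above (f ` A)" by (intro bdd_aboveI2)
next
  assume "bdd_above (f ` A)"
  then obtain b where "\<And>x. x \<in> A \<Longrightarrow> f x \<le> b" by (auto simp: bdd_above_def)
  then show "bdd_above ((\<lambda>x. f x + c) ` A)" by (intro bdd_aboveI2[where M = "b + c"]) simp
qed

lemma cSUP_add_const:
  fixes f :: "'a \<Rightarrow> real"
  assumes "A \<noteq> {}" "bdd_above (f ` A)"
  shows "(SUP x\<in>A. f x + c) = (SUP x\<in>A. f x) + c"
proof (rule antisym)
  show "(SUP x\<in>A. f x + c) \<le> (SUP x\<in>A. f x) + c"
    using assms by (intro cSUP_least) (auto intro: cSUP_upper)
  have "(SUP x\<in>A. f x) \<le> (SUP x\<in>A. f x + c) - c"
  proof (rule cSUP_least[OF assms(1)])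
    fix x assume "x \<in> A"
    then have "f x + c \<le> (SUP x\<in>A. f x + c)"
      using assms(2) by (intro cSUP_upper) (auto simp: bdd_above_add_iff)
    then show "f x \<le> (SUP x\<in>A. f x + c) - c" by simp
  qed
  then show "(SUP x\<in>A. f x) + c \<le> (SUP x\<in>A. f x + c)" by simp
qed

text \<open>Either both families are bounded and the constant cancels, or both are unbounded and
  each difference is the default value minus itself. Increments of suprema thus ignore an additive
  constant even where the suprema are infinite.\<close>

lemma SUP_real_add_diff:
  fixes f g :: "'a \<Rightarrow> real"
  assumes "A \<noteq> {}" "B \<noteq> {}" and "bdd_above (f ` A) \<longleftrightarrow> bdd_above (g ` B)"
  shows "(SUP x\<in>A. f x + c) - (SUP x\<in>B. g x + c) = (SUP x\<in>A. f x) - (SUP x\<in>B. g x)"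
proof (cases "bdd_above (f ` A)")
  case True
  then show ?thesis using assms by (simp add: cSUP_add_const)
next
  case False
  then have "(SUP x\<in>A. f x + c) = (SUP x\<in>B. g x + c)" "(SUP x\<in>A. f x) = (SUP x\<in>B. g x)"
    using assms by (auto intro!: Sup_real_unbounded simp: bdd_above_add_iff)
  then show ?thesis by simp
qed

definition dep_bdd :: "(int \<Rightarrow> real) \<Rightarrow> (int \<Rightarrow> real) \<Rightarrow> int \<Rightarrow> bool" where
  "dep_bdd F w l \<longleftrightarrow> bdd_above ((\<lambda>k. F k + (\<Sum>i=k..l. w i)) ` {..l})"

lemma atMost_int_insert: "{..l} = insert l {..l - 1}" for l :: int by auto

lemma dep_image_insert:
  "(\<lambda>k. F k + (\<Sum>i=k..l. w i)) ` {..l} =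
     insert (F l + w l) ((\<lambda>k. (F k + (\<Sum>i=k..l - 1. w i)) + w l) ` {..l - 1})"
  for F :: "int \<Rightarrow> real" and l :: int
proof -
  have "(\<lambda>k. F k + (\<Sum>i=k..l. w i)) ` {..l - 1} = (\<lambda>k. (F k + (\<Sum>i=k..l - 1. w i)) + w l) ` {..l - 1}"
    by (intro image_cong refl) (simp add: sum_int_last[of _ l w])
  then show ?thesis by (simp add: atMost_int_insert[of l])
qed

text \<open>Moving the endpoint by one site shifts the set and adds one point. Hence the two suprema
  in an increment of \<open>departures\<close> are bounded or unbounded together, which is the
  condition of \<open>SUP_real_add_diff\<close>.\<close>

lemma dep_bdd_pred: "dep_bdd F w l \<longleftrightarrow> dep_bdd F w (l - 1)"
  unfolding dep_bdd_def dep_image_insert[of F w l] by (simp add: bdd_above_add_iff)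

text \<open>With \<open>F l\<close> as the arrival time of customer \<open>l\<close> and
  \<open>w l\<close> as the service time, this is the single-server recursion: service starts at the
  later of the arrival and the previous departure. It comes from splitting the last index off the
  supremum.\<close>

lemma departures_rec:
  assumes "dep_bdd F w l"
  shows "departures F w l = w l + max (departures F w (l - 1)) (F l)"
proof -
  let ?A = "(\<lambda>k. (F k + (\<Sum>i=k..l - 1. w i)) + w l) ` {..l - 1}"
  have b: "bdd_above ((\<lambda>k. F k + (\<Sum>i=k..l - 1. w i)) ` {..l - 1})"
    using assms dep_bdd_pred[of F w l] by (simp add: dep_bdd_def)
  have "departures F w l = Sup (insert (F l + w l) ?A)"
    unfolding departures_def dep_image_insert ..
  also have "\<dots> = sup (F l + w l) (Sup ?A)"
    by (rule cSup_insert) (use b in \<open>auto simp: bdd_above_add_iff\<close>)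
  also have "Sup ?A = departures F w (l - 1) + w l"
    unfolding departures_def by (rule cSUP_add_const) (use b in auto)
  finally show ?thesis by (auto simp: sup_real_def max_def)
qed

lemma departures_least: "(\<And>k. k \<le> l \<Longrightarrow> F k + (\<Sum>i=k..l. w i) \<le> c) \<Longrightarrow> departures F w l \<le> c"
  unfolding departures_def by (rule cSUP_least) auto

text \<open>Two primitives differ by a constant, which cancels in the increments whether or not the
  suprema are finite. So the choice in \<open>queue_map\<close> may always be replaced by a
  convenient primitive, without any stability assumption.\<close>

lemma queue_map_eq:
  assumes "is_primitive F I"
  shows "queue_map I w = (\<lambda>l. departures F w l - departures F w (l - 1))"
proof -
  define G where "G = (SOME F. is_primitive F I)"
  have "is_primitive G I" unfolding G_def by (rule someI[of "\<lambda>F. is_primitive F I", OF assms])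
  then obtain c where G: "G k = F k + c" for k using primitive_unique[OF _ assms] by blast
  have "departures G w l - departures G w (l - 1) = departures F w l - departures F w (l - 1)" for l
  proof -
    have "departures G w m = (SUP k\<in>{..m}. (F k + (\<Sum>i=k..m. w i)) + c)" for m
      unfolding departures_def by (intro SUP_cong) (auto simp: G)
    moreover have "(bdd_above ((\<lambda>k. F k + (\<Sum>i=k..l. w i)) ` {..l})) =
        (bdd_above ((\<lambda>k. F k + (\<Sum>i=k..l - 1. w i)) ` {..l - 1}))"
      using dep_bdd_pred[of F w l] by (simp add: dep_bdd_def)
    ultimately show ?thesis
      by (subst (3 4) departures_def) (simp add: SUP_real_add_diff)
  qed
  then show ?thesis unfolding queue_map_def Let_def G_def[symmetric] by auto
qed

lemma is_primitive_departures: "is_primitive F I \<Longrightarrow> is_primitive (departures F w) (queue_map I w)"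
  unfolding is_primitive_def[of "departures F w"] by (simp add: queue_map_eq[of F])

text \<open>Only the index set of the supremum is relabelled, so covariance holds at every pair of
  sequences, stable or not.\<close>

lemma queue_map_shift: "queue_map (\<lambda>k. I (k + l)) (\<lambda>k. w (k + l)) = (\<lambda>k. queue_map I w (k + l))"
proof -
  have prim: "is_primitive (\<lambda>k. prim I (k + l)) (\<lambda>k. I (k + l))"
    by (rule is_primitive_shift[OF is_primitive_prim])
  have "departures (\<lambda>k. prim I (k + l)) (\<lambda>k. w (k + l)) m = departures (prim I) w (m + l)" for m
  proof -
    have "bij_betw (\<lambda>k. k + l) {..m} {..m + l}"
      by (rule bij_betwI[where g = "\<lambda>k. k - l"]) auto
    then have im: "(\<lambda>k. k + l) ` {..m} = {..m + l}" by (simp add: bij_betw_def)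
    have s: "(\<Sum>i=k..m. w (i + l)) = (\<Sum>i=k + l..m + l. w i)" for k
      by (rule sum.reindex_bij_witness[where i = "\<lambda>i. i - l" and j = "\<lambda>i. i + l"]) auto
    show ?thesis unfolding departures_def im[symmetric] by (simp add: image_image s)
  qed
  then show ?thesis
    by (simp add: queue_map_eq[OF prim] queue_map_eq[OF is_primitive_prim] diff_add_eq)
qed


section \<open>Stable queues\<close>

text \<open>The hypothesis of the queueing map, with the lower index running through
  \<open>- int N\<close> so that it is a limit along a sequence. The offset \<open>k + 1\<close>
  fits the supremum in \<open>departures\<close>: the sum from \<open>k\<close> equals
  \<open>F k + (\<Sum>i=k..0. w i) - F 1\<close>.\<close>

definition stable :: "(int \<Rightarrow> real) \<Rightarrow> (int \<Rightarrow> real) \<Rightarrow> bool" where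
  "stable I w \<longleftrightarrow> filterlim (\<lambda>N::nat. \<Sum>k=- int N..0. w k - I (k + 1)) at_bot sequentially"

text \<open>The terms of the supremum differ from the partial sums in \<open>stable\<close> by
  quantities that do not involve \<open>k\<close>, namely \<open>F 1\<close>, \<open>C 0\<close> and
  \<open>C l\<close>; these are put into the threshold. Hence the terms tend to minus infinity as
  \<open>k\<close> does.\<close>

lemma stable_tail:
  assumes "stable I w" "is_primitive F I"
  shows "\<exists>k0. \<forall>k\<le>k0. k \<le> l \<and> F k + (\<Sum>i=k..l. w i) \<le> c"
proof -
  define C where "C = prim w"
  have C: "is_primitive C w" by (simp add: C_def is_primitive_prim)
  have F1: "is_primitive (\<lambda>k. F (k + 1)) (\<lambda>k. I (k + 1))"
    by (rule is_primitive_shift[OF assms(2)])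
  have "\<forall>\<^sub>F N in sequentially. (\<Sum>k=- int N..0. w k - I (k + 1)) \<le> c - F 1 + C 0 - C l"
    using assms(1) unfolding stable_def filterlim_at_bot by blast
  then obtain N0 where N0: "\<And>N. N \<ge> N0 \<Longrightarrow> (\<Sum>k=- int N..0. w k - I (k + 1)) \<le> c - F 1 + C 0 - C l"
    by (auto simp: eventually_sequentially)
  show ?thesis
  proof (intro exI allI impI)
    fix k assume k: "k \<le> min l (min 0 (- int N0))"
    define N where "N = nat (- k)"
    have N: "k = - int N" "N \<ge> N0" using k by (auto simp: N_def)
    have "(\<Sum>i=k..0. w i - I (i + 1)) = (\<Sum>i=k..0. w i) - (\<Sum>i=k..0. I (i + 1))"
      by (rule sum_subtractf)
    also have "\<dots> = (C 0 - C (k - 1)) - (F 1 - F k)"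
      using sum_primitive[OF C, of k 0] sum_primitive[OF F1, of k 0] k by simp
    finally have "(C 0 - C (k - 1)) - (F 1 - F k) \<le> c - F 1 + C 0 - C l"
      using N0[OF N(2)] N(1) by simp
    moreover have "(\<Sum>i=k..l. w i) = C l - C (k - 1)"
      using k by (intro sum_primitive[OF C]) auto
    ultimately show "k \<le> l \<and> F k + (\<Sum>i=k..l. w i) \<le> c" using k by auto
  qed
qed

lemma stable_dep_bdd:
  assumes "stable I w" "is_primitive F I"
  shows "dep_bdd F w l"
proof -
  obtain k0 where k0: "\<And>k. k \<le> k0 \<Longrightarrow> k \<le> l \<and> F k + (\<Sum>i=k..l. w i) \<le> 0"
    using stable_tail[OF assms] by blast
  have "{..l} = {..k0} \<union> {k0 + 1..l}" using k0 by auto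
  moreover have "bdd_above ((\<lambda>k. F k + (\<Sum>i=k..l. w i)) ` {..k0})"
    using k0 by (intro bdd_aboveI2[where M = 0]) auto
  ultimately show ?thesis unfolding dep_bdd_def by (simp add: image_Un)
qed

text \<open>Unrolling the recursion from \<open>a\<close> separates the influence of the initial
  value from that of the arrivals after \<open>a\<close>, which is collected in \<open>H\<close>.
  The order of quantifiers matters: one \<open>H\<close> serves all solutions \<open>G\<close>, so
  solutions with different initial values can be compared.\<close>

lemma recursion_max_form:
  fixes F w :: "int \<Rightarrow> real"
  assumes "a < k"
  shows "\<exists>H\<ge>F k + w k. \<forall>G. (\<forall>j\<in>{a<..k}. G j = w j + max (G (j - 1)) (F j))
           \<longrightarrow> G k = max (G a + (\<Sum>j=a + 1..k. w j)) H"
proof -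
  have "a + 1 \<le> k" using assms by simp
  then show ?thesis
  proof (induction k rule: int_ge_induct)
    case base
    show ?case by (rule exI[where x = "F (a + 1) + w (a + 1)"]) (auto simp: max_def)
  next
    case (step k)
    then obtain H where H: "F k + w k \<le> H"
      "\<And>G. (\<forall>j\<in>{a<..k}. G j = w j + max (G (j - 1)) (F j)) \<Longrightarrow> G k = max (G a + (\<Sum>j=a + 1..k. w j)) H"
      by blast
    show ?case
    proof (intro exI[where x = "w (k + 1) + max H (F (k + 1))"] conjI allI impI)
      fix G :: "int \<Rightarrow> real" assume G: "\<forall>j\<in>{a<..k + 1}. G j = w j + max (G (j - 1)) (F j)"
      then have "G k = max (G a + (\<Sum>j=a + 1..k. w j)) H" by (intro H(2)) auto
      moreover have "G (k + 1) = w (k + 1) + max (G k) (F (k + 1))" using G step(1) by simp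
      moreover have "(\<Sum>j=a + 1..k + 1. w j) = (\<Sum>j=a + 1..k. w j) + w (k + 1)"
        using sum_int_last[of "a + 1" "k + 1" w] step(1) by simp
      ultimately show "G (k + 1) = max (G a + (\<Sum>j=a + 1..k + 1. w j)) (w (k + 1) + max H (F (k + 1)))"
        by (simp add: max_def)
    qed simp
  qed
qed

text \<open>The departure process is eventually determined by the input after a past time, whatever
  the workload at that time.\<close>

lemma departures_coupling:
  assumes st: "stable I w" and F: "is_primitive F I" and w: "\<And>k. w k \<ge> 0"
  shows "\<exists>a0<k. \<forall>a\<le>a0. \<forall>G. G a = F a + s \<longrightarrow> (\<forall>j\<in>{a<..k}. G j = w j + max (G (j - 1)) (F j))
           \<longrightarrow> G k = departures F w k"
proof -
  have bdd: "dep_bdd F w l" for l by (rule stable_dep_bdd[OF st F])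
  \<comment> \<open>For a start at or before \<open>k0\<close>, the contribution of the past stays
    below \<open>F k + w k\<close> even after adding \<bar>s\<bar>. It then loses in the maximum
    against customer \<open>k\<close> alone, because \<open>F k + w k \<le> H\<close>.\<close>
  obtain k0 where k0: "\<And>j. j \<le> k0 \<Longrightarrow> j \<le> k \<and> F j + (\<Sum>i=j..k. w i) \<le> F k + w k - \<bar>s\<bar>"
    using stable_tail[OF st F] by blast
  show ?thesis
  proof (intro exI[where x = "min k0 (k - 1)"] conjI allI impI)
    show "min k0 (k - 1) < k" by simp
    fix a G assume a: "a \<le> min k0 (k - 1)" and Ga: "G a = F a + s"
      and G: "\<forall>j\<in>{a<..k}. G j = w j + max (G (j - 1)) (F j)"
    obtain H where H: "F k + w k \<le> H"
      "\<And>G. (\<forall>j\<in>{a<..k}. G j = w j + max (G (j - 1)) (F j)) \<Longrightarrow> G k = max (G a + (\<Sum>j=a + 1..k. w j)) H"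
      using recursion_max_form[of a k F w] a by auto
    have split: "(\<Sum>i=j..k. w i) = (\<Sum>i=j..a. w i) + (\<Sum>i=a + 1..k. w i)" if "j \<le> a" for j
      using sum_int_split[of j a k w] that a by simp
    have "departures F w k = max (departures F w a + (\<Sum>j=a + 1..k. w j)) H"
      by (rule H(2)) (use departures_rec[OF bdd] in blast)
    moreover have "departures F w a \<le> F k + w k - (\<Sum>j=a + 1..k. w j)"
    proof (rule departures_least)
      fix j assume "j \<le> a"
      then show "F j + (\<Sum>i=j..a. w i) \<le> F k + w k - (\<Sum>j=a + 1..k. w j)"
        using k0[of j] split[of j] a by simp
    qed
    moreover have "G k = max (G a + (\<Sum>j=a + 1..k. w j)) H" by (rule H(2)[OF G])
    moreover have "G a + (\<Sum>j=a + 1..k. w j) \<le> F k + w k"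
      using k0[of a] split[of a] a w[of a] Ga by simp
    ultimately show "G k = departures F w k" using H(1) by (simp add: max_def)
  qed
qed

text \<open>The time from arrival to departure of customer \<open>k\<close>. Only differences of
  \<open>prim I\<close> occur under the supremum, so the normalisation of the primitive is
  invisible, which gives the covariance under shifts.\<close>

definition sojourn :: "(int \<Rightarrow> real) \<Rightarrow> (int \<Rightarrow> real) \<Rightarrow> int \<Rightarrow> real" where
  "sojourn I w k = (SUP j\<in>{..k}. prim I j - prim I k + (\<Sum>i=j..k. w i))"

text \<open>Defined by conservation: interarrival plus service equals interdeparture plus dual
  service. This form makes a primitive of the dual services immediately available; the familiar form
  as a minimum, valid for stable queues, is derived below.\<close>

definition dual_services :: "(int \<Rightarrow> real) \<Rightarrow> (int \<Rightarrow> real) \<Rightarrow> int \<Rightarrow> real" where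
  "dual_services I w k = I k + w k - queue_map I w k"

lemma sojourn_eq:
  assumes st: "stable I w" and F: "is_primitive F I"
  shows "sojourn I w k = departures F w k - F k"
proof -
  obtain c where c: "prim I j = F j + c" for j
    using primitive_unique[OF is_primitive_prim F] by blast
  have "sojourn I w k = (SUP j\<in>{..k}. (F j + (\<Sum>i=j..k. w i)) + (- F k))"
    unfolding sojourn_def by (intro SUP_cong) (auto simp: c)
  also have "\<dots> = departures F w k + (- F k)"
    unfolding departures_def
    by (rule cSUP_add_const) (use stable_dep_bdd[OF st F, of k] in \<open>auto simp: dep_bdd_def\<close>)
  finally show ?thesis by simp
qed

lemma sojourn_shift: "sojourn (\<lambda>k. I (k + l)) (\<lambda>k. w (k + l)) m = sojourn I w (m + l)"
proof -
  obtain c where c: "prim (\<lambda>k. I (k + l)) j = prim I (j + l) + c" for j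
    using primitive_unique[OF is_primitive_prim is_primitive_shift[OF is_primitive_prim]] by metis
  have "bij_betw (\<lambda>k. k + l) {..m} {..m + l}"
    by (rule bij_betwI[where g = "\<lambda>k. k - l"]) auto
  then have im: "(\<lambda>k. k + l) ` {..m} = {..m + l}" by (simp add: bij_betw_def)
  have s: "(\<Sum>i=k..m. w (i + l)) = (\<Sum>i=k + l..m + l. w i)" for k
    by (rule sum.reindex_bij_witness[where i = "\<lambda>i. i - l" and j = "\<lambda>i. i + l"]) auto
  show ?thesis unfolding sojourn_def im[symmetric] by (simp add: image_image s c)
qed

text \<open>All three follow from the departure recursion by subtracting the arrival time. The
  positive part of \<open>I k - sojourn I w (k - 1)\<close> is the idle time before customer
  \<open>k\<close>, its negative part is the waiting time, and the dual service is the minimum of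
  the two numbers compared.\<close>

lemma
  assumes st: "stable I w"
  shows sojourn_rec: "sojourn I w k = w k + max (sojourn I w (k - 1) - I k) 0"
    and queue_map_rec: "queue_map I w k = w k + max (I k - sojourn I w (k - 1)) 0"
    and dual_services_rec: "dual_services I w k = min (I k) (sojourn I w (k - 1))"
proof -
  define F where "F = prim I"
  have F: "is_primitive F I" by (simp add: F_def is_primitive_prim)
  have Fk: "F k = F (k - 1) + I k"
    using F[unfolded is_primitive_def, THEN spec, of k] by linarith
  note rec = departures_rec[OF stable_dep_bdd[OF st F], of k]
  show "sojourn I w k = w k + max (sojourn I w (k - 1) - I k) 0"
    using rec by (simp add: sojourn_eq[OF st F] Fk)
  show q: "queue_map I w k = w k + max (I k - sojourn I w (k - 1)) 0"
    using rec by (simp add: sojourn_eq[OF st F] queue_map_eq[OF F] Fk)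
  show "dual_services I w k = min (I k) (sojourn I w (k - 1))"
    unfolding dual_services_def q by (simp add: max_def min_def)
qed

section \<open>Cesaro averages\<close>

text \<open>There are \<open>N + 1\<close> terms but the divisor is \<open>N\<close>, in agreement
  with the state space; the ratio of the two tends to 1. The value at \<open>N = 0\<close>, a
  division by zero, does not affect the limit.\<close>

definition has_avg :: "(int \<Rightarrow> real) \<Rightarrow> real \<Rightarrow> bool" where
  "has_avg I L \<longleftrightarrow> (\<lambda>N::nat. (\<Sum>k=- int N..0. I k) / real N) \<longlonglongrightarrow> L"

lemma has_avg_iff_at_bot:
  "has_avg I L \<longleftrightarrow> ((\<lambda>m::int. (\<Sum>k=m..0. I k) / real_of_int \<bar>m\<bar>) \<longlongrightarrow> L) at_bot"
proof
  have lim: "filterlim (\<lambda>N::nat. - int N) at_bot sequentially"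
    unfolding filterlim_at_bot
  proof
    fix Z :: int
    show "\<forall>\<^sub>F N in sequentially. - int N \<le> Z"
      unfolding eventually_sequentially by (rule exI[where x = "nat \<bar>Z\<bar>"]) auto
  qed
  assume "((\<lambda>m::int. (\<Sum>k=m..0. I k) / real_of_int \<bar>m\<bar>) \<longlongrightarrow> L) at_bot"
  from filterlim_compose[OF this lim] show "has_avg I L" by (simp add: has_avg_def)
next
  assume *: "has_avg I L"
  have lim: "filterlim (\<lambda>m::int. nat (- m)) sequentially at_bot"
    unfolding filterlim_at_top
  proof
    fix Z :: nat
    show "\<forall>\<^sub>F m in at_bot. Z \<le> nat (- m)"
      unfolding eventually_at_bot_linorder by (rule exI[where x = "- int Z"]) auto
  qed
  from filterlim_compose[OF *[unfolded has_avg_def] lim]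
  have "((\<lambda>m::int. (\<Sum>k=- int (nat (- m))..0. I k) / real (nat (- m))) \<longlongrightarrow> L) at_bot" .
  then show "((\<lambda>m::int. (\<Sum>k=m..0. I k) / real_of_int \<bar>m\<bar>) \<longlongrightarrow> L) at_bot"
    by (rule Lim_transform_eventually)
       (rule eventually_mono[OF eventually_le_at_bot[of "0::int"]], auto)
qed

lemma has_avg_diff: "has_avg I a \<Longrightarrow> has_avg w b \<Longrightarrow> has_avg (\<lambda>k. I k - w k) (a - b)"
  unfolding has_avg_def sum_subtractf diff_divide_distrib by (rule tendsto_diff)

lemma sum_int_shift: "(\<Sum>i=a..b. f (i + l)) = (\<Sum>i=a + l..b + l. f i)" for a b l :: int
  by (rule sum.reindex_bij_witness[where i = "\<lambda>i. i - l" and j = "\<lambda>i. i + l"]) auto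

lemma has_avg_shift1:
  assumes "has_avg I L"
  shows "has_avg (\<lambda>k. I (k + 1)) L"
proof -
  define S where "S N = (\<Sum>k=- int N..0. I k)" for N :: nat
  have "(\<lambda>N. S N / real N * (real N / real (Suc N)) + I 1 / real (Suc N)) \<longlonglongrightarrow> L * 1 + 0"
    using assms[unfolded has_avg_def S_def[symmetric]] LIMSEQ_Suc[OF lim_const_over_n[of "I 1"]]
    by (intro tendsto_add tendsto_mult LIMSEQ_n_over_Suc_n)
  moreover have "S N / real N * (real N / real (Suc N)) + I 1 / real (Suc N) =
      (\<Sum>k=- int (Suc N)..0. I (k + 1)) / real (Suc N)" if "N > 0" for N
  proof -
    have "(\<Sum>k=- int (Suc N)..0. I (k + 1)) = (\<Sum>k=- int N..1. I k)"
      by (subst sum_int_shift) simp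
    also have "\<dots> = S N + I 1" unfolding S_def using sum_int_last[of "- int N" 1 I] by simp
    finally show ?thesis using that by (simp add: add_divide_distrib)
  qed
  then have "\<forall>\<^sub>F N in sequentially. S N / real N * (real N / real (Suc N)) + I 1 / real (Suc N) =
      (\<Sum>k=- int (Suc N)..0. I (k + 1)) / real (Suc N)"
    by (intro eventually_mono[OF eventually_gt_at_top[of 0]]) auto
  ultimately have "(\<lambda>N. (\<Sum>k=- int (Suc N)..0. I (k + 1)) / real (Suc N)) \<longlonglongrightarrow> L * 1 + 0"
    by (rule Lim_transform_eventually)
  then show ?thesis
    unfolding has_avg_def
    by (intro LIMSEQ_imp_Suc[where f = "\<lambda>N. (\<Sum>k=- int N..0. I (k + 1)) / real N"]) simp
qed

lemma has_avg_shift_minus1: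
  assumes "has_avg I L"
  shows "has_avg (\<lambda>k. I (k - 1)) L"
proof -
  define S where "S N = (\<Sum>k=- int N..0. I k)" for N :: nat
  have "(\<lambda>N. S (Suc N) / real (Suc N) * (real (Suc N) / real N) - I 0 / real N) \<longlonglongrightarrow> L * 1 - 0"
    using LIMSEQ_Suc[OF assms[unfolded has_avg_def S_def[symmetric]]]
    by (intro tendsto_diff tendsto_mult LIMSEQ_Suc_n_over_n lim_const_over_n)
  moreover have "S (Suc N) / real (Suc N) * (real (Suc N) / real N) - I 0 / real N =
      (\<Sum>k=- int N..0. I (k - 1)) / real N" for N
  proof -
    have "(\<Sum>k=- int N..0. I (k - 1)) = (\<Sum>k=- int (Suc N)..-1. I k)"
      using sum_int_shift[of "\<lambda>k. I k" "-1" "- int N" 0] by (simp add: algebra_simps)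
    also have "\<dots> = S (Suc N) - I 0" unfolding S_def using sum_int_last[of "- int (Suc N)" 0 I] by simp
    finally show ?thesis by (simp add: diff_divide_distrib del: of_nat_Suc)
  qed
  ultimately show ?thesis unfolding has_avg_def by simp
qed

lemma has_avg_shift:
  assumes "has_avg I L"
  shows "has_avg (\<lambda>k. I (k + l)) L"
proof (induction l rule: int_induct[where k = 0])
  case (step1 i)
  from has_avg_shift1[OF step1(2)] show ?case by (simp add: add.assoc add.commute[of 1])
next
  case (step2 i)
  from has_avg_shift_minus1[OF step2(2)] show ?case by (simp add: algebra_simps)
qed (use assms in simp)

text \<open>The partial sums behave like \<open>(b - a) * N\<close> and therefore drift to minus
  infinity. Stability is always verified in this way, from a mean service below the mean
  interarrival time.\<close>

lemma stable_of_avg: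
  assumes "has_avg I a" "has_avg w b" "b < a"
  shows "stable I w"
proof -
  have "has_avg (\<lambda>k. w k - I (k + 1)) (b - a)"
    by (intro has_avg_diff has_avg_shift1 assms)
  then have "filterlim (\<lambda>N::nat. ((\<Sum>k=- int N..0. w k - I (k + 1)) / real N) * real N) at_bot sequentially"
    unfolding has_avg_def
    by (rule filterlim_tendsto_neg_mult_at_bot) (use assms(3) filterlim_real_sequentially in auto)
  moreover have "\<forall>\<^sub>F N in sequentially. ((\<Sum>k=- int N..0. w k - I (k + 1)) / real N) * real N =
      (\<Sum>k=- int N..0. w k - I (k + 1))"
    by (intro eventually_mono[OF eventually_gt_at_top[of 0]]) auto
  ultimately show ?thesis unfolding stable_def
    by (subst (asm) filterlim_cong[OF refl refl]) auto
qed


section \<open>Iterated suprema\<close>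

text \<open>Here \<open>L j\<close> is the maximum of \<open>A j l + c l\<close> over the
  intermediate index \<open>l\<close>, so the claim is an exchange of two suprema. As the reals are
  only conditionally complete, boundedness has to be carried along; here it passes from the iterated
  supremum to the single one, and the next lemma handles the opposite direction.\<close>

lemma
  fixes g :: "int \<Rightarrow> real"
  assumes b1: "\<And>l. l \<le> m \<Longrightarrow> bdd_above ((\<lambda>j. g j + A j l) ` {..l})"
    and b2: "bdd_above ((\<lambda>l. (SUP j\<in>{..l}. g j + A j l) + c l) ` {..m})"
    and L1: "\<And>j l. j \<le> l \<Longrightarrow> l \<le> m \<Longrightarrow> A j l + c l \<le> L j"
    and L2: "\<And>j. j \<le> m \<Longrightarrow> \<exists>l\<in>{j..m}. L j = A j l + c l"
  shows nested_SUP_bdd: "bdd_above ((\<lambda>j. g j + L j) ` {..m})"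
    and nested_SUP: "(SUP j\<in>{..m}. g j + L j) = (SUP l\<in>{..m}. (SUP j\<in>{..l}. g j + A j l) + c l)"
proof -
  let ?R = "SUP l\<in>{..m}. (SUP j\<in>{..l}. g j + A j l) + c l"
  have le: "g j + L j \<le> ?R" if j: "j \<in> {..m}" for j
  proof -
    obtain l where l: "l \<in> {j..m}" "L j = A j l + c l" using L2 j by blast
    then have "g j + A j l \<le> (SUP j\<in>{..l}. g j + A j l)" by (intro cSUP_upper b1) auto
    moreover have "(SUP j\<in>{..l}. g j + A j l) + c l \<le> ?R" using l by (intro cSUP_upper b2) auto
    ultimately show ?thesis using l(2) by simp
  qed
  show b: "bdd_above ((\<lambda>j. g j + L j) ` {..m})" using le by (intro bdd_aboveI2)
  show "(SUP j\<in>{..m}. g j + L j) = ?R"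
  proof (rule antisym)
    show "(SUP j\<in>{..m}. g j + L j) \<le> ?R" by (rule cSUP_least) (use le in auto)
    show "?R \<le> (SUP j\<in>{..m}. g j + L j)"
    proof (rule cSUP_least)
      fix l assume l: "l \<in> {..m}"
      have "(SUP j\<in>{..l}. g j + A j l) \<le> (SUP j\<in>{..m}. g j + L j) - c l"
      proof (rule cSUP_least)
        fix j assume j: "j \<in> {..l}"
        have "g j + L j \<le> (SUP j\<in>{..m}. g j + L j)" using j l by (intro cSUP_upper b) auto
        then show "g j + A j l \<le> (SUP j\<in>{..m}. g j + L j) - c l" using L1[of j l] j l by simp
      qed auto
      then show "(SUP j\<in>{..l}. g j + A j l) + c l \<le> (SUP j\<in>{..m}. g j + L j)" by simp
    qed auto
  qed
qed

lemma
  fixes g :: "int \<Rightarrow> real"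
  assumes b: "bdd_above ((\<lambda>j. g j + L j) ` {..m})"
    and L1: "\<And>j l. j \<le> l \<Longrightarrow> l \<le> m \<Longrightarrow> A j l + c l \<le> L j"
  shows nested_bdd_inner: "l \<le> m \<Longrightarrow> bdd_above ((\<lambda>j. g j + A j l) ` {..l})"
    and nested_bdd_outer: "bdd_above ((\<lambda>l. (SUP j\<in>{..l}. g j + A j l) + c l) ` {..m})"
proof -
  obtain M where M: "\<And>j. j \<le> m \<Longrightarrow> g j + L j \<le> M" using b by (auto simp: bdd_above_def)
  have le: "g j + A j l \<le> M - c l" if "j \<le> l" "l \<le> m" for j l
    using M[of j] L1[of j l] that by simp
  then show "l \<le> m \<Longrightarrow> bdd_above ((\<lambda>j. g j + A j l) ` {..l})"
    by (intro bdd_aboveI2[where M = "M - c l"]) auto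
  show "bdd_above ((\<lambda>l. (SUP j\<in>{..l}. g j + A j l) + c l) ` {..m})"
  proof (rule bdd_aboveI2)
    fix l assume l: "l \<in> {..m}"
    have "(SUP j\<in>{..l}. g j + A j l) \<le> M - c l" by (rule cSUP_least) (use le l in auto)
    then show "(SUP j\<in>{..l}. g j + A j l) + c l \<le> M" by simp
  qed
qed


section \<open>The interchange identity for queues in tandem\<close>

text \<open>A running maximum \<open>M\<close> of \<open>x\<close>: the maximum of \<open>x\<close> over a window can be read off from the
  reflected increments \<open>x l - M l - M (l - 1)\<close>. This is why replacing the services of two queues
  in tandem by (dual services, departures) leaves the last-passage values unchanged.\<close>

lemma running_max_window:
  fixes x M :: "int \<Rightarrow> real"
  assumes rec: "\<And>l. M l = max (M (l - 1)) (x l)" and km: "k \<le> m"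
    and X1: "\<And>l. k \<le> l \<Longrightarrow> l \<le> m \<Longrightarrow> x l \<le> X" and X2: "\<exists>l\<in>{k..m}. X = x l"
  shows "(\<forall>l\<in>{k..m}. x l - M l - M (l - 1) + M m + M (k - 1) \<le> X) \<and>
         (\<exists>l\<in>{k..m}. X = x l - M l - M (l - 1) + M m + M (k - 1))"
proof -
  have mono: "M i \<le> M j" if "i \<le> j" for i j
    using that
  proof (induction j rule: int_ge_induct)
    case (step j)
    then show ?case using rec[of "j + 1"] by simp
  qed simp
  have le: "M l \<le> y" if "k - 1 \<le> l" "M (k - 1) \<le> y" "\<And>i. k \<le> i \<Longrightarrow> i \<le> l \<Longrightarrow> x i \<le> y" for l y
    using that
  proof (induction l rule: int_ge_induct)
    case (step j)
    then show ?case using rec[of "j + 1"] by simp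
  qed simp
  show ?thesis
  proof (cases "X \<le> M (k - 1)")
    \<comment> \<open>The window sets no new record: \<open>M\<close> is constant on it, and the
      correction terms cancel.\<close>
    case True
    have c: "M l = M (k - 1)" if "k - 1 \<le> l" "l \<le> m" for l
    proof (rule antisym)
      show "M l \<le> M (k - 1)"
        by (rule le) (use X1 True that in \<open>auto intro: order_trans\<close>)
    qed (use mono that in auto)
    have eq: "x l - M l - M (l - 1) + M m + M (k - 1) = x l" if "l \<in> {k..m}" for l
      using c[of l] c[of "l - 1"] c[of m] that by auto
    show ?thesis using X1 X2 eq by (metis atLeastAtMost_iff)
  next
    case False
    have Mm: "M m = X"
    proof (rule antisym)
      show "M m \<le> X" by (rule le) (use X1 False km in auto)
      obtain l where "l \<in> {k..m}" "X = x l" using X2 by blast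
      then show "X \<le> M m" using rec[of l] mono[of l m] by auto
    qed
    have 1: "x l - M l - M (l - 1) + M m + M (k - 1) \<le> X" if "l \<in> {k..m}" for l
      using rec[of l] mono[of "k - 1" "l - 1"] that Mm by auto
    \<comment> \<open>Now the window sets a record and \<open>M m = X\<close>. At the first site
      \<open>l\<close> above the old record one has \<open>M (l - 1) = M (k - 1)\<close> and
      \<open>M l = x l\<close>, so the reflected expression attains \<open>X\<close> there.\<close>
    define S where "S = {l\<in>{k..m}. x l > M (k - 1)}"
    have "S \<subseteq> {k..m}" by (auto simp: S_def)
    then have "finite S" by (rule finite_subset) simp
    moreover have "S \<noteq> {}" using X2 False by (auto simp: S_def)
    ultimately have Min: "Min S \<in> S" "\<And>l. l \<in> S \<Longrightarrow> Min S \<le> l" by auto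
    define l where "l = Min S"
    have l: "k \<le> l" "l \<le> m" "x l > M (k - 1)" using Min(1) by (auto simp: S_def l_def)
    have "M (l - 1) \<le> M (k - 1)"
    proof (rule le)
      fix i assume i: "k \<le> i" "i \<le> l - 1"
      then have "i \<notin> S" using Min(2)[of i] by (auto simp: l_def)
      then show "x i \<le> M (k - 1)" using i l by (auto simp: S_def)
    qed (use l in auto)
    then have "M (l - 1) = M (k - 1)" using mono[of "k - 1" "l - 1"] l by auto
    then have "x l - M l - M (l - 1) + M m + M (k - 1) = X" using rec[of l] l Mm by simp
    then show ?thesis using 1 l by (metis atLeastAtMost_iff)
  qed
qed

text \<open>A departure time from two queues in tandem is the supremum over \<open>j\<close> of
  \<open>F j\<close> plus a two-row last-passage value. For the rows \<open>b\<close>,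
  \<open>c\<close> that value is a window maximum of \<open>x\<close> plus boundary terms; for the
  rows of dual services and departures it is the window maximum of the reflected increments plus the
  same boundary terms. By \<open>running_max_window\<close> the two agree.\<close>

theorem queue_interchange:
  assumes ab: "stable a b" and abc: "stable (queue_map a b) c" and bc: "stable b c"
  shows "queue_map (queue_map a b) c = queue_map (queue_map a (dual_services b c)) (queue_map b c)"
proof -
  define F where "F = prim a"
  define B where "B = prim b"
  define C where "C = prim c"
  define R where "R = dual_services b c"
  define D where "D = queue_map b c"
  have F: "is_primitive F a" and B: "is_primitive B b" and C: "is_primitive C c"
    by (simp_all add: F_def B_def C_def is_primitive_prim)
  define x where "x l = B l - C (l - 1)" for l
  \<comment> \<open>\<open>M l\<close> is the maximum of \<open>x\<close> over the whole past up to
    \<open>l\<close>: each term \<open>B k + (C l - C (k - 1))\<close> of the supremum is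
    \<open>x k + C l\<close>.\<close>
  define M where "M l = departures B c l - C l" for l
  have Ck: "C k = C (k - 1) + c k" for k
    using C[unfolded is_primitive_def, THEN spec, of k] by linarith
  have rec: "M l = max (M (l - 1)) (x l)" for l
    using departures_rec[OF stable_dep_bdd[OF bc B], of l] by (simp add: M_def x_def Ck[of l])
  have Dp: "is_primitive (\<lambda>k. C k + M k) D"
    using is_primitive_departures[OF B, of c] by (simp add: D_def M_def)
  have Rp: "is_primitive (\<lambda>k. B k - M k) R"
    using B C Dp by (simp add: is_primitive_def R_def dual_services_def D_def)
  let ?L = "\<lambda>m k. C m - B (k - 1) + Max (x ` {k..m})"
  have bsum: "(\<Sum>i=k..l. b i) + (\<Sum>i=l..m. c i) = C m - B (k - 1) + x l" if "k \<le> l" "l \<le> m" for k l m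
    using sum_primitive[OF B, of k l] sum_primitive[OF C, of l m] that by (simp add: x_def)
  have Rsum: "(\<Sum>i=k..l. R i) + (\<Sum>i=l..m. D i) =
      C m - B (k - 1) + (x l - M l - M (l - 1) + M m + M (k - 1))" if "k \<le> l" "l \<le> m" for k l m
    using sum_primitive[OF Rp, of k l] sum_primitive[OF Dp, of l m] that by (simp add: x_def)
  have window: "(\<forall>l\<in>{k..m}. x l - M l - M (l - 1) + M m + M (k - 1) \<le> Max (x ` {k..m})) \<and>
         (\<exists>l\<in>{k..m}. Max (x ` {k..m}) = x l - M l - M (l - 1) + M m + M (k - 1))" if "k \<le> m" for k m
  proof (rule running_max_window[where M = M and x = x, OF rec that])
    have "Max (x ` {k..m}) \<in> x ` {k..m}" using that by (intro Max_in) auto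
    then show "\<exists>l\<in>{k..m}. Max (x ` {k..m}) = x l" by blast
  qed auto
  have key: "departures (departures F b) c m = departures (departures F R) D m" for m
  proof -
    have L1: "(\<Sum>i=j..l. b i) + (\<Sum>i=l..m. c i) \<le> ?L m j" if "j \<le> l" "l \<le> m" for j l
      using bsum[OF that] that by simp
    have L2: "\<exists>l\<in>{j..m}. ?L m j = (\<Sum>i=j..l. b i) + (\<Sum>i=l..m. c i)" if "j \<le> m" for j
    proof -
      have "Max (x ` {j..m}) \<in> x ` {j..m}" using that by (intro Max_in) auto
      then obtain l where "l \<in> {j..m}" "Max (x ` {j..m}) = x l" by blast
      then show ?thesis using bsum[of j l m] by (intro bexI[of _ l]) auto
    qed
    have L1': "(\<Sum>i=j..l. R i) + (\<Sum>i=l..m. D i) \<le> ?L m j" if "j \<le> l" "l \<le> m" for j l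
      using Rsum[OF that] window[of j m] that by auto
    have L2': "\<exists>l\<in>{j..m}. ?L m j = (\<Sum>i=j..l. R i) + (\<Sum>i=l..m. D i)" if "j \<le> m" for j
    proof -
      have "\<exists>l\<in>{j..m}. Max (x ` {j..m}) = x l - M l - M (l - 1) + M m + M (j - 1)"
        using window[OF that] by (rule conjunct2)
      then obtain l where "l \<in> {j..m}" "Max (x ` {j..m}) = x l - M l - M (l - 1) + M m + M (j - 1)"
        by blast
      then show ?thesis using Rsum[of j l m] by (intro bexI[of _ l]) auto
    qed
    have b1: "bdd_above ((\<lambda>j. F j + (\<Sum>i=j..l. b i)) ` {..l})" for l
      using stable_dep_bdd[OF ab F, of l] by (simp add: dep_bdd_def)
    have b2: "bdd_above ((\<lambda>l. (SUP j\<in>{..l}. F j + (\<Sum>i=j..l. b i)) + (\<Sum>i=l..m. c i)) ` {..m})"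
      using stable_dep_bdd[OF abc is_primitive_departures[OF F], of m]
      by (simp add: dep_bdd_def departures_def)
    let ?Ab = "\<lambda>j l. \<Sum>i=j..l. b i" and ?cc = "\<lambda>l. \<Sum>i=l..m. c i"
      and ?AR = "\<lambda>j l. \<Sum>i=j..l. R i" and ?cD = "\<lambda>l. \<Sum>i=l..m. D i"
    \<comment> \<open>Boundedness is known for the left-hand tandem only. It is passed to the single
      supremum with the common value \<open>?L\<close>, and from there to the right-hand
      tandem.\<close>
    note bL = nested_SUP_bdd[where g = F and L = "?L m" and A = ?Ab and c = ?cc, OF b1 b2 L1 L2]
    note eq1 = nested_SUP[where g = F and L = "?L m" and A = ?Ab and c = ?cc, OF b1 b2 L1 L2]
    note bR = nested_bdd_inner[where A = ?AR and c = ?cD, OF bL L1'] nested_bdd_outer[where A = ?AR and c = ?cD, OF bL L1']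
    note eq2 = nested_SUP[where g = F and L = "?L m" and A = ?AR and c = ?cD, OF bR L1' L2']
    show ?thesis unfolding departures_def using eq1 eq2 by simp
  qed
  have "queue_map (queue_map a b) c = (\<lambda>l. departures (departures F b) c l - departures (departures F b) c (l - 1))"
    by (rule queue_map_eq[OF is_primitive_departures[OF F]])
  also have "\<dots> = (\<lambda>l. departures (departures F R) D l - departures (departures F R) D (l - 1))"
    by (simp add: key)
  also have "\<dots> = queue_map (queue_map a R) D"
    by (rule queue_map_eq[OF is_primitive_departures[OF F], symmetric])
  finally show ?thesis by (simp add: R_def D_def)
qed

section \<open>Last-passage values\<close>

lemma lattice_paths_snoc:
  "xs @ [v'] \<in> lattice_paths u v \<longleftrightarrow>
     v' = v \<and> (xs = [] \<and> u = v \<or> (\<exists>v0. xs \<in> lattice_paths u v0 \<and> lattice_step v0 v))"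
  by (auto simp: lattice_paths_def successively_append_iff hd_append)

lemma lattice_paths_bounds:
  "xs \<in> lattice_paths u v \<Longrightarrow>
     fst u \<le> fst v \<and> snd u \<le> snd v \<and> fst v + int (snd v) + 1 = fst u + int (snd u) + int (length xs)"
proof (induction xs arbitrary: v rule: rev_induct)
  case Nil
  then show ?case by (simp add: lattice_paths_def)
next
  case (snoc x xs)
  then consider "xs = []" "u = v" | v0 where "xs \<in> lattice_paths u v0" "lattice_step v0 v"
    unfolding lattice_paths_snoc by blast
  then show ?case
  proof cases
    case 2
    then show ?thesis using snoc.IH[of v0] by (auto simp: lattice_step_def)
  qed simp
qed

lemma lattice_paths_refl: "lattice_paths u u = {[u]}"
proof -
  have "xs = [u]" if xs: "xs \<in> lattice_paths u u" for xs
  proof -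
    have "length xs = 1" using lattice_paths_bounds[OF xs] by simp
    then obtain x where "xs = [x]" by (auto simp: length_Suc_conv)
    then show ?thesis using xs by (simp add: lattice_paths_def)
  qed
  then show ?thesis by (auto simp: lattice_paths_def)
qed

text \<open>Working with the set of sums postpones the maximum. The set obeys its recursion even
  when no path exists, whereas \<open>Max\<close> of an empty set carries no information.\<close>

definition path_sums :: "(int \<times> nat \<Rightarrow> real) \<Rightarrow> int \<times> nat \<Rightarrow> int \<times> nat \<Rightarrow> real set" where
  "path_sums \<omega> u v = (\<lambda>xs. \<Sum>x\<leftarrow>xs. \<omega> x) ` lattice_paths u v"

lemma path_sums_refl: "path_sums \<omega> u u = {\<omega> u}"
  by (simp add: path_sums_def lattice_paths_refl)

lemma path_sums_empty: "k < j \<or> t < s \<Longrightarrow> path_sums \<omega> (j, s) (k, t) = {}"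
  using lattice_paths_bounds[of _ "(j, s)" "(k, t)"] by (fastforce simp: path_sums_def)

text \<open>Paths are split by their last step, from the left or from below; the excluded case is
  the one-point path. The predecessor of row 1 is row 0, which no path starting in row 1
  reaches.\<close>

lemma path_sums_rec:
  assumes "u \<noteq> (k, Suc t)"
  shows "path_sums \<omega> u (k, Suc t) =
    (\<lambda>s. s + \<omega> (k, Suc t)) ` (path_sums \<omega> u (k - 1, Suc t) \<union> path_sums \<omega> u (k, t))"
proof -
  have "lattice_paths u (k, Suc t) =
      (\<lambda>xs. xs @ [(k, Suc t)]) ` (lattice_paths u (k - 1, Suc t) \<union> lattice_paths u (k, t))"
  proof (rule set_eqI)
    fix xs
    have step: "lattice_step v0 (k, Suc t) \<longleftrightarrow> v0 = (k - 1, Suc t) \<or> v0 = (k, t)" for v0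
      by (cases v0) (auto simp: lattice_step_def)
    show "xs \<in> lattice_paths u (k, Suc t) \<longleftrightarrow>
        xs \<in> (\<lambda>xs. xs @ [(k, Suc t)]) ` (lattice_paths u (k - 1, Suc t) \<union> lattice_paths u (k, t))"
    proof (cases xs rule: rev_cases)
      case Nil
      then show ?thesis by (auto simp: lattice_paths_def)
    next
      case (snoc ys y)
      then show ?thesis using assms by (auto simp: lattice_paths_snoc step)
    qed
  qed
  then show ?thesis by (simp add: path_sums_def image_image image_Un)
qed

lemma path_sums_finite_nonempty:
  "finite (path_sums \<omega> (j, 1) (k, t)) \<and> (j \<le> k \<longrightarrow> 1 \<le> t \<longrightarrow> path_sums \<omega> (j, 1) (k, t) \<noteq> {})"
proof (induction t arbitrary: k)
  case 0
  then show ?case by (simp add: path_sums_empty)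
next
  case (Suc t)
  show ?case
  proof (cases "k < j")
    case True
    then show ?thesis by (simp add: path_sums_empty)
  next
    case False
    then have "j \<le> k" by simp
    then show ?thesis
    proof (induction k rule: int_ge_induct)
      case base
      show ?case
      proof (cases "t = 0")
        case True
        then show ?thesis by (simp add: path_sums_refl)
      next
        case False
        then show ?thesis using Suc[of j] path_sums_rec[of "(j, 1)" j t \<omega>] by (simp add: path_sums_empty)
      qed
    next
      case (step k)
      then show ?case using Suc[of "k + 1"] path_sums_rec[of "(j, 1)" "k + 1" t \<omega>] by simp
    qed
  qed
qed

lemma last_passage_path_sums: "last_passage \<omega> u v = Max (path_sums \<omega> u v)"
  by (simp add: last_passage_def path_sums_def)

lemma Max_add_image:
  fixes S :: "real set"
  assumes "finite S" "S \<noteq> {}"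
  shows "Max ((\<lambda>s. s + c) ` S) = Max S + c"
  using Max_add_commute[OF assms, of "\<lambda>s. s" c] by simp

lemma last_passage_start: "last_passage \<omega> (j, 1) (j, 1) = \<omega> (j, 1)"
  by (simp add: last_passage_path_sums path_sums_refl)

lemma last_passage_bottom:
  assumes "j < k"
  shows "last_passage \<omega> (j, 1) (k, 1) = last_passage \<omega> (j, 1) (k - 1, 1) + \<omega> (k, 1)"
proof -
  have "path_sums \<omega> (j, 1) (k, 1) = (\<lambda>s. s + \<omega> (k, 1)) ` path_sums \<omega> (j, 1) (k - 1, 1)"
    using path_sums_rec[of "(j, 1)" k 0 \<omega>] assms by (simp add: path_sums_empty)
  then show ?thesis
    using path_sums_finite_nonempty[of \<omega> j "k - 1" 1] assms
    by (simp add: last_passage_path_sums Max_add_image)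
qed

lemma last_passage_left:
  assumes "1 \<le> t"
  shows "last_passage \<omega> (j, 1) (j, Suc t) = last_passage \<omega> (j, 1) (j, t) + \<omega> (j, Suc t)"
proof -
  have "path_sums \<omega> (j, 1) (j, Suc t) = (\<lambda>s. s + \<omega> (j, Suc t)) ` path_sums \<omega> (j, 1) (j, t)"
    using path_sums_rec[of "(j, 1)" j t \<omega>] assms by (simp add: path_sums_empty)
  then show ?thesis
    using path_sums_finite_nonempty[of \<omega> j j t] assms
    by (simp add: last_passage_path_sums Max_add_image)
qed

lemma last_passage_rec:
  assumes "j < k" "1 \<le> t"
  shows "last_passage \<omega> (j, 1) (k, Suc t) =
    max (last_passage \<omega> (j, 1) (k - 1, Suc t)) (last_passage \<omega> (j, 1) (k, t)) + \<omega> (k, Suc t)"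
proof -
  have "path_sums \<omega> (j, 1) (k, Suc t) = (\<lambda>s. s + \<omega> (k, Suc t)) `
      (path_sums \<omega> (j, 1) (k - 1, Suc t) \<union> path_sums \<omega> (j, 1) (k, t))"
    using path_sums_rec[of "(j, 1)" k t \<omega>] assms by simp
  then show ?thesis
    using path_sums_finite_nonempty[of \<omega> j "k - 1" "Suc t"] path_sums_finite_nonempty[of \<omega> j k t] assms
    unfolding last_passage_path_sums by (subst Max_Un[symmetric]) (auto simp: Max_add_image)
qed

lemma last_passage_row:
  assumes "j \<le> k"
  shows "last_passage \<omega> (j, 1) (k, 1) = (\<Sum>i=j..k. \<omega> (i, 1))"
  using assms
proof (induction k rule: int_ge_induct)
  case base
  then show ?case by (simp add: last_passage_start[simplified])
next
  case (step k)
  then show ?case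
    using last_passage_bottom[of j "k + 1" \<omega>] sum_int_last[of j "k + 1" "\<lambda>i. \<omega> (i, 1)"] by simp
qed

text \<open>\<open>l\<close> is the column in which an optimal path enters the last row. In this
  form the last row has the shape of the supremum in \<open>departures\<close>, and one time step
  becomes one queue.\<close>

lemma last_passage_next_row:
  assumes "j \<le> k" "1 \<le> t"
  shows "(\<forall>l\<in>{j..k}. last_passage \<omega> (j, 1) (l, t) + (\<Sum>i=l..k. \<omega> (i, Suc t)) \<le> last_passage \<omega> (j, 1) (k, Suc t)) \<and>
    (\<exists>l\<in>{j..k}. last_passage \<omega> (j, 1) (k, Suc t) = last_passage \<omega> (j, 1) (l, t) + (\<Sum>i=l..k. \<omega> (i, Suc t)))"
  using assms(1)
proof (induction k rule: int_ge_induct)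
  case base
  then show ?case using last_passage_left[OF assms(2)] by simp
next
  case (step k)
  let ?f = "\<lambda>l k. last_passage \<omega> (j, 1) (l, t) + (\<Sum>i=l..k. \<omega> (i, Suc t))"
  let ?L = "\<lambda>k. last_passage \<omega> (j, 1) (k, Suc t)"
  have rec: "?L (k + 1) = max (?L k) (last_passage \<omega> (j, 1) (k + 1, t)) + \<omega> (k + 1, Suc t)"
    using last_passage_rec[of j "k + 1" t \<omega>] step(1) assms(2) by simp
  have f: "?f l (k + 1) = ?f l k + \<omega> (k + 1, Suc t)" if "l \<le> k + 1" for l
    using sum_int_last[OF that, of "\<lambda>i. \<omega> (i, Suc t)"] by simp
  have 1: "?f l (k + 1) \<le> ?L (k + 1)" if "l \<in> {j..k + 1}" for l
  proof (cases "l = k + 1")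
    case True
    then show ?thesis using rec by simp
  next
    case False
    then have "?f l k \<le> ?L k" using that step.IH by auto
    then show ?thesis using rec f[of l] that by simp
  qed
  have 2: "\<exists>l\<in>{j..k + 1}. ?L (k + 1) = ?f l (k + 1)"
  proof (cases "last_passage \<omega> (j, 1) (k + 1, t) \<ge> ?L k")
    case True
    then show ?thesis using rec step(1) by (intro bexI[of _ "k + 1"]) auto
  next
    case False
    obtain l where "l \<in> {j..k}" "?L k = ?f l k" using step.IH by blast
    then show ?thesis using rec f[of l] False by (intro bexI[of _ l]) auto
  qed
  show ?case using 1 2 by blast
qed

text \<open>The point is uniformity in the starting column \<open>j\<close>: one more column costs
  at most a constant, so boundedness of the supremum over \<open>j\<close> passes from column
  \<open>k - 1\<close> to column \<open>k\<close>. The weights may have any sign here.\<close>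

lemma last_passage_column_bound:
  assumes "1 \<le> t"
  shows "\<exists>C. \<forall>j<k. last_passage \<omega> (j, 1) (k, t) \<le> last_passage \<omega> (j, 1) (k - 1, t) + C"
  using assms
proof (induction t rule: dec_induct)
  case base
  show ?case by (rule exI[of _ "\<omega> (k, 1)"]) (use last_passage_bottom in auto)
next
  case (step t)
  then obtain C where C: "\<And>j. j < k \<Longrightarrow> last_passage \<omega> (j, 1) (k, t) \<le> last_passage \<omega> (j, 1) (k - 1, t) + C" by blast
  show ?case
  proof (intro exI allI impI)
    fix j assume j: "j < k"
    have "last_passage \<omega> (j, 1) (k - 1, t) + \<omega> (k - 1, Suc t) \<le> last_passage \<omega> (j, 1) (k - 1, Suc t)"
      using last_passage_next_row[of j "k - 1" t \<omega>, THEN conjunct1, rule_format, of "k - 1"] j step(1) by simp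
    then show "last_passage \<omega> (j, 1) (k, Suc t) \<le>
        last_passage \<omega> (j, 1) (k - 1, Suc t) + (\<bar>C - \<omega> (k - 1, Suc t)\<bar> + \<omega> (k, Suc t))"
      using last_passage_rec[OF j step(1), of \<omega>] C[OF j] by (auto simp: max_def abs_if)
  qed
qed

lemma last_passage_column_mono:
  assumes "1 \<le> t" "j < k"
  shows "last_passage \<omega> (j, 1) (k - 1, t) + \<omega> (k, t) \<le> last_passage \<omega> (j, 1) (k, t)"
proof (cases "t = 1")
  case True
  then show ?thesis using last_passage_bottom[OF assms(2), of \<omega>] by simp
next
  case False
  then obtain s where "t = Suc s" "1 \<le> s" using assms by (cases t) auto
  then show ?thesis using last_passage_rec[OF assms(2), of s \<omega>] by simp
qed


section \<open>The increment process as iterated queues\<close>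

definition passage_bdd :: "(int \<times> nat \<Rightarrow> real) \<Rightarrow> (int \<Rightarrow> real) \<Rightarrow> int \<Rightarrow> nat \<Rightarrow> bool" where
  "passage_bdd \<omega> G k t \<longleftrightarrow> bdd_above ((\<lambda>j. G j + last_passage \<omega> (j, 1) (k, t)) ` {..k})"

lemma passage_bdd_pred:
  assumes "1 \<le> t"
  shows "passage_bdd \<omega> G k t \<longleftrightarrow> passage_bdd \<omega> G (k - 1) t"
proof
  assume "passage_bdd \<omega> G k t"
  then obtain M where M: "\<And>j. j \<le> k \<Longrightarrow> G j + last_passage \<omega> (j, 1) (k, t) \<le> M"
    by (auto simp: passage_bdd_def bdd_above_def)
  show "passage_bdd \<omega> G (k - 1) t"
    unfolding passage_bdd_def
  proof (rule bdd_aboveI2)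
    fix j assume "j \<in> {..k - 1}"
    then show "G j + last_passage \<omega> (j, 1) (k - 1, t) \<le> M - \<omega> (k, t)"
      using M[of j] last_passage_column_mono[OF assms, of j k \<omega>] by simp
  qed
next
  assume "passage_bdd \<omega> G (k - 1) t"
  then obtain M where M: "\<And>j. j \<in> {..k - 1} \<Longrightarrow> G j + last_passage \<omega> (j, 1) (k - 1, t) \<le> M"
    unfolding passage_bdd_def bdd_above_def by blast
  obtain C where C: "\<And>j. j < k \<Longrightarrow> last_passage \<omega> (j, 1) (k, t) \<le> last_passage \<omega> (j, 1) (k - 1, t) + C"
    using last_passage_column_bound[OF assms] by blast
  have "bdd_above ((\<lambda>j. G j + last_passage \<omega> (j, 1) (k, t)) ` {..k - 1})"
  proof (rule bdd_aboveI2)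
    fix j assume "j \<in> {..k - 1}"
    then show "G j + last_passage \<omega> (j, 1) (k, t) \<le> M + C" using M[of j] C[of j] by simp
  qed
  then show "passage_bdd \<omega> G k t"
    unfolding passage_bdd_def atMost_int_insert[of k] by simp
qed

text \<open>As for \<open>queue_map\<close>, finiteness is not at issue: the suprema at
  \<open>k\<close> and \<open>k - 1\<close> are bounded or unbounded together. An arbitrary
  primitive, possibly chosen without measurability at each sample point, can thus be exchanged for
  \<open>prim\<close>.\<close>

lemma increments_cong_primitive:
  assumes "\<And>i. i \<in> {1..n} \<Longrightarrow> is_primitive (G i) (I i)" "\<And>i. i \<in> {1..n} \<Longrightarrow> is_primitive (H i) (I i)" "1 \<le> t"
  shows "increments n \<omega> G t = increments n \<omega> H t"
  unfolding increments_def
proof (intro restrict_ext ext)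
  fix i k assume i: "i \<in> {1..n}"
  obtain c where c: "G i j = H i j + c" for j
    using primitive_unique[OF assms(1)[OF i] assms(2)[OF i]] by blast
  have "boundary_passage \<omega> (G i) k t = (SUP j\<in>{..k}. (H i j + last_passage \<omega> (j, 1) (k, t)) + c)" for k
    unfolding boundary_passage_def by (intro SUP_cong) (auto simp: c)
  then show "boundary_passage \<omega> (G i) k t - boundary_passage \<omega> (G i) (k - 1) t =
      boundary_passage \<omega> (H i) k t - boundary_passage \<omega> (H i) (k - 1) t"
    using passage_bdd_pred[OF assms(3), of \<omega> "H i" k]
    by (subst (3 4) boundary_passage_def) (simp add: SUP_real_add_diff passage_bdd_def)
qed

lemma boundary_passage_1: "boundary_passage \<omega> G k 1 = departures G (\<lambda>i. \<omega> (i, 1)) k"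
  unfolding boundary_passage_def departures_def
  by (intro SUP_cong refl) (use last_passage_row in auto)

lemma passage_bdd_1: "passage_bdd \<omega> G k 1 \<longleftrightarrow> dep_bdd G (\<lambda>i. \<omega> (i, 1)) k"
  unfolding passage_bdd_def dep_bdd_def
  by (intro arg_cong[of _ _ bdd_above] image_cong refl) (use last_passage_row in auto)

text \<open>The passage times of one row are the arrival times of the queue in the next. This is
  \<open>nested_SUP\<close> with the entry column as intermediate index.\<close>

lemma boundary_passage_Suc:
  assumes t: "1 \<le> t" and b1: "\<And>l. passage_bdd \<omega> G l t"
    and b2: "dep_bdd (\<lambda>l. boundary_passage \<omega> G l t) (\<lambda>i. \<omega> (i, Suc t)) k"
  shows "passage_bdd \<omega> G k (Suc t) \<and>
    boundary_passage \<omega> G k (Suc t) = departures (\<lambda>l. boundary_passage \<omega> G l t) (\<lambda>i. \<omega> (i, Suc t)) k"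
proof -
  let ?A = "\<lambda>j l. last_passage \<omega> (j, 1) (l, t)" and ?c = "\<lambda>l. \<Sum>i=l..k. \<omega> (i, Suc t)"
    and ?L = "\<lambda>j. last_passage \<omega> (j, 1) (k, Suc t)"
  have 1: "bdd_above ((\<lambda>j. G j + ?A j l) ` {..l})" for l
    using b1[of l] by (simp add: passage_bdd_def)
  have 2: "bdd_above ((\<lambda>l. (SUP j\<in>{..l}. G j + ?A j l) + ?c l) ` {..k})"
    using b2 by (simp add: dep_bdd_def boundary_passage_def)
  have 3: "?A j l + ?c l \<le> ?L j" if "j \<le> l" "l \<le> k" for j l
    using last_passage_next_row[of j k t \<omega>] t that by auto
  have 4: "\<exists>l\<in>{j..k}. ?L j = ?A j l + ?c l" if "j \<le> k" for j
    using last_passage_next_row[OF that t, of \<omega>] by blast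
  show ?thesis
    using nested_SUP_bdd[where g = G and L = ?L and A = ?A and c = ?c, OF 1 2 3 4] nested_SUP[where g = G and L = ?L and A = ?A and c = ?c, OF 1 2 3 4]
    unfolding passage_bdd_def boundary_passage_def[of \<omega> G k "Suc t"] departures_def boundary_passage_def[of \<omega> G _ t]
    by simp
qed

text \<open>Boundedness is part of the induction, since suprema can be nested only over finite
  ones.\<close>

lemma boundary_passage_primitive:
  assumes G: "is_primitive G (\<eta> 0)"
    and st: "\<And>s. s < t \<Longrightarrow> stable (\<eta> s) (\<lambda>i. \<omega> (i, Suc s))"
    and Q: "\<And>s. s < t \<Longrightarrow> \<eta> (Suc s) = queue_map (\<eta> s) (\<lambda>i. \<omega> (i, Suc s))"
    and t: "1 \<le> t"
  shows "(\<forall>k. passage_bdd \<omega> G k t) \<and> is_primitive (\<lambda>k. boundary_passage \<omega> G k t) (\<eta> t)"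
  using t st Q
proof (induction t rule: dec_induct)
  case base
  then have "stable (\<eta> 0) (\<lambda>i. \<omega> (i, 1))" "\<eta> 1 = queue_map (\<eta> 0) (\<lambda>i. \<omega> (i, 1))" by auto
  then show ?case
    using stable_dep_bdd[OF _ G, of "\<lambda>i. \<omega> (i, 1)"] is_primitive_departures[OF G, of "\<lambda>i. \<omega> (i, 1)"]
    by (simp add: passage_bdd_1[simplified] boundary_passage_1[simplified])
next
  case (step t)
  let ?H = "\<lambda>l. boundary_passage \<omega> G l t"
  have IH: "\<And>l. passage_bdd \<omega> G l t" "is_primitive ?H (\<eta> t)" using step by auto
  have s: "stable (\<eta> t) (\<lambda>i. \<omega> (i, Suc t))" "\<eta> (Suc t) = queue_map (\<eta> t) (\<lambda>i. \<omega> (i, Suc t))"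
    using step.prems by auto
  note B = boundary_passage_Suc[OF step(1) IH(1) stable_dep_bdd[OF s(1) IH(2)]]
  show ?case using B is_primitive_departures[OF IH(2), of "\<lambda>i. \<omega> (i, Suc t)"] s(2) by simp
qed

section \<open>Measurability\<close>

abbreviation seq_space :: "(int \<Rightarrow> real) measure" where
  "seq_space \<equiv> Pi\<^sub>M (UNIV :: int set) (\<lambda>_. borel)"

text \<open>For a countable family, being bounded by some natural number is a measurable condition
  on the point. Where it holds the supremum is finite, and elsewhere it is the default value, a
  constant; so measurability needs no boundedness assumption.\<close>

lemma borel_measurable_real_SUP:
  fixes f :: "'i \<Rightarrow> 'a \<Rightarrow> real"
  assumes I: "countable I" "I \<noteq> {}" and f [measurable]: "\<And>i. i \<in> I \<Longrightarrow> f i \<in> borel_measurable M"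
  shows "(\<lambda>x. SUP i\<in>I. f i x) \<in> borel_measurable M"
proof -
  define B where "B = {x \<in> space M. \<exists>n::nat. \<forall>i\<in>I. f i x \<le> real n}"
  have B: "B \<in> sets M" unfolding B_def using I(1) by measurable
  have bdd: "bdd_above ((\<lambda>i. f i x) ` I) \<longleftrightarrow> x \<in> B" if "x \<in> space M" for x
  proof
    assume "bdd_above ((\<lambda>i. f i x) ` I)"
    then obtain c where c: "\<And>i. i \<in> I \<Longrightarrow> f i x \<le> c" by (auto simp: bdd_above_def)
    obtain n :: nat where "c \<le> real n" using real_arch_simple by blast
    then show "x \<in> B" unfolding B_def using c that by (auto intro!: exI[of _ n] intro: order_trans)
  next
    assume "x \<in> B"
    then show "bdd_above ((\<lambda>i. f i x) ` I)" by (auto simp: B_def intro: bdd_aboveI2)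
  qed
  define g where "g i x = (if x \<in> B then f i x else 0)" for i x
  have "(\<lambda>x. SUP i\<in>I. g i x) \<in> borel_measurable M"
  proof (rule borel_measurable_cSUP[OF I(1)])
    show "g i \<in> borel_measurable M" if "i \<in> I" for i
      unfolding g_def using that B by measurable
    fix x assume "x \<in> space M"
    then show "bdd_above ((\<lambda>i. g i x) ` I)"
      using bdd[of x] I(2) by (cases "x \<in> B") (auto simp: g_def)
  qed
  \<comment> \<open>\<open>Sup UNIV\<close> serves as a name for the default value of an unbounded
    supremum.\<close>
  then have "(\<lambda>x. if x \<in> B then (SUP i\<in>I. g i x) else Sup (UNIV :: real set)) \<in> borel_measurable M"
    using B by measurable
  moreover have "(SUP i\<in>I. f i x) = (if x \<in> B then (SUP i\<in>I. g i x) else Sup (UNIV :: real set))"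
    if "x \<in> space M" for x
  proof (cases "x \<in> B")
    case False
    have "\<not> bdd_above (UNIV :: real set)" by (simp add: bdd_above_def) (meson gt_ex not_le)
    then show ?thesis using False bdd[OF that] by (auto intro!: Sup_real_unbounded)
  qed (simp add: g_def)
  ultimately show ?thesis by (subst measurable_cong) auto
qed

lemma measurable_seq_spaceI:
  "(\<And>k. (\<lambda>x. f x k) \<in> borel_measurable M) \<Longrightarrow> f \<in> measurable M seq_space"
  by (rule measurable_PiM_single') auto

lemma measurable_seq_component:
  "f \<in> measurable M seq_space \<Longrightarrow> (\<lambda>x. f x k) \<in> borel_measurable M"
  by (rule measurable_component_singleton[THEN measurable_compose[rotated]]) auto

lemma measurable_config_component:
  assumes "f \<in> measurable M (config_space n)" "i \<in> {1..n}"
  shows "(\<lambda>x. f x i) \<in> measurable M seq_space"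
  using assms unfolding config_space_def by (rule measurable_component_singleton[THEN measurable_compose[rotated], rotated])

lemma measurable_config_spaceI:
  assumes "\<And>i. i \<in> {1..n} \<Longrightarrow> (\<lambda>x. f x i) \<in> measurable M seq_space"
  shows "(\<lambda>x. \<lambda>i\<in>{1..n}. f x i) \<in> measurable M (config_space n)"
  unfolding config_space_def by (rule measurable_restrict) (use assms in auto)

lemma measurable_prim [measurable (raw)]:
  assumes [measurable]: "f \<in> measurable M seq_space"
  shows "(\<lambda>x. prim (f x) k) \<in> borel_measurable M"
  unfolding prim_def by measurable

lemma measurable_departures:
  assumes [measurable]: "\<And>k. (\<lambda>x. f x k) \<in> borel_measurable M" "g \<in> measurable M seq_space"
  shows "(\<lambda>x. departures (f x) (g x) k) \<in> borel_measurable M"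
  unfolding departures_def by (rule borel_measurable_real_SUP) auto

lemma measurable_queue_map_component [measurable (raw)]:
  assumes [measurable]: "f \<in> measurable M seq_space" "g \<in> measurable M seq_space"
  shows "(\<lambda>x. queue_map (f x) (g x) k) \<in> borel_measurable M"
proof -
  have [measurable]: "(\<lambda>x. departures (prim (f x)) (g x) k) \<in> borel_measurable M" for k
    by (rule measurable_departures) auto
  show ?thesis by (subst queue_map_eq[OF is_primitive_prim]) measurable
qed

lemma measurable_queue_map [measurable (raw)]:
  assumes [measurable]: "f \<in> measurable M seq_space" "g \<in> measurable M seq_space"
  shows "(\<lambda>x. queue_map (f x) (g x)) \<in> measurable M seq_space"
  by (rule measurable_seq_spaceI) measurable

lemma measurable_dual_services [measurable (raw)]:
  assumes [measurable]: "f \<in> measurable M seq_space" "g \<in> measurable M seq_space"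
  shows "(\<lambda>x. dual_services (f x) (g x)) \<in> measurable M seq_space"
  by (rule measurable_seq_spaceI) (unfold dual_services_def, measurable)

lemma measurable_sojourn [measurable (raw)]:
  assumes [measurable]: "f \<in> measurable M seq_space" "g \<in> measurable M seq_space"
  shows "(\<lambda>x. sojourn (f x) (g x) k) \<in> borel_measurable M"
  unfolding sojourn_def by (rule borel_measurable_real_SUP) auto

text \<open>With tolerances \<open>1 / Suc e\<close> convergence becomes a countable combination of
  measurable conditions. The same device, with thresholds \<open>- real e\<close>, is used for
  \<open>stable\<close>.\<close>

lemma has_avg_pred [measurable (raw)]:
  assumes [measurable]: "f \<in> measurable M seq_space"
  shows "Measurable.pred M (\<lambda>x. has_avg (f x) L)"
proof -
  have eq: "has_avg (f x) L \<longleftrightarrow> (\<forall>e::nat. \<exists>N0. \<forall>N\<ge>N0. \<bar>(\<Sum>k=- int N..0. f x k) / real N - L\<bar> < 1 / real (Suc e))" for x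
  proof
    assume "has_avg (f x) L"
    then show "\<forall>e::nat. \<exists>N0. \<forall>N\<ge>N0. \<bar>(\<Sum>k=- int N..0. f x k) / real N - L\<bar> < 1 / real (Suc e)"
      unfolding has_avg_def LIMSEQ_iff real_norm_def by (intro allI) (metis of_nat_0_less_iff zero_less_Suc zero_less_divide_1_iff)
  next
    assume *: "\<forall>e::nat. \<exists>N0. \<forall>N\<ge>N0. \<bar>(\<Sum>k=- int N..0. f x k) / real N - L\<bar> < 1 / real (Suc e)"
    show "has_avg (f x) L"
      unfolding has_avg_def LIMSEQ_iff real_norm_def
    proof (intro allI impI)
      fix r :: real assume "0 < r"
      then obtain e where "1 / real (Suc e) < r" by (rule nat_approx_posE)
      then show "\<exists>N0. \<forall>N\<ge>N0. \<bar>(\<Sum>k=- int N..0. f x k) / real N - L\<bar> < r"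
        using *[rule_format, of e] by (meson order.strict_trans)
    qed
  qed
  show ?thesis unfolding eq by measurable
qed

lemma stable_pred [measurable (raw)]:
  assumes [measurable]: "f \<in> measurable M seq_space" "g \<in> measurable M seq_space"
  shows "Measurable.pred M (\<lambda>x. stable (f x) (g x))"
proof -
  have eq: "stable (f x) (g x) \<longleftrightarrow>
      (\<forall>e::nat. \<exists>N0. \<forall>N\<ge>N0. (\<Sum>k=- int N..0. g x k - f x (k + 1)) \<le> - real e)" for x
  proof
    assume "stable (f x) (g x)"
    then show "\<forall>e::nat. \<exists>N0. \<forall>N\<ge>N0. (\<Sum>k=- int N..0. g x k - f x (k + 1)) \<le> - real e"
      unfolding stable_def filterlim_at_bot eventually_sequentially by blast
  next
    assume *: "\<forall>e::nat. \<exists>N0. \<forall>N\<ge>N0. (\<Sum>k=- int N..0. g x k - f x (k + 1)) \<le> - real e"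
    show "stable (f x) (g x)"
      unfolding stable_def filterlim_at_bot eventually_sequentially
    proof
      fix Z :: real
      obtain e :: nat where "- Z \<le> real e" using real_arch_simple by blast
      with *[rule_format, of e] show "\<exists>N0. \<forall>N\<ge>N0. (\<Sum>k=- int N..0. g x k - f x (k + 1)) \<le> Z"
        by (meson minus_le_iff order_trans)
    qed
  qed
  show ?thesis unfolding eq by measurable
qed

lemma measurable_last_passage:
  assumes jk: "j \<le> k" and t: "1 \<le> t"
    and \<omega>: "\<And>x. x \<in> sites \<Longrightarrow> (\<lambda>a. \<omega> a x) \<in> borel_measurable M"
  shows "(\<lambda>a. last_passage (\<omega> a) (j, 1) (k, t)) \<in> borel_measurable M"
  using t jk
proof (induction t arbitrary: k rule: dec_induct)
  case base
  then show ?case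
    unfolding last_passage_row[OF base] by (intro borel_measurable_sum \<omega>) (auto simp: sites_def)
next
  case (step t)
  from step.prems show ?case
  proof (induction k rule: int_ge_induct)
    case base
    show ?case
      unfolding last_passage_left[OF step(1)]
      by (intro borel_measurable_add step.IH \<omega>) (auto simp: sites_def)
  next
    case (step k')
    have eq: "last_passage (\<omega> a) (j, 1) (k' + 1, Suc t) =
      max (last_passage (\<omega> a) (j, 1) (k', Suc t)) (last_passage (\<omega> a) (j, 1) (k' + 1, t)) + \<omega> a (k' + 1, Suc t)" for a
      using last_passage_rec[of j "k' + 1" t "\<omega> a"] step.hyps \<open>1 \<le> t\<close> by simp
    show ?case
      unfolding eq using step.hyps
      by (intro borel_measurable_add borel_measurable_max step.IH \<open>\<And>k. j \<le> k \<Longrightarrow> (\<lambda>a. last_passage (\<omega> a) (j, 1) (k, t)) \<in> borel_measurable M\<close> \<omega>) (auto simp: sites_def)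
  qed
qed

lemma measurable_increments_prim:
  assumes \<eta>: "\<eta> \<in> measurable M (config_space n)"
    and \<omega>: "\<And>x. x \<in> sites \<Longrightarrow> (\<lambda>a. \<omega> a x) \<in> borel_measurable M" and t: "1 \<le> t"
  shows "(\<lambda>a. increments n (\<omega> a) (\<lambda>i. prim (\<eta> a i)) t) \<in> measurable M (config_space n)"
  unfolding increments_def
proof (intro measurable_config_spaceI measurable_seq_spaceI)
  fix i k assume i: "i \<in> {1..n}"
  note [measurable] = measurable_config_component[OF \<eta> i]
  have [measurable]: "(\<lambda>a. boundary_passage (\<omega> a) (prim (\<eta> a i)) k t) \<in> borel_measurable M" for k
    unfolding boundary_passage_def
  proof (rule borel_measurable_real_SUP)
    fix j assume "j \<in> {..k}"
    then have [measurable]: "(\<lambda>a. last_passage (\<omega> a) (j, 1) (k, t)) \<in> borel_measurable M"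
      by (intro measurable_last_passage t \<omega>) auto
    show "(\<lambda>a. prim (\<eta> a i) j + last_passage (\<omega> a) (j, 1) (k, t)) \<in> borel_measurable M" by measurable
  qed auto
  show "(\<lambda>a. boundary_passage (\<omega> a) (prim (\<eta> a i)) k t - boundary_passage (\<omega> a) (prim (\<eta> a i)) (k - 1) t)
      \<in> borel_measurable M" by measurable
qed

section \<open>Exponential sequences\<close>

definition exp_dist :: "real \<Rightarrow> real measure" where
  "exp_dist \<sigma> = density lborel (\<lambda>x. ennreal (exponential_density (1 / \<sigma>) x))"

definition exp_seq :: "real \<Rightarrow> (int \<Rightarrow> real) measure" where
  "exp_seq \<sigma> = Pi\<^sub>M UNIV (\<lambda>_. exp_dist \<sigma>)"

lemma exp_product_eq: "exp_product m \<sigma> = Pi\<^sub>M {1..m} (\<lambda>i. exp_seq (\<sigma> i))"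
  by (simp add: exp_product_def exp_seq_def exp_dist_def)

lemma sets_exp_dist [measurable_cong, simp]: "sets (exp_dist \<sigma>) = sets borel"
  by (simp add: exp_dist_def)

lemma space_exp_dist [simp]: "space (exp_dist \<sigma>) = UNIV"
  by (simp add: exp_dist_def)

lemma sets_exp_seq [measurable_cong, simp]: "sets (exp_seq \<sigma>) = sets seq_space"
  unfolding exp_seq_def by (rule sets_PiM_cong) auto

lemma space_seq_space [simp]: "space seq_space = UNIV"
  by (simp add: space_PiM)

lemma space_exp_seq [simp]: "space (exp_seq \<sigma>) = UNIV"
  by (simp add: exp_seq_def space_PiM)

lemma prob_space_exp_dist: "0 < \<sigma> \<Longrightarrow> prob_space (exp_dist \<sigma>)"
  unfolding exp_dist_def by (rule prob_space_exponential_density) simp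

lemma prob_space_exp_seq: "0 < \<sigma> \<Longrightarrow> prob_space (exp_seq \<sigma>)"
  unfolding exp_seq_def by (rule prob_space_PiM) (rule prob_space_exp_dist)

lemma AE_exp_dist_nonneg: "AE x in exp_dist \<sigma>. 0 \<le> x"
  unfolding exp_dist_def by (subst AE_density) (auto simp: exponential_density_def)

lemma AE_exp_seq_nonneg: "0 < \<sigma> \<Longrightarrow> AE x in exp_seq \<sigma>. \<forall>k. 0 \<le> x k"
  unfolding AE_all_countable exp_seq_def
  by (intro allI AE_PiM_component prob_space_exp_dist AE_exp_dist_nonneg) auto

text \<open>Exponential tilting: the density times \<open>exp (s * x)\<close> is a multiple of the
  exponential density with rate \<open>1 / \<sigma> - s\<close>, and that density integrates to
  1.\<close>

lemma nn_integral_exp_dist_mgf: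
  assumes "0 < \<sigma>" "s * \<sigma> < 1"
  shows "(\<integral>\<^sup>+x. ennreal (exp (s * x)) \<partial>exp_dist \<sigma>) = ennreal (1 / (1 - s * \<sigma>))"
proof -
  have s: "0 < 1 / \<sigma> - s" using assms by (simp add: field_simps)
  interpret prob_space "density lborel (\<lambda>x. ennreal (exponential_density (1 / \<sigma> - s) x))"
    by (rule prob_space_exponential_density[OF s])
  have one: "(\<integral>\<^sup>+x. ennreal (exponential_density (1 / \<sigma> - s) x) \<partial>lborel) = 1"
    using emeasure_space_1 by (simp add: emeasure_density)
  have "(\<integral>\<^sup>+x. ennreal (exp (s * x)) \<partial>exp_dist \<sigma>) =
      (\<integral>\<^sup>+x. ennreal (exponential_density (1 / \<sigma>) x) * ennreal (exp (s * x)) \<partial>lborel)"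
    unfolding exp_dist_def by (rule nn_integral_density) auto
  also have "\<dots> = (\<integral>\<^sup>+x. ennreal (1 / (1 - s * \<sigma>)) * ennreal (exponential_density (1 / \<sigma> - s) x) \<partial>lborel)"
  proof (rule nn_integral_cong)
    fix x :: real
    have "exponential_density (1 / \<sigma>) x * exp (s * x) = 1 / (1 - s * \<sigma>) * exponential_density (1 / \<sigma> - s) x"
    proof (cases "x < 0")
      case False
      have "exp (- x * (1 / \<sigma> - s)) = exp (- x * (1 / \<sigma>)) * exp (s * x)"
        by (simp add: exp_add[symmetric] algebra_simps)
      moreover have "1 / \<sigma> = 1 / (1 - s * \<sigma>) * (1 / \<sigma> - s)"
        using assms by (simp add: field_simps)
      ultimately have "1 / \<sigma> * (exp (- x * (1 / \<sigma>)) * exp (s * x)) =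
          1 / (1 - s * \<sigma>) * ((1 / \<sigma> - s) * exp (- x * (1 / \<sigma> - s)))"
        by (metis mult.assoc)
      then show ?thesis using False by (simp add: exponential_density_def mult.assoc)
    qed (simp add: exponential_density_def)
    then show "ennreal (exponential_density (1 / \<sigma>) x) * ennreal (exp (s * x)) =
        ennreal (1 / (1 - s * \<sigma>)) * ennreal (exponential_density (1 / \<sigma> - s) x)"
      using assms s by (simp add: ennreal_mult'[symmetric] exponential_density_nonneg)
  qed
  also have "\<dots> = ennreal (1 / (1 - s * \<sigma>))"
    by (subst nn_integral_cmult) (auto simp: one)
  finally show ?thesis .
qed

lemma nn_integral_PiM_prod:
  fixes M :: "'b measure" and f :: "'b \<Rightarrow> ennreal" and F :: "'i set"
  assumes "prob_space M" "finite F" and f [measurable]: "f \<in> borel_measurable M"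
  shows "(\<integral>\<^sup>+x. (\<Prod>k\<in>F. f (x k)) \<partial>Pi\<^sub>M UNIV (\<lambda>_. M)) = (\<integral>\<^sup>+x. f x \<partial>M) ^ card F"
proof -
  interpret prob_space M by fact
  interpret product_prob_space "\<lambda>_::'i. M" UNIV by unfold_locales
  have "(\<integral>\<^sup>+x. (\<Prod>k\<in>F. f (x k)) \<partial>Pi\<^sub>M UNIV (\<lambda>_. M)) =
      (\<integral>\<^sup>+x. (\<Prod>k\<in>F. f (x k)) \<partial>distr (Pi\<^sub>M UNIV (\<lambda>_. M)) (Pi\<^sub>M F (\<lambda>_. M)) (\<lambda>x. restrict x F))"
    by (subst nn_integral_distr) (auto intro!: nn_integral_cong prod.cong)
  also have "\<dots> = (\<integral>\<^sup>+x. (\<Prod>k\<in>F. f (x k)) \<partial>Pi\<^sub>M F (\<lambda>_. M))"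
    using assms(2) by (subst distr_PiM_restrict_finite) auto
  also have "\<dots> = (\<Prod>k\<in>F. \<integral>\<^sup>+x. f x \<partial>M)"
    by (rule product_nn_integral_prod) (use assms in auto)
  finally show ?thesis by simp
qed

text \<open>The expectation of the exponential of the sum is \<open>q ^ Suc N\<close>, which is
  summable. So almost surely the series of the exponentials converges, its terms tend to 0, and from
  some point on they are below 1.\<close>

lemma AE_sum_eventually_negative:
  fixes M :: "'b measure" and f :: "'b \<Rightarrow> real"
  assumes "prob_space M" and f [measurable]: "f \<in> borel_measurable M"
    and q: "(\<integral>\<^sup>+x. ennreal (exp (f x)) \<partial>M) = ennreal q" "0 \<le> q" "q < 1"
  shows "AE x in Pi\<^sub>M (UNIV :: int set) (\<lambda>_. M). \<forall>\<^sub>F N in sequentially. (\<Sum>k=- int N..0. f (x k)) < 0"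
proof -
  let ?P = "Pi\<^sub>M (UNIV :: int set) (\<lambda>_. M)"
  let ?g = "\<lambda>N x. ennreal (exp (\<Sum>k=- int N..0. f (x k)))"
  have int: "(\<integral>\<^sup>+x. ?g N x \<partial>?P) = ennreal (q ^ Suc N)" for N
  proof -
    have "(\<integral>\<^sup>+x. ?g N x \<partial>?P) = (\<integral>\<^sup>+x. (\<Prod>k\<in>{- int N..0}. ennreal (exp (f (x k)))) \<partial>?P)"
      by (intro nn_integral_cong) (simp add: exp_sum prod_ennreal)
    also have "\<dots> = ennreal q ^ card {- int N..0}"
      using assms by (subst nn_integral_PiM_prod) auto
    finally show ?thesis using q(2) by (simp add: ennreal_power ennreal_mult nat_add_distrib)
  qed
  have "summable (\<lambda>N. q ^ Suc N)" using q by (simp add: summable_mult summable_geometric)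
  then have "(\<Sum>N. ennreal (q ^ Suc N)) \<noteq> \<infinity>"
    using q by (subst suminf_ennreal2) auto
  then have "(\<integral>\<^sup>+x. (\<Sum>N. ?g N x) \<partial>?P) \<noteq> \<infinity>"
    by (subst nn_integral_suminf) (auto simp: int)
  then have "AE x in ?P. (\<Sum>N. ?g N x) \<noteq> \<infinity>"
    by (intro nn_integral_PInf_AE) auto
  then show ?thesis
  proof eventually_elim
    case (elim x)
    have "summable (\<lambda>N. exp (\<Sum>k=- int N..0. f (x k)))"
      by (rule summable_suminf_not_top) (use elim in auto)
    then have "(\<lambda>N. exp (\<Sum>k=- int N..0. f (x k))) \<longlonglongrightarrow> 0" by (rule summable_LIMSEQ_zero)
    then have "\<forall>\<^sub>F N in sequentially. exp (\<Sum>k=- int N..0. f (x k)) < 1"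
      by (rule order_tendstoD) simp
    then show ?case by (simp add: exp_less_one_iff)
  qed
qed

text \<open>A Chernoff bound on either side. In the scaled quantities
  \<open>u = s * \<sigma>\<close> and \<open>d = e / \<sigma>\<close> the conditions on the
  exponential moments read \<open>exp (- (u + u * d)) < 1 - u\<close> and
  \<open>exp (u - u * d) < 1 + u\<close>, which hold for small \<open>u\<close> because the
  quadratic terms of the logarithms are negligible against \<open>u * d\<close>.\<close>

lemma AE_exp_seq_sum_bound:
  assumes \<sigma>: "0 < \<sigma>" and e: "0 < e"
  shows "AE x in exp_seq \<sigma>. \<forall>\<^sub>F N in sequentially. \<bar>(\<Sum>k=- int N..0. x k) - real (Suc N) * \<sigma>\<bar> \<le> real (Suc N) * e"
proof -
  define d where "d = e / \<sigma>"
  have d: "0 < d" using \<sigma> e by (simp add: d_def)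
  \<comment> \<open>\<open>u \<le> 1 / 2\<close> is required by the lower bound for
    \<open>ln (1 - u)\<close>; \<open>2 * u < d\<close> puts the quadratic errors,
    \<open>2 * u\<^sup>2\<close> and \<open>u\<^sup>2\<close>, below \<open>u * d\<close>.\<close>
  define u where "u = min (1 / 2) (d / 4)"
  have u: "0 < u" "u \<le> 1 / 2" "2 * u < d" using d by (auto simp: u_def min_def)
  define s where "s = u / \<sigma>"
  have s: "0 < s" "s * \<sigma> = u" "s * e = u * d"
  proof -
    show "0 < s" "s * \<sigma> = u" using u \<sigma> by (simp_all add: s_def)
    show "s * e = u * d" unfolding s_def d_def by simp
  qed
  have de: "\<sigma> * d = e" using \<sigma> by (simp add: d_def)
  have uu: "2 * u\<^sup>2 < u * d" "u\<^sup>2 < u * d" using u by (auto simp: power2_eq_square)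
  have up: "exp (- (u + u * d)) < 1 - u"
  proof -
    have "- (u + u * d) < ln (1 - u)"
      using ln_one_minus_pos_lower_bound[of u] u uu by linarith
    then have "exp (- (u + u * d)) < exp (ln (1 - u))" by (simp only: exp_less_cancel_iff)
    then show ?thesis using u by simp
  qed
  have lo: "exp (u - u * d) < 1 + u"
  proof -
    have "u - u * d < ln (1 + u)"
      using ln_one_plus_pos_lower_bound[of u] u uu by linarith
    then have "exp (u - u * d) < exp (ln (1 + u))" by (simp only: exp_less_cancel_iff)
    then show ?thesis using u by simp
  qed
  have "AE x in exp_seq \<sigma>. \<forall>\<^sub>F N in sequentially. (\<Sum>k=- int N..0. s * (x k - \<sigma> - e)) < 0"
    unfolding exp_seq_def
  proof (rule AE_sum_eventually_negative[OF prob_space_exp_dist[OF \<sigma>]])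
    have "(\<integral>\<^sup>+x. ennreal (exp (s * (x - \<sigma> - e))) \<partial>exp_dist \<sigma>) =
        (\<integral>\<^sup>+x. ennreal (exp (- (u + u * d))) * ennreal (exp (s * x)) \<partial>exp_dist \<sigma>)"
      by (intro nn_integral_cong)
         (simp add: ennreal_mult'[symmetric] exp_add[symmetric] s(2)[symmetric] algebra_simps de)
    also have "\<dots> = ennreal (exp (- (u + u * d)) * (1 / (1 - u)))"
    proof -
      have "(\<integral>\<^sup>+x. ennreal (exp (s * x)) \<partial>exp_dist \<sigma>) = ennreal (1 / (1 - u))"
        using nn_integral_exp_dist_mgf[of \<sigma> s] \<sigma> u s(2) by simp
      then show ?thesis by (subst nn_integral_cmult, measurable) (simp only: ennreal_mult'[OF exp_ge_zero])
    qed
    finally show "(\<integral>\<^sup>+x. ennreal (exp (s * (x - \<sigma> - e))) \<partial>exp_dist \<sigma>) =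
        ennreal (exp (- (u + u * d)) * (1 / (1 - u)))" .
    show "exp (- (u + u * d)) * (1 / (1 - u)) < 1" using up u by (simp add: divide_less_eq)
  qed (use u in auto)
  moreover have "AE x in exp_seq \<sigma>. \<forall>\<^sub>F N in sequentially. (\<Sum>k=- int N..0. s * (\<sigma> - e - x k)) < 0"
    unfolding exp_seq_def
  proof (rule AE_sum_eventually_negative[OF prob_space_exp_dist[OF \<sigma>]])
    have "(\<integral>\<^sup>+x. ennreal (exp (s * (\<sigma> - e - x))) \<partial>exp_dist \<sigma>) =
        (\<integral>\<^sup>+x. ennreal (exp (u - u * d)) * ennreal (exp (- s * x)) \<partial>exp_dist \<sigma>)"
      by (intro nn_integral_cong)
         (simp add: ennreal_mult'[symmetric] exp_add[symmetric] s(2)[symmetric] algebra_simps de)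
    also have "\<dots> = ennreal (exp (u - u * d) * (1 / (1 + u)))"
    proof -
      have "(\<integral>\<^sup>+x. ennreal (exp (- s * x)) \<partial>exp_dist \<sigma>) = ennreal (1 / (1 + u))"
        using nn_integral_exp_dist_mgf[of \<sigma> "- s"] \<sigma> u s by simp
      then show ?thesis by (subst nn_integral_cmult, measurable) (simp only: ennreal_mult'[OF exp_ge_zero])
    qed
    finally show "(\<integral>\<^sup>+x. ennreal (exp (s * (\<sigma> - e - x))) \<partial>exp_dist \<sigma>) = ennreal (exp (u - u * d) * (1 / (1 + u)))" .
    show "exp (u - u * d) * (1 / (1 + u)) < 1" using lo u by (simp add: divide_less_eq)
  qed (use u in auto)
  ultimately show ?thesis
  proof eventually_elim
    case (elim x)
    from elim(1) elim(2) show ?case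
    proof eventually_elim
      case (elim N)
      have "(\<Sum>k=- int N..0. s * (x k - \<sigma> - e)) = s * ((\<Sum>k=- int N..0. x k) - real (Suc N) * (\<sigma> + e))"
        by (simp add: sum_distrib_left[symmetric] sum_subtractf sum.distrib nat_add_distrib algebra_simps)
      moreover have "(\<Sum>k=- int N..0. s * (\<sigma> - e - x k)) = s * (real (Suc N) * (\<sigma> - e) - (\<Sum>k=- int N..0. x k))"
        by (simp add: sum_distrib_left[symmetric] sum_subtractf sum.distrib nat_add_distrib algebra_simps)
      ultimately have "(\<Sum>k=- int N..0. x k) - real (Suc N) * (\<sigma> + e) < 0"
          "real (Suc N) * (\<sigma> - e) - (\<Sum>k=- int N..0. x k) < 0"
        using elim s(1) by (simp_all only: mult_less_0_iff) auto
      then show ?case by (simp add: abs_le_iff algebra_simps)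
    qed
  qed
qed

lemma AE_exp_seq_avg:
  assumes \<sigma>: "0 < \<sigma>"
  shows "AE x in exp_seq \<sigma>. has_avg x \<sigma>"
proof -
  have "AE x in exp_seq \<sigma>. \<forall>m::nat. \<forall>\<^sub>F N in sequentially.
      \<bar>(\<Sum>k=- int N..0. x k) - real (Suc N) * \<sigma>\<bar> \<le> real (Suc N) * (1 / real (Suc m))"
    unfolding AE_all_countable by (intro allI AE_exp_seq_sum_bound \<sigma>) simp
  then show ?thesis
  proof eventually_elim
    case (elim x)
    let ?S = "\<lambda>N. \<Sum>k=- int N..0. x k"
    have "(\<lambda>N. ?S N / real (Suc N)) \<longlonglongrightarrow> \<sigma>"
      unfolding LIMSEQ_iff real_norm_def
    proof (intro allI impI)
      fix r :: real assume "0 < r"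
      then obtain m where m: "1 / real (Suc m) < r" by (rule nat_approx_posE)
      from elim obtain N0 where N0: "\<And>N. N \<ge> N0 \<Longrightarrow> \<bar>?S N - real (Suc N) * \<sigma>\<bar> \<le> real (Suc N) * (1 / real (Suc m))"
        unfolding eventually_sequentially by blast
      have "\<bar>?S N / real (Suc N) - \<sigma>\<bar> < r" if "N \<ge> N0" for N
      proof -
        have "?S N / real (Suc N) - \<sigma> = (?S N - real (Suc N) * \<sigma>) / real (Suc N)"
          by (simp add: diff_divide_distrib del: of_nat_Suc)
        then have "\<bar>?S N / real (Suc N) - \<sigma>\<bar> = \<bar>?S N - real (Suc N) * \<sigma>\<bar> / real (Suc N)" by (simp add: abs_divide)
        also have "\<dots> \<le> 1 / real (Suc m)" using N0[OF that] by (simp add: divide_le_eq mult.commute del: of_nat_Suc)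
        finally show ?thesis using m by simp
      qed
      then show "\<exists>N0. \<forall>N\<ge>N0. \<bar>?S N / real (Suc N) - \<sigma>\<bar> < r" by blast
    qed
    \<comment> \<open>Passes from division by the number of terms to the division by
      \<open>N\<close> in \<open>has_avg\<close>.\<close>
    then have "(\<lambda>N. ?S N / real (Suc N) * (real (Suc N) / real N)) \<longlonglongrightarrow> \<sigma> * 1"
      by (intro tendsto_mult LIMSEQ_Suc_n_over_n)
    then show ?case unfolding has_avg_def by (simp del: of_nat_Suc)
  qed
qed

lemma AE_exp_seq_stable:
  assumes "0 < \<tau>" "\<tau> < \<sigma>"
  shows "AE x in exp_seq \<sigma> \<Otimes>\<^sub>M exp_seq \<tau>. stable (fst x) (snd x) \<and> (\<forall>k. 0 \<le> fst x k) \<and> (\<forall>k. 0 \<le> snd x k)"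
proof -
  have \<sigma>: "0 < \<sigma>" using assms by simp
  interpret s: prob_space "exp_seq \<sigma>" using assms by (intro prob_space_exp_seq) simp
  interpret t: prob_space "exp_seq \<tau>" using assms by (intro prob_space_exp_seq) simp
  interpret pair_sigma_finite "exp_seq \<sigma>" "exp_seq \<tau>" by unfold_locales
  show ?thesis
  proof (rule AE_pair_measure)
    show "AE x in exp_seq \<sigma>. AE y in exp_seq \<tau>. stable (fst (x, y)) (snd (x, y)) \<and> (\<forall>k. 0 \<le> fst (x, y) k) \<and> (\<forall>k. 0 \<le> snd (x, y) k)"
      using AE_exp_seq_avg[OF \<sigma>] AE_exp_seq_nonneg[OF \<sigma>]
    proof (eventually_elim)
      case (elim x)
      show ?case using AE_exp_seq_avg[OF assms(1)] AE_exp_seq_nonneg[OF assms(1)]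
        by eventually_elim (use elim assms stable_of_avg in auto)
    qed
  qed measurable
qed

section \<open>Burke's theorem\<close>

lemma nn_integral_exp_dist:
  assumes [measurable]: "f \<in> borel_measurable borel"
  shows "(\<integral>\<^sup>+x. f x \<partial>exp_dist \<sigma>) = (\<integral>\<^sup>+x. ennreal (exponential_density (1 / \<sigma>) x) * f x \<partial>lborel)"
  unfolding exp_dist_def by (rule nn_integral_density) auto

lemma nn_integral_lborel_shift:
  fixes t :: real
  assumes "f \<in> borel_measurable borel"
  shows "(\<integral>\<^sup>+x. f x \<partial>lborel) = (\<integral>\<^sup>+x. f (t + x) \<partial>lborel)"
  using nn_integral_real_affine[OF assms, of 1 t] by simp

text \<open>The change of variables is \<open>(J, I) \<mapsto> (min J I, I - J)\<close>; its inverse adds the negative and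
  positive parts of \<open>d = I - J\<close> to the minimum.\<close>

lemma nn_integral_exp_pair:
  assumes \<tau>: "0 < \<tau>" "\<tau> < \<sigma>" and \<kappa>: "\<kappa> = 1 / (1 / \<tau> - 1 / \<sigma>)"
  shows "\<exists>l. l \<in> borel_measurable borel \<and> (\<forall>F\<in>borel_measurable (borel \<Otimes>\<^sub>M borel).
    (\<integral>\<^sup>+J. \<integral>\<^sup>+I. F (J, I) \<partial>exp_dist \<sigma> \<partial>exp_dist \<kappa>) =
    (\<integral>\<^sup>+d. l d * (\<integral>\<^sup>+m. F (m + max (- d) 0, m + max d 0) \<partial>exp_dist \<tau>) \<partial>lborel))"
proof -
  let ?a = "1 / \<sigma>" and ?b = "1 / \<tau>"
  define g where "g = 1 / \<tau> - 1 / \<sigma>"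
  have pos: "0 < ?a" "0 < g" "0 < ?b" using \<tau> by (auto simp: g_def field_simps)
  have \<kappa>g: "1 / \<kappa> = g" using \<kappa> by (simp add: g_def)
  \<comment> \<open>This weight is the density of the difference \<open>I - J\<close>: exponential
    with rate \<open>1 / \<sigma>\<close> on the positive side and with rate \<open>g\<close> on the
    negative side.\<close>
  define l where "l d = ennreal (?a * g / ?b * exp (- g * max (- d) 0 - ?a * max d 0))" for d :: real
  have [measurable]: "l \<in> borel_measurable borel" unfolding l_def by measurable
  \<comment> \<open>The minimum of two independent exponential variables has the sum of their rates.
    Since \<open>g + 1 / \<sigma> = 1 / \<tau>\<close>, it has the law of a service; this is what
    determines \<open>\<kappa>\<close>.\<close>
  have dens: "exponential_density g (m + max (- d) 0) * exponential_density ?a (m + max d 0) =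
      ?a * g / ?b * exp (- g * max (- d) 0 - ?a * max d 0) * exponential_density ?b m" for m d :: real
  proof (cases "m < 0")
    case True
    then have "m + max (- d) 0 < 0 \<or> m + max d 0 < 0" by (auto simp: max_def)
    then show ?thesis using True by (auto simp: exponential_density_def)
  next
    case False
    have "exp (- (m + max (- d) 0) * g) * exp (- (m + max d 0) * ?a) =
        exp (- g * max (- d) 0 - ?a * max d 0) * exp (- m * ?b)"
      by (simp add: exp_add[symmetric] g_def algebra_simps)
    moreover have "0 \<le> m + max (- d) 0" "0 \<le> m + max d 0" using False by (auto simp: max_def)
    ultimately show ?thesis
      using False \<tau>(1) by (simp add: exponential_density_def not_less)
  qed
  show ?thesis
  proof (intro exI[of _ l] conjI ballI)
    fix F :: "real \<times> real \<Rightarrow> ennreal" assume [measurable]: "F \<in> borel_measurable (borel \<Otimes>\<^sub>M borel)"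
    let ?e = "\<lambda>s x. ennreal (exponential_density s x)"
    have "(\<integral>\<^sup>+J. \<integral>\<^sup>+I. F (J, I) \<partial>exp_dist \<sigma> \<partial>exp_dist \<kappa>) =
        (\<integral>\<^sup>+J. ?e g J * (\<integral>\<^sup>+I. ?e ?a I * F (J, I) \<partial>lborel) \<partial>lborel)"
      by (simp add: nn_integral_exp_dist \<kappa>g)
    also have "\<dots> = (\<integral>\<^sup>+J. \<integral>\<^sup>+d. ?e g J * (?e ?a (J + d) * F (J, J + d)) \<partial>lborel \<partial>lborel)"
    proof (rule nn_integral_cong)
      fix J :: real
      have "(\<integral>\<^sup>+I. ?e ?a I * F (J, I) \<partial>lborel) = (\<integral>\<^sup>+d. ?e ?a (J + d) * F (J, J + d) \<partial>lborel)"
        by (rule nn_integral_lborel_shift) measurable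
      then show "?e g J * (\<integral>\<^sup>+I. ?e ?a I * F (J, I) \<partial>lborel) =
          (\<integral>\<^sup>+d. ?e g J * (?e ?a (J + d) * F (J, J + d)) \<partial>lborel)"
        by (subst nn_integral_cmult) auto
    qed
    also have "\<dots> = (\<integral>\<^sup>+d. \<integral>\<^sup>+J. ?e g J * (?e ?a (J + d) * F (J, J + d)) \<partial>lborel \<partial>lborel)"
      by (rule lborel_pair.Fubini'[symmetric]) measurable
    also have "\<dots> = (\<integral>\<^sup>+d. l d * (\<integral>\<^sup>+m. F (m + max (- d) 0, m + max d 0) \<partial>exp_dist \<tau>) \<partial>lborel)"
    proof (rule nn_integral_cong)
      fix d :: real
      have d: "max (- d) 0 + m + d = m + max d 0" for m by (auto simp: max_def)
      have "(\<integral>\<^sup>+J. ?e g J * (?e ?a (J + d) * F (J, J + d)) \<partial>lborel) =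
          (\<integral>\<^sup>+m. ?e g (max (- d) 0 + m) * (?e ?a (max (- d) 0 + m + d) * F (max (- d) 0 + m, max (- d) 0 + m + d)) \<partial>lborel)"
        by (rule nn_integral_lborel_shift) measurable
      also have "\<dots> = (\<integral>\<^sup>+m. l d * (?e ?b m * F (m + max (- d) 0, m + max d 0)) \<partial>lborel)"
      proof (rule nn_integral_cong)
        fix m :: real
        have "?e g (m + max (- d) 0) * ?e ?a (m + max d 0) = l d * ?e ?b m"
          unfolding l_def using pos
          by (subst (1 2) ennreal_mult'[symmetric]) (auto simp: dens exponential_density_nonneg)
        then show "?e g (max (- d) 0 + m) * (?e ?a (max (- d) 0 + m + d) * F (max (- d) 0 + m, max (- d) 0 + m + d)) =
            l d * (?e ?b m * F (m + max (- d) 0, m + max d 0))"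
          unfolding d by (simp add: add.commute[of _ m] mult.assoc[symmetric])
      qed
      also have "\<dots> = l d * (\<integral>\<^sup>+m. F (m + max (- d) 0, m + max d 0) \<partial>exp_dist \<tau>)"
        by (subst nn_integral_cmult) (auto simp: nn_integral_exp_dist)
      finally show "(\<integral>\<^sup>+J. ?e g J * (?e ?a (J + d) * F (J, J + d)) \<partial>lborel) =
          l d * (\<integral>\<^sup>+m. F (m + max (- d) 0, m + max d 0) \<partial>exp_dist \<tau>)" .
    qed
    finally show "(\<integral>\<^sup>+J. \<integral>\<^sup>+I. F (J, I) \<partial>exp_dist \<sigma> \<partial>exp_dist \<kappa>) =
        (\<integral>\<^sup>+d. l d * (\<integral>\<^sup>+m. F (m + max (- d) 0, m + max d 0) \<partial>exp_dist \<tau>) \<partial>lborel)" .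
  qed measurable
qed

text \<open>The input is (previous sojourn time, interarrival time, service), the output (new
  sojourn time, interdeparture time, dual service), according to the recursions of a stable
  queue.\<close>

definition queue_step :: "real \<times> real \<times> real \<Rightarrow> real \<times> real \<times> real" where
  "queue_step = (\<lambda>(J, I, w). (w + max (J - I) 0, w + max (I - J) 0, min I J))"

lemma measurable_queue_step [measurable]: "queue_step \<in> borel \<Otimes>\<^sub>M borel \<Otimes>\<^sub>M borel \<rightarrow>\<^sub>M borel \<Otimes>\<^sub>M borel \<Otimes>\<^sub>M borel"
  unfolding queue_step_def by measurable

text \<open>In the coordinates (minimum, difference, service) the step exchanges minimum and service.\<close>

lemma nn_integral_queue_step:
  assumes \<tau>: "0 < \<tau>" "\<tau> < \<sigma>" and \<kappa>: "\<kappa> = 1 / (1 / \<tau> - 1 / \<sigma>)"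
    and [measurable]: "f \<in> borel_measurable (borel \<Otimes>\<^sub>M borel \<Otimes>\<^sub>M borel)"
  shows "(\<integral>\<^sup>+J. \<integral>\<^sup>+I. \<integral>\<^sup>+w. f (queue_step (J, I, w)) \<partial>exp_dist \<tau> \<partial>exp_dist \<sigma> \<partial>exp_dist \<kappa>) =
    (\<integral>\<^sup>+J. \<integral>\<^sup>+I. \<integral>\<^sup>+w. f (J, I, w) \<partial>exp_dist \<tau> \<partial>exp_dist \<sigma> \<partial>exp_dist \<kappa>)"
proof -
  interpret t: prob_space "exp_dist \<tau>" by (rule prob_space_exp_dist[OF \<tau>(1)])
  interpret tt: pair_sigma_finite "exp_dist \<tau>" "exp_dist \<tau>" by unfold_locales
  obtain l where l: "\<And>F. F \<in> borel_measurable (borel \<Otimes>\<^sub>M borel) \<Longrightarrow>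
    (\<integral>\<^sup>+J. \<integral>\<^sup>+I. F (J, I) \<partial>exp_dist \<sigma> \<partial>exp_dist \<kappa>) =
    (\<integral>\<^sup>+d. l d * (\<integral>\<^sup>+m. F (m + max (- d) 0, m + max d 0) \<partial>exp_dist \<tau>) \<partial>lborel)"
    using nn_integral_exp_pair[OF \<tau> \<kappa>] by blast
  have step: "queue_step (m + max (- d) 0, m + max d 0, w) = (w + max (- d) 0, w + max d 0, m)" for m d w
    by (auto simp: queue_step_def max_def min_def)
  have "(\<integral>\<^sup>+J. \<integral>\<^sup>+I. \<integral>\<^sup>+w. f (queue_step (J, I, w)) \<partial>exp_dist \<tau> \<partial>exp_dist \<sigma> \<partial>exp_dist \<kappa>) =
      (\<integral>\<^sup>+d. l d * (\<integral>\<^sup>+m. \<integral>\<^sup>+w. f (w + max (- d) 0, w + max d 0, m) \<partial>exp_dist \<tau> \<partial>exp_dist \<tau>) \<partial>lborel)"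
    using l[of "\<lambda>(J, I). \<integral>\<^sup>+w. f (queue_step (J, I, w)) \<partial>exp_dist \<tau>"] by (simp add: step)
  also have "\<dots> = (\<integral>\<^sup>+d. l d * (\<integral>\<^sup>+m. \<integral>\<^sup>+w. f (m + max (- d) 0, m + max d 0, w) \<partial>exp_dist \<tau> \<partial>exp_dist \<tau>) \<partial>lborel)"
    by (intro nn_integral_cong arg_cong2[where f = times] refl tt.Fubini') measurable
  also have "\<dots> = (\<integral>\<^sup>+J. \<integral>\<^sup>+I. \<integral>\<^sup>+w. f (J, I, w) \<partial>exp_dist \<tau> \<partial>exp_dist \<sigma> \<partial>exp_dist \<kappa>)"
    using l[of "\<lambda>(J, I). \<integral>\<^sup>+w. f (J, I, w) \<partial>exp_dist \<tau>"] by simp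
  finally show ?thesis .
qed

text \<open>Overwriting one coordinate with an independent copy does not change a product law. It
  serves to isolate the single coordinate on which a local map acts.\<close>

lemma nn_integral_PiM_resample:
  assumes M: "\<And>i. i \<in> I \<Longrightarrow> prob_space (M i)" and k: "k \<in> I"
    and [measurable]: "f \<in> borel_measurable (Pi\<^sub>M I M)"
  shows "(\<integral>\<^sup>+x. f x \<partial>Pi\<^sub>M I M) = (\<integral>\<^sup>+y. \<integral>\<^sup>+x. f (x(k := y)) \<partial>Pi\<^sub>M I M \<partial>M k)"
proof -
  interpret P: prob_space "Pi\<^sub>M I M" by (rule prob_space_PiM) (rule M)
  have ins: "insert k I = I" using k by auto
  have m [measurable]: "(\<lambda>(x, X). X(k := x)) \<in> M k \<Otimes>\<^sub>M Pi\<^sub>M I M \<rightarrow>\<^sub>M Pi\<^sub>M I M"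
    using measurable_fun_upd[of I I k "\<lambda>z. snd z" "M k \<Otimes>\<^sub>M Pi\<^sub>M I M" M "\<lambda>z. fst z"] k
    by (simp add: case_prod_beta insert_absorb)
  have "(\<integral>\<^sup>+x. f x \<partial>Pi\<^sub>M I M) = (\<integral>\<^sup>+x. f x \<partial>distr (M k \<Otimes>\<^sub>M Pi\<^sub>M I M) (Pi\<^sub>M I M) (\<lambda>(x, X). X(k := x)))"
    using distr_pair_PiM_eq_PiM[of I M k] M k by (simp add: ins)
  also have "\<dots> = (\<integral>\<^sup>+z. f ((snd z)(k := fst z)) \<partial>(M k \<Otimes>\<^sub>M Pi\<^sub>M I M))"
    by (subst nn_integral_distr) (auto simp: case_prod_beta)
  also have "\<dots> = (\<integral>\<^sup>+y. \<integral>\<^sup>+x. f (x(k := y)) \<partial>Pi\<^sub>M I M \<partial>M k)"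
    by (subst P.nn_integral_fst[symmetric]) (auto simp: measurable_split_conv[symmetric])
  finally show ?thesis .
qed

lemma measurable_seq_upd [measurable (raw)]:
  assumes [measurable]: "f \<in> measurable M seq_space" "g \<in> borel_measurable M"
  shows "(\<lambda>x. (f x)(k := g x)) \<in> measurable M seq_space"
  by (rule measurable_seq_spaceI) (simp add: fun_upd_def)

text \<open>The step acts in place: site \<open>k\<close> of the arrivals is overwritten by the
  interdeparture time and site \<open>k\<close> of the services by the dual service. Input and
  output then live on the same space, and the product law can be literally invariant.\<close>

definition queue_update :: "int \<Rightarrow> real \<times> (int \<Rightarrow> real) \<times> (int \<Rightarrow> real) \<Rightarrow> real \<times> (int \<Rightarrow> real) \<times> (int \<Rightarrow> real)" where
  "queue_update k = (\<lambda>(J, I, w). case queue_step (J, I k, w k) of (J', D, R) \<Rightarrow> (J', I(k := D), w(k := R)))"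

lemma measurable_queue_update [measurable]:
  "queue_update k \<in> borel \<Otimes>\<^sub>M seq_space \<Otimes>\<^sub>M seq_space \<rightarrow>\<^sub>M borel \<Otimes>\<^sub>M seq_space \<Otimes>\<^sub>M seq_space"
  unfolding queue_update_def queue_step_def by measurable

lemma nn_integral_triple:
  assumes "0 < \<kappa>" "0 < \<sigma>" "0 < \<tau>"
    and f: "f \<in> borel_measurable (borel \<Otimes>\<^sub>M seq_space \<Otimes>\<^sub>M seq_space)"
  shows "(\<integral>\<^sup>+x. f x \<partial>(exp_dist \<kappa> \<Otimes>\<^sub>M exp_seq \<sigma> \<Otimes>\<^sub>M exp_seq \<tau>)) =
    (\<integral>\<^sup>+J. \<integral>\<^sup>+y. \<integral>\<^sup>+z. \<integral>\<^sup>+I. \<integral>\<^sup>+w. f (J, I(k := y), w(k := z)) \<partial>exp_seq \<tau> \<partial>exp_seq \<sigma> \<partial>exp_dist \<tau> \<partial>exp_dist \<sigma> \<partial>exp_dist \<kappa>)"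
proof -
  interpret S: prob_space "exp_seq \<sigma>" using assms by (intro prob_space_exp_seq)
  interpret T: prob_space "exp_seq \<tau>" using assms by (intro prob_space_exp_seq)
  interpret t: prob_space "exp_dist \<tau>" using assms by (intro prob_space_exp_dist)
  interpret K: prob_space "exp_dist \<kappa>" using assms by (intro prob_space_exp_dist)
  interpret ST: pair_prob_space "exp_seq \<sigma>" "exp_seq \<tau>" ..
  interpret tS: pair_sigma_finite "exp_dist \<tau>" "exp_seq \<sigma>" ..
  note [measurable] = f
  have rs: "(\<integral>\<^sup>+x. g x \<partial>exp_seq s) = (\<integral>\<^sup>+y. \<integral>\<^sup>+x. g (x(k := y)) \<partial>exp_seq s \<partial>exp_dist s)"
    if "0 < s" "g \<in> borel_measurable seq_space" for s g
  proof -
    have "g \<in> borel_measurable (exp_seq s)" using that(2) by measurable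
    then show ?thesis using nn_integral_PiM_resample[of UNIV "\<lambda>_. exp_dist s" k g] prob_space_exp_dist[OF that(1)]
      by (simp add: exp_seq_def)
  qed
  have "(\<integral>\<^sup>+x. f x \<partial>(exp_dist \<kappa> \<Otimes>\<^sub>M exp_seq \<sigma> \<Otimes>\<^sub>M exp_seq \<tau>)) =
      (\<integral>\<^sup>+J. \<integral>\<^sup>+I. \<integral>\<^sup>+w. f (J, I, w) \<partial>exp_seq \<tau> \<partial>exp_seq \<sigma> \<partial>exp_dist \<kappa>)"
    by (subst ST.P.nn_integral_fst[symmetric], measurable, subst T.nn_integral_fst[symmetric], measurable)
  also have "\<dots> = (\<integral>\<^sup>+J. \<integral>\<^sup>+y. \<integral>\<^sup>+I. \<integral>\<^sup>+w. f (J, I(k := y), w) \<partial>exp_seq \<tau> \<partial>exp_seq \<sigma> \<partial>exp_dist \<sigma> \<partial>exp_dist \<kappa>)"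
    by (intro nn_integral_cong rs assms) measurable
  also have "\<dots> = (\<integral>\<^sup>+J. \<integral>\<^sup>+y. \<integral>\<^sup>+I. \<integral>\<^sup>+z. \<integral>\<^sup>+w. f (J, I(k := y), w(k := z)) \<partial>exp_seq \<tau> \<partial>exp_dist \<tau> \<partial>exp_seq \<sigma> \<partial>exp_dist \<sigma> \<partial>exp_dist \<kappa>)"
    by (intro nn_integral_cong rs assms) measurable
  also have "\<dots> = (\<integral>\<^sup>+J. \<integral>\<^sup>+y. \<integral>\<^sup>+z. \<integral>\<^sup>+I. \<integral>\<^sup>+w. f (J, I(k := y), w(k := z)) \<partial>exp_seq \<tau> \<partial>exp_seq \<sigma> \<partial>exp_dist \<tau> \<partial>exp_dist \<sigma> \<partial>exp_dist \<kappa>)"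
    by (intro nn_integral_cong tS.Fubini') measurable
  finally show ?thesis .
qed

text \<open>After resampling site \<open>k\<close>, the update changes only the triple of workload,
  arrival and service there. Integrating out all other coordinates leaves a function of this triple,
  to which \<open>nn_integral_queue_step\<close> applies.\<close>

lemma distr_queue_update:
  assumes \<tau>: "0 < \<tau>" "\<tau> < \<sigma>" and \<kappa>: "\<kappa> = 1 / (1 / \<tau> - 1 / \<sigma>)"
  defines "P \<equiv> exp_dist \<kappa> \<Otimes>\<^sub>M exp_seq \<sigma> \<Otimes>\<^sub>M exp_seq \<tau>"
  shows "distr P P (queue_update k) = P"
proof (rule measure_eqI)
  have pos: "0 < \<kappa>" "0 < \<sigma>" "0 < \<tau>" using \<tau> by (auto simp: \<kappa> field_simps)
  interpret S: prob_space "exp_seq \<sigma>" using pos by (intro prob_space_exp_seq)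
  interpret T: prob_space "exp_seq \<tau>" using pos by (intro prob_space_exp_seq)
  have sets [measurable_cong]: "sets P = sets (borel \<Otimes>\<^sub>M seq_space \<Otimes>\<^sub>M seq_space)"
    unfolding P_def by (intro sets_pair_measure_cong) auto
  fix A assume "A \<in> sets (distr P P (queue_update k))"
  then have A [measurable]: "A \<in> sets (borel \<Otimes>\<^sub>M seq_space \<Otimes>\<^sub>M seq_space)" using sets by simp
  let ?h = "\<lambda>x. \<integral>\<^sup>+I. \<integral>\<^sup>+w. indicator A (fst x, I(k := fst (snd x)), w(k := snd (snd x))) \<partial>exp_seq \<tau> \<partial>exp_seq \<sigma>"
  have h: "?h \<in> borel_measurable (borel \<Otimes>\<^sub>M borel \<Otimes>\<^sub>M borel)" by measurable
  have "emeasure (distr P P (queue_update k)) A = (\<integral>\<^sup>+x. indicator A x \<partial>distr P P (queue_update k))"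
    by (rule nn_integral_indicator[symmetric]) simp
  also have "\<dots> = (\<integral>\<^sup>+x. indicator A (queue_update k x) \<partial>P)"
    by (rule nn_integral_distr) measurable
  also have "\<dots> = (\<integral>\<^sup>+J. \<integral>\<^sup>+y. \<integral>\<^sup>+z. \<integral>\<^sup>+I. \<integral>\<^sup>+w. indicator A (queue_update k (J, I(k := y), w(k := z))) \<partial>exp_seq \<tau> \<partial>exp_seq \<sigma> \<partial>exp_dist \<tau> \<partial>exp_dist \<sigma> \<partial>exp_dist \<kappa>)"
    unfolding P_def by (rule nn_integral_triple[OF pos]) measurable
  also have "\<dots> = (\<integral>\<^sup>+J. \<integral>\<^sup>+y. \<integral>\<^sup>+z. ?h (queue_step (J, y, z)) \<partial>exp_dist \<tau> \<partial>exp_dist \<sigma> \<partial>exp_dist \<kappa>)"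
    by (simp add: queue_update_def queue_step_def)
  also have "\<dots> = (\<integral>\<^sup>+J. \<integral>\<^sup>+y. \<integral>\<^sup>+z. ?h (J, y, z) \<partial>exp_dist \<tau> \<partial>exp_dist \<sigma> \<partial>exp_dist \<kappa>)"
    by (rule nn_integral_queue_step[OF \<tau> \<kappa> h])
  also have "\<dots> = (\<integral>\<^sup>+x. indicator A x \<partial>P)"
    unfolding P_def by (subst nn_integral_triple[OF pos, where k = k]) auto
  also have "\<dots> = emeasure P A" by (rule nn_integral_indicator) measurable
  finally show "emeasure (distr P P (queue_update k)) A = emeasure P A" .
qed simp

section \<open>Finite sweeps: the queue started at a finite site with a given workload\<close>

primrec sweep :: "int \<Rightarrow> nat \<Rightarrow> real \<times> (int \<Rightarrow> real) \<times> (int \<Rightarrow> real) \<Rightarrow> real \<times> (int \<Rightarrow> real) \<times> (int \<Rightarrow> real)" where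
  "sweep a 0 x = x"
| "sweep a (Suc n) x = queue_update (a + 1 + int n) (sweep a n x)"

primrec workload_from :: "int \<Rightarrow> real \<Rightarrow> (int \<Rightarrow> real) \<Rightarrow> (int \<Rightarrow> real) \<Rightarrow> nat \<Rightarrow> real" where
  "workload_from a s I w 0 = s"
| "workload_from a s I w (Suc n) = w (a + 1 + int n) + max (workload_from a s I w n - I (a + 1 + int n)) 0"

lemma measurable_sweep [measurable]:
  "sweep a n \<in> borel \<Otimes>\<^sub>M seq_space \<Otimes>\<^sub>M seq_space \<rightarrow>\<^sub>M borel \<Otimes>\<^sub>M seq_space \<Otimes>\<^sub>M seq_space"
proof (induction n)
  case 0
  have "sweep a 0 = (\<lambda>x. x)" by auto
  then show ?case by simp
next
  case (Suc n)
  note [measurable] = Suc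
  have "sweep a (Suc n) = (\<lambda>x. queue_update (a + 1 + int n) (sweep a n x))" by auto
  then show ?case by simp
qed

lemma sweep_eq:
  "fst (sweep a n (s, I, w)) = workload_from a s I w n \<and>
   (\<forall>k>a + int n. fst (snd (sweep a n (s, I, w))) k = I k \<and> snd (snd (sweep a n (s, I, w))) k = w k) \<and>
   (\<forall>i<n. fst (snd (sweep a n (s, I, w))) (a + 1 + int i) =
            w (a + 1 + int i) + max (I (a + 1 + int i) - workload_from a s I w i) 0 \<and>
          snd (snd (sweep a n (s, I, w))) (a + 1 + int i) = min (I (a + 1 + int i)) (workload_from a s I w i))"
proof (induction n)
  case (Suc n)
  obtain J I' w' where S: "sweep a n (s, I, w) = (J, I', w')" by (cases "sweep a n (s, I, w)") auto
  have "J = workload_from a s I w n" "I' (a + 1 + int n) = I (a + 1 + int n)" "w' (a + 1 + int n) = w (a + 1 + int n)"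
    using Suc S by auto
  moreover have "i < Suc n \<longleftrightarrow> i < n \<or> i = n" for i by auto
  ultimately show ?case using Suc S by (auto simp: queue_update_def queue_step_def)
qed simp

text \<open>Adding the arrival times turns the workload recursion into the departure recursion, so
  \<open>departures_coupling\<close> applies. A start far enough in the past is forgotten exactly,
  not just in the limit.\<close>

lemma workload_from_eventually:
  assumes st: "stable I w" and w: "\<And>k. 0 \<le> w k"
  shows "\<exists>a0\<le>k. \<forall>a\<le>a0. workload_from a s I w (nat (k - a)) = sojourn I w k"
proof -
  define F where "F = prim I"
  have F: "is_primitive F I" by (simp add: F_def is_primitive_prim)
  obtain a0 where a0: "a0 < k" "\<And>a G. a \<le> a0 \<Longrightarrow> G a = F a + s \<Longrightarrow>
      (\<forall>j\<in>{a<..k}. G j = w j + max (G (j - 1)) (F j)) \<Longrightarrow> G k = departures F w k"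
    using departures_coupling[OF st F w, of k s] by blast
  have "workload_from a s I w (nat (k - a)) = sojourn I w k" if a: "a \<le> a0" for a
  proof -
    define G where "G j = workload_from a s I w (nat (j - a)) + F j" for j
    have "G k = departures F w k"
    proof (rule a0(2)[OF a])
      show "G a = F a + s" by (simp add: G_def)
      show "\<forall>j\<in>{a<..k}. G j = w j + max (G (j - 1)) (F j)"
      proof
        fix j assume j: "j \<in> {a<..k}"
        define n where "n = nat (j - 1 - a)"
        have n: "nat (j - a) = Suc n" "nat (j - 1 - a) = n" "a + 1 + int n = j"
          using j by (auto simp: n_def)
        have "F j = F (j - 1) + I j"
          using F[unfolded is_primitive_def, THEN spec, of j] by linarith
        then show "G j = w j + max (G (j - 1)) (F j)" by (auto simp: G_def n max_def)
      qed
    qed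
    then show ?thesis by (simp add: G_def sojourn_eq[OF st F])
  qed
  then show ?thesis using a0(1) by (intro exI[of _ a0]) auto
qed

text \<open>Starting at \<open>- int M\<close> and treating \<open>2 * M\<close> sites eventually
  covers every fixed site. The outputs there are the stationary ones as soon as the workload at site
  \<open>k - 1\<close> has forgotten the start; how large \<open>M\<close> must be depends on
  \<open>k\<close> and on the sample.\<close>

lemma sweep_eventually:
  assumes st: "stable I w" and w: "\<And>k. 0 \<le> w k"
  shows "\<forall>\<^sub>F M in sequentially. fst (snd (sweep (- int M) (2 * M) (s, I, w))) k = queue_map I w k \<and>
    snd (snd (sweep (- int M) (2 * M) (s, I, w))) k = dual_services I w k"
proof -
  obtain a0 where a0: "a0 \<le> k - 1" "\<And>a. a \<le> a0 \<Longrightarrow> workload_from a s I w (nat (k - 1 - a)) = sojourn I w (k - 1)"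
    using workload_from_eventually[OF st w, of "k - 1" s] by blast
  show ?thesis
    unfolding eventually_sequentially
  proof (intro exI allI impI)
    fix M assume M: "nat \<bar>a0\<bar> + nat \<bar>k\<bar> \<le> M"
    define a where "a = - int M"
    define i where "i = nat (k - 1 - a)"
    have a: "a \<le> a0" and i: "a + 1 + int i = k" "i < 2 * M" using M a0(1) by (auto simp: a_def i_def)
    show "fst (snd (sweep (- int M) (2 * M) (s, I, w))) k = queue_map I w k \<and>
        snd (snd (sweep (- int M) (2 * M) (s, I, w))) k = dual_services I w k"
      using sweep_eq[of a "2 * M" s I w] a0(2)[OF a] i
      unfolding a_def[symmetric] queue_map_rec[OF st] dual_services_rec[OF st] i_def[symmetric] by auto
  qed
qed

text \<open>On each generating set the indicators at \<open>X n\<close> are eventually equal to the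
  indicator at \<open>Y\<close>, so dominated convergence identifies the laws there. The generating
  sets will be cylinders: each coordinate becomes stationary eventually, but not all coordinates at
  the same time.\<close>

lemma distr_eq_of_eventually_eq:
  fixes X :: "nat \<Rightarrow> 'a \<Rightarrow> 'b"
  assumes P: "prob_space P" and X [measurable]: "\<And>n. X n \<in> measurable P N" and Y [measurable]: "Y \<in> measurable P N"
    and law: "\<And>n. distr P N (X n) = \<mu>"
    and G: "Int_stable G" "sets N = sigma_sets (space N) G" "G \<subseteq> Pow (space N)" "space N \<in> G"
    and ev: "\<And>B. B \<in> G \<Longrightarrow> AE \<omega> in P. \<forall>\<^sub>F n in sequentially. X n \<omega> \<in> B \<longleftrightarrow> Y \<omega> \<in> B"
  shows "distr P N Y = \<mu>"
proof -
  interpret prob_space P by fact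
  have sets: "sets \<mu> = sets N" using law[of 0] by auto
  have GN: "B \<in> sets N" if "B \<in> G" for B using that G(2) by auto
  have main: "emeasure (distr P N Y) B = emeasure \<mu> B" if B: "B \<in> G" for B
  proof -
    note [measurable] = GN[OF B]
    have "(\<lambda>n. \<integral>\<omega>. indicator B (X n \<omega>) \<partial>P) \<longlonglongrightarrow> (\<integral>\<omega>. indicator B (Y \<omega>) \<partial>P :: real)"
    proof (rule integral_dominated_convergence[where w = "\<lambda>_. 1"])
      show "AE \<omega> in P. (\<lambda>n. indicator B (X n \<omega>)) \<longlonglongrightarrow> (indicator B (Y \<omega>) :: real)"
        using ev[OF B]
      proof eventually_elim
        case (elim \<omega>)
        show ?case by (rule tendsto_eventually) (use elim in \<open>auto elim!: eventually_mono simp: indicator_def\<close>)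
      qed
    qed (auto simp: indicator_def)
    moreover have "(\<integral>\<omega>. indicator B (Z \<omega>) \<partial>P :: real) = measure (distr P N Z) B" if [measurable]: "Z \<in> measurable P N" for Z
    proof -
      have "(\<integral>\<omega>. indicator B (Z \<omega>) \<partial>P :: real) = (\<integral>z. indicator B z \<partial>distr P N Z)"
        by (rule integral_distr[symmetric]) measurable
      then show ?thesis by simp
    qed
    ultimately have "(\<lambda>n. measure \<mu> B) \<longlonglongrightarrow> measure (distr P N Y) B" by (simp add: law)
    then have "measure \<mu> B = measure (distr P N Y) B" by (rule LIMSEQ_unique[OF tendsto_const])
    moreover have "prob_space \<mu>" using prob_space_distr[OF X[of 0]] law by simp
    moreover have "prob_space (distr P N Y)" by (rule prob_space_distr) measurable
    ultimately show ?thesis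
      by (simp add: finite_measure.emeasure_eq_measure prob_space.finite_measure)
  qed
  show ?thesis
  proof (rule measure_eqI_generator_eq[OF G(1,3) main, where A = "\<lambda>_. space N"])
    show "sets (distr P N Y) = sigma_sets (space N) G" "sets \<mu> = sigma_sets (space N) G"
      using G(2) sets by auto
    show "emeasure (distr P N Y) (space N) \<noteq> \<infinity>" for i :: nat
      using prob_space.emeasure_space_1[OF prob_space_distr[OF Y]] by simp
  qed (use G(4) in auto)
qed

lemma seq_space_pair_generator:
  defines "E \<equiv> prod_algebra (UNIV :: int set) (\<lambda>_. borel :: real measure)"
  defines "G \<equiv> {a \<times> b | a b. a \<in> E \<and> b \<in> E}"
  shows "Int_stable G" "sets (seq_space \<Otimes>\<^sub>M seq_space) = sigma_sets UNIV G" "UNIV \<in> G"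
    and "B \<in> G \<Longrightarrow> \<exists>J. finite J \<and> (\<forall>x y x' y'. (\<forall>k\<in>J. x k = x' k \<and> y k = y' k) \<longrightarrow> ((x, y) \<in> B \<longleftrightarrow> (x', y') \<in> B))"
proof -
  have U: "UNIV \<in> E"
    using prod_algebraI[of "{0 :: int}" UNIV "\<lambda>_. UNIV" "\<lambda>_. borel :: real measure"]
    by (simp add: E_def prod_emb_def vimage_def PiE_def Pi_def)
  show "UNIV \<in> G" unfolding G_def using U by (auto intro!: exI[of _ UNIV])
  show "Int_stable G"
  proof (rule Int_stableI)
    fix A B assume "A \<in> G" "B \<in> G"
    then obtain a b a' b' where "A = a \<times> b" "B = a' \<times> b'" "a \<in> E" "b \<in> E" "a' \<in> E" "b' \<in> E"
      unfolding G_def by blast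
    then have "A \<inter> B = (a \<inter> a') \<times> (b \<inter> b')" "a \<inter> a' \<in> E" "b \<inter> b' \<in> E"
      using Int_stable_prod_algebra by (auto simp: E_def Int_stable_def)
    then show "A \<inter> B \<in> G" unfolding G_def by blast
  qed
  have s: "sets seq_space = sigma_sets (space seq_space) E"
    unfolding E_def sets_PiM by (simp add: space_PiM)
  have "sets (seq_space \<Otimes>\<^sub>M seq_space) = sets (sigma (space seq_space \<times> space seq_space) G)"
    unfolding G_def
    by (rule sets_pair_eq[OF _ s _ _ _ _ s, where Ca = "{UNIV}" and Cb = "{UNIV}"]) (use U in auto)
  then show "sets (seq_space \<Otimes>\<^sub>M seq_space) = sigma_sets UNIV G" by simp
  assume "B \<in> G"
  then obtain a b where B: "B = a \<times> b" and ab: "a \<in> E" "b \<in> E" unfolding G_def by blast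
  obtain J X where J: "finite J" "a = prod_emb UNIV (\<lambda>_. borel :: real measure) J (Pi\<^sub>E J X)"
    using ab(1) unfolding E_def by (rule prod_algebraE) blast
  obtain K Y where K: "finite K" "b = prod_emb UNIV (\<lambda>_. borel :: real measure) K (Pi\<^sub>E K Y)"
    using ab(2) unfolding E_def by (rule prod_algebraE) blast
  have "x \<in> a \<longleftrightarrow> (\<forall>k\<in>J. x k \<in> X k)" "x \<in> b \<longleftrightarrow> (\<forall>k\<in>K. x k \<in> Y k)" for x
    by (auto simp: J K prod_emb_def PiE_def Pi_def)
  then show "\<exists>J. finite J \<and> (\<forall>x y x' y'. (\<forall>k\<in>J. x k = x' k \<and> y k = y' k) \<longrightarrow> ((x, y) \<in> B \<longleftrightarrow> (x', y') \<in> B))"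
    using J K by (intro exI[of _ "J \<union> K"]) (simp add: B)
qed

lemma distr_pair_snd:
  assumes "prob_space M" "sigma_finite_measure N"
  shows "distr (M \<Otimes>\<^sub>M N) N snd = N"
proof (rule measure_eqI)
  interpret M: prob_space M by fact
  interpret N: sigma_finite_measure N by fact
  fix A assume A: "A \<in> sets (distr (M \<Otimes>\<^sub>M N) N snd)"
  then have "snd -` A \<inter> space (M \<Otimes>\<^sub>M N) = space M \<times> A"
    by (auto simp: space_pair_measure dest: sets.sets_into_space)
  then show "emeasure (distr (M \<Otimes>\<^sub>M N) N snd) A = emeasure N A"
    using A by (simp add: emeasure_distr N.emeasure_pair_measure_Times M.emeasure_space_1)
qed simp

section \<open>Burke's theorem for the stationary queue\<close>

definition burke_map :: "(int \<Rightarrow> real) \<times> (int \<Rightarrow> real) \<Rightarrow> (int \<Rightarrow> real) \<times> (int \<Rightarrow> real)" where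
  "burke_map = (\<lambda>(I, w). (queue_map I w, dual_services I w))"

lemma measurable_burke_map [measurable]: "burke_map \<in> seq_space \<Otimes>\<^sub>M seq_space \<rightarrow>\<^sub>M seq_space \<Otimes>\<^sub>M seq_space"
  unfolding burke_map_def by measurable

text \<open>Every finite sweep preserves the product law of workload, arrivals and services. As the
  sweeps grow, any finite set of coordinates of the swept sequences eventually coincides with the
  output of \<open>burke_map\<close>, which therefore has the same law. The joint statement,
  including the dual services, is what allows these to serve the next line.\<close>

theorem burke:
  assumes \<tau>: "0 < \<tau>" "\<tau> < \<sigma>"
  defines "Q \<equiv> exp_seq \<sigma> \<Otimes>\<^sub>M exp_seq \<tau>"
  shows "distr Q Q burke_map = Q"
proof -
  \<comment> \<open>The mean sojourn time of the stationary queue, whose rate is the service rate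
    minus the arrival rate.\<close>
  define \<kappa> where "\<kappa> = 1 / (1 / \<tau> - 1 / \<sigma>)"
  have pos: "0 < \<kappa>" "0 < \<sigma>" "0 < \<tau>" using \<tau> by (auto simp: \<kappa>_def field_simps)
  interpret S: prob_space "exp_seq \<sigma>" using pos by (intro prob_space_exp_seq)
  interpret T: prob_space "exp_seq \<tau>" using pos by (intro prob_space_exp_seq)
  interpret K: prob_space "exp_dist \<kappa>" using pos by (intro prob_space_exp_dist)
  interpret Q: prob_space Q unfolding Q_def by (intro prob_space_pair) unfold_locales
  define P where "P = exp_dist \<kappa> \<Otimes>\<^sub>M Q"
  interpret P: prob_space P unfolding P_def by (intro prob_space_pair) unfold_locales
  have setsQ [measurable_cong]: "sets Q = sets (seq_space \<Otimes>\<^sub>M seq_space)"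
    unfolding Q_def by (intro sets_pair_measure_cong) auto
  have setsP [measurable_cong]: "sets P = sets (borel \<Otimes>\<^sub>M seq_space \<Otimes>\<^sub>M seq_space)"
    unfolding P_def by (intro sets_pair_measure_cong) (auto simp: setsQ)
  have spaceQ: "space Q = UNIV" using sets_eq_imp_space_eq[OF setsQ] by (simp add: space_pair_measure)
  have sw: "distr P P (sweep a n) = P" for a n
  proof (induction n)
    case 0
    have "sweep a 0 = (\<lambda>x. x)" by auto
    then show ?case by simp
  next
    case (Suc n)
    have "distr P P (sweep a (Suc n)) = distr P P (queue_update (a + 1 + int n) \<circ> sweep a n)"
      by (intro distr_cong) auto
    also have "\<dots> = distr (distr P P (sweep a n)) P (queue_update (a + 1 + int n))"
      by (rule distr_distr[symmetric]) measurable
    also have "\<dots> = P"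
      unfolding Suc using distr_queue_update[OF \<tau> \<kappa>_def] by (simp add: P_def Q_def)
    finally show ?case .
  qed
  have snd: "distr P Q snd = Q" unfolding P_def by (rule distr_pair_snd) unfold_locales
  note gen = seq_space_pair_generator
  have "distr P Q (burke_map \<circ> snd) = Q"
  proof (rule distr_eq_of_eventually_eq[where X = "\<lambda>M. snd \<circ> sweep (- int M) (2 * M)", OF P.prob_space_axioms])
    show "distr P Q (snd \<circ> sweep (- int M) (2 * M)) = Q" for M
      using distr_distr[of snd P Q "sweep (- int M) (2 * M)" P] by (simp add: sw snd)
    show "Int_stable {a \<times> b |a b. a \<in> prod_algebra (UNIV :: int set) (\<lambda>_. borel :: real measure) \<and>
        b \<in> prod_algebra (UNIV :: int set) (\<lambda>_. borel :: real measure)}" by (rule gen(1))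
    show "sets Q = sigma_sets (space Q) {a \<times> b |a b. a \<in> prod_algebra (UNIV :: int set) (\<lambda>_. borel :: real measure) \<and>
        b \<in> prod_algebra (UNIV :: int set) (\<lambda>_. borel :: real measure)}"
      unfolding setsQ spaceQ by (rule gen(2))
    show "space Q \<in> {a \<times> b |a b. a \<in> prod_algebra (UNIV :: int set) (\<lambda>_. borel :: real measure) \<and>
        b \<in> prod_algebra (UNIV :: int set) (\<lambda>_. borel :: real measure)}"
      unfolding spaceQ by (rule gen(3))
    fix B assume "B \<in> {a \<times> b |a b. a \<in> prod_algebra (UNIV :: int set) (\<lambda>_. borel :: real measure) \<and>
        b \<in> prod_algebra (UNIV :: int set) (\<lambda>_. borel :: real measure)}"
    from gen(4)[OF this] obtain J where J: "finite J"
      "\<forall>x y x' y'. (\<forall>k\<in>J. x k = x' k \<and> y k = y' k) \<longrightarrow> ((x, y) \<in> B \<longleftrightarrow> (x', y') \<in> B)"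
      by (elim exE conjE)
    have "AE x in distr P Q snd. stable (fst x) (snd x) \<and> (\<forall>k. 0 \<le> fst x k) \<and> (\<forall>k. 0 \<le> snd x k)"
      unfolding snd unfolding Q_def by (rule AE_exp_seq_stable[OF \<tau>])
    then have "AE x in P. stable (fst (snd x)) (snd (snd x)) \<and> (\<forall>k. 0 \<le> fst (snd x) k) \<and> (\<forall>k. 0 \<le> snd (snd x) k)"
      by (rule AE_distrD[rotated]) measurable
    then show "AE x in P. \<forall>\<^sub>F M in sequentially. (snd \<circ> sweep (- int M) (2 * M)) x \<in> B \<longleftrightarrow> (burke_map \<circ> snd) x \<in> B"
    proof eventually_elim
      case (elim x)
      obtain s I w where x: "x = (s, I, w)" by (cases x) auto
      have "\<forall>\<^sub>F M in sequentially. \<forall>k\<in>J. fst (snd (sweep (- int M) (2 * M) (s, I, w))) k = queue_map I w k \<and>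
          snd (snd (sweep (- int M) (2 * M) (s, I, w))) k = dual_services I w k"
        using elim x by (intro eventually_ball_finite J ballI sweep_eventually) auto
      then show ?case
      proof eventually_elim
        case (elim M)
        show ?case
          using J(2)[THEN spec, THEN spec, THEN spec, THEN spec, of "fst (snd (sweep (- int M) (2 * M) (s, I, w)))" "queue_map I w"
            "snd (snd (sweep (- int M) (2 * M) (s, I, w)))" "dual_services I w"] elim
          by (simp add: x burke_map_def)
      qed
    qed
  qed (auto simp: spaceQ)
  moreover have "distr P Q (burke_map \<circ> snd) = distr (distr P Q snd) Q burke_map"
    by (rule distr_distr[symmetric]) measurable
  ultimately show ?thesis by (simp add: snd)
qed

corollary burke_departures:
  assumes "0 < \<tau>" "\<tau> < \<sigma>"
  shows "distr (exp_seq \<sigma> \<Otimes>\<^sub>M exp_seq \<tau>) (exp_seq \<sigma>) (\<lambda>(I, w). queue_map I w) = exp_seq \<sigma>"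
proof -
  let ?Q = "exp_seq \<sigma> \<Otimes>\<^sub>M exp_seq \<tau>"
  interpret T: prob_space "exp_seq \<tau>" using assms by (intro prob_space_exp_seq)
  have [measurable_cong]: "sets ?Q = sets (seq_space \<Otimes>\<^sub>M seq_space)"
    by (intro sets_pair_measure_cong) auto
  have "distr ?Q (exp_seq \<sigma>) (\<lambda>(I, w). queue_map I w) = distr ?Q (exp_seq \<sigma>) (fst \<circ> burke_map)"
    by (intro distr_cong) (auto simp: burke_map_def)
  also have "\<dots> = distr (distr ?Q ?Q burke_map) (exp_seq \<sigma>) fst"
    by (rule distr_distr[symmetric]) measurable
  also have "\<dots> = exp_seq \<sigma>" by (simp add: burke[OF assms] T.distr_pair_fst)
  finally show ?thesis .
qed

section \<open>Multiclass queues\<close>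

lemma queue_iter_Suc: "1 \<le> j \<Longrightarrow> queue_iter (Suc j) \<zeta> = queue_map (queue_iter j \<zeta>) (\<zeta> (Suc j))"
  by (cases j) auto

lemma queue_iter_cong: "(\<And>l. 1 \<le> l \<Longrightarrow> l \<le> j \<Longrightarrow> \<zeta> l = \<zeta>' l) \<Longrightarrow> queue_iter j \<zeta> = queue_iter j \<zeta>'"
  by (induction j \<zeta> rule: queue_iter.induct) auto

lemma measurable_queue_iter:
  "(\<And>l. 1 \<le> l \<Longrightarrow> l \<le> j \<Longrightarrow> (\<lambda>x. f x l) \<in> measurable M seq_space) \<Longrightarrow> 1 \<le> j \<Longrightarrow>
     (\<lambda>x. queue_iter j (f x)) \<in> measurable M seq_space"
proof (induction j)
  case (Suc j)
  show ?case
  proof (cases "j = 0")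
    case False
    then have [measurable]: "(\<lambda>x. queue_iter j (f x)) \<in> measurable M seq_space" "(\<lambda>x. f x (Suc j)) \<in> measurable M seq_space"
      using Suc by auto
    show ?thesis using False by (simp add: queue_iter_Suc)
  qed (use Suc.prems in auto)
qed simp

text \<open>By induction the output of the first \<open>j\<close> queues has the law of the first
  sequence, and it is independent of the next services because it does not involve them. Burke's
  theorem then treats one more queue.\<close>

lemma distr_queue_iter:
  assumes "1 \<le> j" "\<And>l. 1 \<le> l \<Longrightarrow> l \<le> j \<Longrightarrow> 0 < \<tau> l" "\<And>l. 2 \<le> l \<Longrightarrow> l \<le> j \<Longrightarrow> \<tau> l < \<tau> 1"
  shows "distr (Pi\<^sub>M {1..j} (\<lambda>l. exp_seq (\<tau> l))) (exp_seq (\<tau> 1)) (queue_iter j) = exp_seq (\<tau> 1)"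
  using assms
proof (induction j rule: dec_induct)
  case base
  have "distr (Pi\<^sub>M {1..1} (\<lambda>l. exp_seq (\<tau> l))) (exp_seq (\<tau> 1)) (queue_iter 1) =
      distr (Pi\<^sub>M {1..1} (\<lambda>l. exp_seq (\<tau> l))) (exp_seq (\<tau> 1)) (\<lambda>\<zeta>. \<zeta> 1)"
    by (intro distr_cong) auto
  also have "\<dots> = exp_seq (\<tau> 1)"
    using base by (intro distr_PiM_component) (auto intro: prob_space_exp_seq)
  finally show ?case .
next
  case (step j)
  let ?P = "\<lambda>j. Pi\<^sub>M {1..j} (\<lambda>l. exp_seq (\<tau> l))" and ?E = "exp_seq (\<tau> (Suc j))"
  have ins: "{1..Suc j} = insert (Suc j) {1..j}" by auto
  have pos: "0 < \<tau> l" if "1 \<le> l" "l \<le> Suc j" for l using step.prems that by auto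
  interpret E: prob_space ?E using pos by (intro prob_space_exp_seq) auto
  interpret P: prob_space "?P j" using pos by (intro prob_space_PiM prob_space_exp_seq) auto
  interpret S: prob_space "exp_seq (\<tau> 1)" using pos by (intro prob_space_exp_seq) auto
  interpret EP: pair_sigma_finite ?E "?P j" ..
  have c: "(\<lambda>\<zeta>. \<zeta> l) \<in> measurable (?P i) seq_space" if "1 \<le> l" "l \<le> i" for l i
    using that measurable_component_singleton[of l "{1..i}" "\<lambda>l. exp_seq (\<tau> l)"] by simp
  have q [measurable]: "queue_iter i \<in> measurable (?P i) seq_space" if "1 \<le> i" for i
    using measurable_queue_iter[of i "\<lambda>\<zeta>. \<zeta>" "?P i"] c that by simp
  note qj [measurable] = q[OF step(1)]
  have m [measurable]: "(\<lambda>(x, X). X(Suc j := x)) \<in> ?E \<Otimes>\<^sub>M ?P j \<rightarrow>\<^sub>M ?P (Suc j)"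
    unfolding case_prod_beta by (rule measurable_fun_upd[where J = "{1..j}"]) auto
  have "distr (?P (Suc j)) (exp_seq (\<tau> 1)) (queue_iter (Suc j)) =
      distr (distr (?E \<Otimes>\<^sub>M ?P j) (?P (Suc j)) (\<lambda>(x, X). X(Suc j := x))) (exp_seq (\<tau> 1)) (queue_iter (Suc j))"
  proof -
    have "distr (?E \<Otimes>\<^sub>M ?P j) (?P (Suc j)) (\<lambda>(x, X). X(Suc j := x)) = ?P (Suc j)"
      unfolding ins by (rule distr_pair_PiM_eq_PiM) (use pos in \<open>auto intro: prob_space_exp_seq\<close>)
    then show ?thesis by simp
  qed
  also have "\<dots> = distr (?E \<Otimes>\<^sub>M ?P j) (exp_seq (\<tau> 1)) (queue_iter (Suc j) \<circ> (\<lambda>(x, X). X(Suc j := x)))"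
    by (rule distr_distr[OF _ m]) (use q[of "Suc j"] in simp)
  also have "\<dots> = distr (?E \<Otimes>\<^sub>M ?P j) (exp_seq (\<tau> 1)) ((\<lambda>(I, w). queue_map I w) \<circ> (\<lambda>(x, X). (queue_iter j X, x)))"
  proof (intro distr_cong refl)
    fix z assume "z \<in> space (?E \<Otimes>\<^sub>M ?P j)"
    obtain x X where z: "z = (x, X)" by (cases z)
    have "queue_iter j (X(Suc j := x)) = queue_iter j X" by (rule queue_iter_cong) auto
    then show "(queue_iter (Suc j) \<circ> (\<lambda>(x, X). X(Suc j := x))) z = ((\<lambda>(I, w). queue_map I w) \<circ> (\<lambda>(x, X). (queue_iter j X, x))) z"
      using step(1) by (simp add: z queue_iter_Suc)
  qed
  also have "\<dots> = distr (distr (?E \<Otimes>\<^sub>M ?P j) (exp_seq (\<tau> 1) \<Otimes>\<^sub>M ?E) (\<lambda>(x, X). (queue_iter j X, x))) (exp_seq (\<tau> 1)) (\<lambda>(I, w). queue_map I w)"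
    by (rule distr_distr[symmetric]) measurable
  also have "distr (?E \<Otimes>\<^sub>M ?P j) (exp_seq (\<tau> 1) \<Otimes>\<^sub>M ?E) (\<lambda>(x, X). (queue_iter j X, x)) = exp_seq (\<tau> 1) \<Otimes>\<^sub>M ?E"
  proof -
    interpret PE: pair_sigma_finite "?P j" ?E ..
    have "distr (?P j) (exp_seq (\<tau> 1)) (queue_iter j) \<Otimes>\<^sub>M distr ?E ?E (\<lambda>x. x) =
        distr (?P j \<Otimes>\<^sub>M ?E) (exp_seq (\<tau> 1) \<Otimes>\<^sub>M ?E) (\<lambda>(X, x). (queue_iter j X, x))"
      by (rule pair_measure_distr) (use qj in \<open>auto intro: E.sigma_finite_measure_axioms\<close>)
    moreover have "distr (?P j) (exp_seq (\<tau> 1)) (queue_iter j) = exp_seq (\<tau> 1)" using step by auto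
    ultimately have "exp_seq (\<tau> 1) \<Otimes>\<^sub>M ?E = distr (distr (?E \<Otimes>\<^sub>M ?P j) (?P j \<Otimes>\<^sub>M ?E) (\<lambda>(x, y). (y, x))) (exp_seq (\<tau> 1) \<Otimes>\<^sub>M ?E) (\<lambda>(X, x). (queue_iter j X, x))"
      by (subst PE.distr_pair_swap[symmetric]) simp
    also have "\<dots> = distr (?E \<Otimes>\<^sub>M ?P j) (exp_seq (\<tau> 1) \<Otimes>\<^sub>M ?E) ((\<lambda>(X, x). (queue_iter j X, x)) \<circ> (\<lambda>(x, y). (y, x)))"
      by (rule distr_distr) measurable
    finally show ?thesis by (simp add: comp_def case_prod_unfold)
  qed
  also have "distr (exp_seq (\<tau> 1) \<Otimes>\<^sub>M ?E) (exp_seq (\<tau> 1)) (\<lambda>(I, w). queue_map I w) = exp_seq (\<tau> 1)"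
    by (rule burke_departures) (use step.prems step(1) in auto)
  finally show ?case .
qed

text \<open>Line \<open>k\<close> served by the lines \<open>k - 1\<close> down to
  \<open>k + 1 - j\<close>. For \<open>j = k\<close> this is a component of
  \<open>multi_queue\<close>; smaller \<open>j\<close> give the intermediate outputs, whose averages
  supply the stability conditions of the interchange.\<close>

lemma distr_line_queue_iter:
  assumes \<sigma>: "\<And>l. 1 \<le> l \<Longrightarrow> l \<le> m \<Longrightarrow> 0 < \<sigma> l" "strict_mono_on {1..m} \<sigma>"
    and jk: "1 \<le> j" "j \<le> k" "k \<le> m"
  shows "distr (exp_product m \<sigma>) (exp_seq (\<sigma> k)) (\<lambda>I. queue_iter j (\<lambda>l. I (k + 1 - l))) = exp_seq (\<sigma> k)"
proof -
  let ?t = "\<lambda>I. \<lambda>l\<in>{1..j}. I (k + 1 - l)" and ?N = "Pi\<^sub>M {1..j} (\<lambda>l. exp_seq (\<sigma> (k + 1 - l)))"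
  have re: "distr (exp_product m \<sigma>) ?N ?t = ?N"
    unfolding exp_product_eq using jk
    by (intro distr_PiM_reindex) (auto intro!: prob_space_exp_seq \<sigma> inj_onI)
  have t: "?t \<in> exp_product m \<sigma> \<rightarrow>\<^sub>M ?N"
    unfolding exp_product_eq using jk by (intro measurable_restrict measurable_component_singleton) auto
  have "distr (exp_product m \<sigma>) (exp_seq (\<sigma> k)) (\<lambda>I. queue_iter j (\<lambda>l. I (k + 1 - l))) =
      distr (exp_product m \<sigma>) (exp_seq (\<sigma> k)) (queue_iter j \<circ> ?t)"
    by (intro distr_cong) (auto intro!: queue_iter_cong)
  also have "\<dots> = distr (distr (exp_product m \<sigma>) ?N ?t) (exp_seq (\<sigma> k)) (queue_iter j)"
  proof (rule distr_distr[symmetric, OF _ t])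
    have c: "(\<lambda>\<zeta>. \<zeta> l) \<in> measurable ?N seq_space" if "1 \<le> l" "l \<le> j" for l
      using that measurable_component_singleton[of l "{1..j}" "\<lambda>l. exp_seq (\<sigma> (k + 1 - l))"] by simp
    show "queue_iter j \<in> measurable ?N (exp_seq (\<sigma> k))"
      using measurable_queue_iter[of j "\<lambda>\<zeta>. \<zeta>" ?N] c jk by simp
  qed
  also have "\<dots> = exp_seq (\<sigma> k)"
  proof -
    have "\<sigma> (k + 1 - l) < \<sigma> k" if "2 \<le> l" "l \<le> j" for l
      using strict_mono_onD[OF \<sigma>(2), of "k + 1 - l" k] that jk by auto
    then show ?thesis unfolding re
      using distr_queue_iter[of j "\<lambda>l. \<sigma> (k + 1 - l)"] jk \<sigma>(1) by simp
  qed
  finally show ?thesis .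
qed

text \<open>\<open>u k\<close> is the external service, and \<open>u j\<close> is what remains of it
  after acting on \<open>\<zeta> k\<close> down to \<open>\<zeta> (Suc j)\<close>. Each application
  of \<open>queue_interchange\<close> moves the external service one queue further inside and
  replaces the services of the queue it passes by their own departures.\<close>

lemma queue_iter_interchange:
  assumes "1 \<le> j" "j \<le> k"
    and u: "\<And>j. 1 \<le> j \<Longrightarrow> j < k \<Longrightarrow> u j = dual_services (\<zeta> (Suc j)) (u (Suc j))"
    and st1: "\<And>j. 1 \<le> j \<Longrightarrow> j < k \<Longrightarrow> stable (queue_iter j \<zeta>) (\<zeta> (Suc j))"
    and st2: "\<And>j. 1 \<le> j \<Longrightarrow> j < k \<Longrightarrow> stable (queue_iter (Suc j) \<zeta>) (u (Suc j))"
    and st3: "\<And>j. 1 \<le> j \<Longrightarrow> j < k \<Longrightarrow> stable (\<zeta> (Suc j)) (u (Suc j))"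
  shows "queue_map (queue_iter j \<zeta>) (u j) = queue_iter j (\<lambda>j. queue_map (\<zeta> j) (u j))"
  using assms(1,2)
proof (induction j rule: dec_induct)
  case (step j)
  then have j: "1 \<le> j" "j < k" by auto
  have "queue_map (queue_iter (Suc j) \<zeta>) (u (Suc j)) =
      queue_map (queue_map (queue_iter j \<zeta>) (\<zeta> (Suc j))) (u (Suc j))"
    using j by (simp add: queue_iter_Suc)
  also have "\<dots> = queue_map (queue_map (queue_iter j \<zeta>) (dual_services (\<zeta> (Suc j)) (u (Suc j)))) (queue_map (\<zeta> (Suc j)) (u (Suc j)))"
    using st2[OF j] by (intro queue_interchange st1 st3 j) (simp add: queue_iter_Suc[OF j(1)])
  also have "\<dots> = queue_map (queue_map (queue_iter j \<zeta>) (u j)) (queue_map (\<zeta> (Suc j)) (u (Suc j)))"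
    by (simp add: u[OF j])
  also have "\<dots> = queue_iter (Suc j) (\<lambda>j. queue_map (\<zeta> j) (u j))"
    using step j by (simp add: queue_iter_Suc)
  finally show ?case .
qed simp


section \<open>The multiline process\<close>

text \<open>A map preserving the joint law of an auxiliary variable and one factor preserves the
  whole product when it acts on that factor. Such maps can be iterated over the factors while the
  auxiliary variable is handed on, since it leaves each step independent of all of them.\<close>

lemma distr_component_update:
  assumes E: "prob_space E" and Q: "\<And>i. i \<in> K \<Longrightarrow> prob_space (Q i)" and i: "i \<in> K"
    and \<phi> [measurable]: "\<phi> \<in> E \<Otimes>\<^sub>M Q i \<rightarrow>\<^sub>M E \<Otimes>\<^sub>M Q i" and law: "distr (E \<Otimes>\<^sub>M Q i) (E \<Otimes>\<^sub>M Q i) \<phi> = E \<Otimes>\<^sub>M Q i"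
  defines "U \<equiv> \<lambda>x. (fst (\<phi> (fst x, snd x i)), (snd x)(i := snd (\<phi> (fst x, snd x i))))"
  shows "U \<in> E \<Otimes>\<^sub>M Pi\<^sub>M K Q \<rightarrow>\<^sub>M E \<Otimes>\<^sub>M Pi\<^sub>M K Q" "distr (E \<Otimes>\<^sub>M Pi\<^sub>M K Q) (E \<Otimes>\<^sub>M Pi\<^sub>M K Q) U = E \<Otimes>\<^sub>M Pi\<^sub>M K Q"
proof -
  let ?P = "E \<Otimes>\<^sub>M Pi\<^sub>M K Q"
  interpret E: prob_space E by fact
  interpret Qi: prob_space "Q i" by (rule Q[OF i])
  interpret PQ: prob_space "Pi\<^sub>M K Q" by (rule prob_space_PiM[OF Q])
  interpret EQ: pair_sigma_finite E "Q i" ..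
  have comp [measurable]: "(\<lambda>x. snd x i) \<in> ?P \<rightarrow>\<^sub>M Q i"
    using i by measurable
  have upd [measurable]: "(\<lambda>x. (f x)(i := g x)) \<in> N \<rightarrow>\<^sub>M Pi\<^sub>M K Q"
    if "f \<in> N \<rightarrow>\<^sub>M Pi\<^sub>M K Q" "g \<in> N \<rightarrow>\<^sub>M Q i" for f g and N :: "'z measure"
    using measurable_fun_upd[of K K i f N Q g] that i by (simp add: insert_absorb)
  show U [measurable]: "U \<in> ?P \<rightarrow>\<^sub>M ?P"
    unfolding U_def by (intro measurable_Pair upd) measurable
  \<comment> \<open>Resampling coordinate \<open>i\<close> exposes the pair on which
    \<open>\<phi>\<close> acts, independently of the other coordinates.\<close>
  have tri: "(\<integral>\<^sup>+x. f x \<partial>?P) = (\<integral>\<^sup>+z. \<integral>\<^sup>+X. f (fst z, X(i := snd z)) \<partial>Pi\<^sub>M K Q \<partial>(E \<Otimes>\<^sub>M Q i))"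
    if f [measurable]: "f \<in> borel_measurable ?P" for f
  proof -
    have 1: "(\<lambda>X. f (s, X)) \<in> borel_measurable (Pi\<^sub>M K Q)" if "s \<in> space E" for s
      using that by measurable
    have 2 [measurable]: "(\<lambda>w. f (fst (fst w), (snd w)(i := snd (fst w)))) \<in> borel_measurable ((E \<Otimes>\<^sub>M Q i) \<Otimes>\<^sub>M Pi\<^sub>M K Q)"
      by (rule measurable_compose[OF _ f], intro measurable_Pair upd) measurable
    have "(\<integral>\<^sup>+x. f x \<partial>?P) = (\<integral>\<^sup>+s. \<integral>\<^sup>+X. f (s, X) \<partial>Pi\<^sub>M K Q \<partial>E)"
      by (rule PQ.nn_integral_fst[symmetric]) measurable
    also have "\<dots> = (\<integral>\<^sup>+s. \<integral>\<^sup>+y. \<integral>\<^sup>+X. f (s, X(i := y)) \<partial>Pi\<^sub>M K Q \<partial>Q i \<partial>E)"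
      by (intro nn_integral_cong nn_integral_PiM_resample Q i 1)
    also have "\<dots> = (\<integral>\<^sup>+z. \<integral>\<^sup>+X. f (fst z, X(i := snd z)) \<partial>Pi\<^sub>M K Q \<partial>(E \<Otimes>\<^sub>M Q i))"
      using PQ.borel_measurable_nn_integral_fst[OF 2] by (subst Qi.nn_integral_fst[symmetric]) auto
    finally show ?thesis .
  qed
  show "distr ?P ?P U = ?P"
  proof (rule measure_eqI)
    fix A assume "A \<in> sets (distr ?P ?P U)"
    then have A [measurable]: "A \<in> sets ?P" by simp
    let ?h = "\<lambda>z. \<integral>\<^sup>+X. indicator A (fst z, X(i := snd z)) \<partial>Pi\<^sub>M K Q"
    have h: "?h \<in> borel_measurable (E \<Otimes>\<^sub>M Q i)"
    proof -
      have "(\<lambda>w. indicator A (fst (fst w), (snd w)(i := snd (fst w))) :: ennreal) \<in> borel_measurable ((E \<Otimes>\<^sub>M Q i) \<Otimes>\<^sub>M Pi\<^sub>M K Q)"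
        by (rule measurable_compose[OF _ borel_measurable_indicator[OF A]], intro measurable_Pair upd) measurable
      from PQ.borel_measurable_nn_integral_fst[OF this] show ?thesis by simp
    qed
    have "emeasure (distr ?P ?P U) A = (\<integral>\<^sup>+x. indicator A (U x) \<partial>?P)"
      by (subst nn_integral_indicator[symmetric], simp, rule nn_integral_distr) measurable
    also have "\<dots> = (\<integral>\<^sup>+z. ?h (\<phi> z) \<partial>(E \<Otimes>\<^sub>M Q i))"
      by (subst tri, measurable) (simp add: U_def)
    also have "\<dots> = (\<integral>\<^sup>+z. ?h z \<partial>distr (E \<Otimes>\<^sub>M Q i) (E \<Otimes>\<^sub>M Q i) \<phi>)"
      by (rule nn_integral_distr[symmetric]) (use h in auto)
    also have "\<dots> = (\<integral>\<^sup>+x. indicator A x \<partial>?P)" unfolding law by (rule tri[symmetric]) measurable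
    also have "\<dots> = emeasure ?P A" by (rule nn_integral_indicator) measurable
    finally show "emeasure (distr ?P ?P U) A = emeasure ?P A" .
  qed simp
qed

primrec multiline :: "nat \<Rightarrow> (int \<Rightarrow> real) \<times> config \<Rightarrow> (int \<Rightarrow> real) \<times> config" where
  "multiline 0 x = x"
| "multiline (Suc j) x = (case multiline j x of (w, I) \<Rightarrow>
     (dual_services (I (Suc j)) w, I(Suc j := queue_map (I (Suc j)) w)))"

primrec line_services :: "config \<Rightarrow> (int \<Rightarrow> real) \<Rightarrow> nat \<Rightarrow> int \<Rightarrow> real" where
  "line_services I w 0 = w"
| "line_services I w (Suc j) = dual_services (I (Suc j)) (line_services I w j)"

lemma multiline_eq:
  "multiline j (w, I) = (line_services I w j, \<lambda>i. if i \<in> {1..j} then queue_map (I i) (line_services I w (i - 1)) else I i)"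
  by (induction j) (auto simp: fun_eq_iff)

lemma distr_multiline:
  assumes \<sigma>: "\<And>l. 1 \<le> l \<Longrightarrow> l \<le> m \<Longrightarrow> \<tau> < \<sigma> l" and \<tau>: "0 < \<tau>" and j: "j \<le> m"
  defines "P \<equiv> exp_seq \<tau> \<Otimes>\<^sub>M exp_product m \<sigma>"
  shows "multiline j \<in> P \<rightarrow>\<^sub>M P \<and> distr P P (multiline j) = P"
  using j
proof (induction j)
  case 0
  have "multiline 0 = (\<lambda>x. x)" by auto
  then show ?case by simp
next
  case (Suc j)
  then have j: "1 \<le> Suc j" "Suc j \<le> m" by auto
  let ?E = "exp_seq \<tau>" and ?Q = "exp_seq (\<sigma> (Suc j))"
  define \<phi> :: "(int \<Rightarrow> real) \<times> (int \<Rightarrow> real) \<Rightarrow> (int \<Rightarrow> real) \<times> (int \<Rightarrow> real)"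
    where "\<phi> = (\<lambda>(w, I). (dual_services I w, queue_map I w))"
  let ?U = "\<lambda>x :: (int \<Rightarrow> real) \<times> config. (fst (\<phi> (fst x, snd x (Suc j))), (snd x)(Suc j := snd (\<phi> (fst x, snd x (Suc j)))))"
  have pos: "0 < \<sigma> (Suc j)" "\<tau> < \<sigma> (Suc j)" using \<sigma>[OF j] \<tau> by auto
  interpret E: prob_space ?E by (rule prob_space_exp_seq[OF \<tau>])
  interpret Q: prob_space ?Q by (rule prob_space_exp_seq[OF pos(1)])
  interpret QE: pair_sigma_finite ?Q ?E ..
  interpret EQ: pair_sigma_finite ?E ?Q ..
  have s1 [measurable_cong]: "sets (?Q \<Otimes>\<^sub>M ?E) = sets (seq_space \<Otimes>\<^sub>M seq_space)" "sets (?E \<Otimes>\<^sub>M ?Q) = sets (seq_space \<Otimes>\<^sub>M seq_space)"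
    by (intro sets_pair_measure_cong; simp)+
  have m\<phi> [measurable]: "\<phi> \<in> ?E \<Otimes>\<^sub>M ?Q \<rightarrow>\<^sub>M ?E \<Otimes>\<^sub>M ?Q" unfolding \<phi>_def by measurable
  let ?sw = "\<lambda>(x, y). (y, x)"
  \<comment> \<open>Burke's theorem lists the arrivals first and \<open>\<phi>\<close> lists the
    services first, hence the two swaps.\<close>
  have "distr (?E \<Otimes>\<^sub>M ?Q) (?E \<Otimes>\<^sub>M ?Q) \<phi> = distr (distr (?Q \<Otimes>\<^sub>M ?E) (?E \<Otimes>\<^sub>M ?Q) ?sw) (?E \<Otimes>\<^sub>M ?Q) \<phi>"
    by (subst EQ.distr_pair_swap) simp
  also have "\<dots> = distr (?Q \<Otimes>\<^sub>M ?E) (?E \<Otimes>\<^sub>M ?Q) (?sw \<circ> burke_map)"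
    by (subst distr_distr) (auto intro!: distr_cong simp: \<phi>_def burke_map_def)
  also have "\<dots> = distr (distr (?Q \<Otimes>\<^sub>M ?E) (?Q \<Otimes>\<^sub>M ?E) burke_map) (?E \<Otimes>\<^sub>M ?Q) ?sw"
    by (rule distr_distr[symmetric]) measurable
  also have "\<dots> = ?E \<Otimes>\<^sub>M ?Q"
    unfolding burke[OF \<tau> pos(2)] by (rule EQ.distr_pair_swap[symmetric])
  finally have law: "distr (?E \<Otimes>\<^sub>M ?Q) (?E \<Otimes>\<^sub>M ?Q) \<phi> = ?E \<Otimes>\<^sub>M ?Q" .
  have U: "?U \<in> P \<rightarrow>\<^sub>M P" "distr P P ?U = P"
    unfolding P_def exp_product_eq
    by (rule distr_component_update[where Q = "\<lambda>i. exp_seq (\<sigma> i)" and i = "Suc j", OF E.prob_space_axioms _ _ m\<phi> law];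
        use \<sigma> \<tau> j in \<open>auto intro!: prob_space_exp_seq intro: less_trans\<close>)+
  have eq: "multiline (Suc j) = ?U \<circ> multiline j"
    by (auto simp: fun_eq_iff \<phi>_def split: prod.splits)
  have IH: "multiline j \<in> P \<rightarrow>\<^sub>M P" "distr P P (multiline j) = P" using Suc by auto
  have "distr P P (?U \<circ> multiline j) = distr (distr P P (multiline j)) P ?U"
    by (rule distr_distr[symmetric, OF U(1) IH(1)])
  then have "distr P P (?U \<circ> multiline j) = P" unfolding IH(2) U(2) .
  then show ?case unfolding eq by (intro conjI measurable_comp[OF IH(1) U(1)])
qed

definition serve :: "nat \<Rightarrow> (int \<Rightarrow> real) \<times> config \<Rightarrow> config" where
  "serve n = (\<lambda>(w, \<eta>). \<lambda>i\<in>{1..n}. queue_map (\<eta> i) w)"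

lemma measurable_serve [measurable]: "serve n \<in> seq_space \<Otimes>\<^sub>M config_space n \<rightarrow>\<^sub>M config_space n"
  unfolding serve_def case_prod_beta
proof (rule measurable_config_spaceI)
  fix i assume "i \<in> {1..n}"
  then have [measurable]: "(\<lambda>x. snd x i) \<in> seq_space \<Otimes>\<^sub>M config_space n \<rightarrow>\<^sub>M seq_space"
    by (intro measurable_config_component) auto
  show "(\<lambda>x. queue_map (snd x i) (fst x)) \<in> seq_space \<Otimes>\<^sub>M config_space n \<rightarrow>\<^sub>M seq_space" by measurable
qed

lemma sets_exp_product [measurable_cong, simp]: "sets (exp_product m \<sigma>) = sets (config_space m)"
  unfolding exp_product_eq config_space_def by (rule sets_PiM_cong) auto

lemma measurable_multi_queue [measurable]: "multi_queue m \<in> config_space m \<rightarrow>\<^sub>M config_space m"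
  unfolding multi_queue_def
proof (rule measurable_config_spaceI)
  fix i assume i: "i \<in> {1..m}"
  show "(\<lambda>I. queue_iter i (\<lambda>j. I (i + 1 - j))) \<in> config_space m \<rightarrow>\<^sub>M seq_space"
  proof (rule measurable_queue_iter)
    fix l assume "1 \<le> l" "l \<le> i"
    then show "(\<lambda>I. I (i + 1 - l)) \<in> config_space m \<rightarrow>\<^sub>M seq_space"
      using i by (intro measurable_config_component[where n = m]) auto
  qed (use i in auto)
qed

lemma sets_mu_strict [measurable_cong, simp]: "sets (mu_strict m \<sigma>) = sets (config_space m)"
  by (simp add: mu_strict_def)

lemma prob_space_exp_product: "(\<And>l. l \<in> {1..m} \<Longrightarrow> 0 < \<sigma> l) \<Longrightarrow> prob_space (exp_product m \<sigma>)"
  unfolding exp_product_eq by (intro prob_space_PiM prob_space_exp_seq)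

lemma prob_space_mu_strict: "(\<And>l. l \<in> {1..m} \<Longrightarrow> 0 < \<sigma> l) \<Longrightarrow> prob_space (mu_strict m \<sigma>)"
  unfolding mu_strict_def by (intro prob_space.prob_space_distr prob_space_exp_product) (auto, measurable)

lemma distr_mu_strict_component:
  assumes \<sigma>: "\<And>l. l \<in> {1..m} \<Longrightarrow> 0 < \<sigma> l" "strict_mono_on {1..m} \<sigma>" and k: "k \<in> {1..m}"
  shows "distr (mu_strict m \<sigma>) (exp_seq (\<sigma> k)) (\<lambda>\<eta>. \<eta> k) = exp_seq (\<sigma> k)"
proof -
  have [measurable]: "(\<lambda>\<eta>. \<eta> k) \<in> config_space m \<rightarrow>\<^sub>M seq_space"
    by (rule measurable_config_component[OF _ k]) simp
  have "distr (mu_strict m \<sigma>) (exp_seq (\<sigma> k)) (\<lambda>\<eta>. \<eta> k) = distr (exp_product m \<sigma>) (exp_seq (\<sigma> k)) ((\<lambda>\<eta>. \<eta> k) \<circ> multi_queue m)"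
    unfolding mu_strict_def by (rule distr_distr) measurable
  also have "\<dots> = distr (exp_product m \<sigma>) (exp_seq (\<sigma> k)) (\<lambda>I. queue_iter k (\<lambda>l. I (k + 1 - l)))"
    by (rule distr_cong) (use k in \<open>auto simp: multi_queue_def\<close>)
  also have "\<dots> = exp_seq (\<sigma> k)"
    using k \<sigma> by (intro distr_line_queue_iter) auto
  finally show ?thesis .
qed

text \<open>That serving commutes with \<open>multi_queue\<close> is only known almost surely,
  because the interchange asks for stable queues at every stage. Stability is read off from
  averages: \<open>\<sigma> k\<close> for all partial outputs of line \<open>k\<close>, and 1 for
  the leftover services at every stage.\<close>

theorem mu_strict_invariant:
  assumes \<sigma>: "\<And>l. l \<in> {1..m} \<Longrightarrow> 1 < \<sigma> l" "strict_mono_on {1..m} \<sigma>"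
  shows "distr (exp_seq 1 \<Otimes>\<^sub>M mu_strict m \<sigma>) (config_space m) (serve m) = mu_strict m \<sigma>"
proof -
  let ?\<nu> = "exp_product m \<sigma>" and ?W = "exp_seq 1"
  define P where "P = ?W \<Otimes>\<^sub>M ?\<nu>"
  have pos: "0 < \<sigma> l" if "l \<in> {1..m}" for l using \<sigma>(1)[OF that] by simp
  interpret W: prob_space ?W by (rule prob_space_exp_seq) simp
  interpret N: prob_space ?\<nu> by (rule prob_space_exp_product[OF pos])
  interpret MS: prob_space "mu_strict m \<sigma>" by (rule prob_space_mu_strict[OF pos])
  have setsP [measurable_cong]: "sets P = sets (seq_space \<Otimes>\<^sub>M config_space m)"
    unfolding P_def by (intro sets_pair_measure_cong) auto
  have ml: "multiline j \<in> P \<rightarrow>\<^sub>M P" "distr P P (multiline j) = P" if "j \<le> m" for j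
    using distr_multiline[of m 1 \<sigma> j] \<sigma>(1) that by (auto simp: P_def)
  have sndP: "distr P ?\<nu> snd = ?\<nu>" unfolding P_def by (rule distr_pair_snd) unfold_locales
  have fstP: "distr P ?W fst = ?W" unfolding P_def by (rule N.distr_pair_fst)
  have avgX: "AE x in P. has_avg (queue_iter j (\<lambda>l. snd x (k + 1 - l))) (\<sigma> k)" if jk: "1 \<le> j" "j \<le> k" "k \<le> m" for j k
  proof -
    have m: "(\<lambda>I. queue_iter j (\<lambda>l. I (k + 1 - l))) \<in> ?\<nu> \<rightarrow>\<^sub>M exp_seq (\<sigma> k)"
    proof -
      have "(\<lambda>I. queue_iter j (\<lambda>l. I (k + 1 - l))) \<in> config_space m \<rightarrow>\<^sub>M seq_space"
        using jk by (intro measurable_queue_iter measurable_config_component[where n = m]) auto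
      then show ?thesis by simp
    qed
    have "AE x in distr ?\<nu> (exp_seq (\<sigma> k)) (\<lambda>I. queue_iter j (\<lambda>l. I (k + 1 - l))). has_avg x (\<sigma> k)"
      using jk pos \<sigma> by (subst distr_line_queue_iter) (auto intro!: AE_exp_seq_avg)
    from AE_distrD[OF m this] have "AE x in distr P ?\<nu> snd. has_avg (queue_iter j (\<lambda>l. x (k + 1 - l))) (\<sigma> k)"
      unfolding sndP .
    then show ?thesis by (rule AE_distrD[rotated]) measurable
  qed
  have avgu: "AE x in P. has_avg (line_services (snd x) (fst x) j) 1" if j: "j \<le> m" for j
  proof -
    have "AE y in distr P ?W fst. has_avg y 1" unfolding fstP by (rule AE_exp_seq_avg) simp
    then have "AE y in distr P P (multiline j). has_avg (fst y) 1"
      unfolding ml(2)[OF j] by (rule AE_distrD[rotated]) measurable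
    from AE_distrD[OF ml(1)[OF j] this] show ?thesis
    proof eventually_elim
      case (elim x)
      then show ?case using multiline_eq[of j "fst x" "snd x"] by simp
    qed
  qed
  have avgX': "AE x in P. \<forall>k\<in>{1..m}. \<forall>j\<in>{1..k}. has_avg (queue_iter j (\<lambda>l. snd x (k + 1 - l))) (\<sigma> k)"
    by (intro AE_finite_allI avgX) auto
  have avgu': "AE x in P. \<forall>j\<in>{..m}. has_avg (line_services (snd x) (fst x) j) 1"
    by (intro AE_finite_allI avgu) auto
  have AE: "AE x in P. serve m (fst x, multi_queue m (snd x)) = multi_queue m (snd (multiline m x))"
    using avgX' avgu'
  proof eventually_elim
    case (elim x)
    define I where "I = snd x"
    define w where "w = fst x"
    have x: "x = (w, I)" by (simp add: I_def w_def)
    have Iavg: "has_avg (I k) (\<sigma> k)" if "k \<in> {1..m}" for k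
      using elim(1)[rule_format, OF that, of 1] that by (simp add: I_def)
    show ?case
    proof
      fix k
      show "serve m (fst x, multi_queue m (snd x)) k = multi_queue m (snd (multiline m x)) k"
      proof (cases "k \<in> {1..m}")
        case True
        let ?\<zeta> = "\<lambda>l. I (k + 1 - l)" and ?u = "\<lambda>j. line_services I w (k - j)"
        have X: "has_avg (queue_iter j ?\<zeta>) (\<sigma> k)" if "1 \<le> j" "j \<le> k" for j
          using elim(1) that True by (auto simp: I_def)
        have u: "has_avg (?u j) 1" for j
          using elim(2) True by (auto simp: I_def w_def)
        have \<zeta>: "has_avg (?\<zeta> (Suc j)) (\<sigma> (k - j))" "1 < \<sigma> (k - j)" "\<sigma> (k - j) < \<sigma> k" if "1 \<le> j" "j < k" for j
        proof -
          have kj: "k - j \<in> {1..m}" using that True by auto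
          show "has_avg (?\<zeta> (Suc j)) (\<sigma> (k - j))" "1 < \<sigma> (k - j)" "\<sigma> (k - j) < \<sigma> k"
            using Iavg[OF kj] \<sigma>(1)[OF kj] strict_mono_onD[OF \<sigma>(2) kj True] that by auto
        qed
        have "queue_map (queue_iter k ?\<zeta>) (?u k) = queue_iter k (\<lambda>j. queue_map (?\<zeta> j) (?u j))"
        proof (rule queue_iter_interchange)
          fix j assume j: "1 \<le> j" "j < k"
          then have "k - j = Suc (k - Suc j)" by simp
          then show "?u j = dual_services (?\<zeta> (Suc j)) (?u (Suc j))" by simp
          show "stable (queue_iter j ?\<zeta>) (?\<zeta> (Suc j))"
            using j by (intro stable_of_avg[OF X \<zeta>(1)] \<zeta>) auto
          show "stable (queue_iter (Suc j) ?\<zeta>) (?u (Suc j))"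
            using j \<sigma>(1)[of k] True by (intro stable_of_avg[OF X u]) auto
          show "stable (?\<zeta> (Suc j)) (?u (Suc j))"
            using j by (intro stable_of_avg[OF \<zeta>(1) u] \<zeta>) auto
        qed (use True in auto)
        also have "\<dots> = queue_iter k (\<lambda>j. snd (multiline m x) (k + 1 - j))"
        proof (rule queue_iter_cong)
          fix l assume "1 \<le> l" "l \<le> k"
          then show "queue_map (?\<zeta> l) (?u l) = snd (multiline m x) (k + 1 - l)"
            using True by (auto simp: x multiline_eq)
        qed
        finally show ?thesis using True by (simp add: serve_def multi_queue_def x)
      qed (auto simp: serve_def multi_queue_def)
    qed
  qed
  have ms: "multi_queue m \<circ> snd \<in> P \<rightarrow>\<^sub>M config_space m" unfolding comp_def by measurable
  have "?W \<Otimes>\<^sub>M mu_strict m \<sigma> = distr P (seq_space \<Otimes>\<^sub>M config_space m) (\<lambda>(w, I). (w, multi_queue m I))"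
  proof -
    have "distr ?W seq_space (\<lambda>w. w) \<Otimes>\<^sub>M distr ?\<nu> (config_space m) (multi_queue m) =
        distr (?W \<Otimes>\<^sub>M ?\<nu>) (seq_space \<Otimes>\<^sub>M config_space m) (\<lambda>(w, I). (w, multi_queue m I))"
      using MS.sigma_finite_measure_axioms
      by (intro pair_measure_distr) (auto simp: mu_strict_def, measurable)
    moreover have "distr ?W seq_space (\<lambda>w. w) = ?W" by (rule distr_id2) simp
    ultimately show ?thesis by (simp add: P_def mu_strict_def)
  qed
  then have "distr (?W \<Otimes>\<^sub>M mu_strict m \<sigma>) (config_space m) (serve m) =
      distr P (config_space m) (serve m \<circ> (\<lambda>(w, I). (w, multi_queue m I)))"
    by (simp, intro distr_distr) measurable
  also have "\<dots> = distr P (config_space m) (multi_queue m \<circ> snd \<circ> multiline m)"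
  proof (rule distr_cong_AE)
    show "AE x in P. (serve m \<circ> (\<lambda>(w, I). (w, multi_queue m I))) x = (multi_queue m \<circ> snd \<circ> multiline m) x"
      using AE by (simp add: case_prod_beta)
    show "multi_queue m \<circ> snd \<circ> multiline m \<in> P \<rightarrow>\<^sub>M config_space m"
      by (rule measurable_comp[OF ml(1)[OF order_refl] ms])
  qed (auto, measurable)
  also have "\<dots> = distr (distr P P (multiline m)) (config_space m) (multi_queue m \<circ> snd)"
    by (rule distr_distr[symmetric, OF ms ml(1)[OF order_refl]])
  also have "\<dots> = distr (distr P ?\<nu> snd) (config_space m) (multi_queue m)"
    unfolding ml(2)[OF order_refl] by (rule distr_distr[symmetric]) measurable
  also have "\<dots> = mu_strict m \<sigma>" by (simp add: sndP mu_strict_def)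
  finally show ?thesis .
qed


section \<open>Mixing\<close>

text \<open>Two inductions over the generated sigma algebra: first \<open>A\<close> is extended
  while \<open>B\<close> stays a generator, then \<open>B\<close> is extended for a fixed measurable
  \<open>A\<close>. For disjoint unions, limit and series are exchanged by domination; the bounds
  are \<open>measure M (A i)\<close> in the first round and, by invariance,
  \<open>measure M (B i)\<close> in the second.\<close>

lemma mixing_sigma_sets:
  assumes M: "prob_space M" and \<theta>: "\<And>l. \<theta> l \<in> M \<rightarrow>\<^sub>M M" and inv: "\<And>l::nat. distr M M (\<theta> l) = M"
    and G: "Int_stable G" "sets M = sigma_sets (space M) G" "G \<subseteq> Pow (space M)"
    and mix: "\<And>A B. A \<in> G \<Longrightarrow> B \<in> G \<Longrightarrow>
      (\<lambda>l. measure M (A \<inter> (\<theta> l -` B \<inter> space M))) \<longlonglongrightarrow> measure M A * measure M B"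
    and A: "A \<in> sets M" and B: "B \<in> sets M"
  shows "(\<lambda>l. measure M (A \<inter> (\<theta> l -` B \<inter> space M))) \<longlonglongrightarrow> measure M A * measure M B"
proof -
  interpret prob_space M by fact
  note [measurable] = \<theta>
  let ?p = "\<lambda>A B l. measure M (A \<inter> (\<theta> l -` B \<inter> space M))"
  have inv': "measure M (\<theta> l -` B \<inter> space M) = measure M B" if "B \<in> sets M" for B l
    using measure_distr[OF \<theta>[of l] that] inv[of l] by simp
  have vs: "\<theta> l -` B \<inter> space M \<in> sets M" if "B \<in> sets M" for B l
    using measurable_sets[OF \<theta> that] .
  have GM: "A \<in> sets M" if "A \<in> sigma_sets (space M) G" for A using that G(2) by simp
  have tannery: "(\<lambda>l. \<Sum>i. a i l) \<longlonglongrightarrow> (\<Sum>i. b i)"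
    if "\<And>i. (\<lambda>l. a i l) \<longlonglongrightarrow> b i" "\<And>i l. \<bar>a i l\<bar> \<le> c i" "summable c"
    for a :: "nat \<Rightarrow> nat \<Rightarrow> real" and b c :: "nat \<Rightarrow> real"
    by (rule tannerys_theorem[where M = c, THEN conjunct2, THEN conjunct2])
       (use that in \<open>auto intro!: always_eventually\<close>)
  have step1: "?p A B \<longlonglongrightarrow> measure M A * measure M B" if A: "A \<in> sigma_sets (space M) G" and B: "B \<in> G" for A B
  proof -
    have Bm: "B \<in> sets M" using B G(2) by auto
    show ?thesis
      using G(1,3) A
    proof (induction A rule: sigma_sets_induct_disjoint)
      case (basic A)
      then show ?case by (rule mix[OF _ B])
    next
      case (compl A)
      have "?p (space M - A) B l = measure M B - ?p A B l" for l
      proof -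
        have "(space M - A) \<inter> (\<theta> l -` B \<inter> space M) = (\<theta> l -` B \<inter> space M) - (A \<inter> (\<theta> l -` B \<inter> space M))" by auto
        then show ?thesis
          using finite_measure_Diff[OF vs[OF Bm, of l], of "A \<inter> (\<theta> l -` B \<inter> space M)"] inv'[OF Bm, of l] vs[OF Bm, of l] GM[OF compl(1)]
          by auto
      qed
      moreover have "(\<lambda>l. measure M B - ?p A B l) \<longlonglongrightarrow> measure M B - measure M A * measure M B"
        by (intro tendsto_diff compl tendsto_const)
      ultimately show ?case by (simp only: prob_compl[OF GM[OF compl(1)]] left_diff_distrib mult_1)
    next
      case (union A)
      have Am: "range A \<subseteq> sets M" using union(2) G(2) by simp
      have s: "(\<lambda>i. measure M (A i)) sums measure M (\<Union>i. A i)"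
        by (rule finite_measure_UNION[OF Am union(1)])
      have eq: "?p (\<Union>i. A i) B l = (\<Sum>i. ?p (A i) B l)" for l
      proof -
        have "(\<lambda>i. ?p (A i) B l) sums measure M (\<Union>i. A i \<inter> (\<theta> l -` B \<inter> space M))"
          using Am vs[OF Bm, of l] union(1) by (intro finite_measure_UNION) (auto simp: disjoint_family_on_def)
        then show ?thesis by (simp add: sums_iff)
      qed
      have "(\<lambda>l. \<Sum>i. ?p (A i) B l) \<longlonglongrightarrow> (\<Sum>i. measure M (A i) * measure M B)"
      proof (rule tannery[OF union(3)])
        fix i l
        have "A i \<in> sets M" using Am by auto
        then show "\<bar>?p (A i) B l\<bar> \<le> measure M (A i)" by (auto intro!: finite_measure_mono)
      qed (use s in \<open>simp add: sums_iff\<close>)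
      also have "(\<Sum>i. measure M (A i) * measure M B) = measure M (\<Union>i. A i) * measure M B"
        using s by (subst suminf_mult2[symmetric]) (auto simp: sums_iff)
      finally show ?case by (simp only: eq)
    qed simp
  qed
  have "B \<in> sigma_sets (space M) G" using B G(2) by simp
  with G(1,3) show ?thesis
  proof (induction B rule: sigma_sets_induct_disjoint)
    case (basic B)
    then show ?case using step1 A G(2) by simp
  next
    case (compl B)
    have Bm: "B \<in> sets M" by (rule GM[OF compl(1)])
    have "?p A (space M - B) l = measure M A - ?p A B l" for l
    proof -
      have "A \<inter> (\<theta> l -` (space M - B) \<inter> space M) = A - (A \<inter> (\<theta> l -` B \<inter> space M))"
        using sets.sets_into_space[OF A] measurable_space[OF \<theta>, of _ l] by auto
      then show ?thesis
        using finite_measure_Diff[OF A, of "A \<inter> (\<theta> l -` B \<inter> space M)"] vs[OF Bm, of l] A by auto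
    qed
    moreover have "(\<lambda>l. measure M A - ?p A B l) \<longlonglongrightarrow> measure M A - measure M A * measure M B"
      by (intro tendsto_diff compl tendsto_const)
    ultimately show ?case by (simp only: prob_compl[OF Bm] right_diff_distrib mult_1_right)
  next
    case (union B)
    have Bm: "range B \<subseteq> sets M" using union(2) G(2) by simp
    have s: "(\<lambda>i. measure M (B i)) sums measure M (\<Union>i. B i)"
      by (rule finite_measure_UNION[OF Bm union(1)])
    have eq: "?p A (\<Union>i. B i) l = (\<Sum>i. ?p A (B i) l)" for l
    proof -
      have v: "\<theta> l -` B i \<inter> space M \<in> sets M" for i using vs[of "B i" l] Bm by auto
      have "(\<lambda>i. ?p A (B i) l) sums measure M (\<Union>i. A \<inter> (\<theta> l -` B i \<inter> space M))"
        using v A union(1) by (intro finite_measure_UNION) (auto simp: disjoint_family_on_def)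
      moreover have "(\<Union>i. A \<inter> (\<theta> l -` B i \<inter> space M)) = A \<inter> (\<theta> l -` (\<Union>i. B i) \<inter> space M)" by auto
      ultimately show ?thesis by (simp add: sums_iff)
    qed
    have "(\<lambda>l. \<Sum>i. ?p A (B i) l) \<longlonglongrightarrow> (\<Sum>i. measure M A * measure M (B i))"
    proof (rule tannery[OF union(3)])
      fix i l
      have "B i \<in> sets M" using Bm by auto
      then have "?p A (B i) l \<le> measure M (\<theta> l -` B i \<inter> space M)"
        by (intro finite_measure_mono vs) auto
      then show "\<bar>?p A (B i) l\<bar> \<le> measure M (B i)" using inv'[OF \<open>B i \<in> sets M\<close>] by simp
    qed (use s in \<open>simp add: sums_iff\<close>)
    also have "(\<Sum>i. measure M A * measure M (B i)) = measure M A * measure M (\<Union>i. B i)"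
      using s by (subst suminf_mult) (auto simp: sums_iff)
    finally show ?case by (simp only: eq)
  qed simp
qed

section \<open>Mixing of the exponential sequences\<close>

abbreviation shift_seq :: "int \<Rightarrow> (int \<Rightarrow> real) \<Rightarrow> int \<Rightarrow> real" where
  "shift_seq l x \<equiv> (\<lambda>k. x (k + l))"

lemma measurable_shift_seq [measurable]: "shift_seq l \<in> seq_space \<rightarrow>\<^sub>M seq_space"
  by (rule measurable_seq_spaceI) simp

lemma distr_shift_exp_seq:
  assumes "0 < \<sigma>"
  shows "distr (exp_seq \<sigma>) (exp_seq \<sigma>) (shift_seq l) = exp_seq \<sigma>"
  using distr_PiM_reindex[of UNIV "\<lambda>_. exp_dist \<sigma>" "\<lambda>k. k + l" UNIV] prob_space_exp_dist[OF assms]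
  by (simp add: exp_seq_def inj_on_def restrict_UNIV)

lemma mixing_exp_seq:
  assumes \<sigma>: "0 < \<sigma>" and AB: "A \<in> sets (exp_seq \<sigma>)" "B \<in> sets (exp_seq \<sigma>)"
  shows "(\<lambda>l. measure (exp_seq \<sigma>) (A \<inter> (shift_seq (int l) -` B \<inter> space (exp_seq \<sigma>)))) \<longlonglongrightarrow>
    measure (exp_seq \<sigma>) A * measure (exp_seq \<sigma>) B"
proof (rule mixing_sigma_sets[OF prob_space_exp_seq[OF \<sigma>] _ distr_shift_exp_seq[OF \<sigma>] Int_stable_prod_algebra _ _ _ AB])
  interpret E: prob_space "exp_dist \<sigma>" by (rule prob_space_exp_dist[OF \<sigma>])
  interpret P: product_prob_space "\<lambda>_ :: int. exp_dist \<sigma>" UNIV by unfold_locales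
  show "sets (exp_seq \<sigma>) = sigma_sets (space (exp_seq \<sigma>)) (prod_algebra UNIV (\<lambda>_. exp_dist \<sigma>))"
    unfolding exp_seq_def sets_PiM by (simp add: space_PiM)
  show "prod_algebra UNIV (\<lambda>_. exp_dist \<sigma>) \<subseteq> Pow (space (exp_seq \<sigma>))" by simp
  fix A B :: "(int \<Rightarrow> real) set" assume "A \<in> prod_algebra UNIV (\<lambda>_. exp_dist \<sigma>)" "B \<in> prod_algebra UNIV (\<lambda>_. exp_dist \<sigma>)"
  then obtain J X K Y where J: "finite J" "A = prod_emb UNIV (\<lambda>_. exp_dist \<sigma>) J (Pi\<^sub>E J X)" "\<And>j. j \<in> J \<Longrightarrow> X j \<in> sets (exp_dist \<sigma>)"
    and K: "finite K" "B = prod_emb UNIV (\<lambda>_. exp_dist \<sigma>) K (Pi\<^sub>E K Y)" "\<And>j. j \<in> K \<Longrightarrow> Y j \<in> sets (exp_dist \<sigma>)"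
    by (elim prod_algebraE) blast
  have memb: "x \<in> prod_emb UNIV (\<lambda>_. exp_dist \<sigma>) J (Pi\<^sub>E J X) \<longleftrightarrow> (\<forall>k\<in>J. x k \<in> X k)" for x :: "int \<Rightarrow> real" and J X
    by (auto simp: prod_emb_def PiE_def Pi_def)
  have ev: "measure (exp_seq \<sigma>) (A \<inter> (shift_seq (int l) -` B \<inter> space (exp_seq \<sigma>))) =
      measure (exp_seq \<sigma>) A * measure (exp_seq \<sigma>) B" if l: "nat (\<Sum>j\<in>J. \<bar>j\<bar>) + nat (\<Sum>j\<in>K. \<bar>j\<bar>) < l" for l
  proof -
    define K' where "K' = (\<lambda>k. k + int l) ` K"
    define Z where "Z k = (if k \<in> J then X k else Y (k - int l))" for k
    have bJ: "\<bar>j\<bar> \<le> (\<Sum>j\<in>J. \<bar>j\<bar>)" if "j \<in> J" for j using J(1) that by (intro member_le_sum) auto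
    have bK: "\<bar>j\<bar> \<le> (\<Sum>j\<in>K. \<bar>j\<bar>)" if "j \<in> K" for j using K(1) that by (intro member_le_sum) auto
    have disj: "k + int l \<notin> J" if "k \<in> K" for k
    proof
      assume "k + int l \<in> J"
      then show False using bJ[of "k + int l"] bK[OF that] l by linarith
    qed
    have "A \<inter> (shift_seq (int l) -` B \<inter> space (exp_seq \<sigma>)) = prod_emb UNIV (\<lambda>_. exp_dist \<sigma>) (J \<union> K') (Pi\<^sub>E (J \<union> K') Z)"
    proof -
      have 1: "(\<forall>k\<in>J. x k \<in> Z k) \<longleftrightarrow> (\<forall>k\<in>J. x k \<in> X k)" for x :: "int \<Rightarrow> real" by (simp add: Z_def)
      have 2: "(\<forall>k\<in>K'. x k \<in> Z k) \<longleftrightarrow> (\<forall>k\<in>K. x (k + int l) \<in> Y k)" for x :: "int \<Rightarrow> real"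
        unfolding K'_def Z_def using disj by simp
      show ?thesis unfolding J(2) K(2) set_eq_iff Int_iff vimage_eq memb ball_Un 1 2 by simp
    qed
    also have "measure (exp_seq \<sigma>) \<dots> = (\<Prod>k\<in>J \<union> K'. measure (exp_dist \<sigma>) (Z k))"
      unfolding exp_seq_def
      by (rule P.measure_PiM_emb) (use J K disj in \<open>auto simp: K'_def Z_def\<close>)
    also have "\<dots> = (\<Prod>k\<in>J. measure (exp_dist \<sigma>) (Z k)) * (\<Prod>k\<in>K'. measure (exp_dist \<sigma>) (Z k))"
      using J K disj by (intro prod.union_disjoint) (auto simp: K'_def)
    also have "(\<Prod>k\<in>J. measure (exp_dist \<sigma>) (Z k)) = measure (exp_seq \<sigma>) A"
      unfolding J(2) exp_seq_def using J by (subst P.measure_PiM_emb) (auto simp: Z_def)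
    also have "(\<Prod>k\<in>K'. measure (exp_dist \<sigma>) (Z k)) = (\<Prod>k\<in>K. measure (exp_dist \<sigma>) (Y k))"
      unfolding K'_def using disj by (subst prod.reindex) (auto simp: inj_on_def Z_def)
    also have "\<dots> = measure (exp_seq \<sigma>) B"
      unfolding K(2) exp_seq_def using K by (subst P.measure_PiM_emb) auto
    finally show ?thesis .
  qed
  show "(\<lambda>l. measure (exp_seq \<sigma>) (A \<inter> (shift_seq (int l) -` B \<inter> space (exp_seq \<sigma>)))) \<longlonglongrightarrow>
      measure (exp_seq \<sigma>) A * measure (exp_seq \<sigma>) B"
    by (rule tendsto_eventually) (use ev in \<open>auto intro: eventually_mono[OF eventually_gt_at_top]\<close>)
qed simp

lemma measurable_translation [measurable]: "translation n l \<in> config_space n \<rightarrow>\<^sub>M config_space n"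
  unfolding translation_def
proof (rule measurable_config_spaceI)
  fix i assume "i \<in> {1..n}"
  then have [measurable]: "(\<lambda>\<eta>. \<eta> i) \<in> config_space n \<rightarrow>\<^sub>M seq_space"
    by (intro measurable_config_component) auto
  show "(\<lambda>\<eta>. shift_seq l (\<eta> i)) \<in> config_space n \<rightarrow>\<^sub>M seq_space" by measurable
qed

lemma distr_translation_exp_product:
  assumes "\<And>l. l \<in> {1..m} \<Longrightarrow> 0 < \<sigma> l"
  shows "distr (exp_product m \<sigma>) (exp_product m \<sigma>) (translation m l) = exp_product m \<sigma>"
proof -
  have "distr (Pi\<^sub>M {1..m} (\<lambda>i. exp_seq (\<sigma> i))) (Pi\<^sub>M {1..m} (\<lambda>i. exp_seq (\<sigma> i))) (compose {1..m} (shift_seq l)) =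
      Pi\<^sub>M {1..m} (\<lambda>i. distr (exp_seq (\<sigma> i)) (exp_seq (\<sigma> i)) (shift_seq l))"
    using assms by (intro distr_PiM_finite_prob_space') (auto intro: prob_space_exp_seq)
  also have "\<dots> = Pi\<^sub>M {1..m} (\<lambda>i. exp_seq (\<sigma> i))"
    using assms by (intro PiM_cong) (auto simp: distr_shift_exp_seq)
  also have "compose {1..m} (shift_seq l) = translation m l"
    by (auto simp: compose_def translation_def fun_eq_iff)
  finally show ?thesis by (simp add: exp_product_eq)
qed

lemma measure_PiM_box:
  assumes I: "finite I" and M: "\<And>i. i \<in> I \<Longrightarrow> prob_space (M i)" and A: "\<And>i. i \<in> I \<Longrightarrow> A i \<in> sets (M i)"
  shows "measure (Pi\<^sub>M I M) (Pi\<^sub>E I A) = (\<Prod>i\<in>I. measure (M i) (A i))"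
proof -
  have e: "prod_emb I M I (Pi\<^sub>E I A) = Pi\<^sub>E I A"
    using A by (intro prod_emb_PiE_same_index sets.sets_into_space)
  have "emeasure (Pi\<^sub>M I M) (Pi\<^sub>E I A) = (\<Prod>i\<in>I. emeasure (M i) (A i))"
    using emeasure_PiM_emb[of I M I A] M I A by (simp add: e)
  also have "\<dots> = (\<Prod>i\<in>I. ennreal (measure (M i) (A i)))"
    by (intro prod.cong refl finite_measure.emeasure_eq_measure prob_space.finite_measure M)
  also have "\<dots> = ennreal (\<Prod>i\<in>I. measure (M i) (A i))"
    by (rule prod_ennreal) simp
  finally show ?thesis by (simp add: measure_def prod_nonneg)
qed

text \<open>On rectangles the correlation is a finite product of correlations of the single lines
  and converges factor by factor. Mixing is proved instead of ergodicity because ergodicity alone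
  would not pass to products.\<close>

lemma mixing_exp_product:
  assumes \<sigma>: "\<And>l. l \<in> {1..m} \<Longrightarrow> 0 < \<sigma> l" and AB: "A \<in> sets (exp_product m \<sigma>)" "B \<in> sets (exp_product m \<sigma>)"
  shows "(\<lambda>l. measure (exp_product m \<sigma>) (A \<inter> (translation m (int l) -` B \<inter> space (exp_product m \<sigma>)))) \<longlonglongrightarrow>
    measure (exp_product m \<sigma>) A * measure (exp_product m \<sigma>) B"
proof (rule mixing_sigma_sets[OF prob_space_exp_product[OF \<sigma>] _ distr_translation_exp_product[OF \<sigma>] Int_stable_prod_algebra _ _ _ AB])
  let ?M = "\<lambda>i. exp_seq (\<sigma> i)"
  show "translation m (int l) \<in> exp_product m \<sigma> \<rightarrow>\<^sub>M exp_product m \<sigma>" for l by measurable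
  show "sets (exp_product m \<sigma>) = sigma_sets (space (exp_product m \<sigma>)) (prod_algebra {1..m} ?M)"
    unfolding exp_product_eq sets_PiM by (simp add: space_PiM)
  show "prod_algebra {1..m} ?M \<subseteq> Pow (space (exp_product m \<sigma>))"
    unfolding exp_product_eq space_PiM by (rule prod_algebra_sets_into_space)
  fix A B assume "A \<in> prod_algebra {1..m} ?M" "B \<in> prod_algebra {1..m} ?M"
  then obtain X Y where X: "A = Pi\<^sub>E {1..m} X" "\<And>i. i \<in> {1..m} \<Longrightarrow> X i \<in> sets (?M i)"
    and Y: "B = Pi\<^sub>E {1..m} Y" "\<And>i. i \<in> {1..m} \<Longrightarrow> Y i \<in> sets (?M i)"
    unfolding prod_algebra_eq_finite[OF finite_atLeastAtMost] Pi_iff by blast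
  have p: "prob_space (?M i)" if "i \<in> {1..m}" for i using \<sigma>[OF that] by (rule prob_space_exp_seq)
  have "measure (exp_product m \<sigma>) (A \<inter> (translation m (int l) -` B \<inter> space (exp_product m \<sigma>))) =
      (\<Prod>i\<in>{1..m}. measure (?M i) (X i \<inter> (shift_seq (int l) -` Y i \<inter> space (?M i))))" for l
  proof -
    have "A \<inter> (translation m (int l) -` B \<inter> space (exp_product m \<sigma>)) =
        Pi\<^sub>E {1..m} (\<lambda>i. X i \<inter> (shift_seq (int l) -` Y i \<inter> space (?M i)))"
      unfolding X(1) Y(1) exp_product_eq space_PiM
      by (auto simp: translation_def PiE_iff extensional_def)
    moreover have "X i \<inter> (shift_seq (int l) -` Y i \<inter> space (?M i)) \<in> sets (?M i)" if "i \<in> {1..m}" for i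
      using X(2)[OF that] Y(2)[OF that] measurable_sets[OF measurable_shift_seq, of "Y i" "int l"] by simp
    ultimately show ?thesis
      unfolding exp_product_eq by (simp only:) (rule measure_PiM_box[OF finite_atLeastAtMost p])
  qed
  moreover have "(\<lambda>l. \<Prod>i\<in>{1..m}. measure (?M i) (X i \<inter> (shift_seq (int l) -` Y i \<inter> space (?M i)))) \<longlonglongrightarrow>
      (\<Prod>i\<in>{1..m}. measure (?M i) (X i) * measure (?M i) (Y i))"
    by (intro tendsto_prod mixing_exp_seq \<sigma> X(2) Y(2))
  moreover have "(\<Prod>i\<in>{1..m}. measure (?M i) (X i) * measure (?M i) (Y i)) =
      measure (exp_product m \<sigma>) A * measure (exp_product m \<sigma>) B"
    unfolding prod.distrib X(1) Y(1) exp_product_eq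
    by (simp only: measure_PiM_box[OF finite_atLeastAtMost p X(2)] measure_PiM_box[OF finite_atLeastAtMost p Y(2)])
  ultimately show "(\<lambda>l. measure (exp_product m \<sigma>) (A \<inter> (translation m (int l) -` B \<inter> space (exp_product m \<sigma>)))) \<longlonglongrightarrow>
      measure (exp_product m \<sigma>) A * measure (exp_product m \<sigma>) B" by simp
qed simp

text \<open>For an invariant set the correlation is constant in the shift, so mixing says that its
  probability equals its own square.\<close>

lemma translation_ergodic_exp_product:
  assumes \<sigma>: "\<And>l. l \<in> {1..m} \<Longrightarrow> 0 < \<sigma> l"
  shows "translation_ergodic m (exp_product m \<sigma>)"
  unfolding translation_ergodic_def
proof (intro conjI allI ballI impI)
  fix l
  have "distr (exp_product m \<sigma>) (config_space m) (translation m l) = distr (exp_product m \<sigma>) (exp_product m \<sigma>) (translation m l)"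
    by (rule distr_cong) auto
  then show "distr (exp_product m \<sigma>) (config_space m) (translation m l) = exp_product m \<sigma>"
    by (simp only: distr_translation_exp_product[OF \<sigma>])
next
  fix A assume A: "A \<in> sets (config_space m)" and inv: "\<forall>l. translation m l -` A \<inter> space (config_space m) = A"
  have sp: "space (exp_product m \<sigma>) = space (config_space m)"
    by (rule sets_eq_imp_space_eq) simp
  have "(\<lambda>l. measure (exp_product m \<sigma>) (A \<inter> (translation m (int l) -` A \<inter> space (exp_product m \<sigma>)))) \<longlonglongrightarrow>
      measure (exp_product m \<sigma>) A * measure (exp_product m \<sigma>) A"
    by (rule mixing_exp_product[OF \<sigma>]) (use A in auto)
  then have "(\<lambda>l :: nat. measure (exp_product m \<sigma>) A) \<longlonglongrightarrow> measure (exp_product m \<sigma>) A * measure (exp_product m \<sigma>) A"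
    using inv by (simp add: sp)
  then have "measure (exp_product m \<sigma>) A = measure (exp_product m \<sigma>) A * measure (exp_product m \<sigma>) A"
    by (rule LIMSEQ_unique[OF tendsto_const])
  then show "measure (exp_product m \<sigma>) A = 0 \<or> measure (exp_product m \<sigma>) A = 1" by auto
qed

text \<open>Ergodicity is stated for strictly invariant sets, and the preimage of such a set is
  again strictly invariant because \<open>H\<close> commutes with translations at every point of the
  space. Covariance up to null sets would not give this directly.\<close>

lemma translation_ergodic_distr:
  assumes e: "translation_ergodic m \<mu>" and s [measurable_cong]: "sets \<mu> = sets (config_space m)"
    and H [measurable]: "H \<in> config_space m \<rightarrow>\<^sub>M config_space n"
    and eq: "\<And>\<eta> l. \<eta> \<in> space (config_space m) \<Longrightarrow> H (translation m l \<eta>) = translation n l (H \<eta>)"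
  shows "translation_ergodic n (distr \<mu> (config_space n) H)"
  unfolding translation_ergodic_def
proof (intro conjI allI ballI impI)
  have sp: "space \<mu> = space (config_space m)" by (rule sets_eq_imp_space_eq[OF s])
  fix l
  have "distr (distr \<mu> (config_space n) H) (config_space n) (translation n l) = distr \<mu> (config_space n) (translation n l \<circ> H)"
    by (rule distr_distr) measurable
  also have "\<dots> = distr \<mu> (config_space n) (H \<circ> translation m l)"
    by (rule distr_cong) (auto simp: eq sp)
  also have "\<dots> = distr (distr \<mu> (config_space m) (translation m l)) (config_space n) H"
    by (rule distr_distr[symmetric]) measurable
  also have "\<dots> = distr \<mu> (config_space n) H" using e by (simp add: translation_ergodic_def)
  finally show "distr (distr \<mu> (config_space n) H) (config_space n) (translation n l) = distr \<mu> (config_space n) H" .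
next
  have sp: "space \<mu> = space (config_space m)" by (rule sets_eq_imp_space_eq[OF s])
  fix A assume A: "A \<in> sets (config_space n)" and inv: "\<forall>l. translation n l -` A \<inter> space (config_space n) = A"
  let ?B = "H -` A \<inter> space (config_space m)"
  have "translation m l -` ?B \<inter> space (config_space m) = ?B" for l
  proof -
    have "translation m l \<eta> \<in> ?B \<longleftrightarrow> \<eta> \<in> ?B" if \<eta>: "\<eta> \<in> space (config_space m)" for \<eta>
    proof -
      have "H \<eta> \<in> space (config_space n)" using measurable_space[OF H \<eta>] .
      then have "translation n l (H \<eta>) \<in> A \<longleftrightarrow> H \<eta> \<in> A" using inv by blast
      then show ?thesis using \<eta> measurable_space[OF measurable_translation \<eta>] by (simp add: eq[OF \<eta>])
    qed
    then show ?thesis by blast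
  qed
  moreover have "?B \<in> sets (config_space m)" using H A by (rule measurable_sets)
  ultimately have "measure \<mu> ?B = 0 \<or> measure \<mu> ?B = 1" using e unfolding translation_ergodic_def by blast
  moreover have "measure (distr \<mu> (config_space n) H) A = measure \<mu> (H -` A \<inter> space \<mu>)"
    using A by (intro measure_distr) measurable
  ultimately show "measure (distr \<mu> (config_space n) H) A = 0 \<or> measure (distr \<mu> (config_space n) H) A = 1"
    by (simp add: sp)
qed

section \<open>Ergodicity of the multiline image\<close>

lemma queue_iter_shift: "queue_iter i (\<lambda>l. shift_seq s (\<zeta> l)) = shift_seq s (queue_iter i \<zeta>)"
  by (induction i \<zeta> rule: queue_iter.induct) (auto simp: queue_map_shift)

lemma multi_queue_translation: "multi_queue m (translation m l I) = translation m l (multi_queue m I)"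
proof
  fix i
  show "multi_queue m (translation m l I) i = translation m l (multi_queue m I) i"
  proof (cases "i \<in> {1..m}")
    case True
    then have "queue_iter i (\<lambda>j. translation m l I (i + 1 - j)) = queue_iter i (\<lambda>j. shift_seq l (I (i + 1 - j)))"
      by (intro queue_iter_cong) (auto simp: translation_def)
    then show ?thesis using True queue_iter_shift[where i = i and s = l and \<zeta> = "\<lambda>j. I (i + 1 - j)"] by (simp add: multi_queue_def translation_def)
  qed (auto simp: multi_queue_def translation_def)
qed

lemma translation_ergodic_mu_strict:
  assumes \<sigma>: "\<And>l. l \<in> {1..m} \<Longrightarrow> 0 < \<sigma> l"
  shows "translation_ergodic m (mu_strict m \<sigma>)"
  unfolding mu_strict_def
  by (rule translation_ergodic_distr[OF translation_ergodic_exp_product[OF \<sigma>]]) (auto simp: multi_queue_translation)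

section \<open>The measures \<open>\<mu>\<^sup>\<rho>\<close>\<close>

lemma exists_sorting_permutation:
  fixes \<rho> :: "nat \<Rightarrow> real"
  shows "\<exists>\<pi>. \<pi> permutes {1..n} \<and> mono_on {1..n} (\<rho> \<circ> \<pi>)"
proof -
  define xs where "xs = sort_key \<rho> [1..<Suc n]"
  have xs: "length xs = n" "distinct xs" "set xs = {1..n}" "sorted (map \<rho> xs)"
    by (auto simp: xs_def)
  define \<pi> where "\<pi> i = (if i \<in> {1..n} then xs ! (i - 1) else i)" for i
  have "bij_betw (\<lambda>i. i - 1) {1..n} {..<length xs}"
    by (rule bij_betwI[where g = Suc]) (auto simp: xs)
  moreover have "bij_betw ((!) xs) {..<length xs} {1..n}"
    by (rule bij_betw_nth) (use xs in auto)
  ultimately have "bij_betw ((!) xs \<circ> (\<lambda>i. i - 1)) {1..n} {1..n}" by (rule bij_betw_trans)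
  moreover have "\<pi> i = ((!) xs \<circ> (\<lambda>i. i - 1)) i" if "i \<in> {1..n}" for i
    using that by (simp add: \<pi>_def)
  ultimately have "bij_betw \<pi> {1..n} {1..n}"
    using bij_betw_cong[of "{1..n}" \<pi> "(!) xs \<circ> (\<lambda>i. i - 1)" "{1..n}"] by blast
  then have "\<pi> permutes {1..n}" by (rule bij_imp_permutes) (unfold \<pi>_def, rule if_not_P)
  moreover have "mono_on {1..n} (\<rho> \<circ> \<pi>)"
  proof (rule mono_onI)
    fix i j assume "i \<in> {1..n}" "j \<in> {1..n}" "i \<le> j"
    then show "(\<rho> \<circ> \<pi>) i \<le> (\<rho> \<circ> \<pi>) j"
      using sorted_nth_mono[OF xs(4), of "i - 1" "j - 1"] by (auto simp: \<pi>_def xs(1))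
  qed
  ultimately show ?thesis by blast
qed

text \<open>Induction on the length: the new last value either equals the value of the last block
  and extends it, or is larger and opens a block of its own.\<close>

lemma exists_block_decomposition:
  fixes \<rho> :: "nat \<Rightarrow> real"
  assumes "1 \<le> n" "mono_on {1..n} \<rho>" "\<And>i. i \<in> {1..n} \<Longrightarrow> 0 < \<rho> i"
  shows "\<exists>m \<sigma> b. block_decomposition n \<rho> m \<sigma> b"
  using assms
proof (induction n rule: dec_induct)
  case base
  have "block_decomposition 1 \<rho> 1 (\<lambda>_. \<rho> 1) (\<lambda>l. l)"
    using base by (auto simp: block_decomposition_def strict_mono_on_def)
  then show ?case by blast
next
  case (step n)
  have "mono_on {1..n} \<rho>" using step.prems(1) by (rule mono_on_subset) auto
  then obtain m \<sigma> b where bd: "block_decomposition n \<rho> m \<sigma> b"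
    using step by fastforce
  have m: "1 \<le> m" "m \<le> n" and \<sigma>0: "\<And>l. l \<in> {1..m} \<Longrightarrow> 0 < \<sigma> l" and \<sigma>m: "strict_mono_on {1..m} \<sigma>"
    and b: "b 1 = 1" "b (m + 1) = n + 1" "strict_mono_on {1..m + 1} b"
    and \<rho>: "\<And>l i. l \<in> {1..m} \<Longrightarrow> i \<in> {b l..<b (l + 1)} \<Longrightarrow> \<rho> i = \<sigma> l"
    using bd by (auto simp: block_decomposition_def)
  have bl: "b l < b l'" if "1 \<le> l" "l < l'" "l' \<le> m + 1" for l l'
    using strict_mono_onD[OF b(3), of l l'] that by auto
  have bn: "b l \<le> n" if "1 \<le> l" "l \<le> m" for l using bl[of l "m + 1"] that b(2) by auto
  have "\<rho> n = \<sigma> m" using \<rho>[of m n] bn[of m] b(2) m by auto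
  then have le: "\<sigma> m \<le> \<rho> (Suc n)" using mono_onD[OF step.prems(1), of n "Suc n"] step(1) by auto
  show ?case
  proof (cases "\<rho> (Suc n) = \<sigma> m")
    case True
    \<comment> \<open>Blocks are half-open, so the last one now ends at \<open>n + 2\<close>, one
      past the new index.\<close>
    have "block_decomposition (Suc n) \<rho> m \<sigma> (b(m + 1 := n + 2))"
      unfolding block_decomposition_def
    proof (intro conjI ballI)
      show "strict_mono_on {1..m + 1} (b(m + 1 := n + 2))"
      proof (rule strict_mono_onI)
        fix r s assume rs: "r \<in> {1..m + 1}" "s \<in> {1..m + 1}" "r < s"
        then show "(b(m + 1 := n + 2)) r < (b(m + 1 := n + 2)) s"
          using bl[of r s] bn[of r] by (cases "s = m + 1") auto
      qed
      fix l i assume l: "l \<in> {1..m}" and i: "i \<in> {(b(m + 1 := n + 2)) l..<(b(m + 1 := n + 2)) (l + 1)}"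
      show "\<rho> i = \<sigma> l"
      proof (cases "i = Suc n")
        case True
        have "l = m"
        proof (rule ccontr)
          assume "l \<noteq> m"
          then have "b (l + 1) \<le> n" using bn[of "l + 1"] l by auto
          then show False using i l True \<open>l \<noteq> m\<close> by auto
        qed
        then show ?thesis using True \<open>\<rho> (Suc n) = \<sigma> m\<close> by simp
      next
        case False
        then have "i \<in> {b l..<b (l + 1)}" using i l b(2) by (auto split: if_splits)
        then show ?thesis by (rule \<rho>[OF l])
      qed
    qed (use m b \<sigma>0 \<sigma>m in auto)
    then show ?thesis by blast
  next
    case False
    with le have lt: "\<sigma> m < \<rho> (Suc n)" by simp
    have "block_decomposition (Suc n) \<rho> (m + 1) (\<sigma>(m + 1 := \<rho> (Suc n))) (b(m + 2 := n + 2))"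
      unfolding block_decomposition_def
    proof (intro conjI ballI)
      show "strict_mono_on {1..m + 1 + 1} (b(m + 2 := n + 2))"
      proof (rule strict_mono_onI)
        fix r s assume rs: "r \<in> {1..m + 1 + 1}" "s \<in> {1..m + 1 + 1}" "r < s"
        have "b r \<le> n + 1" if "r \<le> m + 1" using bn[of r] b(2) rs that by (cases "r = m + 1") auto
        then show "(b(m + 2 := n + 2)) r < (b(m + 2 := n + 2)) s"
          using bl[of r s] rs by (cases "s = m + 2") auto
      qed
      show "strict_mono_on {1..m + 1} (\<sigma>(m + 1 := \<rho> (Suc n)))"
      proof (rule strict_mono_onI)
        fix r s assume rs: "r \<in> {1..m + 1}" "s \<in> {1..m + 1}" "r < s"
        have "\<sigma> r \<le> \<sigma> m" if "r \<le> m"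
          using strict_mono_onD[OF \<sigma>m, of r m] rs that by (cases "r = m") auto
        then show "(\<sigma>(m + 1 := \<rho> (Suc n))) r < (\<sigma>(m + 1 := \<rho> (Suc n))) s"
          using strict_mono_onD[OF \<sigma>m, of r s] rs lt by (cases "s = m + 1") auto
      qed
      show "0 < (\<sigma>(m + 1 := \<rho> (Suc n))) l" if "l \<in> {1..m + 1}" for l
        using \<sigma>0[of l] step.prems(2)[of "Suc n"] that by auto
      fix l i assume l: "l \<in> {1..m + 1}" and i: "i \<in> {(b(m + 2 := n + 2)) l..<(b(m + 2 := n + 2)) (l + 1)}"
      show "\<rho> i = (\<sigma>(m + 1 := \<rho> (Suc n))) l"
      proof (cases "l = m + 1")
        case True
        then show ?thesis using i b(2) by (auto simp: le_less_Suc_eq)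
      next
        case False
        then show ?thesis using \<rho>[of l i] i l by auto
      qed
    qed (use m b in auto)
    then show ?thesis by blast
  qed
qed

text \<open>The block containing \<open>i\<close> is the last one that starts at or before
  \<open>i\<close>. Uniqueness, from the monotonicity of the starting points, gives the definite
  description in \<open>mu_mono\<close> its meaning.\<close>

lemma block_index:
  assumes bd: "block_decomposition n \<rho> m \<sigma> b" and i: "i \<in> {1..n}"
  defines "f \<equiv> THE l. l \<in> {1..m} \<and> i \<in> {b l..<b (l + 1)}"
  shows "f \<in> {1..m}" "\<sigma> f = \<rho> i"
proof -
  have m: "1 \<le> m" and b: "b 1 = 1" "b (m + 1) = n + 1" "strict_mono_on {1..m + 1} b"
    and \<rho>: "\<And>l i. l \<in> {1..m} \<Longrightarrow> i \<in> {b l..<b (l + 1)} \<Longrightarrow> \<rho> i = \<sigma> l"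
    using bd by (auto simp: block_decomposition_def)
  have bl: "b l \<le> b l'" if "1 \<le> l" "l \<le> l'" "l' \<le> m + 1" for l l'
    using strict_mono_onD[OF b(3), of l l'] that by (cases "l = l'") auto
  define S where "S = {l\<in>{1..m}. b l \<le> i}"
  have S: "finite S" "S \<noteq> {}" using m b(1) i by (auto simp: S_def)
  then have M: "Max S \<in> S" "\<And>l. l \<in> S \<Longrightarrow> l \<le> Max S" by auto
  have "i < b (Max S + 1)"
  proof (rule ccontr)
    assume "\<not> i < b (Max S + 1)"
    moreover have "Max S \<noteq> m" using calculation b(2) i by auto
    ultimately have "Max S + 1 \<in> S" using M(1) by (auto simp: S_def)
    then show False using M(2) by fastforce
  qed
  then have ex: "Max S \<in> {1..m} \<and> i \<in> {b (Max S)..<b (Max S + 1)}" using M(1) by (auto simp: S_def)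
  have uniq: "l = l'" if "l \<in> {1..m} \<and> i \<in> {b l..<b (l + 1)}" "l' \<in> {1..m} \<and> i \<in> {b l'..<b (l' + 1)}" for l l'
    using bl[of "l + 1" l'] bl[of "l' + 1" l] that by (cases l l' rule: linorder_cases) auto
  have "f \<in> {1..m} \<and> i \<in> {b f..<b (f + 1)}"
    unfolding f_def by (rule theI') (use uniq ex in blast)
  then show "f \<in> {1..m}" "\<sigma> f = \<rho> i" using \<rho> by auto
qed

text \<open>Copies line \<open>f i\<close> into component \<open>i\<close>. Both the repetition of
  lines within blocks and the permutation of components are of this form, and such maps
  compose.\<close>

definition select :: "nat \<Rightarrow> (nat \<Rightarrow> nat) \<Rightarrow> config \<Rightarrow> config" where
  "select n f \<zeta> = (\<lambda>i\<in>{1..n}. \<zeta> (f i))"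

lemma measurable_select:
  assumes "\<And>i. i \<in> {1..n} \<Longrightarrow> f i \<in> {1..m}"
  shows "select n f \<in> config_space m \<rightarrow>\<^sub>M config_space n"
  unfolding select_def using assms
  by (intro measurable_config_spaceI measurable_config_component[where n = m]) auto

text \<open>The choices of a sorting permutation and of a block decomposition are absorbed into one
  index map \<open>f\<close>. All properties of \<open>mu\<close> can then be carried over from the
  strictly increasing case through \<open>select\<close>, without returning to the choices.\<close>

theorem mu_eq_select:
  assumes n: "0 < n" and \<rho>: "\<forall>i\<in>{1..n}. \<rho> i > 1"
  obtains m \<sigma> f where "\<And>l. l \<in> {1..m} \<Longrightarrow> 1 < \<sigma> l" "strict_mono_on {1..m} \<sigma>"
    "\<And>i. i \<in> {1..n} \<Longrightarrow> f i \<in> {1..m}" "\<And>i. i \<in> {1..n} \<Longrightarrow> \<sigma> (f i) = \<rho> i"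
    "mu n \<rho> = distr (mu_strict m \<sigma>) (config_space n) (select n f)"
proof -
  define \<pi> where "\<pi> = (SOME \<pi>. \<pi> permutes {1..n} \<and> mono_on {1..n} (\<rho> \<circ> \<pi>))"
  have "\<pi> permutes {1..n} \<and> mono_on {1..n} (\<rho> \<circ> \<pi>)"
    unfolding \<pi>_def by (rule someI_ex[OF exists_sorting_permutation])
  then have \<pi>: "\<pi> permutes {1..n}" "mono_on {1..n} (\<rho> \<circ> \<pi>)" by auto
  have \<rho>': "1 < (\<rho> \<circ> \<pi>) i" if "i \<in> {1..n}" for i
    using \<rho> permutes_in_image[OF \<pi>(1), of i] that by simp
  obtain m \<sigma> b where s: "(SOME (m, \<sigma>, b). block_decomposition n (\<rho> \<circ> \<pi>) m \<sigma> b) = (m, \<sigma>, b)"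
    by (metis prod_cases3)
  have "\<exists>x. case x of (m, \<sigma>, b) \<Rightarrow> block_decomposition n (\<rho> \<circ> \<pi>) m \<sigma> b"
  proof -
    have "0 < (\<rho> \<circ> \<pi>) i" if "i \<in> {1..n}" for i using \<rho>'[OF that] by linarith
    then show ?thesis using exists_block_decomposition[of n "\<rho> \<circ> \<pi>"] n \<pi>(2) by auto
  qed
  from someI_ex[OF this] have bd: "block_decomposition n (\<rho> \<circ> \<pi>) m \<sigma> b" unfolding s by simp
  define f0 where "f0 i = (THE l. l \<in> {1..m} \<and> i \<in> {b l..<b (l + 1)})" for i
  define f where "f = f0 \<circ> inv \<pi>"
  have f0: "f0 i \<in> {1..m}" "\<sigma> (f0 i) = (\<rho> \<circ> \<pi>) i" if "i \<in> {1..n}" for i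
    using block_index[OF bd that] by (auto simp: f0_def)
  have inv: "inv \<pi> i \<in> {1..n}" if "i \<in> {1..n}" for i
    using permutes_in_image[OF permutes_inv[OF \<pi>(1)], of i] that by simp
  have f: "f i \<in> {1..m}" "\<sigma> (f i) = \<rho> i" if "i \<in> {1..n}" for i
    using f0[OF inv[OF that]] permutes_inverses(1)[OF \<pi>(1), of i] by (simp_all add: f_def)
  have "mu_mono n (\<rho> \<circ> \<pi>) = distr (mu_strict m \<sigma>) (config_space n) (select n f0)"
    unfolding mu_mono_def s select_def f0_def by simp
  then have "mu n \<rho> = distr (distr (mu_strict m \<sigma>) (config_space n) (select n f0)) (config_space n) (select n (inv \<pi>))"
    unfolding mu_def \<pi>_def[symmetric] select_def by simp
  also have "\<dots> = distr (mu_strict m \<sigma>) (config_space n) (select n (inv \<pi>) \<circ> select n f0)"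
    by (rule distr_distr) (use measurable_select inv f0 in \<open>auto simp: mu_strict_def\<close>)
  also have "select n (inv \<pi>) \<circ> select n f0 = select n f"
    using inv by (auto simp: select_def f_def fun_eq_iff)
  finally have mu: "mu n \<rho> = distr (mu_strict m \<sigma>) (config_space n) (select n f)" .
  \<comment> \<open>Every block is nonempty, so \<open>\<sigma> l\<close> is one of the values of
    \<open>\<rho>\<close>.\<close>
  have \<sigma>: "1 < \<sigma> l" if l: "l \<in> {1..m}" for l
  proof -
    have b: "b 1 = 1" "b (m + 1) = n + 1" "strict_mono_on {1..m + 1} b"
      and eq: "\<And>l i. l \<in> {1..m} \<Longrightarrow> i \<in> {b l..<b (l + 1)} \<Longrightarrow> (\<rho> \<circ> \<pi>) i = \<sigma> l"
      using bd by (auto simp: block_decomposition_def)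
    have "b l < b (l + 1)" "b 1 \<le> b l" "b (l + 1) \<le> b (m + 1)"
      using l strict_mono_onD[OF b(3), of l "l + 1"] strict_mono_onD[OF b(3), of 1 l]
        strict_mono_onD[OF b(3), of "l + 1" "m + 1"] by (cases "l = 1"; cases "l = m"; auto)+
    then show ?thesis using eq[OF l, of "b l"] \<rho>'[of "b l"] b by auto
  qed
  show thesis
    by (rule that[OF \<sigma> _ f mu]) (use bd in \<open>auto simp: block_decomposition_def\<close>)
qed

lemma
  assumes n: "0 < n" and \<rho>: "\<forall>i\<in>{1..n}. \<rho> i > 1"
  shows prob_space_mu: "prob_space (mu n \<rho>)"
    and sets_mu: "sets (mu n \<rho>) = sets (config_space n)"
    and translation_ergodic_mu: "translation_ergodic n (mu n \<rho>)"
    and distr_mu_component: "i \<in> {1..n} \<Longrightarrow> distr (mu n \<rho>) (exp_seq (\<rho> i)) (\<lambda>\<eta>. \<eta> i) = exp_seq (\<rho> i)"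
    and mu_serve: "distr (exp_seq 1 \<Otimes>\<^sub>M mu n \<rho>) (config_space n) (serve n) = mu n \<rho>"
proof -
  obtain m \<sigma> f where \<sigma>: "\<And>l. l \<in> {1..m} \<Longrightarrow> 1 < \<sigma> l" "strict_mono_on {1..m} \<sigma>"
    and f: "\<And>i. i \<in> {1..n} \<Longrightarrow> f i \<in> {1..m}" "\<And>i. i \<in> {1..n} \<Longrightarrow> \<sigma> (f i) = \<rho> i"
    and mu: "mu n \<rho> = distr (mu_strict m \<sigma>) (config_space n) (select n f)"
    using mu_eq_select[OF n \<rho>] by metis
  have pos: "0 < \<sigma> l" if "l \<in> {1..m}" for l using \<sigma>(1)[OF that] by simp
  note [measurable] = measurable_select[OF f(1)]
  interpret MS: prob_space "mu_strict m \<sigma>" by (rule prob_space_mu_strict[OF pos])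
  show p: "prob_space (mu n \<rho>)" unfolding mu by (rule MS.prob_space_distr) measurable
  show "sets (mu n \<rho>) = sets (config_space n)" unfolding mu by simp
  show "translation_ergodic n (mu n \<rho>)"
    unfolding mu
  proof (rule translation_ergodic_distr[OF translation_ergodic_mu_strict[OF pos]])
    show "select n f (translation m l \<eta>) = translation n l (select n f \<eta>)" for \<eta> l
      using f(1) by (auto simp: select_def translation_def fun_eq_iff)
  qed auto
  show "distr (mu n \<rho>) (exp_seq (\<rho> i)) (\<lambda>\<eta>. \<eta> i) = exp_seq (\<rho> i)" if i: "i \<in> {1..n}"
  proof -
    have [measurable]: "(\<lambda>\<eta>. \<eta> i) \<in> config_space n \<rightarrow>\<^sub>M seq_space"
      by (rule measurable_config_component[OF _ i]) simp
    have "distr (mu n \<rho>) (exp_seq (\<rho> i)) (\<lambda>\<eta>. \<eta> i) = distr (mu_strict m \<sigma>) (exp_seq (\<rho> i)) ((\<lambda>\<eta>. \<eta> i) \<circ> select n f)"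
      unfolding mu by (rule distr_distr) measurable
    also have "\<dots> = distr (mu_strict m \<sigma>) (exp_seq (\<sigma> (f i))) (\<lambda>\<eta>. \<eta> (f i))"
      by (rule distr_cong) (use i f in \<open>auto simp: select_def\<close>)
    also have "\<dots> = exp_seq (\<sigma> (f i))" by (rule distr_mu_strict_component[OF pos \<sigma>(2) f(1)[OF i]])
    finally show ?thesis using f(2)[OF i] by simp
  qed
  show "distr (exp_seq 1 \<Otimes>\<^sub>M mu n \<rho>) (config_space n) (serve n) = mu n \<rho>"
  proof -
    let ?W = "exp_seq 1"
    interpret W: prob_space ?W by (rule prob_space_exp_seq) simp
    have [measurable_cong]: "sets (?W \<Otimes>\<^sub>M mu_strict m \<sigma>) = sets (seq_space \<Otimes>\<^sub>M config_space m)"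
      by (intro sets_pair_measure_cong) auto
    have "distr ?W seq_space (\<lambda>w. w) \<Otimes>\<^sub>M distr (mu_strict m \<sigma>) (config_space n) (select n f) =
        distr (?W \<Otimes>\<^sub>M mu_strict m \<sigma>) (seq_space \<Otimes>\<^sub>M config_space n) (\<lambda>(w, \<eta>). (w, select n f \<eta>))"
    proof (rule pair_measure_distr)
      show "sigma_finite_measure (distr (mu_strict m \<sigma>) (config_space n) (select n f))"
        using p unfolding mu by (rule prob_space_imp_sigma_finite)
    qed measurable
    moreover have "distr ?W seq_space (\<lambda>w. w) = ?W" by (rule distr_id2) simp
    ultimately have "distr (?W \<Otimes>\<^sub>M mu n \<rho>) (config_space n) (serve n) =
        distr (?W \<Otimes>\<^sub>M mu_strict m \<sigma>) (config_space n) (serve n \<circ> (\<lambda>(w, \<eta>). (w, select n f \<eta>)))"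
      unfolding mu by (simp only:) (rule distr_distr, measurable)
    \<comment> \<open>Serving acts on each component separately and with the same services, hence
      commutes with copying components.\<close>
    also have "\<dots> = distr (?W \<Otimes>\<^sub>M mu_strict m \<sigma>) (config_space n) (select n f \<circ> serve m)"
      by (rule distr_cong) (use f(1) in \<open>auto simp: serve_def select_def\<close>)
    also have "\<dots> = distr (distr (?W \<Otimes>\<^sub>M mu_strict m \<sigma>) (config_space m) (serve m)) (config_space n) (select n f)"
      by (rule distr_distr[symmetric]) measurable
    also have "distr (?W \<Otimes>\<^sub>M mu_strict m \<sigma>) (config_space m) (serve m) = mu_strict m \<sigma>"
      by (rule mu_strict_invariant[OF \<sigma>])
    also have "distr (mu_strict m \<sigma>) (config_space n) (select n f) = mu n \<rho>" by (rule mu[symmetric])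
    finally show ?thesis .
  qed
qed

section \<open>Means and almost sure averages under \<open>mu n \<rho>\<close>\<close>

lemma exp_dist_integrable: "0 < \<sigma> \<Longrightarrow> integrable (exp_dist \<sigma>) (\<lambda>x. x)"
  and exp_dist_mean: "0 < \<sigma> \<Longrightarrow> (\<integral>x. x \<partial>exp_dist \<sigma>) = \<sigma>"
proof -
  assume \<sigma>: "0 < \<sigma>"
  interpret prob_space "exp_dist \<sigma>" by (rule prob_space_exp_dist[OF \<sigma>])
  have "distr (exp_dist \<sigma>) lborel (\<lambda>x. x) = exp_dist \<sigma>" by (rule distr_id2) simp
  then have D: "distributed (exp_dist \<sigma>) lborel (\<lambda>x. x) (exponential_density (1 / \<sigma>))"
    unfolding distributed_def by (auto simp: exp_dist_def)
  show "(\<integral>x. x \<partial>exp_dist \<sigma>) = \<sigma>" using exponential_distributed_expectation[OF _ D] \<sigma> by simp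
  show "integrable (exp_dist \<sigma>) (\<lambda>x. x)" using erlang_ith_moment_integrable[OF _ D, of 1] \<sigma> by simp
qed

lemma has_means_mu:
  assumes n: "0 < n" and \<rho>: "\<forall>i\<in>{1..n}. \<rho> i > 1"
  shows "has_means n \<rho> (mu n \<rho>)"
  unfolding has_means_def
proof (intro ballI allI)
  fix i k assume i: "i \<in> {1..n}"
  have \<rho>i: "0 < \<rho> i" using \<rho> i by force
  note [measurable_cong] = sets_mu[OF n \<rho>]
  have [measurable]: "(\<lambda>\<eta>. \<eta> i) \<in> config_space n \<rightarrow>\<^sub>M seq_space"
    by (rule measurable_config_component[OF _ i]) simp
  have "distr (mu n \<rho>) (exp_dist (\<rho> i)) (\<lambda>\<eta>. \<eta> i k) =
      distr (distr (mu n \<rho>) (exp_seq (\<rho> i)) (\<lambda>\<eta>. \<eta> i)) (exp_dist (\<rho> i)) (\<lambda>x. x k)"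
    by (subst distr_distr) (auto simp: comp_def)
  also have "\<dots> = exp_dist (\<rho> i)"
    unfolding distr_mu_component[OF n \<rho> i] unfolding exp_seq_def
    by (rule distr_PiM_component) (auto intro: prob_space_exp_dist[OF \<rho>i])
  finally have law: "distr (mu n \<rho>) (exp_dist (\<rho> i)) (\<lambda>\<eta>. \<eta> i k) = exp_dist (\<rho> i)" .
  have m: "(\<lambda>\<eta>. \<eta> i k) \<in> mu n \<rho> \<rightarrow>\<^sub>M exp_dist (\<rho> i)"
  proof -
    have "(\<lambda>\<eta>. \<eta> i) \<in> mu n \<rho> \<rightarrow>\<^sub>M seq_space"
      by (rule measurable_config_component[OF _ i]) simp
    from measurable_seq_component[OF this, of k] show ?thesis
      unfolding measurable_cong_sets[OF refl sets_exp_dist] .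
  qed
  show "integrable (mu n \<rho>) (\<lambda>\<eta>. \<eta> i k) \<and> (\<integral>\<eta>. \<eta> i k \<partial>mu n \<rho>) = \<rho> i"
    using integrable_distr_eq[OF m, of "\<lambda>x. x"] integral_distr[OF m, of "\<lambda>x. x"]
      exp_dist_integrable[OF \<rho>i] exp_dist_mean[OF \<rho>i] by (simp add: law)
qed

lemma prob_measure_on_states_mu:
  assumes n: "0 < n" and \<rho>: "\<forall>i\<in>{1..n}. \<rho> i > 1"
  shows "prob_measure_on_states n (mu n \<rho>)"
proof -
  note [measurable_cong] = sets_mu[OF n \<rho>]
  have "AE \<eta> in mu n \<rho>. \<forall>i\<in>{1..n}. (\<forall>k. 0 \<le> \<eta> i k) \<and> has_avg (\<eta> i) (\<rho> i)"
  proof (rule AE_finite_allI)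
    fix i assume i: "i \<in> {1..n}"
    have \<rho>i: "0 < \<rho> i" using \<rho> i by force
    have [measurable]: "(\<lambda>\<eta>. \<eta> i) \<in> config_space n \<rightarrow>\<^sub>M seq_space"
      by (rule measurable_config_component[OF _ i]) simp
    have "AE x in distr (mu n \<rho>) (exp_seq (\<rho> i)) (\<lambda>\<eta>. \<eta> i). (\<forall>k. 0 \<le> x k) \<and> has_avg x (\<rho> i)"
      unfolding distr_mu_component[OF n \<rho> i]
      using AE_exp_seq_nonneg[OF \<rho>i] AE_exp_seq_avg[OF \<rho>i] by eventually_elim auto
    then show "AE \<eta> in mu n \<rho>. (\<forall>k. 0 \<le> \<eta> i k) \<and> has_avg (\<eta> i) (\<rho> i)"
      by (rule AE_distrD[rotated]) measurable
  qed simp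
  moreover have "AE \<eta> in mu n \<rho>. \<eta> \<in> space (config_space n)"
    using AE_space[of "mu n \<rho>"] sets_eq_imp_space_eq[OF sets_mu[OF n \<rho>]] by simp
  ultimately have "AE \<eta> in mu n \<rho>. \<eta> \<in> state_space n"
  proof eventually_elim
    case (elim \<eta>)
    have "\<exists>L>1. ((\<lambda>m::int. (\<Sum>k=m..0. \<eta> i k) / real_of_int \<bar>m\<bar>) \<longlongrightarrow> L) at_bot" if "i \<in> {1..n}" for i
      using elim(1) \<rho> that has_avg_iff_at_bot[of "\<eta> i" "\<rho> i"] by blast
    then show ?case using elim by (simp add: state_space_def)
  qed
  then show ?thesis
    using prob_space_mu[OF n \<rho>] sets_mu[OF n \<rho>] by (simp add: prob_measure_on_states_def)
qed

section \<open>Reduction of invariance to a single queueing step\<close>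

definition weight_space :: "(int \<times> nat \<Rightarrow> real) measure" where
  "weight_space = Pi\<^sub>M sites (\<lambda>_. exp_dist 1)"

abbreviation site_space :: "(int \<times> nat \<Rightarrow> real) measure" where
  "site_space \<equiv> Pi\<^sub>M sites (\<lambda>_. borel)"

definition first_row :: "(int \<times> nat \<Rightarrow> real) \<Rightarrow> int \<Rightarrow> real" where
  "first_row \<omega> = (\<lambda>i. \<omega> (i, 1))"

text \<open>The weights as seen one time step later, restricted again to
  \<open>sites\<close>.\<close>

definition drop_row :: "(int \<times> nat \<Rightarrow> real) \<Rightarrow> (int \<times> nat \<Rightarrow> real)" where
  "drop_row \<omega> = (\<lambda>x\<in>sites. \<omega> (fst x, Suc (snd x)))"

definition add_row :: "(int \<Rightarrow> real) \<Rightarrow> (int \<times> nat \<Rightarrow> real) \<Rightarrow> (int \<times> nat \<Rightarrow> real)" where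
  "add_row w \<omega> = (\<lambda>x\<in>sites. if snd x = 1 then w (fst x) else \<omega> (fst x, snd x - 1))"

lemma sets_weight_space [measurable_cong, simp]: "sets weight_space = sets site_space"
  unfolding weight_space_def by (rule sets_PiM_cong) auto

lemma space_weight_space: "space weight_space = sites \<rightarrow>\<^sub>E UNIV"
  by (simp add: weight_space_def space_PiM)

lemma prob_space_weight_space: "prob_space weight_space"
  unfolding weight_space_def by (intro prob_space_PiM prob_space_exp_dist) simp

lemma measurable_site: "x \<in> sites \<Longrightarrow> (\<lambda>\<omega>. \<omega> x) \<in> borel_measurable site_space"
  by (rule measurable_component_singleton)

lemma measurable_first_row [measurable]: "first_row \<in> site_space \<rightarrow>\<^sub>M seq_space"
  unfolding first_row_def by (rule measurable_seq_spaceI) (auto intro!: measurable_site simp: sites_def)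

lemma measurable_drop_row [measurable]: "drop_row \<in> site_space \<rightarrow>\<^sub>M site_space"
  unfolding drop_row_def by (rule measurable_restrict) (auto intro!: measurable_site simp: sites_def)

lemma measurable_add_row [measurable]: "(\<lambda>(w, \<omega>). add_row w \<omega>) \<in> seq_space \<Otimes>\<^sub>M site_space \<rightarrow>\<^sub>M site_space"
  unfolding add_row_def case_prod_beta
proof (rule measurable_restrict)
  fix x assume x: "x \<in> sites"
  show "(\<lambda>z. if snd x = 1 then fst z (fst x) else snd z (fst x, snd x - 1)) \<in> borel_measurable (seq_space \<Otimes>\<^sub>M site_space)"
  proof (cases "snd x = 1")
    case True
    have "(\<lambda>z. fst z (fst x)) \<in> borel_measurable (seq_space \<Otimes>\<^sub>M site_space)"
      by (rule measurable_seq_component[OF measurable_fst])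
    then show ?thesis unfolding if_P[OF True] .
  next
    case False
    then have m: "(fst x, snd x - 1) \<in> sites" using x by (auto simp: sites_def)
    have "(\<lambda>z. snd z (fst x, snd x - 1)) \<in> borel_measurable (seq_space \<Otimes>\<^sub>M site_space)"
      by (rule measurable_compose[OF measurable_snd measurable_site[OF m]])
    then show ?thesis unfolding if_not_P[OF False] .
  qed
qed

lemma first_row_add_row: "first_row (add_row w \<omega>) = w"
  by (auto simp: first_row_def add_row_def sites_def)

lemma drop_row_add_row: "\<omega> \<in> space site_space \<Longrightarrow> drop_row (add_row w \<omega>) = \<omega>"
  by (auto simp: drop_row_def add_row_def sites_def space_PiM fun_eq_iff PiE_iff extensional_def)

text \<open>Inserting an independent first row and moving the other rows up reproduces the law of
  the weights. On cylinder sets this amounts to splitting the finite index set into its first row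
  and the rest. Read backwards, it says that the first row is independent of the weights of all
  later steps.\<close>

lemma distr_add_row: "distr (exp_seq 1 \<Otimes>\<^sub>M weight_space) site_space (\<lambda>(w, \<omega>). add_row w \<omega>) = weight_space"
proof -
  interpret E: prob_space "exp_dist 1" by (rule prob_space_exp_dist) simp
  interpret W: prob_space "exp_seq 1" by (rule prob_space_exp_seq) simp
  interpret O: prob_space weight_space by (rule prob_space_weight_space)
  interpret P: product_prob_space "\<lambda>_ :: int \<times> nat. exp_dist 1" sites by unfold_locales
  interpret R: product_prob_space "\<lambda>_ :: int. exp_dist 1" UNIV by unfold_locales
  let ?Q = "exp_seq 1 \<Otimes>\<^sub>M weight_space"
  have [measurable_cong]: "sets ?Q = sets (seq_space \<Otimes>\<^sub>M site_space)"
    by (intro sets_pair_measure_cong) auto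
  let ?emb = "prod_emb sites (\<lambda>_. exp_dist 1)"
  show ?thesis
    unfolding weight_space_def[symmetric]
  proof (subst (2) weight_space_def, rule P.PiM_eq)
    show "sets (distr ?Q site_space (\<lambda>(w, \<omega>). add_row w \<omega>)) = sets (Pi\<^sub>M sites (\<lambda>_. exp_dist 1))"
      by (simp add: sets_weight_space[unfolded weight_space_def])
    fix J F assume J: "finite J" "J \<subseteq> sites" and F: "\<And>j. j \<in> J \<Longrightarrow> F j \<in> sets (exp_dist 1)"
    define J1 where "J1 = {i. (i, 1) \<in> J}"
    define J2 where "J2 = {x \<in> sites. (fst x, Suc (snd x)) \<in> J}"
    have J1: "finite J1" unfolding J1_def using J(1) by (rule finite_subset[rotated, OF finite_imageI[of _ fst]]) force
    have J2: "finite J2" "J2 \<subseteq> sites"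
    proof -
      have "J2 \<subseteq> (\<lambda>x. (fst x, snd x - 1)) ` J" unfolding J2_def by force
      then show "finite J2" by (rule finite_subset) (use J(1) in simp)
    qed (auto simp: J2_def)
    have Jeq: "J = (\<lambda>i. (i, 1)) ` J1 \<union> (\<lambda>x. (fst x, Suc (snd x))) ` J2"
    proof (rule set_eqI)
      fix x :: "int \<times> nat"
      obtain i t where x: "x = (i, t)" by (cases x)
      show "x \<in> J \<longleftrightarrow> x \<in> (\<lambda>i. (i, 1)) ` J1 \<union> (\<lambda>x. (fst x, Suc (snd x))) ` J2"
      proof
        assume xJ: "x \<in> J"
        then have "1 \<le> t" using J(2) x by (auto simp: sites_def)
        then consider "t = 1" | s where "t = Suc s" "1 \<le> s" by (cases t) (auto simp: le_Suc_eq)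
        then show "x \<in> (\<lambda>i. (i, 1)) ` J1 \<union> (\<lambda>x. (fst x, Suc (snd x))) ` J2"
        proof cases
          case 1
          then show ?thesis using xJ x by (auto simp: J1_def)
        next
          case 2
          then have "(i, s) \<in> J2" using xJ x by (auto simp: J2_def sites_def)
          then show ?thesis using x 2 by force
        qed
      qed (auto simp: J1_def J2_def)
    qed
    have disj: "(\<lambda>i. (i, 1)) ` J1 \<inter> (\<lambda>x. (fst x, Suc (snd x))) ` J2 = {}"
      using J2(2) by (auto simp: sites_def)
    let ?A = "prod_emb UNIV (\<lambda>_. exp_dist 1) J1 (Pi\<^sub>E J1 (\<lambda>i. F (i, 1)))"
    let ?B = "?emb J2 (Pi\<^sub>E J2 (\<lambda>x. F (fst x, Suc (snd x))))"
    have Jm: "?emb J (Pi\<^sub>E J F) \<in> sets site_space"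
    proof -
      have "?emb J (Pi\<^sub>E J F) \<in> sets (Pi\<^sub>M sites (\<lambda>_. exp_dist 1))" by (rule sets_PiM_I) (use J F in auto)
      then show ?thesis by (simp add: sets_weight_space[unfolded weight_space_def])
    qed
    have vim: "(\<lambda>(w, \<omega>). add_row w \<omega>) -` ?emb J (Pi\<^sub>E J F) \<inter> space ?Q = ?A \<times> ?B"
    proof -
      have "add_row w \<omega> \<in> ?emb J (Pi\<^sub>E J F) \<longleftrightarrow> w \<in> ?A \<and> \<omega> \<in> ?B" if "\<omega> \<in> space weight_space" for w \<omega>
      proof -
        have "add_row w \<omega> \<in> ?emb J (Pi\<^sub>E J F) \<longleftrightarrow> (\<forall>x\<in>J. add_row w \<omega> x \<in> F x)"
          using J(2) by (auto simp: prod_emb_def add_row_def PiE_iff)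
        also have "\<dots> \<longleftrightarrow> (\<forall>i\<in>J1. w i \<in> F (i, 1)) \<and> (\<forall>x\<in>J2. \<omega> x \<in> F (fst x, Suc (snd x)))"
        proof -
          have "add_row w \<omega> (i, 1) = w i" for i by (simp add: add_row_def sites_def)
          moreover have "add_row w \<omega> (fst x, Suc (snd x)) = \<omega> x" if "x \<in> J2" for x
            using J2(2) that by (auto simp: add_row_def sites_def)
          ultimately show ?thesis by (subst Jeq) (simp add: ball_Un)
        qed
        also have "\<dots> \<longleftrightarrow> w \<in> ?A \<and> \<omega> \<in> ?B"
          using J2(2) that by (auto simp: prod_emb_def PiE_iff space_weight_space)
        finally show ?thesis .
      qed
      moreover have "?B \<subseteq> space weight_space" by (auto simp: prod_emb_def space_weight_space)
      ultimately show ?thesis by (auto simp: space_pair_measure)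
    qed
    have AB: "?A \<in> sets (exp_seq 1)" "?B \<in> sets weight_space"
      unfolding exp_seq_def weight_space_def by (rule sets_PiM_I; use J1 J2 F in \<open>auto simp: J1_def J2_def\<close>)+
    have "emeasure (distr ?Q site_space (\<lambda>(w, \<omega>). add_row w \<omega>)) (?emb J (Pi\<^sub>E J F)) = emeasure ?Q (?A \<times> ?B)"
      using Jm by (subst emeasure_distr) (auto simp: vim)
    also have "\<dots> = emeasure (exp_seq 1) ?A * emeasure weight_space ?B"
      by (rule O.emeasure_pair_measure_Times[OF AB])
    also have "emeasure (exp_seq 1) ?A = (\<Prod>i\<in>J1. emeasure (exp_dist 1) (F (i, 1)))"
      unfolding exp_seq_def by (rule R.emeasure_PiM_emb) (use J1 F in \<open>auto simp: J1_def\<close>)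
    also have "emeasure weight_space ?B = (\<Prod>x\<in>J2. emeasure (exp_dist 1) (F (fst x, Suc (snd x))))"
      unfolding weight_space_def by (rule P.emeasure_PiM_emb) (use J2 F in \<open>auto simp: J2_def\<close>)
    also have "(\<Prod>i\<in>J1. emeasure (exp_dist 1) (F (i, 1))) * (\<Prod>x\<in>J2. emeasure (exp_dist 1) (F (fst x, Suc (snd x)))) =
        (\<Prod>x\<in>J. emeasure (exp_dist 1) (F x))"
      unfolding Jeq using J1 J2 disj
      by (subst prod.union_disjoint) (auto simp: prod.reindex inj_on_def prod_eq_iff)
    finally show "emeasure (distr ?Q site_space (\<lambda>(w, \<omega>). add_row w \<omega>)) (?emb J (Pi\<^sub>E J F)) = (\<Prod>j\<in>J. emeasure (exp_dist 1) (F j))" .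
  qed
qed

lemma distr_split_rows:
  "distr weight_space (seq_space \<Otimes>\<^sub>M site_space) (\<lambda>\<omega>. (first_row \<omega>, drop_row \<omega>)) = exp_seq 1 \<Otimes>\<^sub>M weight_space"
proof -
  let ?Q = "exp_seq 1 \<Otimes>\<^sub>M weight_space"
  have s [measurable_cong]: "sets ?Q = sets (seq_space \<Otimes>\<^sub>M site_space)"
    by (intro sets_pair_measure_cong) auto
  have "distr weight_space (seq_space \<Otimes>\<^sub>M site_space) (\<lambda>\<omega>. (first_row \<omega>, drop_row \<omega>)) =
      distr (distr ?Q site_space (\<lambda>(w, \<omega>). add_row w \<omega>)) (seq_space \<Otimes>\<^sub>M site_space) (\<lambda>\<omega>. (first_row \<omega>, drop_row \<omega>))"
    by (simp add: distr_add_row)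
  also have "\<dots> = distr ?Q (seq_space \<Otimes>\<^sub>M site_space) ((\<lambda>\<omega>. (first_row \<omega>, drop_row \<omega>)) \<circ> (\<lambda>(w, \<omega>). add_row w \<omega>))"
    by (rule distr_distr) measurable
  also have "\<dots> = distr ?Q (seq_space \<Otimes>\<^sub>M site_space) (\<lambda>x. x)"
  proof (rule distr_cong)
    fix x assume "x \<in> space ?Q"
    then have "snd x \<in> space site_space"
      unfolding space_pair_measure sets_eq_imp_space_eq[OF sets_weight_space] mem_Times_iff by (rule conjunct2)
    then show "((\<lambda>\<omega>. (first_row \<omega>, drop_row \<omega>)) \<circ> (\<lambda>(w, \<omega>). add_row w \<omega>)) x = x"
      by (cases x) (simp add: first_row_add_row drop_row_add_row)
  qed auto
  also have "\<dots> = ?Q" by (rule distr_id2) (rule s[symmetric])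
  finally show ?thesis .
qed

definition advance :: "nat \<Rightarrow> config \<times> (int \<times> nat \<Rightarrow> real) \<Rightarrow> config \<times> (int \<times> nat \<Rightarrow> real)" where
  "advance n = (\<lambda>(\<eta>, \<omega>). (serve n (first_row \<omega>, \<eta>), drop_row \<omega>))"

lemma measurable_advance [measurable]:
  "advance n \<in> config_space n \<Otimes>\<^sub>M site_space \<rightarrow>\<^sub>M config_space n \<Otimes>\<^sub>M site_space"
  unfolding advance_def by measurable

text \<open>First row, configuration and remaining rows are independent, and Fubini's theorem
  regroups them so that \<open>serve\<close> can be applied to the first two.\<close>

lemma distr_config_first_row:
  assumes \<mu>: "prob_space \<mu>" and s [measurable_cong]: "sets \<mu> = sets (config_space n)"
  shows "distr (\<mu> \<Otimes>\<^sub>M weight_space) (seq_space \<Otimes>\<^sub>M config_space n) (\<lambda>(\<eta>, \<omega>). (first_row \<omega>, \<eta>)) = exp_seq 1 \<Otimes>\<^sub>M \<mu>"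
    and "distr (\<mu> \<Otimes>\<^sub>M weight_space) ((seq_space \<Otimes>\<^sub>M config_space n) \<Otimes>\<^sub>M site_space) (\<lambda>(\<eta>, \<omega>). ((first_row \<omega>, \<eta>), drop_row \<omega>)) =
      (exp_seq 1 \<Otimes>\<^sub>M \<mu>) \<Otimes>\<^sub>M weight_space"
proof -
  interpret M: prob_space \<mu> by fact
  interpret W: prob_space "exp_seq 1" by (rule prob_space_exp_seq) simp
  interpret O: prob_space weight_space by (rule prob_space_weight_space)
  interpret WM: prob_space "exp_seq 1 \<Otimes>\<^sub>M \<mu>" by (intro prob_space_pair) unfold_locales
  let ?f = "\<lambda>(\<eta>, \<omega>). ((first_row \<omega>, \<eta>), drop_row \<omega>)" and ?N = "(seq_space \<Otimes>\<^sub>M config_space n) \<Otimes>\<^sub>M site_space"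
  have s2 [measurable_cong]: "sets (\<mu> \<Otimes>\<^sub>M weight_space) = sets (config_space n \<Otimes>\<^sub>M site_space)"
    "sets (exp_seq 1 \<Otimes>\<^sub>M \<mu>) = sets (seq_space \<Otimes>\<^sub>M config_space n)"
    by (intro sets_pair_measure_cong; simp add: s)+
  have s3: "sets ((exp_seq 1 \<Otimes>\<^sub>M \<mu>) \<Otimes>\<^sub>M weight_space) = sets ?N"
    by (intro sets_pair_measure_cong s2) simp
  show 2: "distr (\<mu> \<Otimes>\<^sub>M weight_space) ?N ?f = (exp_seq 1 \<Otimes>\<^sub>M \<mu>) \<Otimes>\<^sub>M weight_space"
  proof (rule measure_eqI)
    fix A assume "A \<in> sets (distr (\<mu> \<Otimes>\<^sub>M weight_space) ?N ?f)"
    then have A [measurable]: "A \<in> sets ?N" by simp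
    have A' [measurable]: "A \<in> sets ((exp_seq 1 \<Otimes>\<^sub>M \<mu>) \<Otimes>\<^sub>M weight_space)" using A s3 by simp
    have "emeasure (distr (\<mu> \<Otimes>\<^sub>M weight_space) ?N ?f) A = (\<integral>\<^sup>+x. indicator A (?f x) \<partial>(\<mu> \<Otimes>\<^sub>M weight_space))"
      by (subst nn_integral_indicator[symmetric], simp, rule nn_integral_distr) measurable
    also have "\<dots> = (\<integral>\<^sup>+\<eta>. \<integral>\<^sup>+\<omega>. indicator A ((first_row \<omega>, \<eta>), drop_row \<omega>) \<partial>weight_space \<partial>\<mu>)"
    proof -
      have f: "?f \<in> \<mu> \<Otimes>\<^sub>M weight_space \<rightarrow>\<^sub>M ?N" by measurable
      have "(\<lambda>x. indicator A (?f x) :: ennreal) \<in> borel_measurable (\<mu> \<Otimes>\<^sub>M weight_space)"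
        by (rule measurable_compose[OF f borel_measurable_indicator[OF A]])
      from O.nn_integral_fst[OF this] show ?thesis by simp
    qed
    also have "\<dots> = (\<integral>\<^sup>+\<eta>. \<integral>\<^sup>+w. \<integral>\<^sup>+\<omega>. indicator A ((w, \<eta>), \<omega>) \<partial>weight_space \<partial>exp_seq 1 \<partial>\<mu>)"
    proof (rule nn_integral_cong)
      fix \<eta> assume "\<eta> \<in> space \<mu>"
      then have [measurable]: "\<eta> \<in> space (config_space n)" using sets_eq_imp_space_eq[OF s] by simp
      have "(\<integral>\<^sup>+\<omega>. indicator A ((first_row \<omega>, \<eta>), drop_row \<omega>) \<partial>weight_space) =
          (\<integral>\<^sup>+z. indicator A ((fst z, \<eta>), snd z) \<partial>distr weight_space (seq_space \<Otimes>\<^sub>M site_space) (\<lambda>\<omega>. (first_row \<omega>, drop_row \<omega>)))"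
        by (subst nn_integral_distr, measurable, measurable)
      also have "\<dots> = (\<integral>\<^sup>+w. \<integral>\<^sup>+\<omega>. indicator A ((w, \<eta>), \<omega>) \<partial>weight_space \<partial>exp_seq 1)"
      proof -
        have "(\<lambda>z. ((fst z, \<eta>), snd z)) \<in> exp_seq 1 \<Otimes>\<^sub>M weight_space \<rightarrow>\<^sub>M ?N" by measurable
        from O.nn_integral_fst[OF measurable_compose[OF this borel_measurable_indicator[OF A]]]
        show ?thesis unfolding distr_split_rows by simp
      qed
      finally show "(\<integral>\<^sup>+\<omega>. indicator A ((first_row \<omega>, \<eta>), drop_row \<omega>) \<partial>weight_space) =
          (\<integral>\<^sup>+w. \<integral>\<^sup>+\<omega>. indicator A ((w, \<eta>), \<omega>) \<partial>weight_space \<partial>exp_seq 1)" .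
    qed
    also have "\<dots> = (\<integral>\<^sup>+w. \<integral>\<^sup>+\<eta>. \<integral>\<^sup>+\<omega>. indicator A ((w, \<eta>), \<omega>) \<partial>weight_space \<partial>\<mu> \<partial>exp_seq 1)"
    proof -
      interpret pair_sigma_finite "exp_seq 1" \<mu> ..
      show ?thesis by (rule Fubini') measurable
    qed
    also have "\<dots> = (\<integral>\<^sup>+z. \<integral>\<^sup>+\<omega>. indicator A (z, \<omega>) \<partial>weight_space \<partial>(exp_seq 1 \<Otimes>\<^sub>M \<mu>))"
    proof -
      have "(\<lambda>z. \<integral>\<^sup>+\<omega>. indicator A (z, \<omega>) \<partial>weight_space) \<in> borel_measurable (exp_seq 1 \<Otimes>\<^sub>M \<mu>)"
        by (rule O.borel_measurable_nn_integral_fst[OF borel_measurable_indicator[OF A']])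
      from M.nn_integral_fst[OF this] show ?thesis by simp
    qed
    also have "\<dots> = (\<integral>\<^sup>+x. indicator A x \<partial>((exp_seq 1 \<Otimes>\<^sub>M \<mu>) \<Otimes>\<^sub>M weight_space))"
      by (rule O.nn_integral_fst[OF borel_measurable_indicator[OF A']])
    also have "\<dots> = emeasure ((exp_seq 1 \<Otimes>\<^sub>M \<mu>) \<Otimes>\<^sub>M weight_space) A" by (rule nn_integral_indicator[OF A'])
    finally show "emeasure (distr (\<mu> \<Otimes>\<^sub>M weight_space) ?N ?f) A = emeasure ((exp_seq 1 \<Otimes>\<^sub>M \<mu>) \<Otimes>\<^sub>M weight_space) A" .
  qed (unfold sets_distr, rule s3[symmetric])
  have "distr (\<mu> \<Otimes>\<^sub>M weight_space) (seq_space \<Otimes>\<^sub>M config_space n) (\<lambda>(\<eta>, \<omega>). (first_row \<omega>, \<eta>)) =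
      distr (\<mu> \<Otimes>\<^sub>M weight_space) (seq_space \<Otimes>\<^sub>M config_space n) (fst \<circ> ?f)"
    by (rule distr_cong) auto
  also have "\<dots> = distr (distr (\<mu> \<Otimes>\<^sub>M weight_space) ?N ?f) (seq_space \<Otimes>\<^sub>M config_space n) fst"
    by (rule distr_distr[symmetric]) measurable
  also have "\<dots> = distr ((exp_seq 1 \<Otimes>\<^sub>M \<mu>) \<Otimes>\<^sub>M weight_space) (exp_seq 1 \<Otimes>\<^sub>M \<mu>) fst"
    unfolding 2 by (rule distr_cong[OF refl s2(2)[symmetric] refl])
  also have "\<dots> = exp_seq 1 \<Otimes>\<^sub>M \<mu>" by (rule O.distr_pair_fst)
  finally show "distr (\<mu> \<Otimes>\<^sub>M weight_space) (seq_space \<Otimes>\<^sub>M config_space n) (\<lambda>(\<eta>, \<omega>). (first_row \<omega>, \<eta>)) = exp_seq 1 \<Otimes>\<^sub>M \<mu>" .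
qed

lemma distr_advance:
  assumes \<mu>: "prob_space \<mu>" and s [measurable_cong]: "sets \<mu> = sets (config_space n)"
    and inv: "distr (exp_seq 1 \<Otimes>\<^sub>M \<mu>) (config_space n) (serve n) = \<mu>"
  shows "distr (\<mu> \<Otimes>\<^sub>M weight_space) (\<mu> \<Otimes>\<^sub>M weight_space) (advance n) = \<mu> \<Otimes>\<^sub>M weight_space"
proof -
  interpret M: prob_space \<mu> by fact
  interpret W: prob_space "exp_seq 1" by (rule prob_space_exp_seq) simp
  interpret O: prob_space weight_space by (rule prob_space_weight_space)
  have s2 [measurable_cong]: "sets (\<mu> \<Otimes>\<^sub>M weight_space) = sets (config_space n \<Otimes>\<^sub>M site_space)"
    "sets (exp_seq 1 \<Otimes>\<^sub>M \<mu>) = sets (seq_space \<Otimes>\<^sub>M config_space n)"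
    by (intro sets_pair_measure_cong; simp add: s)+
  let ?f = "\<lambda>(\<eta>, \<omega>). ((first_row \<omega>, \<eta>), drop_row \<omega>)" and ?N = "(seq_space \<Otimes>\<^sub>M config_space n) \<Otimes>\<^sub>M site_space"
  let ?P = "\<mu> \<Otimes>\<^sub>M weight_space"
  have "distr ?P ?P (advance n) = distr ?P ?P ((\<lambda>(z, \<omega>). (serve n z, \<omega>)) \<circ> ?f)"
    by (rule distr_cong) (auto simp: advance_def)
  also have "\<dots> = distr (distr ?P ?N ?f) ?P (\<lambda>(z, \<omega>). (serve n z, \<omega>))"
    by (rule distr_distr[symmetric]) measurable
  also have "\<dots> = distr ((exp_seq 1 \<Otimes>\<^sub>M \<mu>) \<Otimes>\<^sub>M weight_space) (config_space n \<Otimes>\<^sub>M site_space) (\<lambda>(z, \<omega>). (serve n z, \<omega>))"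
    unfolding distr_config_first_row(2)[OF \<mu> s] by (rule distr_cong[OF refl s2(1) refl])
  also have "\<dots> = distr (exp_seq 1 \<Otimes>\<^sub>M \<mu>) (config_space n) (serve n) \<Otimes>\<^sub>M distr weight_space site_space (\<lambda>\<omega>. \<omega>)"
  proof (rule pair_measure_distr[symmetric])
    have "distr weight_space site_space (\<lambda>\<omega>. \<omega>) = weight_space" by (rule distr_id2) simp
    then show "sigma_finite_measure (distr weight_space site_space (\<lambda>\<omega>. \<omega>))"
      using O.sigma_finite_measure_axioms by simp
  qed measurable
  also have "distr weight_space site_space (\<lambda>\<omega>. \<omega>) = weight_space" by (rule distr_id2) simp
  finally show ?thesis by (simp add: inv)
qed

lemma last_passage_cong:
  assumes jk: "j \<le> k" and t: "1 \<le> t" and eq: "\<And>x. x \<in> sites \<Longrightarrow> \<omega> x = \<omega>' x"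
  shows "last_passage \<omega> (j, 1) (k, t) = last_passage \<omega>' (j, 1) (k, t)"
  using t jk
proof (induction t arbitrary: k rule: dec_induct)
  case base
  then show ?case unfolding last_passage_row[OF base] by (intro sum.cong refl eq) (auto simp: sites_def)
next
  case (step t)
  have s: "\<omega> (k, Suc t) = \<omega>' (k, Suc t)" for k by (rule eq) (auto simp: sites_def)
  from step.prems show ?case
  proof (induction k rule: int_ge_induct)
    case base
    show ?case unfolding last_passage_left[OF step(1)] by (simp only: step.IH[OF order_refl] s)
  next
    case (step k')
    have "j < k' + 1" using step(1) by simp
    from last_passage_rec[OF this \<open>1 \<le> t\<close>] show ?case
      using step \<open>\<And>k. j \<le> k \<Longrightarrow> last_passage \<omega> (j, 1) (k, t) = last_passage \<omega>' (j, 1) (k, t)\<close>[of "k' + 1"] s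
      by simp
  qed
qed

lemma increments_cong_sites:
  assumes "1 \<le> t" "\<And>x. x \<in> sites \<Longrightarrow> \<omega> x = \<omega>' x"
  shows "increments n \<omega> G t = increments n \<omega>' G t"
proof -
  have "boundary_passage \<omega> F k t = boundary_passage \<omega>' F k t" for F k
    unfolding boundary_passage_def
    by (intro SUP_cong refl) (use last_passage_cong[OF _ assms(1), of _ _ \<omega> \<omega>'] assms(2) in auto)
  then show ?thesis by (simp add: increments_def)
qed

lemma increments_prim_1: "increments n \<omega> (\<lambda>i. prim (\<eta> i)) 1 = serve n (first_row \<omega>, \<eta>)"
proof -
  have "boundary_passage \<omega> (prim (\<eta> i)) k 1 = departures (prim (\<eta> i)) (first_row \<omega>) k" for i k
    unfolding first_row_def by (rule boundary_passage_1)
  then show ?thesis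
    unfolding increments_def serve_def by (simp add: queue_map_eq[OF is_primitive_prim])
qed

lemma measurable_increments_canonical:
  assumes "1 \<le> t"
  shows "(\<lambda>(\<eta>, \<omega>). increments n \<omega> (\<lambda>i. prim (\<eta> i)) t) \<in> config_space n \<Otimes>\<^sub>M site_space \<rightarrow>\<^sub>M config_space n"
  unfolding case_prod_beta
proof (rule measurable_increments_prim[OF measurable_fst _ assms])
  fix x assume "x \<in> sites"
  then show "(\<lambda>a. snd a x) \<in> borel_measurable (config_space n \<Otimes>\<^sub>M site_space)"
    by (rule measurable_compose[OF measurable_snd measurable_site])
qed

text \<open>The averages of a state exceed 1, which is the mean service; this is where the bound in
  the definition of the state space enters.\<close>

lemma AE_state_space_stable:
  assumes \<mu>: "prob_measure_on_states n \<mu>"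
  shows "AE x in exp_seq 1 \<Otimes>\<^sub>M \<mu>. (\<forall>k. 0 \<le> fst x k) \<and> (\<forall>i\<in>{1..n}. (\<forall>k. 0 \<le> snd x i k) \<and> stable (snd x i) (fst x))"
proof -
  have p: "prob_space \<mu>" and s [measurable_cong]: "sets \<mu> = sets (config_space n)" and ae: "AE \<eta> in \<mu>. \<eta> \<in> state_space n"
    using \<mu> by (auto simp: prob_measure_on_states_def)
  interpret M: prob_space \<mu> by fact
  interpret W: prob_space "exp_seq 1" by (rule prob_space_exp_seq) simp
  have W: "AE w in exp_seq 1. (\<forall>k. 0 \<le> w k) \<and> has_avg w 1"
    using AE_exp_seq_nonneg[of 1] AE_exp_seq_avg[of 1] by simp
  have "AE x in exp_seq 1 \<Otimes>\<^sub>M \<mu>. (\<forall>k. 0 \<le> fst x k) \<and> has_avg (fst x) 1"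
  proof (rule AE_distrD[of fst _ "exp_seq 1"])
    show "AE x in distr (exp_seq 1 \<Otimes>\<^sub>M \<mu>) (exp_seq 1) fst. (\<forall>k. 0 \<le> x k) \<and> has_avg x 1"
      unfolding M.distr_pair_fst by (rule W)
  qed simp
  moreover have "AE x in exp_seq 1 \<Otimes>\<^sub>M \<mu>. snd x \<in> state_space n"
  proof (rule AE_distrD[of snd _ \<mu>])
    have "distr (exp_seq 1 \<Otimes>\<^sub>M \<mu>) \<mu> snd = \<mu>" by (rule distr_pair_snd) unfold_locales
    then show "AE x in distr (exp_seq 1 \<Otimes>\<^sub>M \<mu>) \<mu> snd. x \<in> state_space n" by (simp only: ae)
  qed simp
  ultimately show ?thesis
  proof eventually_elim
    case (elim x)
    have "stable (snd x i) (fst x)" if i: "i \<in> {1..n}" for i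
    proof -
      obtain L where "L > 1" "has_avg (snd x i) L"
        using elim(2) i unfolding state_space_def has_avg_iff_at_bot by blast
      then show ?thesis using elim(1) by (intro stable_of_avg) auto
    qed
    then show ?case using elim unfolding state_space_def by blast
  qed
qed

section \<open>The increment process as an iteration of the time step\<close>

primrec advance_iter :: "nat \<Rightarrow> nat \<Rightarrow> config \<times> (int \<times> nat \<Rightarrow> real) \<Rightarrow> config \<times> (int \<times> nat \<Rightarrow> real)" where
  "advance_iter n 0 x = x"
| "advance_iter n (Suc t) x = advance n (advance_iter n t x)"

lemma advance_iter_row: "first_row (snd (advance_iter n t (\<eta>, \<omega>))) = (\<lambda>i. \<omega> (i, Suc t))"
proof -
  have "\<forall>i s. 1 \<le> s \<longrightarrow> snd (advance_iter n t (\<eta>, \<omega>)) (i, s) = \<omega> (i, s + t)"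
  proof (induction t)
    case (Suc t)
    then show ?case by (auto simp: advance_def drop_row_def sites_def split: prod.splits)
  qed simp
  then show ?thesis by (simp add: first_row_def)
qed

lemma
  assumes \<mu>: "prob_measure_on_states n \<mu>" and inv: "distr (exp_seq 1 \<Otimes>\<^sub>M \<mu>) (config_space n) (serve n) = \<mu>"
  defines "P \<equiv> \<mu> \<Otimes>\<^sub>M weight_space"
  shows measurable_advance_iter: "advance_iter n t \<in> P \<rightarrow>\<^sub>M P"
    and distr_advance_iter: "distr P P (advance_iter n t) = P"
    and AE_advance_iter: "1 \<le> t \<Longrightarrow> AE x in P. fst (advance_iter n t x) = increments n (snd x) (\<lambda>i. prim (fst x i)) t"
proof -
  have p: "prob_space \<mu>" and s [measurable_cong]: "sets \<mu> = sets (config_space n)"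
    using \<mu> by (auto simp: prob_measure_on_states_def)
  have s2 [measurable_cong]: "sets P = sets (config_space n \<Otimes>\<^sub>M site_space)"
    unfolding P_def by (intro sets_pair_measure_cong; simp add: s)
  have sp: "space P = space (config_space n \<Otimes>\<^sub>M site_space)" by (rule sets_eq_imp_space_eq[OF s2])
  have both: "advance_iter n t \<in> P \<rightarrow>\<^sub>M P \<and> distr P P (advance_iter n t) = P" for t
  proof (induction t)
    case 0
    have "advance_iter n 0 = (\<lambda>x. x)" by auto
    then show ?case by simp
  next
    case (Suc t)
    have eq: "advance_iter n (Suc t) = advance n \<circ> advance_iter n t" by auto
    have m: "advance n \<in> P \<rightarrow>\<^sub>M P" by measurable
    have "distr P P (advance n \<circ> advance_iter n t) = distr (distr P P (advance_iter n t)) P (advance n)"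
      using Suc m by (intro distr_distr[symmetric]) auto
    also have "\<dots> = P" using Suc distr_advance[OF p s inv] by (simp add: P_def)
    finally have "distr P P (advance n \<circ> advance_iter n t) = P" .
    then show ?case unfolding eq by (intro conjI measurable_comp[OF conjunct1[OF Suc] m])
  qed
  then show m: "advance_iter n t \<in> P \<rightarrow>\<^sub>M P" and "distr P P (advance_iter n t) = P" for t by auto
  have st: "AE x in P. \<forall>i\<in>{1..n}. stable (fst x i) (first_row (snd x))"
  proof -
    have "AE z in distr P (seq_space \<Otimes>\<^sub>M config_space n) (\<lambda>(\<eta>, \<omega>). (first_row \<omega>, \<eta>)). \<forall>i\<in>{1..n}. stable (snd z i) (fst z)"
      unfolding P_def distr_config_first_row(1)[OF p s] using AE_state_space_stable[OF \<mu>] by eventually_elim blast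
    then have "AE x in P. \<forall>i\<in>{1..n}. stable (snd ((\<lambda>(\<eta>, \<omega>). (first_row \<omega>, \<eta>)) x) i) (fst ((\<lambda>(\<eta>, \<omega>). (first_row \<omega>, \<eta>)) x))"
      by (rule AE_distrD[rotated]) measurable
    then show ?thesis by eventually_elim (simp add: case_prod_beta)
  qed
  \<comment> \<open>By invariance the pair at time \<open>r\<close> has the law of the initial pair,
    so stability of the first queue carries over to the queue at every time.\<close>
  have "AE x in P. \<forall>i\<in>{1..n}. stable (fst (advance_iter n r x) i) (first_row (snd (advance_iter n r x)))" for r
  proof (rule AE_distrD[OF m[of r]])
    show "AE x in distr P P (advance_iter n r). \<forall>i\<in>{1..n}. stable (fst x i) (first_row (snd x))"
      unfolding conjunct2[OF both[of r]] by (rule st)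
  qed
  then have all: "AE x in P. \<forall>r. \<forall>i\<in>{1..n}. stable (fst (advance_iter n r x) i) (first_row (snd (advance_iter n r x)))"
    by (simp add: AE_all_countable)
  assume t: "1 \<le> t"
  show "AE x in P. fst (advance_iter n t x) = increments n (snd x) (\<lambda>i. prim (fst x i)) t"
    using all AE_space
  proof eventually_elim
    case (elim x)
    obtain \<eta> \<omega> where x: "x = (\<eta>, \<omega>)" by (cases x)
    have ext: "fst (advance_iter n t x) = (\<lambda>i\<in>{1..n}. fst (advance_iter n t x) i)"
    proof -
      obtain r where r: "t = Suc r" using t by (cases t) auto
      show ?thesis unfolding r by (auto simp: advance_def serve_def case_prod_beta)
    qed
    have "is_primitive (\<lambda>k. boundary_passage \<omega> (prim (\<eta> i)) k t) (fst (advance_iter n t x) i)" if i: "i \<in> {1..n}" for i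
    proof (rule boundary_passage_primitive[where \<eta> = "\<lambda>t. fst (advance_iter n t x) i", THEN conjunct2])
      show "is_primitive (prim (\<eta> i)) (fst (advance_iter n 0 x) i)" by (simp add: x is_primitive_prim)
      fix r
      show "stable (fst (advance_iter n r x) i) (\<lambda>i. \<omega> (i, Suc r))"
        using elim(1)[THEN spec[of _ r], THEN bspec, OF i] unfolding x advance_iter_row .
      show "fst (advance_iter n (Suc r) x) i = queue_map (fst (advance_iter n r x) i) (\<lambda>i. \<omega> (i, Suc r))"
        using i advance_iter_row[of n r \<eta> \<omega>] x by (simp add: advance_def serve_def case_prod_beta)
    qed (rule t)
    then have "increments n \<omega> (\<lambda>i. prim (\<eta> i)) t = (\<lambda>i\<in>{1..n}. fst (advance_iter n t x) i)"
      unfolding increments_def is_primitive_def by (intro restrict_ext ext) auto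
    then show ?case using ext by (simp add: x)
  qed
qed

text \<open>The sample space is arbitrary, so everything is expressed through the joint law of
  initial state and weights, which is a product by independence. The increments are a fixed
  measurable function of this pair, and almost surely they agree with an iterate of
  \<open>advance\<close>, which preserves the product.\<close>

lemma invariant_measure_of_serve:
  assumes \<mu>: "prob_measure_on_states n \<mu>" and inv: "distr (exp_seq 1 \<Otimes>\<^sub>M \<mu>) (config_space n) (serve n) = \<mu>"
  shows "invariant_measure TYPE('a) n \<mu>"
  unfolding invariant_measure_def
proof (intro allI impI)
  fix M :: "'a measure" and \<omega> \<eta>0 G0 and t :: nat
  assume D: "process_data n M \<omega> \<eta>0" and G0: "\<forall>a\<in>space M. \<forall>i\<in>{1..n}. is_primitive (G0 a i) (\<eta>0 a i)"
    and law: "has_law M (config_space n) \<eta>0 \<mu>" and t: "1 \<le> t"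
  have p: "prob_space \<mu>" and s [measurable_cong]: "sets \<mu> = sets (config_space n)"
    using \<mu> by (auto simp: prob_measure_on_states_def)
  interpret M: prob_space M using D by (simp add: process_data_def)
  interpret MU: prob_space \<mu> by fact
  interpret O: prob_space weight_space by (rule prob_space_weight_space)
  have ind: "M.indep_vars (\<lambda>_. borel) \<omega> sites"
    and dist: "\<And>x. x \<in> sites \<Longrightarrow> distributed M lborel (\<omega> x) (exponential_density 1)"
    and \<eta>0 [measurable]: "\<eta>0 \<in> M \<rightarrow>\<^sub>M config_space n"
    and indep: "M.indep_set (sets (vimage_algebra (space M) \<eta>0 (config_space n)))
       (sets (vimage_algebra (space M) (\<lambda>a. \<lambda>x\<in>sites. \<omega> x a) (Pi\<^sub>M sites (\<lambda>_. borel))))"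
    using D by (auto simp: process_data_def)
  define R where "R a = (\<lambda>x\<in>sites. \<omega> x a)" for a
  have R_eq: "R = (\<lambda>a. \<lambda>x\<in>sites. \<omega> x a)" by (rule ext) (rule R_def)
  have \<omega>m: "\<omega> x \<in> borel_measurable M" if "x \<in> sites" for x
    using distributed_measurable[OF dist[OF that]] unfolding measurable_cong_sets[OF refl sets_lborel] .
  have R [measurable]: "R \<in> M \<rightarrow>\<^sub>M site_space"
    unfolding R_def by (rule measurable_restrict) (rule \<omega>m)
  have Rlaw: "distr M site_space R = weight_space"
  proof -
    have "sites \<noteq> {}" by (auto simp: sites_def)
    then have "distr M site_space R = Pi\<^sub>M sites (\<lambda>x. distr M borel (\<omega> x))"
      using M.indep_vars_iff_distr_eq_PiM'[of sites \<omega> "\<lambda>_. borel"] \<omega>m ind unfolding R_def by blast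
    also have "\<dots> = weight_space"
      unfolding weight_space_def
    proof (intro PiM_cong refl)
      fix x assume "x \<in> sites"
      have "distr M borel (\<omega> x) = distr M lborel (\<omega> x)" by (rule distr_cong) auto
      also have "\<dots> = exp_dist 1"
        using distributed_distr_eq_density[OF dist[OF \<open>x \<in> sites\<close>]] by (simp add: exp_dist_def)
      finally show "distr M borel (\<omega> x) = exp_dist 1" .
    qed
    finally show ?thesis .
  qed
  have \<eta>law: "distr M (config_space n) \<eta>0 = \<mu>" using law by (simp add: has_law_def)
  have pair: "distr M (config_space n \<Otimes>\<^sub>M site_space) (\<lambda>a. (\<eta>0 a, R a)) = \<mu> \<Otimes>\<^sub>M weight_space"
  proof (rule pair_measure_eqI[symmetric])
    show "sigma_finite_measure \<mu>" "sigma_finite_measure weight_space" by unfold_locales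
    show "sets (\<mu> \<Otimes>\<^sub>M weight_space) = sets (distr M (config_space n \<Otimes>\<^sub>M site_space) (\<lambda>a. (\<eta>0 a, R a)))"
      unfolding sets_distr by (intro sets_pair_measure_cong s sets_weight_space)
    fix A B assume A: "A \<in> sets \<mu>" and B: "B \<in> sets weight_space"
    have A' [measurable]: "A \<in> sets (config_space n)" and B' [measurable]: "B \<in> sets site_space" using A B s by auto
    have "emeasure (distr M (config_space n \<Otimes>\<^sub>M site_space) (\<lambda>a. (\<eta>0 a, R a))) (A \<times> B) =
        emeasure M ((\<eta>0 -` A \<inter> space M) \<inter> (R -` B \<inter> space M))"
    proof -
      have "(\<lambda>a. (\<eta>0 a, R a)) -` (A \<times> B) \<inter> space M = (\<eta>0 -` A \<inter> space M) \<inter> (R -` B \<inter> space M)" by auto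
      moreover have "(\<lambda>a. (\<eta>0 a, R a)) \<in> M \<rightarrow>\<^sub>M config_space n \<Otimes>\<^sub>M site_space" by measurable
      ultimately show ?thesis using emeasure_distr[of "\<lambda>a. (\<eta>0 a, R a)" M _ "A \<times> B"] A' B' by (simp only: pair_measureI)
    qed
    also have "\<dots> = ennreal (measure M (\<eta>0 -` A \<inter> space M) * measure M (R -` B \<inter> space M))"
    proof -
      have "\<eta>0 -` A \<inter> space M \<in> sets (vimage_algebra (space M) \<eta>0 (config_space n))"
        by (rule in_vimage_algebra[OF A'])
      moreover have "R -` B \<inter> space M \<in> sets (vimage_algebra (space M) (\<lambda>a. \<lambda>x\<in>sites. \<omega> x a) (Pi\<^sub>M sites (\<lambda>_. borel)))"
        using in_vimage_algebra[OF B', of R "space M"] unfolding R_eq .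
      ultimately have "measure M ((\<eta>0 -` A \<inter> space M) \<inter> (R -` B \<inter> space M)) =
          measure M (\<eta>0 -` A \<inter> space M) * measure M (R -` B \<inter> space M)"
        by (rule M.indep_setD[OF indep])
      then show ?thesis by (simp only: M.emeasure_eq_measure)
    qed
    also have "\<dots> = emeasure (distr M (config_space n) \<eta>0) A * emeasure (distr M site_space R) B"
      by (simp add: emeasure_distr M.emeasure_eq_measure ennreal_mult)
    finally show "emeasure \<mu> A * emeasure weight_space B = emeasure (distr M (config_space n \<Otimes>\<^sub>M site_space) (\<lambda>a. (\<eta>0 a, R a))) (A \<times> B)"
      by (simp add: \<eta>law Rlaw)
  qed
  let ?P = "\<mu> \<Otimes>\<^sub>M weight_space"
  have s2 [measurable_cong]: "sets ?P = sets (config_space n \<Otimes>\<^sub>M site_space)"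
    by (intro sets_pair_measure_cong; simp add: s)
  let ?\<Phi> = "\<lambda>(\<eta>, \<omega>). increments n \<omega> (\<lambda>i. prim (\<eta> i)) t"
  note [measurable] = measurable_increments_canonical[OF t]
  \<comment> \<open>Two replacements: the given primitive by \<open>prim\<close>, and the weights by
    their restriction to \<open>sites\<close>. Both leave the increments unchanged at every sample
    point, so measurability of the increments follows as well.\<close>
  have inc: "increments n (\<lambda>x. \<omega> x a) (G0 a) t = ?\<Phi> (\<eta>0 a, R a)" if a: "a \<in> space M" for a
  proof -
    have "increments n (\<lambda>x. \<omega> x a) (G0 a) t = increments n (\<lambda>x. \<omega> x a) (\<lambda>i. prim (\<eta>0 a i)) t"
      by (rule increments_cong_primitive[where I = "\<eta>0 a"]) (use G0 a t is_primitive_prim in auto)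
    also have "\<dots> = increments n (R a) (\<lambda>i. prim (\<eta>0 a i)) t"
      by (rule increments_cong_sites[OF t]) (simp add: R_def)
    finally show ?thesis by simp
  qed
  have "distr M (config_space n) (\<lambda>a. increments n (\<lambda>x. \<omega> x a) (G0 a) t) = distr M (config_space n) (?\<Phi> \<circ> (\<lambda>a. (\<eta>0 a, R a)))"
    by (rule distr_cong) (use inc in auto)
  also have "\<dots> = distr (distr M (config_space n \<Otimes>\<^sub>M site_space) (\<lambda>a. (\<eta>0 a, R a))) (config_space n) ?\<Phi>"
    by (rule distr_distr[symmetric]) measurable
  also have "\<dots> = distr ?P (config_space n) ?\<Phi>" by (simp only: pair)
  also have "\<dots> = distr ?P (config_space n) (fst \<circ> advance_iter n t)"
  proof (rule distr_cong_AE[symmetric])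
    show "AE x in ?P. (fst \<circ> advance_iter n t) x = ?\<Phi> x"
      using AE_advance_iter[OF \<mu> inv t] by eventually_elim (simp add: case_prod_beta)
    have "fst \<in> ?P \<rightarrow>\<^sub>M config_space n" by measurable
    then show "fst \<circ> advance_iter n t \<in> ?P \<rightarrow>\<^sub>M config_space n"
      by (rule measurable_comp[OF measurable_advance_iter[OF \<mu> inv]])
  qed (simp, measurable)
  also have "\<dots> = distr (distr ?P ?P (advance_iter n t)) (config_space n) fst"
    by (rule distr_distr[symmetric, OF _ measurable_advance_iter[OF \<mu> inv]]) measurable
  also have "\<dots> = distr ?P (config_space n) fst" by (simp only: distr_advance_iter[OF \<mu> inv])
  also have "\<dots> = distr ?P \<mu> fst" by (rule distr_cong) (auto simp: s)
  also have "\<dots> = \<mu>" by (rule O.distr_pair_fst)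
  finally have eq: "distr M (config_space n) (\<lambda>a. increments n (\<lambda>x. \<omega> x a) (G0 a) t) = \<mu>" .
  have "(\<lambda>a. ?\<Phi> (\<eta>0 a, R a)) \<in> M \<rightarrow>\<^sub>M config_space n" by measurable
  moreover have "(\<lambda>a. increments n (\<lambda>x. \<omega> x a) (G0 a) t) \<in> M \<rightarrow>\<^sub>M config_space n \<longleftrightarrow>
      (\<lambda>a. ?\<Phi> (\<eta>0 a, R a)) \<in> M \<rightarrow>\<^sub>M config_space n"
    by (rule measurable_cong) (rule inc)
  ultimately have "(\<lambda>a. increments n (\<lambda>x. \<omega> x a) (G0 a) t) \<in> M \<rightarrow>\<^sub>M config_space n" by blast
  with eq show "has_law M (config_space n) (\<lambda>a. increments n (\<lambda>x. \<omega> x a) (G0 a) t) \<mu>"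
    unfolding has_law_def by (rule conjI[rotated])
qed

text \<open>Invariance quantifies over all processes on a given sample type. It is tested on one of
  them, the process on the product of \<open>\<mu>\<close> with the law of the weights, at time 1.
  This product has the type \<open>canonical_sample\<close>; most of the proof checks that it
  carries admissible data.\<close>

lemma serve_of_invariant_measure:
  assumes \<mu>: "prob_measure_on_states n \<mu>" and inv: "invariant_measure TYPE(canonical_sample) n \<mu>"
  shows "distr (exp_seq 1 \<Otimes>\<^sub>M \<mu>) (config_space n) (serve n) = \<mu>"
proof -
  have p: "prob_space \<mu>" and s [measurable_cong]: "sets \<mu> = sets (config_space n)" and ae: "AE \<eta> in \<mu>. \<eta> \<in> state_space n"
    using \<mu> by (auto simp: prob_measure_on_states_def)
  interpret MU: prob_space \<mu> by fact
  interpret O: prob_space weight_space by (rule prob_space_weight_space)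
  let ?P = "\<mu> \<Otimes>\<^sub>M weight_space"
  interpret P: prob_space ?P by (intro prob_space_pair) unfold_locales
  have s2 [measurable_cong]: "sets ?P = sets (config_space n \<Otimes>\<^sub>M site_space)"
    by (intro sets_pair_measure_cong; simp add: s)
  let ?\<omega> = "\<lambda>x (a :: canonical_sample). snd a x"
  have fstP: "distr ?P \<mu> fst = \<mu>" by (rule O.distr_pair_fst)
  have fstP': "distr ?P (config_space n) fst = \<mu>"
  proof -
    have "distr ?P (config_space n) fst = distr ?P \<mu> fst" by (rule distr_cong) (auto simp: s)
    then show ?thesis using fstP by simp
  qed
  have sndP: "distr ?P weight_space snd = weight_space" by (rule distr_pair_snd) unfold_locales
  have \<omega>m: "?\<omega> x \<in> borel_measurable ?P" if x: "x \<in> sites" for x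
  proof -
    have "snd \<in> ?P \<rightarrow>\<^sub>M site_space" by measurable
    then show ?thesis by (rule measurable_compose[OF _ measurable_site[OF x]])
  qed
  have \<omega>law: "distr ?P borel (?\<omega> x) = exp_dist 1" if x: "x \<in> sites" for x
  proof -
    have "distr ?P borel (?\<omega> x) = distr ?P borel ((\<lambda>z. z x) \<circ> snd)" by (rule distr_cong) auto
    also have "\<dots> = distr (distr ?P weight_space snd) borel (\<lambda>z. z x)"
    proof (rule distr_distr[symmetric])
      show "(\<lambda>z. z x) \<in> borel_measurable weight_space"
        using measurable_site[OF x] unfolding measurable_cong_sets[OF sets_weight_space refl] .
    qed simp
    also have "\<dots> = distr weight_space (exp_dist 1) (\<lambda>z. z x)"
      unfolding sndP by (rule distr_cong) auto
    also have "\<dots> = exp_dist 1"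
      unfolding weight_space_def by (rule distr_PiM_component) (use x prob_space_exp_dist in auto)
    finally show ?thesis .
  qed
  have restr: "(\<lambda>x\<in>sites. ?\<omega> x a) = snd a" if "a \<in> space ?P" for a
    using that by (auto simp: space_pair_measure space_weight_space fun_eq_iff PiE_iff extensional_def)
  have D: "process_data n ?P ?\<omega> fst"
    unfolding process_data_def
  proof (intro conjI ballI)
    show "prob_space ?P" by (rule P.prob_space_axioms)
    show "P.indep_vars (\<lambda>_. borel) ?\<omega> sites"
    proof -
      have ne: "sites \<noteq> {}" by (auto simp: sites_def)
      have "distr ?P site_space (\<lambda>a. \<lambda>x\<in>sites. ?\<omega> x a) = distr ?P weight_space snd"
        by (rule distr_cong) (auto simp: restr)
      also have "\<dots> = Pi\<^sub>M sites (\<lambda>_. exp_dist 1)" by (rule trans[OF sndP weight_space_def])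
      also have "\<dots> = Pi\<^sub>M sites (\<lambda>x. distr ?P borel (?\<omega> x))"
        by (intro PiM_cong refl \<omega>law[symmetric])
      finally show ?thesis using P.indep_vars_iff_distr_eq_PiM'[OF ne, of ?\<omega> "\<lambda>_. borel"] \<omega>m by blast
    qed
    show "distributed ?P lborel (?\<omega> x) (exponential_density 1)" if x: "x \<in> sites" for x
      unfolding distributed_def
    proof (intro conjI)
      have "distr ?P lborel (?\<omega> x) = distr ?P borel (?\<omega> x)" by (rule distr_cong) auto
      then show "distr ?P lborel (?\<omega> x) = density lborel (exponential_density 1)"
        using \<omega>law[OF x] by (simp add: exp_dist_def)
      show "?\<omega> x \<in> ?P \<rightarrow>\<^sub>M lborel" using \<omega>m[OF x] unfolding measurable_cong_sets[OF refl sets_lborel] .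
    qed simp
    show "fst \<in> ?P \<rightarrow>\<^sub>M config_space n" by measurable
    show "AE a in ?P. fst a \<in> state_space n"
    proof (rule AE_distrD[of fst _ \<mu>])
      show "AE \<eta> in distr ?P \<mu> fst. \<eta> \<in> state_space n" unfolding fstP by (rule ae)
    qed measurable
    show "P.indep_set (sets (vimage_algebra (space ?P) fst (config_space n)))
        (sets (vimage_algebra (space ?P) (\<lambda>a. \<lambda>x\<in>sites. ?\<omega> x a) site_space))"
    proof (rule P.indep_setI)
      have Rm: "(\<lambda>a. \<lambda>x\<in>sites. ?\<omega> x a) \<in> ?P \<rightarrow>\<^sub>M site_space"
        by (rule measurable_restrict) (rule \<omega>m)
      have "fst \<in> ?P \<rightarrow>\<^sub>M config_space n" by measurable
      then show "sets (vimage_algebra (space ?P) fst (config_space n)) \<subseteq> P.events"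
        by (rule sets_image_in_sets[OF refl])
      show "sets (vimage_algebra (space ?P) (\<lambda>a. \<lambda>x\<in>sites. ?\<omega> x a) site_space) \<subseteq> P.events"
        using Rm by (rule sets_image_in_sets[OF refl])
      fix X Y assume Xm: "X \<in> sets (vimage_algebra (space ?P) fst (config_space n))"
        and Ym: "Y \<in> sets (vimage_algebra (space ?P) (\<lambda>a. \<lambda>x\<in>sites. ?\<omega> x a) site_space)"
      have va: "sets (vimage_algebra (space ?P) fst (config_space n)) = {fst -` A \<inter> space ?P | A. A \<in> sets (config_space n)}"
        by (rule sets_vimage_algebra2) (auto simp: space_pair_measure sets_eq_imp_space_eq[OF s])
      have vb: "sets (vimage_algebra (space ?P) (\<lambda>a. \<lambda>x\<in>sites. ?\<omega> x a) site_space) =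
          {(\<lambda>a. \<lambda>x\<in>sites. ?\<omega> x a) -` A \<inter> space ?P | A. A \<in> sets site_space}"
        by (rule sets_vimage_algebra2) (use measurable_space[OF Rm] in blast)
      from Xm obtain A where A: "A \<in> sets (config_space n)" "X = fst -` A \<inter> space ?P"
        unfolding va by blast
      from Ym obtain B where B: "B \<in> sets site_space" "Y = (\<lambda>a. \<lambda>x\<in>sites. ?\<omega> x a) -` B \<inter> space ?P"
        unfolding vb by blast
      have X: "X = A \<times> space weight_space"
        unfolding A(2) using sets.sets_into_space[OF A(1)] by (auto simp: space_pair_measure sets_eq_imp_space_eq[OF s])
      have Y: "Y = space \<mu> \<times> B"
        unfolding B(2) using sets.sets_into_space[of B weight_space] B(1) restr by (auto simp: space_pair_measure)
      have Am: "A \<in> sets \<mu>" and Bm: "B \<in> sets weight_space" using A(1) B(1) by (simp_all add: s)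
      have XY: "X \<inter> Y = A \<times> B"
        unfolding X Y using sets.sets_into_space[OF Am] sets.sets_into_space[OF Bm] by auto
      have pr: "measure ?P (A' \<times> B') = measure \<mu> A' * measure weight_space B'"
        if "A' \<in> sets \<mu>" "B' \<in> sets weight_space" for A' B'
        unfolding measure_def O.emeasure_pair_measure_Times[OF that] by (rule enn2real_mult)
      show "P.prob (X \<inter> Y) = P.prob X * P.prob Y"
        unfolding XY unfolding X Y pr[OF Am Bm] pr[OF Am sets.top] pr[OF sets.top Bm]
        by (simp only: MU.prob_space O.prob_space mult_1 mult_1_right)
    qed
  qed
  have "has_law ?P (config_space n) (\<lambda>a. increments n (\<lambda>x. ?\<omega> x a) (\<lambda>i. prim (fst a i)) 1) \<mu>"
  proof (rule inv[unfolded invariant_measure_def, rule_format, OF D])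
    have "fst \<in> ?P \<rightarrow>\<^sub>M config_space n" by measurable
    then show "has_law ?P (config_space n) fst \<mu>" unfolding has_law_def using fstP' by (rule conjI)
  qed (auto simp: is_primitive_prim)
  then have "distr ?P (config_space n) (\<lambda>a. increments n (snd a) (\<lambda>i. prim (fst a i)) 1) = \<mu>"
    unfolding has_law_def by (rule conjunct2)
  moreover have "distr ?P (config_space n) (\<lambda>a. increments n (snd a) (\<lambda>i. prim (fst a i)) 1) =
      distr ?P (config_space n) (serve n \<circ> (\<lambda>(\<eta>, \<omega>). (first_row \<omega>, \<eta>)))"
    by (rule distr_cong) (auto simp: increments_prim_1[unfolded One_nat_def] comp_def case_prod_beta)
  moreover have "\<dots> = distr (distr ?P (seq_space \<Otimes>\<^sub>M config_space n) (\<lambda>(\<eta>, \<omega>). (first_row \<omega>, \<eta>))) (config_space n) (serve n)"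
    by (rule distr_distr[symmetric]) measurable
  ultimately show ?thesis by (simp add: distr_config_first_row(1)[OF p s])
qed

section \<open>Averages under ergodic measures\<close>

lemma has_avg_fun_pred:
  assumes f: "f \<in> measurable M seq_space" and g: "g \<in> borel_measurable M"
  shows "Measurable.pred M (\<lambda>x. has_avg (f x) (g x))"
proof -
  have eq: "has_avg (f x) (g x) \<longleftrightarrow> has_avg (\<lambda>k. f x k - g x) 0" for x
  proof -
    have "(\<lambda>N. g x * (real (Suc N) / real N)) \<longlonglongrightarrow> g x * 1"
      by (intro tendsto_mult tendsto_const LIMSEQ_Suc_n_over_n)
    then have c: "has_avg (\<lambda>_. g x) (g x)"
      by (simp add: has_avg_def nat_add_distrib mult.commute)
    have z: "has_avg (\<lambda>_. 0) 0" by (simp add: has_avg_def)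
    show ?thesis
      using has_avg_diff[OF _ c, of "f x" "g x"] has_avg_diff[OF _ has_avg_diff[OF z c], of "\<lambda>k. f x k - g x" 0] by auto
  qed
  have "(\<lambda>x k. f x k - g x) \<in> measurable M seq_space"
    by (intro measurable_seq_spaceI borel_measurable_diff measurable_seq_component[OF f] g)
  then show ?thesis unfolding eq by (rule has_avg_pred)
qed

text \<open>The state space provides the almost sure limit \<open>L\<close>. For \<open>c\<close>
  below the mean, the event that \<open>L\<close> is at most \<open>c\<close> is invariant and
  cannot have probability 1, as truncated means show; so \<open>L\<close> is at least the mean. A
  bound on a truncated mean of \<open>L\<close> gives equality, and convergence of nonnegative
  variables with constant mean to that mean takes place in L1.\<close>

lemma ergodic_average_L1:
  assumes \<mu>: "prob_measure_on_states n \<mu>" and erg: "translation_ergodic n \<mu>" and means: "has_means n \<rho> \<mu>"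
    and i: "i \<in> {1..n}"
  shows "(\<lambda>N. \<integral>\<eta>. \<bar>(\<Sum>k=- int N..0. \<eta> i k) / real (Suc N) - \<rho> i\<bar> \<partial>\<mu>) \<longlonglongrightarrow> 0"
proof -
  have p: "prob_space \<mu>" and s [measurable_cong]: "sets \<mu> = sets (config_space n)" and ae: "AE \<eta> in \<mu>. \<eta> \<in> state_space n"
    using \<mu> by (auto simp: prob_measure_on_states_def)
  interpret prob_space \<mu> by fact
  have sp: "space \<mu> = space (config_space n)" by (rule sets_eq_imp_space_eq[OF s])
  have seqC: "(\<lambda>\<eta>. \<eta> i) \<in> config_space n \<rightarrow>\<^sub>M seq_space" by (rule measurable_config_component[OF _ i]) simp
  have atC: "(\<lambda>\<eta>. \<eta> i k) \<in> borel_measurable (config_space n)" for k by (rule measurable_seq_component[OF seqC])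
  have at: "(\<lambda>\<eta>. \<eta> i k) \<in> borel_measurable \<mu>" for k using atC unfolding measurable_cong_sets[OF s refl] .
  have int: "integrable \<mu> (\<lambda>\<eta>. \<eta> i k)" and mean: "(\<integral>\<eta>. \<eta> i k \<partial>\<mu>) = \<rho> i" for k
    using means i by (auto simp: has_means_def)
  have nonneg: "AE \<eta> in \<mu>. \<forall>k. 0 \<le> \<eta> i k" using ae by eventually_elim (use i in \<open>auto simp: state_space_def\<close>)
  have st: "(\<integral>\<eta>. g (\<eta> i k) \<partial>\<mu>) = (\<integral>\<eta>. g (\<eta> i 0) \<partial>\<mu>)" if g: "g \<in> borel_measurable borel" for g :: "real \<Rightarrow> real" and k
  proof -
    have d: "distr \<mu> (config_space n) (translation n k) = \<mu>" using erg by (simp add: translation_ergodic_def)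
    have "(\<integral>\<eta>. g (\<eta> i 0) \<partial>\<mu>) = (\<integral>\<eta>. g (\<eta> i 0) \<partial>distr \<mu> (config_space n) (translation n k))" by (simp only: d)
    also have "\<dots> = (\<integral>\<eta>. g (translation n k \<eta> i 0) \<partial>\<mu>)"
    proof (rule integral_distr)
      show "translation n k \<in> \<mu> \<rightarrow>\<^sub>M config_space n" by measurable
      show "(\<lambda>\<eta>. g (\<eta> i 0)) \<in> borel_measurable (config_space n)" by (rule measurable_compose[OF atC g])
    qed
    also have "\<dots> = (\<integral>\<eta>. g (\<eta> i k) \<partial>\<mu>)" using i by (simp add: translation_def)
    finally show ?thesis ..
  qed
  \<comment> \<open>Division by the number of terms, unlike in \<open>has_avg\<close>, so that the
    mean of \<open>A N\<close> is exactly \<open>\<rho> i\<close>.\<close>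
  define A where "A N \<eta> = (\<Sum>k=- int N..0. \<eta> i k) / real (Suc N)" for N and \<eta> :: config
  define L where "L \<eta> = lim (\<lambda>N. A N \<eta>)" for \<eta>
  have A: "A N \<in> borel_measurable \<mu>" for N
    unfolding A_def by (intro borel_measurable_divide borel_measurable_sum at borel_measurable_const)
  have AC: "A N \<in> borel_measurable (config_space n)" for N
    unfolding A_def by (intro borel_measurable_divide borel_measurable_sum atC borel_measurable_const)
  have L: "L \<in> borel_measurable \<mu>" unfolding L_def[abs_def] by (rule borel_measurable_lim_metric[OF A])
  have LC: "L \<in> borel_measurable (config_space n)" unfolding L_def[abs_def] by (rule borel_measurable_lim_metric[OF AC])
  have AL: "(\<lambda>N. A N \<eta>) \<longlonglongrightarrow> c" if "has_avg (\<eta> i) c" for \<eta> c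
  proof -
    have "(\<lambda>N. (\<Sum>k=- int N..0. \<eta> i k) / real N * (real N / real (Suc N))) \<longlonglongrightarrow> c * 1"
      using that unfolding has_avg_def by (intro tendsto_mult LIMSEQ_n_over_Suc_n)
    moreover have "\<forall>\<^sub>F N in sequentially. (\<Sum>k=- int N..0. \<eta> i k) / real N * (real N / real (Suc N)) = A N \<eta>"
      by (rule eventually_mono[OF eventually_gt_at_top[of 0]]) (simp add: A_def del: of_nat_Suc)
    ultimately show ?thesis by (simp add: Lim_transform_eventually)
  qed
  have Leq: "L \<eta> = c" if "has_avg (\<eta> i) c" for \<eta> c unfolding L_def by (rule limI, rule AL, rule that)
  have aeL: "AE \<eta> in \<mu>. has_avg (\<eta> i) (L \<eta>)"
    using ae
  proof eventually_elim
    case (elim \<eta>)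
    then obtain c where "has_avg (\<eta> i) c" using i unfolding state_space_def has_avg_iff_at_bot by blast
    then show ?case using Leq by auto
  qed
  have aeA: "AE \<eta> in \<mu>. (\<lambda>N. A N \<eta>) \<longlonglongrightarrow> L \<eta>" using aeL by eventually_elim (rule AL)
  have Apos: "AE \<eta> in \<mu>. \<forall>N. 0 \<le> A N \<eta>" using nonneg by eventually_elim (auto simp: A_def intro!: divide_nonneg_nonneg sum_nonneg)
  have Lpos: "AE \<eta> in \<mu>. 0 \<le> L \<eta>" using aeA Apos by eventually_elim (auto intro: LIMSEQ_le_const)
  have cN: "(\<Sum>k=- int N..0. c) = real (Suc N) * c" for N and c :: real
    by (simp add: nat_add_distrib)
  have Aint: "integrable \<mu> (A N)" and Amean: "(\<integral>\<eta>. A N \<eta> \<partial>\<mu>) = \<rho> i" for N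
  proof -
    show "integrable \<mu> (A N)" unfolding A_def by (intro integrable_divide Bochner_Integration.integrable_sum int)
    have "(\<integral>\<eta>. A N \<eta> \<partial>\<mu>) = (\<Sum>k=- int N..0. \<rho> i) / real (Suc N)"
      unfolding A_def by (simp add: int mean del: of_nat_Suc sum_constant)
    then show "(\<integral>\<eta>. A N \<eta> \<partial>\<mu>) = \<rho> i" unfolding cN by (simp del: of_nat_Suc)
  qed
  have \<rho>0: "0 \<le> \<rho> i"
    unfolding mean[of 0, symmetric] by (rule integral_nonneg_AE) (use nonneg in eventually_elim, auto)
  \<comment> \<open>The mean excess above the level \<open>K\<close>. By convexity an average has no
    larger mean excess than its terms, and by stationarity all terms have the same; so one bound
    controls the averages for all \<open>N\<close>, a uniform integrability.\<close>
  define e where "e K = (\<integral>\<eta>. max (\<eta> i 0 - K) 0 \<partial>\<mu>)" for K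
  have e0: "(\<lambda>j. e (real j)) \<longlonglongrightarrow> 0"
  proof -
    have "(\<lambda>j. \<integral>\<eta>. max (\<eta> i 0 - real j) 0 \<partial>\<mu>) \<longlonglongrightarrow> (\<integral>\<eta>. 0 \<partial>\<mu>)"
    proof (rule integral_dominated_convergence[where w = "\<lambda>\<eta>. \<bar>\<eta> i 0\<bar>"])
      show "(\<lambda>\<eta>. max (\<eta> i 0 - real j) 0) \<in> borel_measurable \<mu>" for j
        by (intro borel_measurable_max borel_measurable_diff at borel_measurable_const)
      show "integrable \<mu> (\<lambda>\<eta>. \<bar>\<eta> i 0\<bar>)" by (intro integrable_abs int)
      show "AE \<eta> in \<mu>. (\<lambda>j. max (\<eta> i 0 - real j) 0) \<longlonglongrightarrow> 0"
      proof (rule AE_I2)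
        fix \<eta> :: config
        obtain j0 :: nat where j0: "\<eta> i 0 \<le> real j0" using real_arch_simple by blast
        have "\<forall>\<^sub>F j in sequentially. max (\<eta> i 0 - real j) 0 = 0"
          by (rule eventually_mono[OF eventually_ge_at_top[of j0]]) (use j0 in auto)
        then show "(\<lambda>j. max (\<eta> i 0 - real j) 0) \<longlonglongrightarrow> 0" by (rule tendsto_eventually)
      qed
      show "AE \<eta> in \<mu>. norm (max (\<eta> i 0 - real j) 0) \<le> \<bar>\<eta> i 0\<bar>" for j by (rule AE_I2) auto
    qed simp
    then show ?thesis by (simp add: e_def)
  qed
  have trunc: "\<rho> i - e K \<le> (\<integral>\<eta>. min (A N \<eta>) K \<partial>\<mu>)" if K: "0 \<le> K" for N K
  proof -
    have minint: "integrable \<mu> (\<lambda>\<eta>. min (A N \<eta>) K)" by (intro integrable_min Aint integrable_const)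
    have maxint: "integrable \<mu> (\<lambda>\<eta>. max (\<eta> i k - K) 0)" for k
      by (intro integrable_max Bochner_Integration.integrable_diff int integrable_const integrable_zero)
    have "A N \<eta> - min (A N \<eta>) K \<le> (\<Sum>k=- int N..0. max (\<eta> i k - K) 0) / real (Suc N)" for \<eta>
    proof -
      have "A N \<eta> - K = (\<Sum>k=- int N..0. \<eta> i k - K) / real (Suc N)"
        unfolding A_def sum_subtractf cN by (simp add: diff_divide_distrib del: of_nat_Suc)
      also have "\<dots> \<le> (\<Sum>k=- int N..0. max (\<eta> i k - K) 0) / real (Suc N)"
        by (intro divide_right_mono sum_mono) auto
      finally have "A N \<eta> - K \<le> (\<Sum>k=- int N..0. max (\<eta> i k - K) 0) / real (Suc N)" .
      moreover have "0 \<le> (\<Sum>k=- int N..0. max (\<eta> i k - K) 0) / real (Suc N)"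
        by (intro divide_nonneg_nonneg sum_nonneg) auto
      ultimately show ?thesis by (auto simp: min_def)
    qed
    then have "(\<integral>\<eta>. A N \<eta> - min (A N \<eta>) K \<partial>\<mu>) \<le> (\<integral>\<eta>. (\<Sum>k=- int N..0. max (\<eta> i k - K) 0) / real (Suc N) \<partial>\<mu>)"
      by (intro integral_mono Bochner_Integration.integrable_diff Aint minint integrable_divide Bochner_Integration.integrable_sum maxint)
    also have "\<dots> = (\<Sum>k=- int N..0. \<integral>\<eta>. max (\<eta> i k - K) 0 \<partial>\<mu>) / real (Suc N)"
      by (simp add: maxint Bochner_Integration.integral_sum del: of_nat_Suc)
    also have "\<dots> = (\<Sum>k=- int N..0. e K) / real (Suc N)"
    proof -
      have "(\<integral>\<eta>. max (\<eta> i k - K) 0 \<partial>\<mu>) = e K" for k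
        unfolding e_def by (rule st[of "\<lambda>x. max (x - K) 0"]) measurable
      then show ?thesis by (simp only:)
    qed
    also have "\<dots> = e K" unfolding cN by (simp del: of_nat_Suc)
    finally show ?thesis using Aint minint by (simp add: Amean)
  qed
  have minlim: "(\<lambda>N. \<integral>\<eta>. min (A N \<eta>) K \<partial>\<mu>) \<longlonglongrightarrow> (\<integral>\<eta>. min (L \<eta>) K \<partial>\<mu>)" if K: "0 \<le> K" for K
  proof (rule integral_dominated_convergence[where w = "\<lambda>_. K"])
    show "AE \<eta> in \<mu>. (\<lambda>N. min (A N \<eta>) K) \<longlonglongrightarrow> min (L \<eta>) K"
      using aeA by eventually_elim (intro tendsto_min tendsto_const)
    show "AE \<eta> in \<mu>. norm (min (A N \<eta>) K) \<le> K" for N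
      using Apos by eventually_elim (use K in \<open>auto simp: min_def\<close>)
  qed (intro borel_measurable_min L A borel_measurable_const integrable_const)+
  have low: "AE \<eta> in \<mu>. c < L \<eta>" if c: "c < \<rho> i" for c
  proof -
    \<comment> \<open>Convergence is part of the condition: where the averages diverge,
      \<open>L\<close> is a default value that need not be translation-invariant, and
      \<open>S\<close> has to be strictly invariant.\<close>
    define S where "S = {\<eta> \<in> space (config_space n). has_avg (\<eta> i) (L \<eta>) \<and> L \<eta> \<le> c}"
    have S: "S \<in> sets (config_space n)"
      unfolding S_def
      by (intro sets.sets_Collect_conj predE[OF has_avg_fun_pred[OF seqC LC]] borel_measurable_le LC borel_measurable_const)
    have Siff: "\<eta> \<in> S \<longleftrightarrow> \<eta> \<in> space (config_space n) \<and> (\<exists>b\<le>c. has_avg (\<eta> i) b)" for \<eta>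
      unfolding S_def using Leq by auto
    have "translation n l -` S \<inter> space (config_space n) = S" for l
    proof -
      have "translation n l \<eta> \<in> S \<longleftrightarrow> \<eta> \<in> S" if \<eta>: "\<eta> \<in> space (config_space n)" for \<eta>
      proof -
        have t: "translation n l \<eta> i = shift_seq l (\<eta> i)" using i by (simp add: translation_def)
        have "has_avg (shift_seq l (\<eta> i)) b \<longleftrightarrow> has_avg (\<eta> i) b" for b
          using has_avg_shift[of "\<eta> i" b l] has_avg_shift[of "shift_seq l (\<eta> i)" b "- l"] by auto
        then show ?thesis unfolding Siff t using \<eta> measurable_space[OF measurable_translation \<eta>] by simp
      qed
      then show ?thesis unfolding set_eq_iff using Siff by blast
    qed
    then have "measure \<mu> S = 0 \<or> measure \<mu> S = 1" using erg S unfolding translation_ergodic_def by blast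
    moreover have "measure \<mu> S \<noteq> 1"
    proof
      assume "measure \<mu> S = 1"
      then have aeS: "AE \<eta> in \<mu>. L \<eta> \<le> c"
        using AE_in_set_eq_1[of S] S s by (auto simp: S_def)
      have c0: "0 \<le> c"
      proof -
        have "AE \<eta> in \<mu>. 0 \<le> c" using aeS Lpos by eventually_elim simp
        then show ?thesis by simp
      qed
      have "\<forall>\<^sub>F j in sequentially. e (real j) < \<rho> i - c" using order_tendstoD(2)[OF e0] c by simp
      then obtain j where j: "e (real j) < \<rho> i - c" by (auto simp: eventually_sequentially)
      have "\<rho> i - e (real j) \<le> (\<integral>\<eta>. min (L \<eta>) (real j) \<partial>\<mu>)"
        by (rule LIMSEQ_le_const[OF minlim]) (use trunc in auto)
      also have "\<dots> \<le> (\<integral>\<eta>. c \<partial>\<mu>)"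
      proof (rule integral_mono_AE)
        show "integrable \<mu> (\<lambda>\<eta>. min (L \<eta>) (real j))"
        proof (rule integrable_const_bound[where B = "real j"])
          show "AE \<eta> in \<mu>. norm (min (L \<eta>) (real j)) \<le> real j" using Lpos by eventually_elim auto
        qed (intro borel_measurable_min L borel_measurable_const)
        show "AE \<eta> in \<mu>. min (L \<eta>) (real j) \<le> c" using aeS by eventually_elim auto
      qed simp
      finally show False using j by (simp add: prob_space)
    qed
    ultimately have "S \<in> null_sets \<mu>" using S s by (auto simp: emeasure_eq_measure null_sets_def)
    then have "AE \<eta> in \<mu>. \<eta> \<notin> S" by (rule AE_not_in)
    then show ?thesis using aeL AE_space by eventually_elim (auto simp: S_def sp)
  qed
  have ge: "AE \<eta> in \<mu>. \<rho> i \<le> L \<eta>"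
  proof -
    have "AE \<eta> in \<mu>. \<forall>j::nat. \<rho> i - 1 / real (Suc j) < L \<eta>" unfolding AE_all_countable by (intro allI low) simp
    then show ?thesis
    proof eventually_elim
      case (elim \<eta>)
      show ?case
      proof (rule ccontr)
        assume "\<not> \<rho> i \<le> L \<eta>"
        then obtain j where "1 / real (Suc j) < \<rho> i - L \<eta>" using nat_approx_posE[of "\<rho> i - L \<eta>"] by auto
        then show False using elim[rule_format, of j] by linarith
      qed
    qed
  qed
  have eq: "AE \<eta> in \<mu>. L \<eta> = \<rho> i"
  proof -
    \<comment> \<open>Any level above \<open>\<rho> i\<close> would do. Truncation there still
      detects the limit: if the truncated value is \<open>\<rho> i\<close>, then so is
      \<open>L \<eta>\<close>.\<close>
    let ?K = "\<rho> i + 1"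
    have i2: "integrable \<mu> (\<lambda>\<eta>. min (L \<eta>) ?K)"
    proof (rule integrable_const_bound[where B = ?K])
      show "AE \<eta> in \<mu>. norm (min (L \<eta>) ?K) \<le> ?K" using Lpos by eventually_elim (use \<rho>0 in auto)
    qed (intro borel_measurable_min L borel_measurable_const)
    have "(\<integral>\<eta>. min (L \<eta>) ?K \<partial>\<mu>) \<le> \<rho> i"
    proof (rule LIMSEQ_le_const2[OF minlim])
      have "(\<integral>\<eta>. min (A N \<eta>) ?K \<partial>\<mu>) \<le> (\<integral>\<eta>. A N \<eta> \<partial>\<mu>)" for N
        by (intro integral_mono integrable_min Aint integrable_const) auto
      then show "\<exists>N. \<forall>n\<ge>N. (\<integral>\<eta>. min (A n \<eta>) ?K \<partial>\<mu>) \<le> \<rho> i" by (simp add: Amean)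
    qed (use \<rho>0 in simp)
    then have le0: "(\<integral>\<eta>. min (L \<eta>) ?K - \<rho> i \<partial>\<mu>) \<le> 0" using i2 by (simp add: prob_space)
    have nn: "AE \<eta> in \<mu>. 0 \<le> min (L \<eta>) ?K - \<rho> i" using ge by eventually_elim auto
    have "(\<integral>\<eta>. min (L \<eta>) ?K - \<rho> i \<partial>\<mu>) = 0" using le0 integral_nonneg_AE[OF nn] by simp
    then have "AE \<eta> in \<mu>. min (L \<eta>) ?K - \<rho> i = 0"
      using integral_nonneg_eq_0_iff_AE[OF _ nn] i2 by simp
    then show ?thesis by eventually_elim (auto simp: min_def split: if_splits)
  qed
  \<comment> \<open>Only the deviation below the mean is treated by domination, with the bound
    \<open>\<rho> i\<close>. The deviation above has the same mean, because \<open>A N\<close> has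
    mean \<open>\<rho> i\<close>.\<close>
  have half: "(\<lambda>N. \<integral>\<eta>. max (\<rho> i - A N \<eta>) 0 \<partial>\<mu>) \<longlonglongrightarrow> (\<integral>\<eta>. 0 \<partial>\<mu>)"
  proof (rule integral_dominated_convergence[where w = "\<lambda>_. \<rho> i"])
    show "AE \<eta> in \<mu>. (\<lambda>N. max (\<rho> i - A N \<eta>) 0) \<longlonglongrightarrow> 0"
      using aeA eq
    proof eventually_elim
      case (elim \<eta>)
      have "(\<lambda>N. max (\<rho> i - A N \<eta>) 0) \<longlonglongrightarrow> max (\<rho> i - L \<eta>) 0"
        by (intro tendsto_max tendsto_diff tendsto_const elim(1))
      then show ?case using elim(2) by simp
    qed
    show "AE \<eta> in \<mu>. norm (max (\<rho> i - A N \<eta>) 0) \<le> \<rho> i" for N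
      using Apos by eventually_elim (use \<rho>0 in auto)
  qed (intro borel_measurable_max borel_measurable_diff A borel_measurable_const integrable_const)+
  have "(\<integral>\<eta>. \<bar>A N \<eta> - \<rho> i\<bar> \<partial>\<mu>) = 2 * (\<integral>\<eta>. max (\<rho> i - A N \<eta>) 0 \<partial>\<mu>)" for N
  proof -
    have m: "integrable \<mu> (\<lambda>\<eta>. max (\<rho> i - A N \<eta>) 0)"
      by (intro integrable_max Bochner_Integration.integrable_diff Aint integrable_const integrable_zero)
    have "\<bar>A N \<eta> - \<rho> i\<bar> = (A N \<eta> - \<rho> i) + 2 * max (\<rho> i - A N \<eta>) 0" for \<eta> by (auto simp: max_def)
    then have "(\<integral>\<eta>. \<bar>A N \<eta> - \<rho> i\<bar> \<partial>\<mu>) = (\<integral>\<eta>. (A N \<eta> - \<rho> i) + 2 * max (\<rho> i - A N \<eta>) 0 \<partial>\<mu>)" by simp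
    also have "\<dots> = (\<integral>\<eta>. A N \<eta> - \<rho> i \<partial>\<mu>) + (\<integral>\<eta>. 2 * max (\<rho> i - A N \<eta>) 0 \<partial>\<mu>)"
      by (intro Bochner_Integration.integral_add Bochner_Integration.integrable_diff Aint integrable_const integrable_mult_right m)
    also have "(\<integral>\<eta>. A N \<eta> - \<rho> i \<partial>\<mu>) = 0" using Aint by (simp add: Amean prob_space)
    finally show ?thesis by simp
  qed
  moreover have "(\<lambda>N. 2 * (\<integral>\<eta>. max (\<rho> i - A N \<eta>) 0 \<partial>\<mu>)) \<longlonglongrightarrow> 2 * 0"
    using half by (intro tendsto_mult tendsto_const) simp
  ultimately show ?thesis unfolding A_def by simp
qed

section \<open>Contraction of stationary couplings\<close>

text \<open>Positive and negative part move in opposite directions, so splitting a number into its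
  two parts is an isometry into the plane with the sum norm. In a queue the two parts become idle
  time and waiting time.\<close>

lemma pos_neg_parts_diff:
  fixes u v :: real
  shows "\<bar>max u 0 - max v 0\<bar> + \<bar>max (- u) 0 - max (- v) 0\<bar> = \<bar>u - v\<bar>"
  by (auto simp: max_def)

abbreviation gap :: "(int \<Rightarrow> real) \<times> (int \<Rightarrow> real) \<Rightarrow> int \<Rightarrow> real" where
  "gap x k \<equiv> fst x k - snd x k"

text \<open>The two arrival processes are coupled by \<open>\<Lambda>\<close> and use the same services \<open>fst x\<close>.\<close>

locale queue_coupling =
  fixes \<Lambda> :: "((int \<Rightarrow> real) \<times> (int \<Rightarrow> real)) measure"
  assumes prob_\<Lambda>: "prob_space \<Lambda>"
    and sets_\<Lambda>: "sets \<Lambda> = sets (seq_space \<Otimes>\<^sub>M seq_space)"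
    and stationary: "distr \<Lambda> (seq_space \<Otimes>\<^sub>M seq_space) (\<lambda>x. (shift_seq l (fst x), shift_seq l (snd x))) = \<Lambda>"
    and good: "AE x in exp_seq 1 \<Otimes>\<^sub>M \<Lambda>. (\<forall>k. 0 \<le> fst x k) \<and> (\<forall>k. 0 \<le> fst (snd x) k) \<and> (\<forall>k. 0 \<le> snd (snd x) k) \<and>
        stable (fst (snd x)) (fst x) \<and> stable (snd (snd x)) (fst x)"
    and integrable_in: "integrable \<Lambda> (\<lambda>x. fst x k)" "integrable \<Lambda> (\<lambda>x. snd x k)"
    and integrable_out: "integrable (exp_seq 1 \<Otimes>\<^sub>M \<Lambda>) (\<lambda>x. queue_map (fst (snd x)) (fst x) 0)"
        "integrable (exp_seq 1 \<Otimes>\<^sub>M \<Lambda>) (\<lambda>x. queue_map (snd (snd x)) (fst x) 0)"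
begin

definition P where "P = exp_seq 1 \<Otimes>\<^sub>M \<Lambda>"

definition I where "I k x = fst (snd x) k" for k :: int and x :: "(int \<Rightarrow> real) \<times> (int \<Rightarrow> real) \<times> (int \<Rightarrow> real)"
definition I' where "I' k x = snd (snd x) k" for k :: int and x :: "(int \<Rightarrow> real) \<times> (int \<Rightarrow> real) \<times> (int \<Rightarrow> real)"
definition D where "D k x = queue_map (fst (snd x)) (fst x) k" for k :: int and x :: "(int \<Rightarrow> real) \<times> (int \<Rightarrow> real) \<times> (int \<Rightarrow> real)"
definition D' where "D' k x = queue_map (snd (snd x)) (fst x) k" for k :: int and x :: "(int \<Rightarrow> real) \<times> (int \<Rightarrow> real) \<times> (int \<Rightarrow> real)"
definition J where "J k x = sojourn (fst (snd x)) (fst x) k" for k :: int and x :: "(int \<Rightarrow> real) \<times> (int \<Rightarrow> real) \<times> (int \<Rightarrow> real)"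
definition J' where "J' k x = sojourn (snd (snd x)) (fst x) k" for k :: int and x :: "(int \<Rightarrow> real) \<times> (int \<Rightarrow> real) \<times> (int \<Rightarrow> real)"

text \<open>For the arrival gap \<open>a\<close> and the workload gap \<open>b\<close> this is
  \<bar>a\<bar> + \<bar>b\<bar> - \<bar>a - b\<bar>: twice the smaller modulus if the signs agree,
  and 0 otherwise. It is the part of the total discrepancy that disappears at site
  \<open>k\<close>.\<close>

definition loss where
  "loss k x = \<bar>I k x - I' k x\<bar> + \<bar>J (k - 1) x - J' (k - 1) x\<bar> - \<bar>(I k x - I' k x) - (J (k - 1) x - J' (k - 1) x)\<bar>"

sublocale L: prob_space \<Lambda> by (rule prob_\<Lambda>)
sublocale W: prob_space "exp_seq 1" by (rule prob_space_exp_seq) simp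
sublocale P: prob_space P unfolding P_def by (intro prob_space_pair) unfold_locales

lemma sets_P: "sets P = sets (seq_space \<Otimes>\<^sub>M seq_space \<Otimes>\<^sub>M seq_space)"
  unfolding P_def by (intro sets_pair_measure_cong sets_exp_seq sets_\<Lambda>)

lemma measurable_coords:
  "fst \<in> P \<rightarrow>\<^sub>M seq_space" "(\<lambda>x. fst (snd x)) \<in> P \<rightarrow>\<^sub>M seq_space" "(\<lambda>x. snd (snd x)) \<in> P \<rightarrow>\<^sub>M seq_space"
  unfolding measurable_cong_sets[OF sets_P refl] by measurable

lemma borel_coords:
  "I k \<in> borel_measurable P" "I' k \<in> borel_measurable P" "D k \<in> borel_measurable P" "D' k \<in> borel_measurable P"
  "J k \<in> borel_measurable P" "J' k \<in> borel_measurable P"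
  unfolding I_def[abs_def] I'_def[abs_def] D_def[abs_def] D'_def[abs_def] J_def[abs_def] J'_def[abs_def]
  by (rule measurable_seq_component[OF measurable_coords(2)] measurable_seq_component[OF measurable_coords(3)]
        measurable_seq_component[OF measurable_queue_map[OF measurable_coords(2) measurable_coords(1)]]
        measurable_seq_component[OF measurable_queue_map[OF measurable_coords(3) measurable_coords(1)]]
        measurable_sojourn[OF measurable_coords(2) measurable_coords(1)]
        measurable_sojourn[OF measurable_coords(3) measurable_coords(1)])+

lemma borel_loss: "loss k \<in> borel_measurable P"
  unfolding loss_def[abs_def]
  by (intro borel_measurable_diff borel_measurable_add borel_measurable_abs borel_coords)

definition shift3 where
  "shift3 l x = (shift_seq l (fst x), shift_seq l (fst (snd x)), shift_seq l (snd (snd x)))"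
  for l :: int and x :: "(int \<Rightarrow> real) \<times> (int \<Rightarrow> real) \<times> (int \<Rightarrow> real)"

lemma shift3_coords: "I k (shift3 l x) = I (k + l) x" "I' k (shift3 l x) = I' (k + l) x"
  "D k (shift3 l x) = D (k + l) x" "D' k (shift3 l x) = D' (k + l) x"
  "J k (shift3 l x) = J (k + l) x" "J' k (shift3 l x) = J' (k + l) x"
  by (simp_all add: I_def I'_def D_def D'_def J_def J'_def shift3_def queue_map_shift sojourn_shift)

lemma measurable_shift3: "shift3 l \<in> P \<rightarrow>\<^sub>M P"
  unfolding shift3_def[abs_def] measurable_cong_sets[OF sets_P sets_P]
  by (intro measurable_Pair measurable_compose[OF _ measurable_shift_seq]) measurable

lemma distr_shift3: "distr P P (shift3 l) = P"
proof -
  let ?S = "\<lambda>x :: (int \<Rightarrow> real) \<times> (int \<Rightarrow> real). (shift_seq l (fst x), shift_seq l (snd x))"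
  have S: "?S \<in> \<Lambda> \<rightarrow>\<^sub>M seq_space \<Otimes>\<^sub>M seq_space"
    unfolding measurable_cong_sets[OF sets_\<Lambda> refl]
    by (intro measurable_Pair measurable_compose[OF _ measurable_shift_seq]) measurable
  have "distr (exp_seq 1) (exp_seq 1) (shift_seq l) \<Otimes>\<^sub>M distr \<Lambda> (seq_space \<Otimes>\<^sub>M seq_space) ?S =
      distr (exp_seq 1 \<Otimes>\<^sub>M \<Lambda>) (exp_seq 1 \<Otimes>\<^sub>M (seq_space \<Otimes>\<^sub>M seq_space)) (\<lambda>(w, x). (shift_seq l w, ?S x))"
  proof (rule pair_measure_distr[OF _ S])
    show "sigma_finite_measure (distr \<Lambda> (seq_space \<Otimes>\<^sub>M seq_space) ?S)"
      unfolding stationary by unfold_locales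
  qed measurable
  then have "P = distr (exp_seq 1 \<Otimes>\<^sub>M \<Lambda>) (exp_seq 1 \<Otimes>\<^sub>M (seq_space \<Otimes>\<^sub>M seq_space)) (\<lambda>(w, x). (shift_seq l w, ?S x))"
    unfolding stationary distr_shift_exp_seq[OF zero_less_one] P_def .
  also have "\<dots> = distr P P (shift3 l)"
    by (rule distr_cong) (auto simp: P_def shift3_def sets_\<Lambda> intro!: sets_pair_measure_cong)
  finally show ?thesis ..
qed

lemma expectation_shift:
  fixes f :: "_ \<Rightarrow> real"
  assumes "f \<in> borel_measurable P"
  shows "P.expectation (\<lambda>x. f (shift3 l x)) = P.expectation f"
  using integral_distr[OF measurable_shift3 assms, of l] by (simp only: distr_shift3)

lemma integrable_shift:
  fixes f :: "_ \<Rightarrow> real"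
  assumes "integrable P f"
  shows "integrable P (\<lambda>x. f (shift3 l x))"
  using integrable_distr[OF measurable_shift3, of l f] assms by (simp only: distr_shift3)

lemma AE_good: "AE x in P. (\<forall>k. 0 \<le> fst x k) \<and> (\<forall>k. 0 \<le> I k x) \<and> (\<forall>k. 0 \<le> I' k x) \<and>
    stable (fst (snd x)) (fst x) \<and> stable (snd (snd x)) (fst x)"
  using good unfolding P_def I_def I'_def .

lemma integral_input:
  fixes f :: "_ \<Rightarrow> real"
  assumes f: "f \<in> borel_measurable \<Lambda>"
  shows "P.expectation (\<lambda>x. f (snd x)) = L.expectation f" "integrable P (\<lambda>x. f (snd x)) \<longleftrightarrow> integrable \<Lambda> f"
proof -
  have sn: "snd \<in> P \<rightarrow>\<^sub>M \<Lambda>" unfolding P_def by (rule measurable_snd)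
  have d: "distr P \<Lambda> snd = \<Lambda>" unfolding P_def by (rule distr_pair_snd) unfold_locales
  show "P.expectation (\<lambda>x. f (snd x)) = L.expectation f"
    using integral_distr[OF sn f] unfolding d by simp
  show "integrable P (\<lambda>x. f (snd x)) \<longleftrightarrow> integrable \<Lambda> f"
    using integrable_distr_eq[OF sn f] unfolding d by simp
qed

lemma borel_in: "(\<lambda>x. fst x k) \<in> borel_measurable \<Lambda>" "(\<lambda>x. snd x k) \<in> borel_measurable \<Lambda>"
  unfolding measurable_cong_sets[OF sets_\<Lambda> refl]
  by (intro measurable_seq_component measurable_fst measurable_snd)+

lemma integrable_I: "integrable P (I k)" "integrable P (I' k)"
  using integral_input(2)[OF borel_in(1)[of k]] integral_input(2)[OF borel_in(2)[of k]] integrable_in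
  unfolding I_def[abs_def] I'_def[abs_def] by blast+

lemma integrable_D: "integrable P (D k)" "integrable P (D' k)"
proof -
  have 0: "integrable P (D 0)" "integrable P (D' 0)"
    using integrable_out unfolding D_def[abs_def] D'_def[abs_def] P_def .
  show "integrable P (D k)" "integrable P (D' k)"
    using integrable_shift[OF 0(1), of k] integrable_shift[OF 0(2), of k] by (simp_all add: shift3_coords)
qed

section \<open>The balance of discrepancies and its expectation\<close>

lemma AE_balance: "AE x in P. \<forall>k. \<bar>D k x - D' k x\<bar> + \<bar>J k x - J' k x\<bar> = \<bar>(I k x - I' k x) - (J (k - 1) x - J' (k - 1) x)\<bar>"
  using AE_good
proof eventually_elim
  case (elim x)
  have st: "stable (fst (snd x)) (fst x)" "stable (snd (snd x)) (fst x)" using elim by auto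
  show ?case
  proof
    fix k
    let ?u = "I k x - J (k - 1) x" and ?v = "I' k x - J' (k - 1) x"
    have "D k x = fst x k + max ?u 0" "J k x = fst x k + max (- ?u) 0"
      using queue_map_rec[OF st(1), of k] sojourn_rec[OF st(1), of k] by (simp_all add: D_def J_def I_def)
    moreover have "D' k x = fst x k + max ?v 0" "J' k x = fst x k + max (- ?v) 0"
      using queue_map_rec[OF st(2), of k] sojourn_rec[OF st(2), of k] by (simp_all add: D'_def J'_def I'_def)
    ultimately have "\<bar>D k x - D' k x\<bar> + \<bar>J k x - J' k x\<bar> = \<bar>?u - ?v\<bar>"
      using pos_neg_parts_diff[of ?u ?v] by simp
    then show "\<bar>D k x - D' k x\<bar> + \<bar>J k x - J' k x\<bar> = \<bar>(I k x - I' k x) - (J (k - 1) x - J' (k - 1) x)\<bar>"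
      by (simp add: algebra_simps)
  qed
qed

lemma loss_bounds: "0 \<le> loss k x" "loss k x \<le> 2 * \<bar>I k x - I' k x\<bar>"
  unfolding loss_def
  using abs_triangle_ineq4[of "I k x - I' k x" "J (k - 1) x - J' (k - 1) x"]
    abs_triangle_ineq2_sym[of "J (k - 1) x - J' (k - 1) x" "I k x - I' k x"] by linarith+

lemma integrable_loss: "integrable P (loss k)"
proof (rule Bochner_Integration.integrable_bound)
  show "integrable P (\<lambda>x. 2 * \<bar>I k x - I' k x\<bar>)"
    by (intro integrable_mult_right integrable_abs Bochner_Integration.integrable_diff integrable_I)
  show "AE x in P. norm (loss k x) \<le> norm (2 * \<bar>I k x - I' k x\<bar>)"
    by (rule AE_I2) (use loss_bounds in simp)
qed (rule borel_loss)

text \<open>The workload difference need not be integrable; its increments are, and truncation shows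
  that they have mean zero.\<close>

lemma workload_increment:
  "integrable P (\<lambda>x. \<bar>J k x - J' k x\<bar> - \<bar>J (k - 1) x - J' (k - 1) x\<bar>)"
  "P.expectation (\<lambda>x. \<bar>J k x - J' k x\<bar> - \<bar>J (k - 1) x - J' (k - 1) x\<bar>) = 0"
proof -
  define Y where "Y k x = \<bar>J k x - J' k x\<bar>" for k x
  have Y: "Y k \<in> borel_measurable P" for k
    unfolding Y_def[abs_def] by (intro borel_measurable_abs borel_measurable_diff borel_coords)
  have Ymin: "(\<lambda>x. min (Y k x) c) \<in> borel_measurable P" for k c
    by (intro borel_measurable_min borel_measurable_const Y)
  \<comment> \<open>By the balance, the workload gap cannot change by more than the arrival gap plus
    the departure gap. Both are integrable, and this dominates the increments although the workload
    gap itself may have no mean.\<close>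
  define B where "B x = \<bar>I k x - I' k x\<bar> + \<bar>D k x - D' k x\<bar>" for x
  have B: "integrable P B"
    unfolding B_def[abs_def] by (intro Bochner_Integration.integrable_add integrable_abs Bochner_Integration.integrable_diff integrable_I integrable_D)
  have bound: "AE x in P. \<bar>Y k x - Y (k - 1) x\<bar> \<le> B x"
    using AE_balance
  proof eventually_elim
    case (elim x)
    from elim[rule_format, of k] show ?case unfolding Y_def B_def by linarith
  qed
  show int: "integrable P (\<lambda>x. \<bar>J k x - J' k x\<bar> - \<bar>J (k - 1) x - J' (k - 1) x\<bar>)"
    unfolding Y_def[symmetric]
  proof (rule Bochner_Integration.integrable_bound[OF B])
    show "AE x in P. norm (Y k x - Y (k - 1) x) \<le> norm (B x)"
      using bound by eventually_elim simp
  qed (intro borel_measurable_diff Y)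
  have "(\<lambda>K. P.expectation (\<lambda>x. min (Y k x) (real K) - min (Y (k - 1) x) (real K))) \<longlonglongrightarrow>
      P.expectation (\<lambda>x. Y k x - Y (k - 1) x)"
  proof (rule integral_dominated_convergence[where w = B])
    show "AE x in P. (\<lambda>K. min (Y k x) (real K) - min (Y (k - 1) x) (real K)) \<longlonglongrightarrow> Y k x - Y (k - 1) x"
    proof (rule AE_I2)
      fix x
      obtain K0 :: nat where K0: "max (Y k x) (Y (k - 1) x) \<le> real K0" using real_arch_simple by blast
      have "\<forall>\<^sub>F K in sequentially. min (Y k x) (real K) - min (Y (k - 1) x) (real K) = Y k x - Y (k - 1) x"
        by (rule eventually_mono[OF eventually_ge_at_top[of K0]]) (use K0 in auto)
      then show "(\<lambda>K. min (Y k x) (real K) - min (Y (k - 1) x) (real K)) \<longlonglongrightarrow> Y k x - Y (k - 1) x"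
        by (rule tendsto_eventually)
    qed
    show "AE x in P. norm (min (Y k x) (real K) - min (Y (k - 1) x) (real K)) \<le> B x" for K
      using bound by eventually_elim auto
  qed (intro borel_measurable_diff Ymin Y B)+
  moreover have "P.expectation (\<lambda>x. min (Y k x) (real K) - min (Y (k - 1) x) (real K)) = 0" for K
  proof -
    have i: "integrable P (\<lambda>x. min (Y j x) (real K))" for j
    proof (rule P.integrable_const_bound[where B = "real K"])
      show "AE x in P. norm (min (Y j x) (real K)) \<le> real K" by (rule AE_I2) (simp add: Y_def)
    qed (rule Ymin)
    have "P.expectation (\<lambda>x. min (Y (k - 1) (shift3 1 x)) (real K)) = P.expectation (\<lambda>x. min (Y (k - 1) x) (real K))"
      by (rule expectation_shift[OF Ymin])
    moreover have "Y (k - 1) (shift3 1 x) = Y k x" for x by (simp add: Y_def shift3_coords)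
    ultimately show ?thesis using i by simp
  qed
  ultimately have "(\<lambda>K :: nat. 0) \<longlonglongrightarrow> P.expectation (\<lambda>x. Y k x - Y (k - 1) x)" by simp
  then show "P.expectation (\<lambda>x. \<bar>J k x - J' k x\<bar> - \<bar>J (k - 1) x - J' (k - 1) x\<bar>) = 0"
    unfolding Y_def by (rule LIMSEQ_unique) (rule tendsto_const)
qed

lemma borel_gap: "(\<lambda>x. \<bar>gap x k\<bar>) \<in> borel_measurable \<Lambda>"
  by (intro borel_measurable_abs borel_measurable_diff borel_in)

lemma expectation_gap: "P.expectation (\<lambda>x. \<bar>I k x - I' k x\<bar>) = P.expectation (\<lambda>x. \<bar>I 0 x - I' 0 x\<bar>)"
  using expectation_shift[OF borel_measurable_abs[OF borel_measurable_diff[OF borel_coords(1)[of 0] borel_coords(2)[of 0]]], of k]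
  unfolding shift3_coords add_0 .

text \<open>The balance writes the loss as arrival gap minus departure gap minus the increment of
  the workload gap, and the last term has mean zero. So the mean loss at any site is the decrease of
  the mean gap in one service step.\<close>

lemma expectation_loss:
  "P.expectation (loss k) = L.expectation (\<lambda>x. \<bar>gap x 0\<bar>) - P.expectation (\<lambda>x. \<bar>D 0 x - D' 0 x\<bar>)"
proof -
  have i: "integrable P (\<lambda>x. \<bar>I j x - I' j x\<bar>)" "integrable P (\<lambda>x. \<bar>D j x - D' j x\<bar>)" for j
    by (intro integrable_abs Bochner_Integration.integrable_diff integrable_I integrable_D)+
  have "P.expectation (loss k) = P.expectation (\<lambda>x. \<bar>I k x - I' k x\<bar> - \<bar>D k x - D' k x\<bar> - (\<bar>J k x - J' k x\<bar> - \<bar>J (k - 1) x - J' (k - 1) x\<bar>))"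
  proof (rule integral_cong_AE)
    show "AE x in P. loss k x = \<bar>I k x - I' k x\<bar> - \<bar>D k x - D' k x\<bar> - (\<bar>J k x - J' k x\<bar> - \<bar>J (k - 1) x - J' (k - 1) x\<bar>)"
      using AE_balance
    proof eventually_elim
      case (elim x)
      from elim[rule_format, of k] show ?case unfolding loss_def by linarith
    qed
  qed (intro borel_loss borel_measurable_diff borel_measurable_abs borel_coords)+
  also have "\<dots> = P.expectation (\<lambda>x. \<bar>I k x - I' k x\<bar>) - P.expectation (\<lambda>x. \<bar>D k x - D' k x\<bar>)"
    using i workload_increment[of k] by simp
  also have "P.expectation (\<lambda>x. \<bar>D k x - D' k x\<bar>) = P.expectation (\<lambda>x. \<bar>D 0 x - D' 0 x\<bar>)"
    using expectation_shift[OF borel_measurable_abs[OF borel_measurable_diff[OF borel_coords(3)[of 0] borel_coords(4)[of 0]]], of k]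
    unfolding shift3_coords add_0 .
  also have "P.expectation (\<lambda>x. \<bar>I k x - I' k x\<bar>) = P.expectation (\<lambda>x. \<bar>I 0 x - I' 0 x\<bar>)"
    by (rule expectation_gap)
  also have "\<dots> = L.expectation (\<lambda>x. \<bar>gap x 0\<bar>)"
    using integral_input(1)[OF borel_gap, of 0] unfolding I_def I'_def .
  finally show ?thesis .
qed

text \<open>A service larger than all arrivals of the window keeps both queues busy throughout the
  window, so that the workload difference changes exactly by the gaps.\<close>

lemma AE_loss_window:
  "AE x in P. (\<Sum>k=- int m..0. I k x + I' k x) < fst x (- int m - 1) \<longrightarrow>
     (\<Sum>k=- int m..0. \<bar>I k x - I' k x\<bar>) - \<bar>\<Sum>k=- int m..0. I k x - I' k x\<bar> \<le> (\<Sum>k=- int m..0. loss k x)"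
  using AE_good
proof eventually_elim
  case (elim x)
  \<comment> \<open>The site just before the window; its service alone is assumed to exceed all
    arrivals of the window.\<close>
  define a where "a = - int m - 1"
  have nn: "0 \<le> fst x k" "0 \<le> I k x" "0 \<le> I' k x" for k using elim by auto
  have st: "stable (fst (snd x)) (fst x)" "stable (snd (snd x)) (fst x)" using elim by auto
  have Jrec: "J k x = fst x k + max (J (k - 1) x - I k x) 0" "J' k x = fst x k + max (J' (k - 1) x - I' k x) 0" for k
    using sojourn_rec[OF st(1), of k] sojourn_rec[OF st(2), of k] by (simp_all add: J_def J'_def I_def I'_def)
  have Jge: "J (k - 1) x - I k x \<le> J k x" "J' (k - 1) x - I' k x \<le> J' k x" "fst x k \<le> J k x" "fst x k \<le> J' k x" for k
    using Jrec[of k] nn(1)[of k] by linarith+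
  show ?case
  proof
    assume big: "(\<Sum>k=- int m..0. I k x + I' k x) < fst x (- int m - 1)"
    \<comment> \<open>Starting from the service at \<open>a\<close>, each arrival can reduce a
      sojourn time by at most its own size, as services and positive parts only add to it.\<close>
    have low: "fst x a - (\<Sum>j=a + 1..k. I j x) \<le> J k x \<and> fst x a - (\<Sum>j=a + 1..k. I' j x) \<le> J' k x" if "a \<le> k" for k
      using that
    proof (induction k rule: int_ge_induct)
      case base
      show ?case using Jge(3,4)[of a] by simp
    next
      case (step k)
      have "(\<Sum>j=a + 1..k + 1. f j) = (\<Sum>j=a + 1..k. f j) + f (k + 1)" for f :: "int \<Rightarrow> real"
        using sum_int_last[of "a + 1" "k + 1" f] step(1) by simp
      then show ?case using Jge(1,2)[of "k + 1"] step.IH by simp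
    qed
    have busy: "J k x - J' k x = (J (k - 1) x - J' (k - 1) x) - (I k x - I' k x)" if k: "a + 1 \<le> k" "k \<le> 0" for k
    proof -
      have sub: "(\<Sum>j=a + 1..k. I j x) \<le> (\<Sum>j=- int m..0. I j x + I' j x)"
        "(\<Sum>j=a + 1..k. I' j x) \<le> (\<Sum>j=- int m..0. I j x + I' j x)"
      proof -
        have s: "{a + 1..k} \<subseteq> {- int m..0}" using k by (auto simp: a_def)
        have "(\<Sum>j=a + 1..k. I j x) \<le> (\<Sum>j=a + 1..k. I j x + I' j x)" "(\<Sum>j=a + 1..k. I' j x) \<le> (\<Sum>j=a + 1..k. I j x + I' j x)"
          by (intro sum_mono; use nn in simp)+
        moreover have "(\<Sum>j=a + 1..k. I j x + I' j x) \<le> (\<Sum>j=- int m..0. I j x + I' j x)"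
          by (rule sum_mono2[OF _ s]) (use nn in auto)
        ultimately show "(\<Sum>j=a + 1..k. I j x) \<le> (\<Sum>j=- int m..0. I j x + I' j x)"
          "(\<Sum>j=a + 1..k. I' j x) \<le> (\<Sum>j=- int m..0. I j x + I' j x)" by linarith+
      qed
      have "(\<Sum>j=a + 1..k. f j) = (\<Sum>j=a + 1..k - 1. f j) + f k" for f :: "int \<Rightarrow> real"
        using sum_int_last[of "a + 1" k f] k by simp
      then have "I k x \<le> J (k - 1) x" "I' k x \<le> J' (k - 1) x"
        using low[of "k - 1"] sub big k by (auto simp: a_def)
      then show ?thesis using Jrec[of k] by simp
    qed
    \<comment> \<open>While both queues are busy, the difference subtracted in the loss is, up to
      sign, the next workload gap. The losses therefore telescope, and the workload gap changes by
      exactly the net arrival gap, to which the triangle inequality is applied afterwards.\<close>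
    have tel: "(\<Sum>k=a + 1..l. loss k x) = (\<Sum>k=a + 1..l. \<bar>I k x - I' k x\<bar>) + \<bar>J a x - J' a x\<bar> - \<bar>J l x - J' l x\<bar> \<and>
        J l x - J' l x = (J a x - J' a x) - (\<Sum>k=a + 1..l. I k x - I' k x)" if "a \<le> l" "l \<le> 0" for l
      using that
    proof (induction l rule: int_ge_induct)
      case (step l)
      have s: "(\<Sum>j=a + 1..l + 1. f j) = (\<Sum>j=a + 1..l. f j) + f (l + 1)" for f :: "int \<Rightarrow> real"
        using sum_int_last[of "a + 1" "l + 1" f] step(1) by simp
      have b: "J (l + 1) x - J' (l + 1) x = (J l x - J' l x) - (I (l + 1) x - I' (l + 1) x)"
        using busy[of "l + 1"] step by simp
      have "loss (l + 1) x = \<bar>I (l + 1) x - I' (l + 1) x\<bar> + \<bar>J l x - J' l x\<bar> - \<bar>J (l + 1) x - J' (l + 1) x\<bar>"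
        unfolding loss_def b by (simp add: abs_minus_commute)
      then show ?case unfolding s using step b by simp
    qed simp
    have "\<bar>J a x - J' a x\<bar> - \<bar>J 0 x - J' 0 x\<bar> \<ge> - \<bar>\<Sum>k=a + 1..0. I k x - I' k x\<bar>"
      using tel[of 0] by (auto simp: a_def)
    then show "(\<Sum>k=- int m..0. \<bar>I k x - I' k x\<bar>) - \<bar>\<Sum>k=- int m..0. I k x - I' k x\<bar> \<le> (\<Sum>k=- int m..0. loss k x)"
      using tel[of 0] by (simp add: a_def)
  qed
qed

text \<open>\<open>AE_loss_window\<close> applies when the service before the window exceeds
  \<open>K\<close> and the arrivals of the window sum up to at most \<open>K\<close>. The first
  event has probability \<open>exp (- K)\<close> and is independent of the arrivals. Where the sum
  exceeds \<open>K\<close> the gain is given up; it is at most \<open>S\<close>, whose tail is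
  therefore subtracted.\<close>

theorem coupling_gain:
  fixes K :: real and m :: nat
  assumes K: "0 \<le> K"
  defines "S \<equiv> \<lambda>x :: (int \<Rightarrow> real) \<times> (int \<Rightarrow> real). \<Sum>k=- int m..0. fst x k + snd x k"
  shows "exp (- K) * (real (Suc m) * L.expectation (\<lambda>x. \<bar>gap x 0\<bar>) - L.expectation (\<lambda>x. \<bar>\<Sum>k=- int m..0. gap x k\<bar>)
            - L.expectation (\<lambda>x. S x * indicator {x. K < S x} x))
    \<le> real (Suc m) * (L.expectation (\<lambda>x. \<bar>gap x 0\<bar>) - P.expectation (\<lambda>x. \<bar>D 0 x - D' 0 x\<bar>))"
proof -
  have sp: "space \<Lambda> = UNIV" using sets_eq_imp_space_eq[OF sets_\<Lambda>] by (simp add: space_pair_measure space_PiM)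
  have S: "S \<in> borel_measurable \<Lambda>" unfolding S_def by (intro borel_measurable_sum borel_measurable_add borel_in)
  define g where "g x = (\<Sum>k=- int m..0. \<bar>gap x k\<bar>) - \<bar>\<Sum>k=- int m..0. gap x k\<bar>" for x :: "(int \<Rightarrow> real) \<times> (int \<Rightarrow> real)"
  have g0: "0 \<le> g x" for x unfolding g_def using sum_abs[of "gap x" "{- int m..0}"] by simp
  have gm: "g \<in> borel_measurable \<Lambda>"
    unfolding g_def[abs_def] by (intro borel_measurable_diff borel_measurable_sum borel_measurable_abs borel_in)
  define u where "u x = g x * indicator {x. S x \<le> K} x" for x
  have sets_le: "{x. S x \<le> K} \<in> sets \<Lambda>" "{x. K < S x} \<in> sets \<Lambda>"
    using borel_measurable_le[OF S borel_measurable_const[of K]] borel_measurable_less[OF borel_measurable_const[of K] S]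
    unfolding sp by simp_all
  have um: "u \<in> borel_measurable \<Lambda>"
    unfolding u_def[abs_def] by (intro borel_measurable_times gm borel_measurable_indicator sets_le)
  have gapint: "integrable \<Lambda> (\<lambda>x. gap x k)" for k by (intro Bochner_Integration.integrable_diff integrable_in)
  have gint: "integrable \<Lambda> g" unfolding g_def[abs_def]
    by (intro Bochner_Integration.integrable_diff Bochner_Integration.integrable_sum integrable_abs gapint)
  have Sint: "integrable \<Lambda> S" unfolding S_def
    by (intro Bochner_Integration.integrable_sum Bochner_Integration.integrable_add integrable_in)
  have uint: "integrable \<Lambda> u"
    by (rule Bochner_Integration.integrable_bound[OF gint um AE_I2]) (simp add: u_def indicator_def)
  have SKint: "integrable \<Lambda> (\<lambda>x. S x * indicator {x. K < S x} x)"
  proof (rule Bochner_Integration.integrable_bound[OF Sint _ AE_I2])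
    show "(\<lambda>x. S x * indicator {x. K < S x} x) \<in> borel_measurable \<Lambda>"
      by (intro borel_measurable_times S borel_measurable_indicator sets_le)
  qed (simp add: indicator_def)
  define v where "v w = (indicator {w. K < w (- int m - 1)} w :: real)" for w :: "int \<Rightarrow> real"
  have vset: "{w. K < w (- int m - 1)} \<in> sets (exp_seq 1)"
  proof -
    have "(\<lambda>w. w (- int m - 1)) \<in> borel_measurable (exp_seq 1)"
      unfolding measurable_cong_sets[OF sets_exp_seq refl] by (rule measurable_seq_component) simp
    from measurable_sets[OF this, of "{K<..}"] show ?thesis by (simp add: vimage_def)
  qed
  have v: "W.expectation v = exp (- K)"
  proof -
    interpret E: prob_space "exp_dist 1" by (rule prob_space_exp_dist) simp
    have "distr (exp_dist 1) lborel (\<lambda>x. x) = exp_dist 1" by (rule distr_id2) simp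
    then have "distributed (exp_dist 1) lborel (\<lambda>x. x) (exponential_density 1)"
      unfolding distributed_def by (auto simp: exp_dist_def)
    from E.exponential_distributedD_gt[OF this K] have "measure (exp_dist 1) {x. K < x} = exp (- K)" by simp
    moreover have "measure (exp_seq 1) {w. K < w (- int m - 1)} = measure (exp_dist 1) {x. K < x}"
    proof -
      have "distr (exp_seq 1) (exp_dist 1) (\<lambda>w. w (- int m - 1)) = exp_dist 1"
        unfolding exp_seq_def by (rule distr_PiM_component) (auto intro: prob_space_exp_dist)
      moreover have "measure (distr (exp_seq 1) (exp_dist 1) (\<lambda>w. w (- int m - 1))) {x. K < x} =
          measure (exp_seq 1) ((\<lambda>w. w (- int m - 1)) -` {x. K < x} \<inter> space (exp_seq 1))"
      proof (rule measure_distr)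
        show "(\<lambda>w. w (- int m - 1)) \<in> exp_seq 1 \<rightarrow>\<^sub>M exp_dist 1"
          unfolding measurable_cong_sets[OF sets_exp_seq sets_exp_dist] by (rule measurable_seq_component) simp
      qed simp
      ultimately show ?thesis by (simp add: vimage_def)
    qed
    ultimately show ?thesis unfolding v_def using vset by simp
  qed
  have vint: "integrable (exp_seq 1) v" unfolding v_def using vset by (intro integrable_real_indicator) (auto simp: W.emeasure_eq_measure)
  interpret WL: pair_sigma_finite "exp_seq 1" \<Lambda> ..
  let ?f = "\<lambda>x. v (fst x) * u (snd x)"
  have fm: "?f \<in> borel_measurable (exp_seq 1 \<Otimes>\<^sub>M \<Lambda>)"
    by (intro borel_measurable_times measurable_compose[OF measurable_fst borel_measurable_integrable[OF vint]]
          measurable_compose[OF measurable_snd um])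
  have fint: "integrable (exp_seq 1 \<Otimes>\<^sub>M \<Lambda>) ?f"
  proof (rule WL.Fubini_integrable[OF fm])
    have "(\<lambda>w. L.expectation (\<lambda>y. norm (?f (w, y)))) = (\<lambda>w. \<bar>v w\<bar> * L.expectation (\<lambda>y. \<bar>u y\<bar>))"
      by (simp add: abs_mult)
    then show "integrable (exp_seq 1) (\<lambda>w. L.expectation (\<lambda>y. norm (?f (w, y))))"
      using integrable_abs[OF vint] by (simp only: integrable_mult_left)
    show "AE w in exp_seq 1. integrable \<Lambda> (\<lambda>y. ?f (w, y))"
      by (rule AE_I2) (simp add: uint)
  qed
  have "P.expectation ?f = W.expectation (\<lambda>w. L.expectation (\<lambda>y. ?f (w, y)))"
    unfolding P_def by (rule WL.integral_fst'[OF fint, symmetric])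
  also have "\<dots> = exp (- K) * L.expectation u" by (simp add: v)
  finally have prodexp: "P.expectation ?f = exp (- K) * L.expectation u" .
  have "P.expectation ?f \<le> P.expectation (\<lambda>x. \<Sum>k=- int m..0. loss k x)"
  proof (rule integral_mono_AE)
    show "integrable P ?f" unfolding P_def by (rule fint)
    show "integrable P (\<lambda>x. \<Sum>k=- int m..0. loss k x)" by (intro Bochner_Integration.integrable_sum integrable_loss)
    show "AE x in P. ?f x \<le> (\<Sum>k=- int m..0. loss k x)"
      using AE_loss_window[of m]
    proof eventually_elim
      case (elim x)
      have l0: "0 \<le> (\<Sum>k=- int m..0. loss k x)" by (intro sum_nonneg loss_bounds)
      show ?case
      proof (cases "K < fst x (- int m - 1) \<and> S (snd x) \<le> K")
        case True
        then have "g (snd x) \<le> (\<Sum>k=- int m..0. loss k x)"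
          using elim unfolding g_def S_def I_def I'_def by simp
        then show ?thesis using True by (simp add: u_def v_def)
      next
        case False
        then have "?f x = 0" by (auto simp: u_def v_def indicator_def)
        then show ?thesis using l0 by auto
      qed
    qed
  qed
  also have "\<dots> = (\<Sum>k=- int m..0. P.expectation (loss k))"
    by (rule Bochner_Integration.integral_sum) (rule integrable_loss)
  also have "\<dots> = real (Suc m) * (L.expectation (\<lambda>x. \<bar>gap x 0\<bar>) - P.expectation (\<lambda>x. \<bar>D 0 x - D' 0 x\<bar>))"
    by (simp add: expectation_loss nat_add_distrib)
  finally have main: "exp (- K) * L.expectation u \<le>
      real (Suc m) * (L.expectation (\<lambda>x. \<bar>gap x 0\<bar>) - P.expectation (\<lambda>x. \<bar>D 0 x - D' 0 x\<bar>))"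
    unfolding prodexp .
  have "L.expectation g - L.expectation (\<lambda>x. S x * indicator {x. K < S x} x) =
      P.expectation (\<lambda>x. g (snd x) - S (snd x) * indicator {x. K < S x} (snd x))"
    using integral_input(1)[OF borel_measurable_diff[OF gm borel_measurable_integrable[OF SKint]]]
    unfolding Bochner_Integration.integral_diff[OF gint SKint] by (rule sym)
  also have "\<dots> \<le> P.expectation (\<lambda>x. u (snd x))"
  proof (rule integral_mono_AE)
    show "integrable P (\<lambda>x. g (snd x) - S (snd x) * indicator {x. K < S x} (snd x))"
      using integral_input(2)[OF borel_measurable_diff[OF gm borel_measurable_integrable[OF SKint]]]
        Bochner_Integration.integrable_diff[OF gint SKint] by blast
    show "integrable P (\<lambda>x. u (snd x))" using integral_input(2)[OF um] uint by blast
    show "AE x in P. g (snd x) - S (snd x) * indicator {x. K < S x} (snd x) \<le> u (snd x)"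
      using AE_good
    proof eventually_elim
      case (elim x)
      have "g (snd x) \<le> (\<Sum>k=- int m..0. \<bar>gap (snd x) k\<bar>)" unfolding g_def by simp
      also have "\<dots> \<le> S (snd x)"
        unfolding S_def
      proof (rule sum_mono)
        fix k
        have "0 \<le> I k x" "0 \<le> I' k x" using elim by auto
        then show "\<bar>gap (snd x) k\<bar> \<le> fst (snd x) k + snd (snd x) k" by (simp add: I_def I'_def)
      qed
      finally show ?case by (auto simp: u_def indicator_def)
    qed
  qed
  also have "\<dots> = L.expectation u" by (rule integral_input(1)[OF um])
  finally have ul: "L.expectation g - L.expectation (\<lambda>x. S x * indicator {x. K < S x} x) \<le> L.expectation u" .
  have gap0: "L.expectation (\<lambda>x. \<bar>gap x k\<bar>) = L.expectation (\<lambda>x. \<bar>gap x 0\<bar>)" for k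
    using integral_input(1)[OF borel_gap[of k]] integral_input(1)[OF borel_gap[of 0]] expectation_gap[of k]
    unfolding I_def I'_def by argo
  have "L.expectation g = (\<Sum>k=- int m..0. L.expectation (\<lambda>x. \<bar>gap x k\<bar>)) - L.expectation (\<lambda>x. \<bar>\<Sum>k=- int m..0. gap x k\<bar>)"
    unfolding g_def[abs_def]
    by (subst Bochner_Integration.integral_diff)
       (intro Bochner_Integration.integrable_sum integrable_abs gapint,
        intro integrable_abs Bochner_Integration.integrable_sum gapint,
        subst Bochner_Integration.integral_sum, intro integrable_abs gapint, rule refl)
  also have "(\<Sum>k=- int m..0. L.expectation (\<lambda>x. \<bar>gap x k\<bar>)) = (\<Sum>k=- int m..0. L.expectation (\<lambda>x. \<bar>gap x 0\<bar>))"
    by (intro sum.cong refl gap0)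
  also have "\<dots> = real (Suc m) * L.expectation (\<lambda>x. \<bar>gap x 0\<bar>)" by (simp add: nat_add_distrib)
  finally have "L.expectation g = real (Suc m) * L.expectation (\<lambda>x. \<bar>gap x 0\<bar>) - L.expectation (\<lambda>x. \<bar>\<Sum>k=- int m..0. gap x k\<bar>)" .
  with ul have "real (Suc m) * L.expectation (\<lambda>x. \<bar>gap x 0\<bar>) - L.expectation (\<lambda>x. \<bar>\<Sum>k=- int m..0. gap x k\<bar>)
      - L.expectation (\<lambda>x. S x * indicator {x. K < S x} x) \<le> L.expectation u" by simp
  then have "exp (- K) * (real (Suc m) * L.expectation (\<lambda>x. \<bar>gap x 0\<bar>) - L.expectation (\<lambda>x. \<bar>\<Sum>k=- int m..0. gap x k\<bar>)
      - L.expectation (\<lambda>x. S x * indicator {x. K < S x} x)) \<le> exp (- K) * L.expectation u"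
    by (intro mult_left_mono) auto
  then show ?thesis using main by linarith
qed

lemma coupling_decrease: "P.expectation (\<lambda>x. \<bar>D 0 x - D' 0 x\<bar>) \<le> L.expectation (\<lambda>x. \<bar>gap x 0\<bar>)"
proof -
  have "0 \<le> P.expectation (loss 0)" by (rule integral_nonneg_AE) (simp add: loss_bounds)
  then show ?thesis unfolding expectation_loss by simp
qed

end

section \<open>Uniqueness\<close>

text \<open>The last clause is joint stationarity, without joint ergodicity. It is preserved by
  \<open>couple_step\<close>, and it suffices because ergodicity is used only for the
  marginals.\<close>

definition coupling :: "nat \<Rightarrow> config measure \<Rightarrow> config measure \<Rightarrow> (config \<times> config) measure \<Rightarrow> bool" where
  "coupling n \<mu> \<mu>' \<Gamma> \<longleftrightarrow> prob_space \<Gamma> \<and> sets \<Gamma> = sets (config_space n \<Otimes>\<^sub>M config_space n) \<and>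
     distr \<Gamma> (config_space n) fst = \<mu> \<and> distr \<Gamma> (config_space n) snd = \<mu>' \<and>
     (\<forall>l. distr \<Gamma> (config_space n \<Otimes>\<^sub>M config_space n) (\<lambda>x. (translation n l (fst x), translation n l (snd x))) = \<Gamma>)"

definition serve_both :: "nat \<Rightarrow> (int \<Rightarrow> real) \<times> config \<times> config \<Rightarrow> config \<times> config" where
  "serve_both n x = (serve n (fst x, fst (snd x)), serve n (fst x, snd (snd x)))"

definition couple_step :: "nat \<Rightarrow> (config \<times> config) measure \<Rightarrow> (config \<times> config) measure" where
  "couple_step n \<Gamma> = distr (exp_seq 1 \<Otimes>\<^sub>M \<Gamma>) (config_space n \<Otimes>\<^sub>M config_space n) (serve_both n)"

definition cost :: "nat \<Rightarrow> (config \<times> config) measure \<Rightarrow> real" where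
  "cost i \<Gamma> = (\<integral>x. \<bar>fst x i 0 - snd x i 0\<bar> \<partial>\<Gamma>)"

definition stationary_state :: "nat \<Rightarrow> (nat \<Rightarrow> real) \<Rightarrow> config measure \<Rightarrow> bool" where
  "stationary_state n \<rho> \<mu> \<longleftrightarrow> prob_measure_on_states n \<mu> \<and> translation_ergodic n \<mu> \<and> has_means n \<rho> \<mu> \<and>
     distr (exp_seq 1 \<Otimes>\<^sub>M \<mu>) (config_space n) (serve n) = \<mu>"

lemma measurable_serve_both [measurable]:
  "serve_both n \<in> seq_space \<Otimes>\<^sub>M config_space n \<Otimes>\<^sub>M config_space n \<rightarrow>\<^sub>M config_space n \<Otimes>\<^sub>M config_space n"
  unfolding serve_both_def[abs_def]
  by (intro measurable_Pair measurable_compose[OF _ measurable_serve]) measurable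

lemma serve_translation: "serve n (shift_seq l w, translation n l \<eta>) = translation n l (serve n (w, \<eta>))"
  by (auto simp: serve_def translation_def fun_eq_iff queue_map_shift)

lemma distr_pair_map_snd:
  assumes M: "prob_space M" and N: "prob_space N" and f: "f \<in> N \<rightarrow>\<^sub>M N'"
  shows "distr (M \<Otimes>\<^sub>M N) (M \<Otimes>\<^sub>M N') (\<lambda>x. (fst x, f (snd x))) = M \<Otimes>\<^sub>M distr N N' f"
proof -
  have "distr M M (\<lambda>x. x) \<Otimes>\<^sub>M distr N N' f = distr (M \<Otimes>\<^sub>M N) (M \<Otimes>\<^sub>M N') (\<lambda>(x, y). (x, f y))"
    by (rule pair_measure_distr[OF _ f])
       (auto intro: prob_space_imp_sigma_finite prob_space.prob_space_distr[OF N f])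
  moreover have "distr M M (\<lambda>x. x) = M" by (rule distr_id2) simp
  ultimately show ?thesis by (simp add: case_prod_unfold)
qed

text \<open>The marginals are kept because each state is invariant under a queueing step. Joint
  stationarity is kept because serving commutes with simultaneous translation of services and
  states, and the services are stationary.\<close>

lemma coupling_couple_step:
  assumes c: "coupling n \<mu> \<mu>' \<Gamma>" and \<mu>: "stationary_state n \<rho> \<mu>" and \<mu>': "stationary_state n \<rho> \<mu>'"
  shows "coupling n \<mu> \<mu>' (couple_step n \<Gamma>)"
proof -
  let ?C = "config_space n" and ?W = "exp_seq 1"
  have p: "prob_space \<Gamma>" and s: "sets \<Gamma> = sets (?C \<Otimes>\<^sub>M ?C)" and f: "distr \<Gamma> ?C fst = \<mu>" and g: "distr \<Gamma> ?C snd = \<mu>'"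
    and t: "\<And>l. distr \<Gamma> (?C \<Otimes>\<^sub>M ?C) (\<lambda>x. (translation n l (fst x), translation n l (snd x))) = \<Gamma>"
    using c by (auto simp: coupling_def)
  interpret L: prob_space \<Gamma> by fact
  interpret W: prob_space ?W by (rule prob_space_exp_seq) simp
  interpret P: prob_space "?W \<Otimes>\<^sub>M \<Gamma>" by (intro prob_space_pair) unfold_locales
  have sP: "sets (?W \<Otimes>\<^sub>M \<Gamma>) = sets (seq_space \<Otimes>\<^sub>M ?C \<Otimes>\<^sub>M ?C)"
    by (intro sets_pair_measure_cong sets_exp_seq s)
  have sW: "sets (?W \<Otimes>\<^sub>M ?C) = sets (seq_space \<Otimes>\<^sub>M ?C)"
    by (intro sets_pair_measure_cong sets_exp_seq refl)
  have sb: "serve_both n \<in> ?W \<Otimes>\<^sub>M \<Gamma> \<rightarrow>\<^sub>M ?C \<Otimes>\<^sub>M ?C"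
    unfolding measurable_cong_sets[OF sP refl] by (rule measurable_serve_both)
  \<comment> \<open>\<open>h\<close> stands for either projection, so that both marginals are
    handled at once.\<close>
  have marg: "distr (couple_step n \<Gamma>) ?C h = \<nu>"
    if h: "h \<in> ?C \<Otimes>\<^sub>M ?C \<rightarrow>\<^sub>M ?C" "\<And>x. h (serve_both n x) = serve n (fst x, h (snd x))"
      and law: "distr \<Gamma> ?C h = \<nu>" and inv: "distr (?W \<Otimes>\<^sub>M \<nu>) ?C (serve n) = \<nu>" for h \<nu>
  proof -
    have hm: "h \<in> \<Gamma> \<rightarrow>\<^sub>M ?C" unfolding measurable_cong_sets[OF s refl] by (rule h(1))
    have m: "(\<lambda>x. (fst x, h (snd x))) \<in> ?W \<Otimes>\<^sub>M \<Gamma> \<rightarrow>\<^sub>M ?W \<Otimes>\<^sub>M ?C"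
      by (intro measurable_Pair measurable_fst measurable_compose[OF measurable_snd hm])
    have "distr (couple_step n \<Gamma>) ?C h = distr (?W \<Otimes>\<^sub>M \<Gamma>) ?C (h \<circ> serve_both n)"
      unfolding couple_step_def by (rule distr_distr[OF h(1) sb])
    also have "\<dots> = distr (?W \<Otimes>\<^sub>M \<Gamma>) ?C (serve n \<circ> (\<lambda>x. (fst x, h (snd x))))"
      by (rule distr_cong) (auto simp: h(2))
    also have "\<dots> = distr (distr (?W \<Otimes>\<^sub>M \<Gamma>) (?W \<Otimes>\<^sub>M ?C) (\<lambda>x. (fst x, h (snd x)))) ?C (serve n)"
    proof (rule distr_distr[symmetric, OF _ m])
      show "serve n \<in> ?W \<Otimes>\<^sub>M ?C \<rightarrow>\<^sub>M ?C" unfolding measurable_cong_sets[OF sW refl] by (rule measurable_serve)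
    qed
    also have "\<dots> = \<nu>"
      unfolding distr_pair_map_snd[OF W.prob_space_axioms p hm] law by (rule inv)
    finally show ?thesis .
  qed
  have "distr (couple_step n \<Gamma>) (?C \<Otimes>\<^sub>M ?C) (\<lambda>x. (translation n l (fst x), translation n l (snd x))) = couple_step n \<Gamma>" for l
  proof -
    let ?T = "\<lambda>x. (translation n l (fst x), translation n l (snd x))"
    have T: "?T \<in> ?C \<Otimes>\<^sub>M ?C \<rightarrow>\<^sub>M ?C \<Otimes>\<^sub>M ?C"
      by (intro measurable_Pair measurable_compose[OF _ measurable_translation] measurable_fst measurable_snd)
    have T': "?T \<in> \<Gamma> \<rightarrow>\<^sub>M ?C \<Otimes>\<^sub>M ?C" unfolding measurable_cong_sets[OF s refl] by (rule T)
    let ?S = "\<lambda>(w, x). (shift_seq l w, ?T x)"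
    have sC: "sets (?W \<Otimes>\<^sub>M (?C \<Otimes>\<^sub>M ?C)) = sets (?W \<Otimes>\<^sub>M \<Gamma>)" by (intro sets_pair_measure_cong refl s[symmetric])
    have "distr ?W ?W (shift_seq l) \<Otimes>\<^sub>M distr \<Gamma> (?C \<Otimes>\<^sub>M ?C) ?T = distr (?W \<Otimes>\<^sub>M \<Gamma>) (?W \<Otimes>\<^sub>M (?C \<Otimes>\<^sub>M ?C)) ?S"
    proof (rule pair_measure_distr[OF _ T'])
      show "sigma_finite_measure (distr \<Gamma> (?C \<Otimes>\<^sub>M ?C) ?T)" unfolding t by unfold_locales
    qed measurable
    then have S: "distr (?W \<Otimes>\<^sub>M \<Gamma>) (?W \<Otimes>\<^sub>M (?C \<Otimes>\<^sub>M ?C)) ?S = ?W \<Otimes>\<^sub>M \<Gamma>"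
      unfolding t distr_shift_exp_seq[OF zero_less_one] by (rule sym)
    have Sm: "?S \<in> ?W \<Otimes>\<^sub>M \<Gamma> \<rightarrow>\<^sub>M ?W \<Otimes>\<^sub>M (?C \<Otimes>\<^sub>M ?C)"
      unfolding case_prod_beta
      by (intro measurable_Pair measurable_compose[OF measurable_fst] measurable_compose[OF measurable_snd T']) measurable
    have "distr (couple_step n \<Gamma>) (?C \<Otimes>\<^sub>M ?C) ?T = distr (?W \<Otimes>\<^sub>M \<Gamma>) (?C \<Otimes>\<^sub>M ?C) (?T \<circ> serve_both n)"
      unfolding couple_step_def by (rule distr_distr[OF T sb])
    also have "\<dots> = distr (?W \<Otimes>\<^sub>M \<Gamma>) (?C \<Otimes>\<^sub>M ?C) (serve_both n \<circ> ?S)"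
      by (rule distr_cong) (auto simp: serve_both_def serve_translation)
    also have "\<dots> = distr (distr (?W \<Otimes>\<^sub>M \<Gamma>) (?W \<Otimes>\<^sub>M (?C \<Otimes>\<^sub>M ?C)) ?S) (?C \<Otimes>\<^sub>M ?C) (serve_both n)"
      by (rule distr_distr[symmetric, OF _ Sm]) (unfold measurable_cong_sets[OF sC refl], rule sb)
    finally show ?thesis unfolding S couple_step_def .
  qed
  moreover have "distr (couple_step n \<Gamma>) ?C fst = \<mu>"
    by (rule marg[OF measurable_fst _ f]) (use \<mu> in \<open>auto simp: serve_both_def stationary_state_def\<close>)
  moreover have "distr (couple_step n \<Gamma>) ?C snd = \<mu>'"
    by (rule marg[OF measurable_snd _ g]) (use \<mu>' in \<open>auto simp: serve_both_def stationary_state_def\<close>)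
  moreover have "prob_space (couple_step n \<Gamma>)" unfolding couple_step_def by (rule P.prob_space_distr[OF sb])
  ultimately show ?thesis unfolding coupling_def by (simp add: couple_step_def)
qed

lemma coupling_product:
  assumes \<mu>: "stationary_state n \<rho> \<mu>" and \<mu>': "stationary_state n \<rho> \<mu>'"
  shows "coupling n \<mu> \<mu>' (\<mu> \<Otimes>\<^sub>M \<mu>')"
proof -
  let ?C = "config_space n"
  have p: "prob_space \<mu>" "prob_space \<mu>'" and s: "sets \<mu> = sets ?C" "sets \<mu>' = sets ?C"
    and t: "\<And>l. distr \<mu> ?C (translation n l) = \<mu>" "\<And>l. distr \<mu>' ?C (translation n l) = \<mu>'"
    using \<mu> \<mu>' by (auto simp: stationary_state_def prob_measure_on_states_def translation_ergodic_def)
  interpret M: prob_space \<mu> by fact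
  interpret M': prob_space \<mu>' by fact
  have sp: "sets (\<mu> \<Otimes>\<^sub>M \<mu>') = sets (?C \<Otimes>\<^sub>M ?C)" by (intro sets_pair_measure_cong s)
  have "distr (\<mu> \<Otimes>\<^sub>M \<mu>') ?C fst = distr (\<mu> \<Otimes>\<^sub>M \<mu>') \<mu> fst" by (rule distr_cong) (auto simp: s)
  then have "distr (\<mu> \<Otimes>\<^sub>M \<mu>') ?C fst = \<mu>" by (simp only: M'.distr_pair_fst)
  moreover have "distr (\<mu> \<Otimes>\<^sub>M \<mu>') ?C snd = distr (\<mu> \<Otimes>\<^sub>M \<mu>') \<mu>' snd" by (rule distr_cong) (auto simp: s)
  then have "distr (\<mu> \<Otimes>\<^sub>M \<mu>') ?C snd = \<mu>'"
    using distr_pair_snd[OF p(1) prob_space_imp_sigma_finite[OF p(2)]] by (simp only:)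
  moreover have "distr (\<mu> \<Otimes>\<^sub>M \<mu>') (?C \<Otimes>\<^sub>M ?C) (\<lambda>x. (translation n l (fst x), translation n l (snd x))) = \<mu> \<Otimes>\<^sub>M \<mu>'" for l
  proof -
    have tm: "translation n l \<in> \<mu> \<rightarrow>\<^sub>M ?C" "translation n l \<in> \<mu>' \<rightarrow>\<^sub>M ?C"
      unfolding measurable_cong_sets[OF s(1) refl] measurable_cong_sets[OF s(2) refl] by (rule measurable_translation)+
    have "distr \<mu> ?C (translation n l) \<Otimes>\<^sub>M distr \<mu>' ?C (translation n l) =
        distr (\<mu> \<Otimes>\<^sub>M \<mu>') (?C \<Otimes>\<^sub>M ?C) (\<lambda>(x, y). (translation n l x, translation n l y))"
      by (rule pair_measure_distr[OF tm]) (unfold t, unfold_locales)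
    then show ?thesis unfolding t by (simp add: case_prod_unfold)
  qed
  moreover have "prob_space (\<mu> \<Otimes>\<^sub>M \<mu>')" by (rule prob_space_pair[OF p])
  ultimately show ?thesis unfolding coupling_def by (simp add: sp)
qed

definition line_coupling :: "nat \<Rightarrow> (config \<times> config) measure \<Rightarrow> ((int \<Rightarrow> real) \<times> (int \<Rightarrow> real)) measure" where
  "line_coupling i \<Gamma> = distr \<Gamma> (seq_space \<Otimes>\<^sub>M seq_space) (\<lambda>x. (fst x i, snd x i))"

locale stationary_coupling =
  fixes n i and \<rho> :: "nat \<Rightarrow> real" and \<mu> \<mu>' \<Gamma>
  assumes c: "coupling n \<mu> \<mu>' \<Gamma>" and \<mu>: "stationary_state n \<rho> \<mu>" and \<mu>': "stationary_state n \<rho> \<mu>'"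
    and i: "i \<in> {1..n}"
begin

lemma sets_coupling: "sets \<Gamma> = sets (config_space n \<Otimes>\<^sub>M config_space n)"
  and prob_coupling: "prob_space \<Gamma>"
  using c by (auto simp: coupling_def)

lemma measurable_line: "(\<lambda>x. (fst x i, snd x i)) \<in> \<Gamma> \<rightarrow>\<^sub>M seq_space \<Otimes>\<^sub>M seq_space"
  unfolding measurable_cong_sets[OF sets_coupling refl]
  by (intro measurable_Pair measurable_config_component[OF _ i] measurable_fst measurable_snd)

lemma coupling_fst:
  fixes g :: "config \<Rightarrow> real"
  assumes "g \<in> borel_measurable (config_space n)"
  shows "(\<integral>x. g (fst x) \<partial>\<Gamma>) = (\<integral>\<eta>. g \<eta> \<partial>\<mu>)" "integrable \<Gamma> (\<lambda>x. g (fst x)) \<longleftrightarrow> integrable \<mu> g"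
proof -
  have m: "fst \<in> \<Gamma> \<rightarrow>\<^sub>M config_space n" unfolding measurable_cong_sets[OF sets_coupling refl] by (rule measurable_fst)
  have d: "distr \<Gamma> (config_space n) fst = \<mu>" using c by (simp add: coupling_def)
  show "(\<integral>x. g (fst x) \<partial>\<Gamma>) = (\<integral>\<eta>. g \<eta> \<partial>\<mu>)" "integrable \<Gamma> (\<lambda>x. g (fst x)) \<longleftrightarrow> integrable \<mu> g"
    using integral_distr[OF m assms] integrable_distr_eq[OF m assms] unfolding d by simp_all
qed

lemma coupling_snd:
  fixes g :: "config \<Rightarrow> real"
  assumes "g \<in> borel_measurable (config_space n)"
  shows "(\<integral>x. g (snd x) \<partial>\<Gamma>) = (\<integral>\<eta>. g \<eta> \<partial>\<mu>')" "integrable \<Gamma> (\<lambda>x. g (snd x)) \<longleftrightarrow> integrable \<mu>' g"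
proof -
  have m: "snd \<in> \<Gamma> \<rightarrow>\<^sub>M config_space n" unfolding measurable_cong_sets[OF sets_coupling refl] by (rule measurable_snd)
  have d: "distr \<Gamma> (config_space n) snd = \<mu>'" using c by (simp add: coupling_def)
  show "(\<integral>x. g (snd x) \<partial>\<Gamma>) = (\<integral>\<eta>. g \<eta> \<partial>\<mu>')" "integrable \<Gamma> (\<lambda>x. g (snd x)) \<longleftrightarrow> integrable \<mu>' g"
    using integral_distr[OF m assms] integrable_distr_eq[OF m assms] unfolding d by simp_all
qed

lemma borel_config: "(\<lambda>\<eta>. \<eta> i k) \<in> borel_measurable (config_space n)"
  by (rule measurable_seq_component[OF measurable_config_component[OF measurable_ident_sets[OF refl] i]])

lemma integrable_coupling: "integrable \<Gamma> (\<lambda>x. fst x i k)" "integrable \<Gamma> (\<lambda>x. snd x i k)"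
proof -
  have "integrable \<mu> (\<lambda>\<eta>. \<eta> i k)" "integrable \<mu>' (\<lambda>\<eta>. \<eta> i k)"
    using \<mu> \<mu>' i by (auto simp: stationary_state_def has_means_def)
  then show "integrable \<Gamma> (\<lambda>x. fst x i k)" "integrable \<Gamma> (\<lambda>x. snd x i k)"
    using coupling_fst(2)[OF borel_config] coupling_snd(2)[OF borel_config] by blast+
qed

lemma distr_line_product:
  "distr (exp_seq 1 \<Otimes>\<^sub>M \<Gamma>) (exp_seq 1 \<Otimes>\<^sub>M (seq_space \<Otimes>\<^sub>M seq_space)) (\<lambda>x. (fst x, (fst (snd x) i, snd (snd x) i))) =
     exp_seq 1 \<Otimes>\<^sub>M line_coupling i \<Gamma>"
  unfolding line_coupling_def
  by (rule distr_pair_map_snd[OF _ prob_coupling measurable_line]) (rule prob_space_exp_seq, simp)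

lemma measurable_line_product:
  "(\<lambda>x. (fst x, (fst (snd x) i, snd (snd x) i))) \<in> exp_seq 1 \<Otimes>\<^sub>M \<Gamma> \<rightarrow>\<^sub>M exp_seq 1 \<Otimes>\<^sub>M (seq_space \<Otimes>\<^sub>M seq_space)"
  by (intro measurable_Pair[OF measurable_fst measurable_compose[OF measurable_snd measurable_line]])

lemma coupling_step_product:
  assumes h: "h \<in> config_space n \<Otimes>\<^sub>M config_space n \<rightarrow>\<^sub>M config_space n" and law: "distr \<Gamma> (config_space n) h = \<nu>"
  shows "distr (exp_seq 1 \<Otimes>\<^sub>M \<Gamma>) (exp_seq 1 \<Otimes>\<^sub>M config_space n) (\<lambda>x. (fst x, h (snd x))) = exp_seq 1 \<Otimes>\<^sub>M \<nu>"
proof -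
  have hm: "h \<in> \<Gamma> \<rightarrow>\<^sub>M config_space n" unfolding measurable_cong_sets[OF sets_coupling refl] by (rule h)
  show ?thesis
    using distr_pair_map_snd[OF _ prob_coupling hm, of "exp_seq 1"] prob_space_exp_seq[of 1] law by simp
qed

lemma AE_coupling_good:
  assumes h: "h \<in> config_space n \<Otimes>\<^sub>M config_space n \<rightarrow>\<^sub>M config_space n" and law: "distr \<Gamma> (config_space n) h = \<nu>"
    and \<nu>: "stationary_state n \<rho> \<nu>"
  shows "AE x in exp_seq 1 \<Otimes>\<^sub>M \<Gamma>. (\<forall>k. 0 \<le> fst x k) \<and> (\<forall>k. 0 \<le> h (snd x) i k) \<and> stable (h (snd x) i) (fst x)"
    and "integrable (exp_seq 1 \<Otimes>\<^sub>M \<Gamma>) (\<lambda>x. queue_map (h (snd x) i) (fst x) 0)"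
proof -
  let ?C = "config_space n" and ?W = "exp_seq 1"
  have hm: "h \<in> \<Gamma> \<rightarrow>\<^sub>M ?C" unfolding measurable_cong_sets[OF sets_coupling refl] by (rule h)
  let ?f = "\<lambda>x. (fst x, h (snd x))"
  have m: "?f \<in> ?W \<Otimes>\<^sub>M \<Gamma> \<rightarrow>\<^sub>M ?W \<Otimes>\<^sub>M ?C" by (intro measurable_Pair[OF measurable_fst measurable_compose[OF measurable_snd hm]])
  note d = coupling_step_product[OF h law]
  have "AE z in ?W \<Otimes>\<^sub>M \<nu>. (\<forall>k. 0 \<le> fst z k) \<and> (\<forall>k. 0 \<le> snd z i k) \<and> stable (snd z i) (fst z)"
  proof -
    have "prob_measure_on_states n \<nu>" using \<nu> by (simp add: stationary_state_def)
    from AE_state_space_stable[OF this] show ?thesis by eventually_elim (use i in blast)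
  qed
  then have "AE z in distr (?W \<Otimes>\<^sub>M \<Gamma>) (?W \<Otimes>\<^sub>M ?C) ?f. (\<forall>k. 0 \<le> fst z k) \<and> (\<forall>k. 0 \<le> snd z i k) \<and> stable (snd z i) (fst z)"
    unfolding d .
  from AE_distrD[OF m this]
  show "AE x in ?W \<Otimes>\<^sub>M \<Gamma>. (\<forall>k. 0 \<le> fst x k) \<and> (\<forall>k. 0 \<le> h (snd x) i k) \<and> stable (h (snd x) i) (fst x)" by simp
  have sW: "sets (?W \<Otimes>\<^sub>M ?C) = sets (seq_space \<Otimes>\<^sub>M ?C)" by (intro sets_pair_measure_cong sets_exp_seq refl)
  have sv: "serve n \<in> ?W \<Otimes>\<^sub>M ?C \<rightarrow>\<^sub>M ?C" unfolding measurable_cong_sets[OF sW refl] by (rule measurable_serve)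
  \<comment> \<open>The departures form component \<open>i\<close> of a configuration that again has
    law \<open>\<nu>\<close>; invariance thus provides their integrability.\<close>
  have "integrable \<nu> (\<lambda>\<eta>. \<eta> i 0)" using \<nu> i by (auto simp: stationary_state_def has_means_def)
  moreover have "distr (?W \<Otimes>\<^sub>M \<Gamma>) ?C (serve n \<circ> ?f) = \<nu>"
    using distr_distr[OF sv m] \<nu> unfolding d by (simp add: stationary_state_def)
  ultimately have "integrable (distr (?W \<Otimes>\<^sub>M \<Gamma>) ?C (serve n \<circ> ?f)) (\<lambda>\<eta>. \<eta> i 0)" by simp
  from integrable_distr[OF measurable_comp[OF m sv] this]
  show "integrable (?W \<Otimes>\<^sub>M \<Gamma>) (\<lambda>x. queue_map (h (snd x) i) (fst x) 0)"
    using i by (simp add: serve_def)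
qed

end

lemma coupling_good_pred:
  "{x \<in> space (exp_seq 1 \<Otimes>\<^sub>M (seq_space \<Otimes>\<^sub>M seq_space)). (\<forall>k. 0 \<le> fst x k) \<and> (\<forall>k. 0 \<le> fst (snd x) k) \<and>
      (\<forall>k. 0 \<le> snd (snd x) k) \<and> stable (fst (snd x)) (fst x) \<and> stable (snd (snd x)) (fst x)}
     \<in> sets (exp_seq 1 \<Otimes>\<^sub>M (seq_space \<Otimes>\<^sub>M seq_space))"
proof -
  let ?M = "exp_seq 1 \<Otimes>\<^sub>M (seq_space \<Otimes>\<^sub>M seq_space)"
  have s: "sets ?M = sets (seq_space \<Otimes>\<^sub>M seq_space \<Otimes>\<^sub>M seq_space)"
    by (intro sets_pair_measure_cong sets_exp_seq refl)
  have m: "fst \<in> ?M \<rightarrow>\<^sub>M seq_space" "(\<lambda>x. fst (snd x)) \<in> ?M \<rightarrow>\<^sub>M seq_space" "(\<lambda>x. snd (snd x)) \<in> ?M \<rightarrow>\<^sub>M seq_space"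
    unfolding measurable_cong_sets[OF s refl] by measurable
  show ?thesis
    by (intro sets.sets_Collect_conj sets.sets_Collect_countable_All borel_measurable_le borel_measurable_const
        measurable_seq_component[OF m(1)] measurable_seq_component[OF m(2)] measurable_seq_component[OF m(3)]
        predE[OF stable_pred[OF m(2) m(1)]] predE[OF stable_pred[OF m(3) m(1)]])
qed

section \<open>Error terms expressed through the marginals\<close>

abbreviation window :: "nat \<Rightarrow> nat \<Rightarrow> config \<Rightarrow> real" where
  "window i m \<eta> \<equiv> \<Sum>k=- int m..0. \<eta> i k"

definition deviation :: "(nat \<Rightarrow> real) \<Rightarrow> nat \<Rightarrow> config measure \<Rightarrow> nat \<Rightarrow> real" where
  "deviation \<rho> i \<nu> m = (\<integral>\<eta>. \<bar>window i m \<eta> / real (Suc m) - \<rho> i\<bar> \<partial>\<nu>)"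

text \<open>The factor 2 decouples the two states: the sum of two nonnegative windows is at most
  twice the larger one, so if the sum exceeds \<open>K\<close>, then twice the larger one does too.
  The tail of the sum is thus bounded by marginal tails, whatever the coupling.\<close>

definition tail_mean :: "nat \<Rightarrow> config measure \<Rightarrow> nat \<Rightarrow> real \<Rightarrow> real" where
  "tail_mean i \<nu> m K = (\<integral>\<eta>. 2 * window i m \<eta> * indicator {\<eta>. K < 2 * window i m \<eta>} \<eta> \<partial>\<nu>)"

context stationary_coupling
begin

lemma queue_coupling_line: "queue_coupling (line_coupling i \<Gamma>)"
proof (rule queue_coupling.intro)
  let ?C = "config_space n" and ?W = "exp_seq 1" and ?S = "seq_space \<Otimes>\<^sub>M seq_space"
  let ?g = "\<lambda>x :: config \<times> config. (fst x i, snd x i)"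
  let ?h = "\<lambda>x :: (int \<Rightarrow> real) \<times> config \<times> config. (fst x, (fst (snd x) i, snd (snd x) i))"
  have fs: "distr \<Gamma> ?C fst = \<mu>" "distr \<Gamma> ?C snd = \<mu>'" using c by (simp_all add: coupling_def)
  note good = AE_coupling_good[OF measurable_fst fs(1) \<mu>] AE_coupling_good[OF measurable_snd fs(2) \<mu>']
  show "prob_space (line_coupling i \<Gamma>)"
    unfolding line_coupling_def by (rule prob_space.prob_space_distr[OF prob_coupling measurable_line])
  show "sets (line_coupling i \<Gamma>) = sets ?S" by (simp add: line_coupling_def)
  show "distr (line_coupling i \<Gamma>) ?S (\<lambda>x. (shift_seq l (fst x), shift_seq l (snd x))) = line_coupling i \<Gamma>" for l
  proof -
    let ?t = "\<lambda>x :: (int \<Rightarrow> real) \<times> (int \<Rightarrow> real). (shift_seq l (fst x), shift_seq l (snd x))"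
    let ?T = "\<lambda>x. (translation n l (fst x), translation n l (snd x))"
    have t: "?t \<in> ?S \<rightarrow>\<^sub>M ?S"
      by (intro measurable_Pair measurable_compose[OF _ measurable_shift_seq] measurable_fst measurable_snd)
    have T: "?T \<in> \<Gamma> \<rightarrow>\<^sub>M ?C \<Otimes>\<^sub>M ?C"
      unfolding measurable_cong_sets[OF sets_coupling refl]
      by (intro measurable_Pair measurable_compose[OF _ measurable_translation] measurable_fst measurable_snd)
    have inv: "distr \<Gamma> (?C \<Otimes>\<^sub>M ?C) ?T = \<Gamma>" using c by (simp add: coupling_def)
    have "distr (line_coupling i \<Gamma>) ?S ?t = distr \<Gamma> ?S (?t \<circ> ?g)"
      unfolding line_coupling_def by (rule distr_distr[OF t measurable_line])
    also have "\<dots> = distr \<Gamma> ?S (?g \<circ> ?T)"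
      by (rule distr_cong[OF refl refl]) (use i in \<open>simp add: translation_def\<close>)
    also have "\<dots> = distr (distr \<Gamma> (?C \<Otimes>\<^sub>M ?C) ?T) ?S ?g"
    proof (rule distr_distr[symmetric, OF _ T])
      show "?g \<in> ?C \<Otimes>\<^sub>M ?C \<rightarrow>\<^sub>M ?S"
        using measurable_line unfolding measurable_cong_sets[OF sets_coupling refl] .
    qed
    finally show ?thesis unfolding inv line_coupling_def .
  qed
  show "AE x in ?W \<Otimes>\<^sub>M line_coupling i \<Gamma>. (\<forall>k. 0 \<le> fst x k) \<and> (\<forall>k. 0 \<le> fst (snd x) k) \<and> (\<forall>k. 0 \<le> snd (snd x) k) \<and>
        stable (fst (snd x)) (fst x) \<and> stable (snd (snd x)) (fst x)"
    unfolding distr_line_product[symmetric] AE_distr_iff[OF measurable_line_product coupling_good_pred]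
    using good(1,3) by eventually_elim (simp only: fst_conv snd_conv simp_thms)
  show "integrable (line_coupling i \<Gamma>) (\<lambda>x. fst x k)" "integrable (line_coupling i \<Gamma>) (\<lambda>x. snd x k)" for k
  proof -
    have b: "(\<lambda>x. fst x k) \<in> borel_measurable ?S" "(\<lambda>x. snd x k) \<in> borel_measurable ?S"
      by (rule measurable_seq_component[OF measurable_fst] measurable_seq_component[OF measurable_snd])+
    show "integrable (line_coupling i \<Gamma>) (\<lambda>x. fst x k)" "integrable (line_coupling i \<Gamma>) (\<lambda>x. snd x k)"
      unfolding line_coupling_def integrable_distr_eq[OF measurable_line b(1)] integrable_distr_eq[OF measurable_line b(2)]
        fst_conv snd_conv by (rule integrable_coupling)+
  qed
  have s: "sets (?W \<Otimes>\<^sub>M ?S) = sets (seq_space \<Otimes>\<^sub>M ?S)" by (intro sets_pair_measure_cong sets_exp_seq refl)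
  have b: "(\<lambda>x. queue_map (fst (snd x)) (fst x) 0) \<in> borel_measurable (?W \<Otimes>\<^sub>M ?S)"
    "(\<lambda>x. queue_map (snd (snd x)) (fst x) 0) \<in> borel_measurable (?W \<Otimes>\<^sub>M ?S)"
    unfolding measurable_cong_sets[OF s refl]
    by (intro measurable_queue_map_component measurable_fst measurable_compose[OF measurable_snd measurable_fst]
        measurable_compose[OF measurable_snd measurable_snd])+
  show "integrable (?W \<Otimes>\<^sub>M line_coupling i \<Gamma>) (\<lambda>x. queue_map (fst (snd x)) (fst x) 0)"
    unfolding distr_line_product[symmetric] integrable_distr_eq[OF measurable_line_product b(1)] fst_conv snd_conv
    by (rule good(2))
  show "integrable (?W \<Otimes>\<^sub>M line_coupling i \<Gamma>) (\<lambda>x. queue_map (snd (snd x)) (fst x) 0)"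
    unfolding distr_line_product[symmetric] integrable_distr_eq[OF measurable_line_product b(2)] fst_conv snd_conv
    by (rule good(4))
qed

sublocale Q: queue_coupling "line_coupling i \<Gamma>" by (rule queue_coupling_line)

lemma expectation_line:
  fixes f :: "_ \<Rightarrow> real"
  assumes "f \<in> borel_measurable (seq_space \<Otimes>\<^sub>M seq_space)"
  shows "Q.L.expectation f = (\<integral>x. f (fst x i, snd x i) \<partial>\<Gamma>)"
  unfolding line_coupling_def by (rule integral_distr[OF measurable_line assms])

lemma cost_line: "Q.L.expectation (\<lambda>x. \<bar>gap x 0\<bar>) = cost i \<Gamma>"
  unfolding cost_def
  by (subst expectation_line)
     (intro borel_measurable_abs borel_measurable_diff measurable_seq_component[OF measurable_fst] measurable_seq_component[OF measurable_snd], simp)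

lemma cost_couple_step: "Q.P.expectation (\<lambda>x. \<bar>Q.D 0 x - Q.D' 0 x\<bar>) = cost i (couple_step n \<Gamma>)"
proof -
  let ?C = "config_space n" and ?W = "exp_seq 1" and ?S = "seq_space \<Otimes>\<^sub>M seq_space"
  have s: "sets (?W \<Otimes>\<^sub>M ?S) = sets (seq_space \<Otimes>\<^sub>M ?S)" by (intro sets_pair_measure_cong sets_exp_seq refl)
  have b: "(\<lambda>x. \<bar>queue_map (fst (snd x)) (fst x) 0 - queue_map (snd (snd x)) (fst x) 0\<bar>) \<in> borel_measurable (?W \<Otimes>\<^sub>M ?S)"
    unfolding measurable_cong_sets[OF s refl]
    by (intro borel_measurable_abs borel_measurable_diff measurable_queue_map_component measurable_fst
        measurable_compose[OF measurable_snd measurable_fst] measurable_compose[OF measurable_snd measurable_snd])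
  have sP: "sets (?W \<Otimes>\<^sub>M \<Gamma>) = sets (seq_space \<Otimes>\<^sub>M ?C \<Otimes>\<^sub>M ?C)"
    by (intro sets_pair_measure_cong sets_exp_seq sets_coupling)
  have sb: "serve_both n \<in> ?W \<Otimes>\<^sub>M \<Gamma> \<rightarrow>\<^sub>M ?C \<Otimes>\<^sub>M ?C"
    unfolding measurable_cong_sets[OF sP refl] by (rule measurable_serve_both)
  have bc: "(\<lambda>x. \<bar>fst x i 0 - snd x i 0\<bar>) \<in> borel_measurable (?C \<Otimes>\<^sub>M ?C)"
    by (intro borel_measurable_abs borel_measurable_diff measurable_compose[OF measurable_fst borel_config]
        measurable_compose[OF measurable_snd borel_config])
  have "Q.P.expectation (\<lambda>x. \<bar>Q.D 0 x - Q.D' 0 x\<bar>) =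
      (\<integral>x. \<bar>queue_map (fst (snd x) i) (fst x) 0 - queue_map (snd (snd x) i) (fst x) 0\<bar> \<partial>(?W \<Otimes>\<^sub>M \<Gamma>))"
    unfolding Q.P_def Q.D_def Q.D'_def distr_line_product[symmetric] integral_distr[OF measurable_line_product b] fst_conv snd_conv ..
  also have "\<dots> = (\<integral>x. \<bar>fst (serve_both n x) i 0 - snd (serve_both n x) i 0\<bar> \<partial>(?W \<Otimes>\<^sub>M \<Gamma>))"
    using i by (simp add: serve_both_def serve_def)
  also have "\<dots> = cost i (couple_step n \<Gamma>)"
    unfolding cost_def couple_step_def by (rule integral_distr[OF sb bc, symmetric])
  finally show ?thesis .
qed

lemma cost_decreasing: "cost i (couple_step n \<Gamma>) \<le> cost i \<Gamma>"
  using Q.coupling_decrease unfolding cost_line cost_couple_step .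

lemma window_nonneg: "AE \<eta> in \<mu>. 0 \<le> window i m \<eta>" "AE \<eta> in \<mu>'. 0 \<le> window i m \<eta>"
proof -
  have "AE \<eta> in \<nu>. 0 \<le> window i m \<eta>" if "stationary_state n \<rho> \<nu>" for \<nu>
  proof -
    have "AE \<eta> in \<nu>. \<eta> \<in> state_space n" using that by (simp add: stationary_state_def prob_measure_on_states_def)
    then show ?thesis
    proof eventually_elim
      case (elim \<eta>)
      then have "0 \<le> \<eta> i k" for k using i by (auto simp: state_space_def)
      then show ?case by (intro sum_nonneg)
    qed
  qed
  then show "AE \<eta> in \<mu>. 0 \<le> window i m \<eta>" "AE \<eta> in \<mu>'. 0 \<le> window i m \<eta>" using \<mu> \<mu>' by blast+
qed

lemma borel_window: "window i m \<in> borel_measurable (config_space n)"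
  by (intro borel_measurable_sum borel_config)

lemma borel_tail: "(\<lambda>\<eta>. 2 * window i m \<eta> * indicator {\<eta>. K < 2 * window i m \<eta>} \<eta>) \<in> borel_measurable (config_space n)"
proof -
  let ?f = "\<lambda>x :: real. 2 * x * indicator {x. K < 2 * x} x"
  have f: "?f \<in> borel_measurable borel" by measurable
  have "(\<lambda>\<eta>. ?f (window i m \<eta>)) \<in> borel_measurable (config_space n)"
    by (rule measurable_compose[OF borel_window f])
  then show ?thesis unfolding indicator_def mem_Collect_eq .
qed

lemma integrable_window:
  assumes "stationary_state n \<rho> \<nu>"
  shows "integrable \<nu> (window i m)"
proof -
  have "integrable \<nu> (\<lambda>\<eta>. \<eta> i k)" for k using assms i by (auto simp: stationary_state_def has_means_def)
  then show ?thesis by (intro Bochner_Integration.integrable_sum)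
qed

lemma integrable_state:
  assumes "stationary_state n \<rho> \<nu>"
  shows "integrable \<nu> (\<lambda>\<eta>. \<bar>window i m \<eta> / real (Suc m) - \<rho> i\<bar>)"
    and "integrable \<nu> (\<lambda>\<eta>. 2 * window i m \<eta> * indicator {\<eta>. K < 2 * window i m \<eta>} \<eta>)"
proof -
  note w = integrable_window[OF assms, of m]
  interpret prob_space \<nu> using assms by (simp add: stationary_state_def prob_measure_on_states_def)
  show "integrable \<nu> (\<lambda>\<eta>. \<bar>window i m \<eta> / real (Suc m) - \<rho> i\<bar>)"
    by (intro integrable_abs Bochner_Integration.integrable_diff integrable_divide w integrable_const)
  have s: "sets \<nu> = sets (config_space n)" using assms by (simp add: stationary_state_def prob_measure_on_states_def)
  show "integrable \<nu> (\<lambda>\<eta>. 2 * window i m \<eta> * indicator {\<eta>. K < 2 * window i m \<eta>} \<eta>)"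
  proof (rule Bochner_Integration.integrable_bound[OF integrable_mult_right[of 2, OF w] _ AE_I2])
    show "(\<lambda>\<eta>. 2 * window i m \<eta> * indicator {\<eta>. K < 2 * window i m \<eta>} \<eta>) \<in> borel_measurable \<nu>"
      unfolding measurable_cong_sets[OF s refl] by (rule borel_tail)
    show "norm (2 * window i m \<eta> * indicator {\<eta>. K < 2 * window i m \<eta>} \<eta>) \<le> norm (2 * window i m \<eta>)" for \<eta>
      by (simp add: indicator_def)
  qed
qed


text \<open>Both window averages are compared with the same number \<open>\<rho> i\<close>. This is
  where the two states having equal means enters; the bound involves the marginals only.\<close>

lemma expectation_window:
  "(\<integral>x. \<bar>\<Sum>k=- int m..0. fst x i k - snd x i k\<bar> \<partial>\<Gamma>) \<le> real (Suc m) * (deviation \<rho> i \<mu> m + deviation \<rho> i \<mu>' m)"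
proof -
  let ?d = "\<lambda>\<eta>. \<bar>window i m \<eta> / real (Suc m) - \<rho> i\<bar>"
  have b: "?d \<in> borel_measurable (config_space n)"
    by (intro borel_measurable_abs borel_measurable_diff borel_measurable_divide borel_window borel_measurable_const)
  have int: "integrable \<Gamma> (\<lambda>x. ?d (fst x))" "integrable \<Gamma> (\<lambda>x. ?d (snd x))"
    using coupling_fst(2)[OF b] coupling_snd(2)[OF b] integrable_state(1)[OF \<mu>] integrable_state(1)[OF \<mu>'] by blast+
  have "(\<integral>x. \<bar>\<Sum>k=- int m..0. fst x i k - snd x i k\<bar> \<partial>\<Gamma>) \<le> (\<integral>x. real (Suc m) * (?d (fst x) + ?d (snd x)) \<partial>\<Gamma>)"
  proof (rule integral_mono)
    show "integrable \<Gamma> (\<lambda>x. \<bar>\<Sum>k=- int m..0. fst x i k - snd x i k\<bar>)"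
      by (intro integrable_abs Bochner_Integration.integrable_sum Bochner_Integration.integrable_diff integrable_coupling)
    show "integrable \<Gamma> (\<lambda>x. real (Suc m) * (?d (fst x) + ?d (snd x)))"
      by (intro integrable_mult_right Bochner_Integration.integrable_add int)
    fix x :: "config \<times> config"
    let ?a = "window i m (fst x) / real (Suc m)" and ?b = "window i m (snd x) / real (Suc m)"
    have "\<bar>\<Sum>k=- int m..0. fst x i k - snd x i k\<bar> = real (Suc m) * \<bar>?a - ?b\<bar>"
      unfolding sum_subtractf diff_divide_distrib[symmetric] abs_divide by (simp del: of_nat_Suc)
    also have "\<dots> \<le> real (Suc m) * (?d (fst x) + ?d (snd x))" by (intro mult_left_mono) linarith+
    finally show "\<bar>\<Sum>k=- int m..0. fst x i k - snd x i k\<bar> \<le> real (Suc m) * (?d (fst x) + ?d (snd x))" .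
  qed
  also have "\<dots> = real (Suc m) * ((\<integral>x. ?d (fst x) \<partial>\<Gamma>) + (\<integral>x. ?d (snd x) \<partial>\<Gamma>))"
    unfolding integral_mult_right_zero Bochner_Integration.integral_add[OF int] ..
  also have "\<dots> = real (Suc m) * (deviation \<rho> i \<mu> m + deviation \<rho> i \<mu>' m)"
    unfolding deviation_def coupling_fst(1)[OF b] coupling_snd(1)[OF b] ..
  finally show ?thesis .
qed

lemma expectation_tail:
  "(\<integral>x. (\<Sum>k=- int m..0. fst x i k + snd x i k) * indicator {x. K < (\<Sum>k=- int m..0. fst x i k + snd x i k)} x \<partial>\<Gamma>)
     \<le> tail_mean i \<mu> m K + tail_mean i \<mu>' m K"
proof -
  let ?f = "\<lambda>\<eta>. 2 * window i m \<eta> * indicator {\<eta>. K < 2 * window i m \<eta>} \<eta>"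
  let ?s = "\<lambda>x. \<Sum>k=- int m..0. fst x i k + snd x i k"
  have int: "integrable \<Gamma> (\<lambda>x. ?f (fst x))" "integrable \<Gamma> (\<lambda>x. ?f (snd x))"
    using coupling_fst(2)[OF borel_tail] coupling_snd(2)[OF borel_tail] integrable_state(2)[OF \<mu>] integrable_state(2)[OF \<mu>'] by blast+
  have nn: "AE x in \<Gamma>. 0 \<le> window i m (fst x)" "AE x in \<Gamma>. 0 \<le> window i m (snd x)"
  proof -
    have m: "fst \<in> \<Gamma> \<rightarrow>\<^sub>M config_space n" "snd \<in> \<Gamma> \<rightarrow>\<^sub>M config_space n"
      unfolding measurable_cong_sets[OF sets_coupling refl] by (rule measurable_fst measurable_snd)+
    have d: "distr \<Gamma> (config_space n) fst = \<mu>" "distr \<Gamma> (config_space n) snd = \<mu>'" using c by (simp_all add: coupling_def)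
    show "AE x in \<Gamma>. 0 \<le> window i m (fst x)"
      by (rule AE_distrD[OF m(1)]) (unfold d, rule window_nonneg)
    show "AE x in \<Gamma>. 0 \<le> window i m (snd x)"
      by (rule AE_distrD[OF m(2)]) (unfold d, rule window_nonneg)
  qed
  have s: "?s x = window i m (fst x) + window i m (snd x)" for x by (rule sum.distrib)
  have "(\<integral>x. ?s x * indicator {x. K < ?s x} x \<partial>\<Gamma>) \<le> (\<integral>x. ?f (fst x) + ?f (snd x) \<partial>\<Gamma>)"
  proof (rule integral_mono_AE)
    show "integrable \<Gamma> (\<lambda>x. ?f (fst x) + ?f (snd x))" by (intro Bochner_Integration.integrable_add int)
    have si: "integrable \<Gamma> ?s"
      by (intro Bochner_Integration.integrable_sum Bochner_Integration.integrable_add integrable_coupling)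
    show "integrable \<Gamma> (\<lambda>x. ?s x * indicator {x. K < ?s x} x)"
    proof (rule Bochner_Integration.integrable_bound[OF si _ AE_I2])
      have f: "(\<lambda>x :: real. x * indicator {x. K < x} x) \<in> borel_measurable borel" by measurable
      have "(\<lambda>x. ?s x * indicator {x. K < x} (?s x)) \<in> borel_measurable \<Gamma>"
        by (rule measurable_compose[OF borel_measurable_integrable[OF si] f])
      then show "(\<lambda>x. ?s x * indicator {x. K < ?s x} x) \<in> borel_measurable \<Gamma>"
        unfolding indicator_def mem_Collect_eq .
      show "norm (?s x * indicator {x. K < ?s x} x) \<le> norm (?s x)" for x by (simp add: indicator_def)
    qed
    show "AE x in \<Gamma>. ?s x * indicator {x. K < ?s x} x \<le> ?f (fst x) + ?f (snd x)"
      using nn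
    proof eventually_elim
      case (elim x)
      then show ?case unfolding s indicator_def mem_Collect_eq by auto
    qed
  qed
  also have "\<dots> = tail_mean i \<mu> m K + tail_mean i \<mu>' m K"
    unfolding Bochner_Integration.integral_add[OF int] tail_mean_def coupling_fst(1)[OF borel_tail] coupling_snd(1)[OF borel_tail] ..
  finally show ?thesis .
qed

text \<open>\<open>coupling_gain\<close> per site of the window, with every error term replaced by a
  quantity of the marginals. For fixed \<open>m\<close> and \<open>K\<close> the factor and the
  errors stay the same along all iterates of the coupling.\<close>

lemma cost_gain:
  assumes K: "0 \<le> K"
  shows "exp (- K) * (cost i \<Gamma> - (deviation \<rho> i \<mu> m + deviation \<rho> i \<mu>' m) - (tail_mean i \<mu> m K + tail_mean i \<mu>' m K) / real (Suc m))
    \<le> cost i \<Gamma> - cost i (couple_step n \<Gamma>)"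
proof -
  let ?S = "seq_space \<Otimes>\<^sub>M seq_space"
  let ?s = "\<lambda>x :: (int \<Rightarrow> real) \<times> (int \<Rightarrow> real). \<Sum>k=- int m..0. fst x k + snd x k"
  have at: "(\<lambda>x. fst x k) \<in> borel_measurable ?S" "(\<lambda>x. snd x k) \<in> borel_measurable ?S" for k
    by (rule measurable_seq_component[OF measurable_fst] measurable_seq_component[OF measurable_snd])+
  have b: "(\<lambda>x. \<bar>\<Sum>k=- int m..0. gap x k\<bar>) \<in> borel_measurable ?S" "?s \<in> borel_measurable ?S"
    by (intro borel_measurable_abs borel_measurable_sum borel_measurable_diff borel_measurable_add at)+
  have f: "(\<lambda>x :: real. x * indicator {x. K < x} x) \<in> borel_measurable borel" by measurable
  have "(\<lambda>x. ?s x * indicator {x. K < x} (?s x)) \<in> borel_measurable ?S" by (rule measurable_compose[OF b(2) f])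
  then have b': "(\<lambda>x. ?s x * indicator {x. K < ?s x} x) \<in> borel_measurable ?S"
    unfolding indicator_def mem_Collect_eq .
  have "Q.L.expectation (\<lambda>x. \<bar>\<Sum>k=- int m..0. gap x k\<bar>) \<le> real (Suc m) * (deviation \<rho> i \<mu> m + deviation \<rho> i \<mu>' m)"
    unfolding expectation_line[OF b(1)] fst_conv snd_conv by (rule expectation_window)
  moreover have "Q.L.expectation (\<lambda>x. ?s x * indicator {x. K < ?s x} x) \<le> tail_mean i \<mu> m K + tail_mean i \<mu>' m K"
    using expectation_tail[of m K] unfolding expectation_line[OF b'] unfolding indicator_def mem_Collect_eq fst_conv snd_conv .
  ultimately have "real (Suc m) * cost i \<Gamma> - real (Suc m) * (deviation \<rho> i \<mu> m + deviation \<rho> i \<mu>' m) - (tail_mean i \<mu> m K + tail_mean i \<mu>' m K)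
      \<le> real (Suc m) * Q.L.expectation (\<lambda>x. \<bar>gap x 0\<bar>) - Q.L.expectation (\<lambda>x. \<bar>\<Sum>k=- int m..0. gap x k\<bar>)
            - Q.L.expectation (\<lambda>x. ?s x * indicator {x. K < ?s x} x)"
    unfolding cost_line by linarith
  then have "exp (- K) * (real (Suc m) * cost i \<Gamma> - real (Suc m) * (deviation \<rho> i \<mu> m + deviation \<rho> i \<mu>' m) - (tail_mean i \<mu> m K + tail_mean i \<mu>' m K))
      \<le> exp (- K) * (real (Suc m) * Q.L.expectation (\<lambda>x. \<bar>gap x 0\<bar>) - Q.L.expectation (\<lambda>x. \<bar>\<Sum>k=- int m..0. gap x k\<bar>)
            - Q.L.expectation (\<lambda>x. ?s x * indicator {x. K < ?s x} x))"
    by (rule mult_left_mono) simp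
  also have "\<dots> \<le> real (Suc m) * (cost i \<Gamma> - cost i (couple_step n \<Gamma>))"
    using Q.coupling_gain[OF K, of m] unfolding cost_line cost_couple_step .
  finally have "exp (- K) * (real (Suc m) * cost i \<Gamma> - real (Suc m) * (deviation \<rho> i \<mu> m + deviation \<rho> i \<mu>' m) - (tail_mean i \<mu> m K + tail_mean i \<mu>' m K))
      \<le> real (Suc m) * (cost i \<Gamma> - cost i (couple_step n \<Gamma>))" .
  moreover have "real (Suc m) * (exp (- K) * (a - b - d / real (Suc m))) = exp (- K) * (real (Suc m) * a - real (Suc m) * b - d)" for a b d
    by (simp add: right_diff_distrib del: of_nat_Suc)
  ultimately have "real (Suc m) * (exp (- K) * (cost i \<Gamma> - (deviation \<rho> i \<mu> m + deviation \<rho> i \<mu>' m) - (tail_mean i \<mu> m K + tail_mean i \<mu>' m K) / real (Suc m)))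
      \<le> real (Suc m) * (cost i \<Gamma> - cost i (couple_step n \<Gamma>))"
    by (simp only:)
  then show ?thesis by (rule mult_left_le_imp_le) simp
qed

end


section \<open>Decay of the mean gap under iteration\<close>

lemma deviation_tendsto_0:
  assumes \<mu>: "stationary_state n \<rho> \<mu>" and i: "i \<in> {1..n}"
  shows "deviation \<rho> i \<mu> \<longlonglongrightarrow> 0"
  using ergodic_average_L1[of n \<mu> \<rho> i] \<mu> i unfolding deviation_def[abs_def] stationary_state_def by blast

lemma tail_mean_tendsto_0:
  assumes \<mu>: "stationary_state n \<rho> \<mu>" and i: "i \<in> {1..n}"
  shows "(\<lambda>j. tail_mean i \<mu> m (real j)) \<longlonglongrightarrow> 0"
proof -
  have int: "integrable \<mu> (\<lambda>\<eta>. \<eta> i k)" for k using \<mu> i by (auto simp: stationary_state_def has_means_def)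
  have w: "integrable \<mu> (window i m)" by (intro Bochner_Integration.integrable_sum int)
  have "(\<lambda>j. tail_mean i \<mu> m (real j)) \<longlonglongrightarrow> (\<integral>\<eta>. 0 \<partial>\<mu>)"
    unfolding tail_mean_def
  proof (rule integral_dominated_convergence[where w = "\<lambda>\<eta>. \<bar>2 * window i m \<eta>\<bar>"])
    show "integrable \<mu> (\<lambda>\<eta>. \<bar>2 * window i m \<eta>\<bar>)" by (intro integrable_abs integrable_mult_right w)
    show "(\<lambda>\<eta>. 2 * window i m \<eta> * indicator {\<eta>. real j < 2 * window i m \<eta>} \<eta>) \<in> borel_measurable \<mu>" for j
    proof -
      have f: "(\<lambda>x :: real. 2 * x * indicator {x. real j < 2 * x} x) \<in> borel_measurable borel" by measurable
      have "(\<lambda>\<eta>. 2 * window i m \<eta> * indicator {x. real j < 2 * x} (window i m \<eta>)) \<in> borel_measurable \<mu>"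
        by (rule measurable_compose[OF borel_measurable_integrable[OF w] f])
      then show ?thesis unfolding indicator_def mem_Collect_eq .
    qed
    show "AE \<eta> in \<mu>. (\<lambda>j. 2 * window i m \<eta> * indicator {\<eta>. real j < 2 * window i m \<eta>} \<eta>) \<longlonglongrightarrow> 0"
    proof (rule AE_I2)
      fix \<eta> :: config
      obtain j0 :: nat where j0: "2 * window i m \<eta> \<le> real j0" using real_arch_simple by blast
      have "\<forall>\<^sub>F j in sequentially. 2 * window i m \<eta> * indicator {\<eta>. real j < 2 * window i m \<eta>} \<eta> = 0"
        by (rule eventually_mono[OF eventually_ge_at_top[of j0]]) (use j0 in \<open>auto simp: indicator_def\<close>)
      then show "(\<lambda>j. 2 * window i m \<eta> * indicator {\<eta>. real j < 2 * window i m \<eta>} \<eta>) \<longlonglongrightarrow> 0"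
        by (rule tendsto_eventually)
    qed
    show "AE \<eta> in \<mu>. norm (2 * window i m \<eta> * indicator {\<eta>. real j < 2 * window i m \<eta>} \<eta>) \<le> \<bar>2 * window i m \<eta>\<bar>" for j
      by (rule AE_I2) (simp add: indicator_def)
  qed simp
  then show ?thesis by simp
qed

text \<open>The window length \<open>m\<close> is chosen first, to make the averages close to the
  mean; then the level \<open>j\<close>, to make the tails of this window small. Four errors share
  \<open>\<epsilon>\<close> equally. The rate \<open>exp (- real j)\<close> depends on
  \<open>\<epsilon>\<close> but not on the coupling.\<close>

lemma cost_contraction:
  assumes \<mu>: "stationary_state n \<rho> \<mu>" and \<mu>': "stationary_state n \<rho> \<mu>'" and i: "i \<in> {1..n}" and \<epsilon>: "0 < \<epsilon>"
  shows "\<exists>p>0. \<forall>\<Gamma>. coupling n \<mu> \<mu>' \<Gamma> \<longrightarrow> p * (cost i \<Gamma> - \<epsilon>) \<le> cost i \<Gamma> - cost i (couple_step n \<Gamma>)"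
proof -
  have "\<forall>\<^sub>F m in sequentially. deviation \<rho> i \<mu> m < \<epsilon> / 4 \<and> deviation \<rho> i \<mu>' m < \<epsilon> / 4"
    by (intro eventually_conj order_tendstoD(2)[OF deviation_tendsto_0[OF \<mu> i]]
        order_tendstoD(2)[OF deviation_tendsto_0[OF \<mu>' i]]) (use \<epsilon> in auto)
  then obtain m where m: "deviation \<rho> i \<mu> m < \<epsilon> / 4" "deviation \<rho> i \<mu>' m < \<epsilon> / 4"
    by (auto simp: eventually_sequentially)
  have e: "0 < \<epsilon> / 4 * real (Suc m)" using \<epsilon> by simp
  have "\<forall>\<^sub>F j in sequentially. tail_mean i \<mu> m (real j) < \<epsilon> / 4 * real (Suc m) \<and> tail_mean i \<mu>' m (real j) < \<epsilon> / 4 * real (Suc m)"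
    by (intro eventually_conj order_tendstoD(2)[OF tail_mean_tendsto_0[OF \<mu> i] e]
        order_tendstoD(2)[OF tail_mean_tendsto_0[OF \<mu>' i] e])
  then obtain j where j: "tail_mean i \<mu> m (real j) < \<epsilon> / 4 * real (Suc m)" "tail_mean i \<mu>' m (real j) < \<epsilon> / 4 * real (Suc m)"
    by (auto simp: eventually_sequentially)
  have "(tail_mean i \<mu> m (real j) + tail_mean i \<mu>' m (real j)) / real (Suc m) \<le> \<epsilon> / 2"
    unfolding pos_divide_le_eq[OF of_nat_0_less_iff[THEN iffD2, OF zero_less_Suc]] using j by linarith
  with m have small: "deviation \<rho> i \<mu> m + deviation \<rho> i \<mu>' m + (tail_mean i \<mu> m (real j) + tail_mean i \<mu>' m (real j)) / real (Suc m) \<le> \<epsilon>"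
    by linarith
  have "exp (- real j) * (cost i \<Gamma> - \<epsilon>) \<le> cost i \<Gamma> - cost i (couple_step n \<Gamma>)" if "coupling n \<mu> \<mu>' \<Gamma>" for \<Gamma>
  proof -
    interpret stationary_coupling n i \<rho> \<mu> \<mu>' \<Gamma> by unfold_locales (fact that \<mu> \<mu>' i)+
    have "exp (- real j) * (cost i \<Gamma> - \<epsilon>) \<le> exp (- real j) * (cost i \<Gamma> - (deviation \<rho> i \<mu> m + deviation \<rho> i \<mu>' m)
        - (tail_mean i \<mu> m (real j) + tail_mean i \<mu>' m (real j)) / real (Suc m))"
      by (intro mult_left_mono) (use small in linarith, simp)
    also have "\<dots> \<le> cost i \<Gamma> - cost i (couple_step n \<Gamma>)" by (rule cost_gain) simp
    finally show ?thesis .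
  qed
  then show ?thesis by (intro exI[of _ "exp (- real j)"]) simp
qed

lemma coupling_iterate:
  assumes \<mu>: "stationary_state n \<rho> \<mu>" and \<mu>': "stationary_state n \<rho> \<mu>'"
  shows "coupling n \<mu> \<mu>' ((couple_step n ^^ t) (\<mu> \<Otimes>\<^sub>M \<mu>'))"
  by (induction t) (simp_all add: coupling_product[OF \<mu> \<mu>'] coupling_couple_step[OF _ \<mu> \<mu>'])

text \<open>The rate may degenerate as \<open>\<epsilon>\<close> decreases, so no speed of
  convergence results. The costs decrease to some limit \<open>L\<close>; in the limit the
  contraction reads \<open>p * (L - \<epsilon>) \<le> 0\<close>, which gives
  \<open>L \<le> \<epsilon>\<close> for every positive \<open>\<epsilon>\<close>.\<close>

lemma cost_iterate_tendsto_0: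
  assumes \<mu>: "stationary_state n \<rho> \<mu>" and \<mu>': "stationary_state n \<rho> \<mu>'" and i: "i \<in> {1..n}"
  shows "(\<lambda>t. cost i ((couple_step n ^^ t) (\<mu> \<Otimes>\<^sub>M \<mu>'))) \<longlonglongrightarrow> 0"
proof -
  define C where "C t = cost i ((couple_step n ^^ t) (\<mu> \<Otimes>\<^sub>M \<mu>'))" for t
  have C0: "0 \<le> C t" for t unfolding C_def cost_def by simp
  have step: "C (Suc t) \<le> C t" for t
  proof -
    interpret stationary_coupling n i \<rho> \<mu> \<mu>' "(couple_step n ^^ t) (\<mu> \<Otimes>\<^sub>M \<mu>')"
      by unfold_locales (fact coupling_iterate[OF \<mu> \<mu>'] \<mu> \<mu>' i)+
    show ?thesis using cost_decreasing by (simp add: C_def)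
  qed
  have "decseq C" by (rule decseq_SucI) (rule step)
  then obtain L where L: "C \<longlonglongrightarrow> L" using decseq_convergent[of C 0] C0 by blast
  have "L \<le> \<epsilon>" if \<epsilon>: "0 < \<epsilon>" for \<epsilon>
  proof -
    obtain p where p: "0 < p" "\<And>\<Gamma>. coupling n \<mu> \<mu>' \<Gamma> \<Longrightarrow> p * (cost i \<Gamma> - \<epsilon>) \<le> cost i \<Gamma> - cost i (couple_step n \<Gamma>)"
      using cost_contraction[OF \<mu> \<mu>' i \<epsilon>] by blast
    have "p * (C t - \<epsilon>) \<le> C t - C (Suc t)" for t
      using p(2)[OF coupling_iterate[OF \<mu> \<mu>']] by (simp add: C_def)
    moreover have "(\<lambda>t. p * (C t - \<epsilon>)) \<longlonglongrightarrow> p * (L - \<epsilon>)" by (intro tendsto_intros L)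
    moreover have "(\<lambda>t. C t - C (Suc t)) \<longlonglongrightarrow> L - L" by (intro tendsto_diff L LIMSEQ_Suc)
    ultimately have "p * (L - \<epsilon>) \<le> L - L" by (intro LIMSEQ_le[of _ "p * (L - \<epsilon>)" _ "L - L"]) blast+
    then show ?thesis using p(1) by (simp add: mult_le_0_iff)
  qed
  then have "L \<le> 0 + e" if "0 < e" for e using that by (simp only: add_0)
  then have "L \<le> 0" by (rule field_le_epsilon)
  moreover have "0 \<le> L" by (rule LIMSEQ_le_const[OF L]) (use C0 in blast)
  ultimately show ?thesis using L unfolding C_def[abs_def] by simp
qed

section \<open>From vanishing gaps to equality of the measures, tested on lower orthants\<close>

definition lower_box :: "nat \<Rightarrow> (nat \<times> int \<times> real) set \<Rightarrow> real \<Rightarrow> config set" where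
  "lower_box n F \<delta> = {\<eta> \<in> space (config_space n). \<forall>(i, k, b)\<in>F. \<eta> i k \<le> b + \<delta>}"

abbreviation constraints :: "nat \<Rightarrow> (nat \<times> int \<times> real) set set" where
  "constraints n \<equiv> {F. finite F \<and> fst ` F \<subseteq> {1..n}}"

lemma borel_config_component: "i \<in> {1..n} \<Longrightarrow> (\<lambda>\<eta>. \<eta> i k) \<in> borel_measurable (config_space n)"
  by (rule measurable_seq_component[OF measurable_config_component[OF measurable_ident_sets[OF refl]]])

lemma sets_box: "F \<in> constraints n \<Longrightarrow> lower_box n F \<delta> \<in> sets (config_space n)"
  unfolding lower_box_def case_prod_beta
  by (intro sets.sets_Collect_finite_All borel_measurable_le borel_config_component borel_measurable_const) auto

lemma sets_config_space_box: "sets (config_space n) = sigma_sets (space (config_space n)) {lower_box n F 0 |F. F \<in> constraints n}"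
proof
  let ?E = "{lower_box n F 0 |F. F \<in> constraints n}" and ?M = "sigma (space (config_space n)) {lower_box n F 0 |F. F \<in> constraints n}"
  have E: "?E \<subseteq> Pow (space (config_space n))" by (auto simp: lower_box_def)
  show "sigma_sets (space (config_space n)) ?E \<subseteq> sets (config_space n)"
    by (rule sets.sigma_sets_subset) (use sets_box in blast)
  have sp: "space ?M = space (config_space n)" using E by (rule space_measure_of)
  have sM: "sets ?M = sigma_sets (space (config_space n)) ?E" using E by (rule sets_measure_of)
  have "(\<lambda>\<eta>. \<lambda>i\<in>{1..n}. \<eta> i) \<in> ?M \<rightarrow>\<^sub>M config_space n"
  proof (intro measurable_config_spaceI measurable_seq_spaceI)
    fix i k assume i: "i \<in> {1..n}"
    show "(\<lambda>\<eta>. \<eta> i k) \<in> borel_measurable ?M"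
      unfolding borel_measurable_iff_le
    proof
      fix a
      have eq: "{\<eta> \<in> space ?M. \<eta> i k \<le> a} = lower_box n {(i, k, a)} 0" unfolding sp by (auto simp: lower_box_def)
      have "finite {(i, k, a)} \<and> fst ` {(i, k, a)} \<subseteq> {1..n}" using i by simp
      then have "lower_box n {(i, k, a)} 0 \<in> ?E" by blast
      then have "lower_box n {(i, k, a)} 0 \<in> sigma_sets (space (config_space n)) ?E" by (rule sigma_sets.Basic)
      then show "{\<eta> \<in> space ?M. \<eta> i k \<le> a} \<in> sets ?M" unfolding eq sM .
    qed
  qed
  then have "(\<lambda>\<eta>. \<eta>) \<in> ?M \<rightarrow>\<^sub>M config_space n"
  proof (rule measurable_cong[THEN iffD1, rotated])
    fix \<eta> assume "\<eta> \<in> space ?M"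
    then have "\<eta> \<in> space (config_space n)" unfolding sp .
    then show "(\<lambda>i\<in>{1..n}. \<eta> i) = \<eta>" unfolding config_space_def space_PiM by (rule PiE_restrict)
  qed
  from measurable_sets[OF this] show "sets (config_space n) \<subseteq> sigma_sets (space (config_space n)) ?E"
    unfolding sM sp using sets.sets_into_space by fastforce
qed

lemma measure_eqI_box:
  assumes \<mu>: "prob_space \<mu>" "sets \<mu> = sets (config_space n)" and \<mu>': "prob_space \<mu>'" "sets \<mu>' = sets (config_space n)"
    and eq: "\<And>F. F \<in> constraints n \<Longrightarrow> measure \<mu> (lower_box n F 0) = measure \<mu>' (lower_box n F 0)"
  shows "\<mu> = \<mu>'"
proof (rule measure_eqI_generator_eq)
  interpret M: prob_space \<mu> by fact
  interpret M': prob_space \<mu>' by fact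
  let ?E = "{lower_box n F 0 |F. F \<in> constraints n}"
  show "Int_stable ?E"
  proof (rule Int_stableI)
    fix a b assume "a \<in> ?E" "b \<in> ?E"
    then obtain F G where F: "a = lower_box n F 0" "F \<in> constraints n" and G: "b = lower_box n G 0" "G \<in> constraints n" by blast
    have "a \<inter> b = lower_box n (F \<union> G) 0" unfolding F(1) G(1) lower_box_def by blast
    moreover have "F \<union> G \<in> constraints n" using F(2) G(2) by auto
    ultimately show "a \<inter> b \<in> ?E" by blast
  qed
  show "?E \<subseteq> Pow (space (config_space n))" by (auto simp: lower_box_def)
  show "emeasure \<mu> X = emeasure \<mu>' X" if "X \<in> ?E" for X
    using that eq unfolding M.emeasure_eq_measure M'.emeasure_eq_measure by auto
  show "sets \<mu> = sigma_sets (space (config_space n)) ?E" "sets \<mu>' = sigma_sets (space (config_space n)) ?E"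
    unfolding \<mu>(2) \<mu>'(2) by (rule sets_config_space_box)+
  have "lower_box n {} 0 = space (config_space n)" by (auto simp: lower_box_def)
  moreover have "lower_box n {} 0 \<in> ?E" by blast
  ultimately show "range (\<lambda>_. space (config_space n)) \<subseteq> ?E" by auto
  show "emeasure \<mu> (space (config_space n)) \<noteq> \<infinity>" by (simp add: M.emeasure_eq_measure)
qed simp

lemma (in stationary_coupling) cost_shift: "(\<integral>x. \<bar>fst x i k - snd x i k\<bar> \<partial>\<Gamma>) = cost i \<Gamma>"
proof -
  let ?C = "config_space n" and ?T = "\<lambda>x. (translation n k (fst x), translation n k (snd x))"
  have T: "?T \<in> \<Gamma> \<rightarrow>\<^sub>M ?C \<Otimes>\<^sub>M ?C"
    unfolding measurable_cong_sets[OF sets_coupling refl]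
    by (intro measurable_Pair measurable_compose[OF _ measurable_translation] measurable_fst measurable_snd)
  have inv: "distr \<Gamma> (?C \<Otimes>\<^sub>M ?C) ?T = \<Gamma>" using c by (simp add: coupling_def)
  have b: "(\<lambda>x. \<bar>fst x i 0 - snd x i 0\<bar>) \<in> borel_measurable (?C \<Otimes>\<^sub>M ?C)"
    by (intro borel_measurable_abs borel_measurable_diff measurable_compose[OF measurable_fst borel_config]
        measurable_compose[OF measurable_snd borel_config])
  show ?thesis
    using integral_distr[OF T b] i unfolding inv cost_def by (simp add: translation_def)
qed

text \<open>If the first configuration obeys the bounds and the second violates them by more than
  \<open>\<delta>\<close>, then the gap at one of the finitely many constrained sites exceeds
  \<open>\<delta>\<close>. Markov's inequality turns this into the sum of the costs divided by
  \<open>\<delta>\<close>.\<close>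

lemma coupling_box_le:
  assumes c: "coupling n \<mu> \<mu>' \<Gamma>" and \<mu>: "stationary_state n \<rho> \<mu>" and \<mu>': "stationary_state n \<rho> \<mu>'"
    and n: "0 < n" and F: "F \<in> constraints n" and \<delta>: "0 < \<delta>"
  shows "measure \<mu> (lower_box n F 0) \<le> measure \<mu>' (lower_box n F \<delta>) + (\<Sum>(i, k, b)\<in>F. cost i \<Gamma>) / \<delta>"
proof -
  have n1: "1 \<in> {1..n}" using n by simp
  interpret S1: stationary_coupling n 1 \<rho> \<mu> \<mu>' \<Gamma> by unfold_locales (fact c \<mu> \<mu>' n1)+
  interpret G: prob_space \<Gamma> by (rule S1.prob_coupling)
  have s: "sets \<mu> = sets (config_space n)" "sets \<mu>' = sets (config_space n)"
    using \<mu> \<mu>' by (simp_all add: stationary_state_def prob_measure_on_states_def)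
  have meas: "measure \<nu> (lower_box n F e) = (\<integral>\<eta>. indicator (lower_box n F e) \<eta> \<partial>\<nu>)" if "sets \<nu> = sets (config_space n)" for \<nu> e
  proof -
    have "lower_box n F e \<inter> space \<nu> = lower_box n F e" using sets_eq_imp_space_eq[OF that] by (auto simp: lower_box_def)
    then show ?thesis by simp
  qed
  have ib: "indicator (lower_box n F e) \<in> borel_measurable (config_space n)" for e
    by (rule borel_measurable_indicator[OF sets_box[OF F]])
  have m: "fst \<in> \<Gamma> \<rightarrow>\<^sub>M config_space n" "snd \<in> \<Gamma> \<rightarrow>\<^sub>M config_space n"
    unfolding measurable_cong_sets[OF S1.sets_coupling refl] by (rule measurable_fst measurable_snd)+
  have int1: "integrable \<Gamma> (\<lambda>x. indicator (lower_box n F 0) (fst x) :: real)" "integrable \<Gamma> (\<lambda>x. indicator (lower_box n F \<delta>) (snd x) :: real)"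
    by (rule G.integrable_const_bound[of _ 1], rule AE_I2, simp add: indicator_def, rule measurable_compose[OF m(1) ib],
        rule G.integrable_const_bound[of _ 1], rule AE_I2, simp add: indicator_def, rule measurable_compose[OF m(2) ib])
  have icost: "integrable \<Gamma> (\<lambda>x. \<bar>fst x i k - snd x i k\<bar>)" "(\<integral>x. \<bar>fst x i k - snd x i k\<bar> \<partial>\<Gamma>) = cost i \<Gamma>" if "(i, k, b) \<in> F" for i k b
  proof -
    have i: "i \<in> {1..n}" using F that by force
    interpret S: stationary_coupling n i \<rho> \<mu> \<mu>' \<Gamma> by unfold_locales (fact c \<mu> \<mu>' i)+
    show "integrable \<Gamma> (\<lambda>x. \<bar>fst x i k - snd x i k\<bar>)"
      by (intro integrable_abs Bochner_Integration.integrable_diff S.integrable_coupling)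
    show "(\<integral>x. \<bar>fst x i k - snd x i k\<bar> \<partial>\<Gamma>) = cost i \<Gamma>" by (rule S.cost_shift)
  qed
  let ?h = "\<lambda>x :: config \<times> config. \<Sum>(i, k, b)\<in>F. \<bar>fst x i k - snd x i k\<bar>"
  have hint: "integrable \<Gamma> ?h"
  proof (rule Bochner_Integration.integrable_sum)
    show "integrable \<Gamma> (\<lambda>x. case p of (i, k, b) \<Rightarrow> \<bar>fst x i k - snd x i k\<bar>)" if "p \<in> F" for p
      using that icost(1) by (cases p) auto
  qed
  have "measure \<mu> (lower_box n F 0) = (\<integral>x. indicator (lower_box n F 0) (fst x) \<partial>\<Gamma>)"
    unfolding S1.coupling_fst(1)[OF ib] by (rule meas[OF s(1)])
  also have "\<dots> \<le> (\<integral>x. indicator (lower_box n F \<delta>) (snd x) + ?h x / \<delta> \<partial>\<Gamma>)"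
  proof (rule integral_mono[OF int1(1)])
    show "integrable \<Gamma> (\<lambda>x. indicator (lower_box n F \<delta>) (snd x) + ?h x / \<delta>)"
      by (intro Bochner_Integration.integrable_add int1(2) integrable_divide hint)
    fix x assume x: "x \<in> space \<Gamma>"
    have sx: "snd x \<in> space (config_space n)" using measurable_space[OF m(2) x] .
    have h0: "0 \<le> ?h x / \<delta>" using \<delta> by (intro divide_nonneg_pos sum_nonneg) auto
    show "indicator (lower_box n F 0) (fst x) \<le> indicator (lower_box n F \<delta>) (snd x) + ?h x / \<delta>"
    proof (cases "fst x \<in> lower_box n F 0 \<and> snd x \<notin> lower_box n F \<delta>")
      case False
      then show ?thesis using h0 by (auto simp: indicator_def)
    next
      case True
      then obtain i k b where f: "(i, k, b) \<in> F" "b + \<delta> < snd x i k" using sx by (auto simp: lower_box_def not_le)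
      moreover have "fst x i k \<le> b" using True f(1) by (auto simp: lower_box_def)
      ultimately have "\<delta> \<le> \<bar>fst x i k - snd x i k\<bar>" by linarith
      also have "\<dots> \<le> ?h x"
        using member_le_sum[OF f(1), of "\<lambda>(i, k, b). \<bar>fst x i k - snd x i k\<bar>"] F by auto
      finally have "1 \<le> ?h x / \<delta>" using \<delta> by simp
      then show ?thesis using True by (simp add: indicator_def)
    qed
  qed
  also have "\<dots> = (\<integral>x. indicator (lower_box n F \<delta>) (snd x) \<partial>\<Gamma>) + (\<integral>x. ?h x \<partial>\<Gamma>) / \<delta>"
    unfolding Bochner_Integration.integral_add[OF int1(2) integrable_divide[OF hint]] by simp
  also have "(\<integral>x. indicator (lower_box n F \<delta>) (snd x) \<partial>\<Gamma>) = measure \<mu>' (lower_box n F \<delta>)"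
    unfolding S1.coupling_snd(1)[OF ib] by (rule meas[OF s(2), symmetric])
  also have "(\<integral>x. ?h x \<partial>\<Gamma>) = (\<Sum>(i, k, b)\<in>F. cost i \<Gamma>)"
  proof -
    have "(\<integral>x. ?h x \<partial>\<Gamma>) = (\<Sum>p\<in>F. \<integral>x. (case p of (i, k, b) \<Rightarrow> \<bar>fst x i k - snd x i k\<bar>) \<partial>\<Gamma>)"
      by (rule Bochner_Integration.integral_sum) (use icost(1) in \<open>auto split: prod.split\<close>)
    also have "\<dots> = (\<Sum>(i, k, b)\<in>F. cost i \<Gamma>)"
      by (rule sum.cong[OF refl]) (use icost(2) in \<open>auto split: prod.split\<close>)
    finally show ?thesis .
  qed
  finally show ?thesis .
qed

text \<open>Time tends to infinity at a fixed slack, and then the slack decreases to 0. The bounds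
  are non-strict, so the relaxed boxes shrink to the box itself. Exchanging the roles of the two
  measures yields equality.\<close>

lemma box_le:
  assumes \<mu>: "stationary_state n \<rho> \<mu>" and \<mu>': "stationary_state n \<rho> \<mu>'" and n: "0 < n" and F: "F \<in> constraints n"
  shows "measure \<mu> (lower_box n F 0) \<le> measure \<mu>' (lower_box n F 0)"
proof -
  have p: "prob_space \<mu>'" and s: "sets \<mu>' = sets (config_space n)"
    using \<mu>' by (simp_all add: stationary_state_def prob_measure_on_states_def)
  interpret M': prob_space \<mu>' by fact
  have le: "measure \<mu> (lower_box n F 0) \<le> measure \<mu>' (lower_box n F \<delta>)" if \<delta>: "0 < \<delta>" for \<delta>
  proof (rule LIMSEQ_le_const)
    let ?C = "\<lambda>t. \<Sum>(i, k, b)\<in>F. cost i ((couple_step n ^^ t) (\<mu> \<Otimes>\<^sub>M \<mu>'))"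
    have "?C \<longlonglongrightarrow> (\<Sum>x\<in>F. 0)"
      unfolding case_prod_beta by (intro tendsto_sum cost_iterate_tendsto_0[OF \<mu> \<mu>']) (use F in force)
    then have "(\<lambda>t. measure \<mu>' (lower_box n F \<delta>) + ?C t / \<delta>) \<longlonglongrightarrow> measure \<mu>' (lower_box n F \<delta>) + (\<Sum>x\<in>F. 0) / \<delta>"
      by (intro tendsto_add tendsto_divide tendsto_const) (use \<delta> in auto)
    then show "(\<lambda>t. measure \<mu>' (lower_box n F \<delta>) + ?C t / \<delta>) \<longlonglongrightarrow> measure \<mu>' (lower_box n F \<delta>)" by simp
    show "\<exists>N. \<forall>t\<ge>N. measure \<mu> (lower_box n F 0) \<le> measure \<mu>' (lower_box n F \<delta>) + ?C t / \<delta>"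
      using coupling_box_le[OF coupling_iterate[OF \<mu> \<mu>'] \<mu> \<mu>' n F \<delta>] by blast
  qed
  let ?A = "\<lambda>j. lower_box n F (1 / real (Suc j))"
  have lim: "(\<lambda>j. measure \<mu>' (?A j)) \<longlonglongrightarrow> measure \<mu>' (\<Inter>j. ?A j)"
  proof (rule M'.finite_Lim_measure_decseq)
    show "range ?A \<subseteq> sets \<mu>'" unfolding s using sets_box[OF F] by blast
    show "decseq ?A"
    proof (rule decseq_SucI)
      fix j
      have "1 / real (Suc (Suc j)) \<le> 1 / real (Suc j)" by (simp add: frac_le)
      then show "?A (Suc j) \<subseteq> ?A j" by (fastforce simp: lower_box_def simp del: of_nat_Suc)
    qed
  qed
  have "(\<Inter>j. ?A j) = lower_box n F 0"
  proof
    show "lower_box n F 0 \<subseteq> (\<Inter>j. ?A j)"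
    proof
      fix \<eta> assume "\<eta> \<in> lower_box n F 0"
      then have \<eta>: "\<eta> \<in> space (config_space n)" "\<And>i k b. (i, k, b) \<in> F \<Longrightarrow> \<eta> i k \<le> b" by (auto simp: lower_box_def)
      have "0 \<le> 1 / real (Suc j)" for j by simp
      then have "\<eta> i k \<le> b + 1 / real (Suc j)" if "(i, k, b) \<in> F" for i k b j
        using \<eta>(2)[OF that] by (simp only: add_increasing2)
      then show "\<eta> \<in> (\<Inter>j. ?A j)" using \<eta>(1) unfolding lower_box_def by blast
    qed
    show "(\<Inter>j. ?A j) \<subseteq> lower_box n F 0"
    proof
      fix \<eta> assume \<eta>: "\<eta> \<in> (\<Inter>j. ?A j)"
      have "\<eta> i k \<le> b" if f: "(i, k, b) \<in> F" for i k b
      proof (rule field_le_epsilon)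
        fix e :: real assume "0 < e"
        then obtain j where "1 / real (Suc j) < e" by (rule nat_approx_posE)
        moreover have "\<eta> \<in> ?A j" using \<eta> by blast
        then have "\<eta> i k \<le> b + 1 / real (Suc j)" using f unfolding lower_box_def by blast
        ultimately show "\<eta> i k \<le> b + e" by linarith
      qed
      moreover have "\<eta> \<in> ?A 0" using \<eta> by blast
      then have "\<eta> \<in> space (config_space n)" unfolding lower_box_def by blast
      ultimately show "\<eta> \<in> lower_box n F 0" by (auto simp: lower_box_def)
    qed
  qed
  with lim have "(\<lambda>j. measure \<mu>' (?A j)) \<longlonglongrightarrow> measure \<mu>' (lower_box n F 0)" by (simp only:)
  moreover have "\<exists>N. \<forall>j\<ge>N. measure \<mu> (lower_box n F 0) \<le> measure \<mu>' (?A j)"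
    by (intro exI[of _ 0] allI impI le) simp
  ultimately show ?thesis by (rule LIMSEQ_le_const)
qed

lemma stationary_state_unique:
  assumes \<mu>: "stationary_state n \<rho> \<mu>" and \<mu>': "stationary_state n \<rho> \<mu>'" and n: "0 < n"
  shows "\<mu> = \<mu>'"
proof (rule measure_eqI_box)
  show "prob_space \<mu>" "sets \<mu> = sets (config_space n)" "prob_space \<mu>'" "sets \<mu>' = sets (config_space n)"
    using \<mu> \<mu>' by (simp_all add: stationary_state_def prob_measure_on_states_def)
  show "measure \<mu> (lower_box n F 0) = measure \<mu>' (lower_box n F 0)" if "F \<in> constraints n" for F
    using box_le[OF \<mu> \<mu>' n that] box_le[OF \<mu>' \<mu> n that] by (rule antisym)
qed

theorem theorem5p4:
  fixes n :: nat and \<rho> :: "nat \<Rightarrow> real"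
  assumes "n > 0" and "\<forall>i\<in>{1..n}. \<rho> i > 1"
  shows "invariant_measure TYPE('a) n (mu n \<rho>)
    \<and> prob_measure_on_states n (mu n \<rho>)
    \<and> translation_ergodic n (mu n \<rho>)
    \<and> has_means n \<rho> (mu n \<rho>)
    \<and> (\<forall>\<mu>. prob_measure_on_states n \<mu> \<and> translation_ergodic n \<mu> \<and> has_means n \<rho> \<mu>
           \<and> invariant_measure TYPE(canonical_sample) n \<mu> \<longrightarrow> \<mu> = mu n \<rho>)"
proof (intro conjI allI impI)
  show states: "prob_measure_on_states n (mu n \<rho>)" by (rule prob_measure_on_states_mu[OF assms])
  show "invariant_measure TYPE('a) n (mu n \<rho>)"
    by (rule invariant_measure_of_serve[OF states mu_serve[OF assms]])
  show ergodic: "translation_ergodic n (mu n \<rho>)" by (rule translation_ergodic_mu[OF assms])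
  show means: "has_means n \<rho> (mu n \<rho>)" by (rule has_means_mu[OF assms])
  fix \<mu>
  assume "prob_measure_on_states n \<mu> \<and> translation_ergodic n \<mu> \<and> has_means n \<rho> \<mu>
     \<and> invariant_measure TYPE(canonical_sample) n \<mu>"
  then have "stationary_state n \<rho> \<mu>"
    using serve_of_invariant_measure unfolding stationary_state_def by blast
  moreover have "stationary_state n \<rho> (mu n \<rho>)"
    using states ergodic means mu_serve[OF assms] unfolding stationary_state_def by blast
  ultimately show "\<mu> = mu n \<rho>" using assms(1) by (rule stationary_state_unique)
qed

end
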